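(* If $Z=(X,Y)\in\Omega_{fs}$, then $Z$ is locally $\Sigma$-equivalent near the origin to $Z_{fs}=(X_{fs},Y_{fs})\in\Omega_{fs}$, where $$X_{fs}(x,y)=(-y,\ x),\qquad Y_{fs}(x,y)=(y,\ x).$$
   Context: Let $\mathcal U\subset\mathbb R^2$ be a bounded open set containing the origin $O$, and let $\mathfrak X$ be the set of $\mathcal C^1$ vector fields on $\mathcal U$. Put $\Sigma^+=\{(x,y)\in\mathcal U:y>0\}$, $\Sigma^-=\{(x,y)\in\mathcal U:y<0\}$, $\Sigma=\{(x,y)\in\mathcal U:y=0\}$ (the switching line). $\Omega$ is the set of piecewise smooth vector fields $Z=(X,Y)$, with $X=(X_1,X_2)$, $Y=(Y_1,Y_2)\in\mathfrak X$, given by $Z=X$ on $\Sigma^+$ and $Z=Y$ on $\Sigma^-$. On $\Sigma$, $Z$ is defined to be $Z_\Sigma$ by the Filippov convention. If $X\equiv Y$ on $\Sigma$, then $Z_\Sigma=X=Y$. Otherwise: on the crossing set $\Sigma^c=\{p\in\Sigma:X_2(p)Y_2(p)>0\}$, $Z_\Sigma=X$ if $X_2>0$ and $Z_\Sigma=Y$ if $X_2<0$ (orbits cross $\Sigma$ there); on the sliding set $\Sigma^s=\{p\in\Sigma:X_2(p)Y_2(p)\le0\}$, $Z_\Sigma=\left(\frac{Y_2X_1-X_2Y_1}{Y_2-X_2},0\right)$ if $X_2\ne Y_2$, and $Z_\Sigma=(0,0)$ if $X_2=Y_2=0$. Orbits of $Z$ are obtained by concatenating orbits of $X$ in $\Sigma^+$,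 $Y$ in $\Sigma^-$ and $Z_\Sigma$ in $\Sigma$. $\Omega_0\subset\Omega$ is the set of $Z=(X,Y)$ with $X(0,0)=Y(0,0)=(0,0)$, $\det A^+\det A^-\neq0$ and $X_{2x}(0,0)\,Y_{2x}(0,0)>0$, where $A^+$ (resp. $A^-$) is the Jacobian matrix of $X$ (resp. $Y$) at $O$ and the subscript $x$ denotes the partial derivative in $x$. Let $\lambda_1^\pm,\lambda_2^\pm$ be the eigenvalues of $A^\pm$. Then $\Omega_1=\{Z\in\Omega_0:\lambda_1^+\ne\lambda_2^+,\ \lambda_1^-\ne\lambda_2^-,\ \ell\ne0\}$, where $\ell=\frac{\mathrm{Re}\lambda_1^+}{|\mathrm{Im}\lambda_1^+|}+\frac{\mathrm{Re}\lambda_1^-}{|\mathrm{Im}\lambda_1^-|}$ if $\mathrm{Im}\lambda_1^+\,\mathrm{Im}\lambda_1^-\ne0$, and $\ell=1$ if $\mathrm{Im}\lambda_1^+\,\mathrm{Im}\lambda_1^-=0$. Further, $\Omega_{fs}$ is the set of $Z\in\Omega_1$ such that either $\lambda_1^+,\lambda_2^+\in\mathbb C\setminus\mathbb R$, $\lambda_1^-,\lambda_2^-\in\mathbb R$, $\lambda_1^-\lambda_2^-<0$, or $\lambda_1^-,\lambda_2^-\in\mathbb C\setminus\mathbb R$, $\lambda_1^+,\lambda_2^+\in\mathbb R$, $\lambda_1^+\lambda_2^+<0$. $Z_1,Z_2\in\Omega_0$ are locally $\Sigma$-equivalent near the origin if there exist neighborhoods $U,V$ of the origin and a homeomorphism $H:U\to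 V$ that maps the orbits of $Z_1$ in $U$ onto the orbits of $Z_2$ in $V$, preserving the direction of time, and sends $\Sigma\cap U$ to $\Sigma\cap V$. *)

theory Defs
  imports "HOL-Analysis.Analysis"
begin

type_synonym vector_field = "real^2 \<Rightarrow> real^2"

text \<open>
  A piecewise smooth vector field is the pair \<open>(X, Y)\<close> of its two smooth pieces. Fields are total
  functions; only their values on the domain \<open>\<U>\<close> matter.
\<close>

type_synonym pw_field = "vector_field \<times> vector_field"

definition Sigma_pos :: "(real^2) set \<Rightarrow> (real^2) set" where
  "Sigma_pos \<U> = {p \<in> \<U>. p $ 2 > 0}"

definition Sigma_neg :: "(real^2) set \<Rightarrow> (real^2) set" where
  "Sigma_neg \<U> = {p \<in> \<U>. p $ 2 < 0}"

definition Sigma_line :: "(real^2) set \<Rightarrow> (real^2) set" where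
  "Sigma_line \<U> = {p \<in> \<U>. p $ 2 = 0}"

definition C1_field :: "(real^2) set \<Rightarrow> vector_field \<Rightarrow> bool" where
  "C1_field \<U> X \<longleftrightarrow>
     (\<forall>p\<in>\<U>. X differentiable (at p)) \<and> continuous_on \<U> (\<lambda>p. jacobian X (at p))"

definition Omega :: "(real^2) set \<Rightarrow> pw_field set" where
  "Omega \<U> = {(X, Y). C1_field \<U> X \<and> C1_field \<U> Y}"

text \<open>The Filippov convention on the switching line.\<close>

definition Z_Sigma :: "(real^2) set \<Rightarrow> pw_field \<Rightarrow> vector_field" where
  "Z_Sigma \<U> Z = (case Z of (X, Y) \<Rightarrow> (\<lambda>p.
     if \<forall>q\<in>Sigma_line \<U>. X q = Y q then X p
     else if X p $ 2 * Y p $ 2 > 0 then (if X p $ 2 > 0 then X p else Y p)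
     else if X p $ 2 \<noteq> Y p $ 2
       then vector [(Y p $ 2 * X p $ 1 - X p $ 2 * Y p $ 1) / (Y p $ 2 - X p $ 2), 0]
     else 0))"

text \<open>
  \<open>orbit_piece \<U> Z a b \<gamma>\<close>: on the open time interval from \<open>a\<close> to \<open>b\<close>, \<open>\<gamma>\<close> is an integral curve of
  \<open>X\<close> lying in the upper part, or of \<open>Y\<close> lying in the lower part, or of the Filippov field lying in
  the switching line.
\<close>

definition orbit_piece ::
    "(real^2) set \<Rightarrow> pw_field \<Rightarrow> real \<Rightarrow> real \<Rightarrow> (real \<Rightarrow> real^2) \<Rightarrow> bool" where
  "orbit_piece \<U> Z a b \<gamma> \<longleftrightarrow>
     (\<forall>t\<in>{a<..<b}. \<gamma> t \<in> Sigma_pos \<U> \<and> (\<gamma> has_vector_derivative fst Z (\<gamma> t)) (at t)) \<or>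
     (\<forall>t\<in>{a<..<b}. \<gamma> t \<in> Sigma_neg \<U> \<and> (\<gamma> has_vector_derivative snd Z (\<gamma> t)) (at t)) \<or>
     (\<forall>t\<in>{a<..<b}. \<gamma> t \<in> Sigma_line \<U> \<and> (\<gamma> has_vector_derivative Z_Sigma \<U> Z (\<gamma> t)) (at t))"

text \<open>
  Trajectories of \<open>Z\<close> in \<open>U\<close>: continuous concatenations of such pieces over an interval \<open>I\<close>. The
  set \<open>D\<close> contains the junction times, of which there are finitely many in every compact part of
  \<open>I\<close>. The curve \<open>\<gamma>\<close> is a total function that is only meaningful on \<open>I\<close>.
\<close>

definition trajectory ::
    "(real^2) set \<Rightarrow> pw_field \<Rightarrow> (real^2) set \<Rightarrow> real set \<Rightarrow> (real \<Rightarrow> real^2) \<Rightarrow> bool" where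
  "trajectory \<U> Z U I \<gamma> \<longleftrightarrow>
     is_interval I \<and> I \<noteq> {} \<and> continuous_on I \<gamma> \<and> \<gamma> ` I \<subseteq> U \<and>
     (\<exists>D. (\<forall>a b. {a..b} \<subseteq> I \<longrightarrow> finite (D \<inter> {a..b})) \<and>
          (\<forall>a b. a < b \<and> {a<..<b} \<subseteq> I - D \<longrightarrow> orbit_piece \<U> Z a b \<gamma>))"

definition maximal_trajectory ::
    "(real^2) set \<Rightarrow> pw_field \<Rightarrow> (real^2) set \<Rightarrow> real set \<Rightarrow> (real \<Rightarrow> real^2) \<Rightarrow> bool" where
  "maximal_trajectory \<U> Z U I \<gamma> \<longleftrightarrow>
     trajectory \<U> Z U I \<gamma> \<and>
     (\<forall>J \<delta>. trajectory \<U> Z U J \<delta> \<and> I \<subseteq> J \<and> (\<forall>t\<in>I. \<delta> t = \<gamma> t) \<longrightarrow> J = I)"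

text \<open>
  \<open>H\<close> carries the curve \<open>\<gamma>\<close> on \<open>I\<close> to the curve \<open>\<delta>\<close> on \<open>J\<close> up to an increasing change of time
  (an increasing surjection between intervals is automatically a homeomorphism).
\<close>

definition maps_oriented ::
    "(real^2 \<Rightarrow> real^2) \<Rightarrow> real set \<Rightarrow> (real \<Rightarrow> real^2) \<Rightarrow> real set \<Rightarrow> (real \<Rightarrow> real^2) \<Rightarrow> bool" where
  "maps_oriented H I \<gamma> J \<delta> \<longleftrightarrow>
     (\<exists>\<tau>::real \<Rightarrow> real. strict_mono_on I \<tau> \<and> \<tau> ` I = J \<and> (\<forall>t\<in>I. H (\<gamma> t) = \<delta> (\<tau> t)))"

text \<open>
  An orbit of \<open>Z\<close> in \<open>U\<close> is the oriented curve traced by a maximal trajectory in \<open>U\<close>. The last two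
  clauses say that \<open>H\<close> sends orbits to orbits and that all orbits in \<open>V\<close> arise in this way.
\<close>

definition locally_Sigma_equivalent :: "(real^2) set \<Rightarrow> pw_field \<Rightarrow> pw_field \<Rightarrow> bool" where
  "locally_Sigma_equivalent \<U> Z1 Z2 \<longleftrightarrow>
     (\<exists>U V H H'.
        open U \<and> 0 \<in> U \<and> U \<subseteq> \<U> \<and> open V \<and> 0 \<in> V \<and> V \<subseteq> \<U> \<and>
        homeomorphism U V H H' \<and>
        H ` (Sigma_line \<U> \<inter> U) = Sigma_line \<U> \<inter> V \<and>
        (\<forall>I \<gamma>. maximal_trajectory \<U> Z1 U I \<gamma> \<longrightarrow>
           (\<exists>J \<delta>. maximal_trajectory \<U> Z2 V J \<delta> \<and> maps_oriented H I \<gamma> J \<delta>)) \<and>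
        (\<forall>J \<delta>. maximal_trajectory \<U> Z2 V J \<delta> \<longrightarrow>
           (\<exists>I \<gamma>. maximal_trajectory \<U> Z1 U I \<gamma> \<and> maps_oriented H I \<gamma> J \<delta>)))"

text \<open>
  \<open>eigenvalues2 A l1 l2\<close>: the complex eigenvalues of \<open>A\<close>, listed with algebraic multiplicity, are
  \<open>l1\<close> and \<open>l2\<close>. Such a pair exists and is unique up to order; the conditions below do not depend
  on the order.
\<close>

definition eigenvalues2 :: "real^2^2 \<Rightarrow> complex \<Rightarrow> complex \<Rightarrow> bool" where
  "eigenvalues2 A l1 l2 \<longleftrightarrow>
     (\<forall>z. det (mat z - map_matrix complex_of_real A) = (z - l1) * (z - l2))"

text \<open>The \<open>(2,1)\<close> entry of the Jacobian matrix of \<open>X\<close> is the partial derivative of \<open>X\<^sub>2\<close> in \<open>x\<close>.\<close>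

definition Omega0 :: "(real^2) set \<Rightarrow> pw_field set" where
  "Omega0 \<U> = {(X, Y) \<in> Omega \<U>.
     X 0 = 0 \<and> Y 0 = 0 \<and>
     det (jacobian X (at 0)) * det (jacobian Y (at 0)) \<noteq> 0 \<and>
     jacobian X (at 0) $ 2 $ 1 * jacobian Y (at 0) $ 2 $ 1 > 0}"

definition ell :: "complex \<Rightarrow> complex \<Rightarrow> real" where
  "ell lp lm = (if Im lp * Im lm \<noteq> 0 then Re lp / \<bar>Im lp\<bar> + Re lm / \<bar>Im lm\<bar> else 1)"

definition Omega1 :: "(real^2) set \<Rightarrow> pw_field set" where
  "Omega1 \<U> = {(X, Y) \<in> Omega0 \<U>.
     \<exists>lp1 lp2 lm1 lm2.
       eigenvalues2 (jacobian X (at 0)) lp1 lp2 \<and> eigenvalues2 (jacobian Y (at 0)) lm1 lm2 \<and>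
       lp1 \<noteq> lp2 \<and> lm1 \<noteq> lm2 \<and> ell lp1 lm1 \<noteq> 0}"

definition nonreal_pair :: "complex \<Rightarrow> complex \<Rightarrow> bool" where
  "nonreal_pair l1 l2 \<longleftrightarrow> l1 \<notin> \<real> \<and> l2 \<notin> \<real>"

definition saddle_pair :: "complex \<Rightarrow> complex \<Rightarrow> bool" where
  "saddle_pair l1 l2 \<longleftrightarrow> l1 \<in> \<real> \<and> l2 \<in> \<real> \<and> Re (l1 * l2) < 0"

definition Omega_fs :: "(real^2) set \<Rightarrow> pw_field set" where
  "Omega_fs \<U> = {(X, Y) \<in> Omega1 \<U>.
     \<exists>lp1 lp2 lm1 lm2.
       eigenvalues2 (jacobian X (at 0)) lp1 lp2 \<and> eigenvalues2 (jacobian Y (at 0)) lm1 lm2 \<and>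
       (nonreal_pair lp1 lp2 \<and> saddle_pair lm1 lm2 \<or> nonreal_pair lm1 lm2 \<and> saddle_pair lp1 lp2)}"

definition X_fs :: vector_field where
  "X_fs p = vector [- (p $ 2), p $ 1]"

definition Y_fs :: vector_field where
  "Y_fs p = vector [p $ 2, p $ 1]"

end

theory Submission
  imports Defs
begin

text \<open>
  After a piecewise linear change of coordinates preserving the switching line, which exchanges the two
  sides if the focus is below, the linear parts are
  \<open>(-P y, Q x + S y)\<close> (focus, above) and \<open>(P' y, Q' x + S' y)\<close> (saddle, below) with
  \<open>P, Q, P', Q' > 0\<close>. Each orbit in the half-plane \<open>x \<ge> 0\<close> moves towards the \<open>y\<close>-axis, and its
  point \<open>(0, h)\<close> of arrival (the origin for the stable separatrix of the saddle) depends continuously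
  on the initial point. Together with a function \<open>G\<close> that increases along orbits, \<open>h\<close> is an injective
  chart of the half-plane; the half-plane \<open>x \<le> 0\<close> is the mirror image under time reversal. By
  invariance of domain the two charts glue to a homeomorphism which turns the orbits into horizontal
  segments run through from left to right, interrupted only by the equilibrium at the origin, and
  \<open>G\<close> can be scaled so that the switching line becomes \<open>{(g, h). h = \<bar>g\<bar>}\<close>. This picture does not
  depend on the field, so that two such charts, for \<open>Z\<close> and for the model, compose to the required
  homeomorphism.
\<close>

subsection \<open>Differential equations with Lipschitz right-hand side\<close>

text \<open>Linearising the two sides separately does not help: the two homeomorphisms would in
  general disagree on the switching line. A direct chart is possible because in normal form both
  fields cross the y-axis to the left, above as well as below the origin, so that no orbit returns
  and every orbit meets that axis at most once. Only the stable separatrix has no arrival point off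
  the origin; it is the obstacle to injectivity and the reason for a cone condition on differences
  of solutions. To have forward flows for all times and estimates without boundary effects, each
  field is replaced by one on the whole plane that is uniformly close to its linear part; shrinking
  the charts brings the statement back to the given field. A separate shear on each side clears the
  upper left entries of the two matrices, and since shears act on the switching line by a sign only,
  they fit together. Charts exist onto every small square, which lets two fields share one.\<close>

lemma norm_integral_exp_bound:
  fixes w :: "real \<Rightarrow> 'a::euclidean_space"
  assumes L: "L > 0" and t: "0 \<le> t" and w: "continuous_on {0..t} w"
    and b: "\<And>s. s \<in> {0..t} \<Longrightarrow> norm (w s) \<le> K + L * M * exp (2 * L * s)"
  shows "norm (integral {0..t} w) \<le> K * t + M * (exp (2 * L * t) - 1) / 2"
proof -
  \<comment> \<open>A rate of twice the Lipschitz constant makes the integration divide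
    \<open>L * M\<close> by \<open>2 * L\<close>; the factor 1/2 that remains becomes the
    contraction constant.\<close>
  have "((\<lambda>s. K + L * M * exp (2 * L * s)) has_integral
        (K * t + M * exp (2 * L * t) / 2 - (K * 0 + M * exp (2 * L * 0) / 2))) {0..t}"
    by (rule fundamental_theorem_of_calculus[OF t])
      (auto intro!: derivative_eq_intros simp: has_real_derivative_iff_has_vector_derivative[symmetric])
  then have i: "((\<lambda>s. K + L * M * exp (2 * L * s)) has_integral (K * t + M * (exp (2 * L * t) - 1) / 2)) {0..t}"
    by (simp add: algebra_simps diff_divide_distrib)
  have "norm (integral {0..t} w) \<le> integral {0..t} (\<lambda>s. K + L * M * exp (2 * L * s))"
    using i b by (intro integral_norm_bound_integral integrable_continuous_real w has_integral_integrable[OF i]) auto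
  then show ?thesis using integral_unique[OF i] by simp
qed

text \<open>The constant part of the Picard integrand contributes a term linear in time; the weight
  has to absorb it for the operator to preserve boundedness.\<close>

lemma t_exp_bound:
  fixes L t :: real assumes "L > 0"
  shows "t * exp (- (2 * L * t)) \<le> 1 / (2 * L)"
proof -
  have "2 * L * t \<le> exp (2 * L * t)" using exp_ge_add_one_self[of "2*L*t"] by linarith
  then have "2 * L * t * exp (- (2 * L * t)) \<le> exp (2 * L * t) * exp (- (2 * L * t))"
    by (rule mult_right_mono) simp
  then have "2 * L * t * exp (- (2 * L * t)) \<le> 1" by (simp add: exp_minus)
  then show ?thesis using assms by (simp add: field_simps)
qed

text \<open>The Picard operator is a contraction of the bounded continuous functions once solutions are
  weighted by \<open>exp (- 2 * L * t)\<close>, which gives the global forward solution in one step.\<close>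

lemma Lipschitz_solution_exists:
  fixes F :: "'a::euclidean_space \<Rightarrow> 'a"
  assumes L: "L > 0" and lip: "\<And>p q. norm (F p - F q) \<le> L * norm (p - q)"
  shows "\<exists>u. u 0 = p \<and> (\<forall>t\<ge>0. (u has_vector_derivative F (u t)) (at t within {0..}))"
proof -
  have contF: "continuous_on UNIV F"
    by (rule lipschitz_on_continuous_on[of L]) (auto intro!: lipschitz_onI simp: dist_norm lip L less_imp_le)
  \<comment> \<open>The unknown is the displacement \<open>u t - p\<close> multiplied by
    \<open>exp (- (2 * L * t))\<close>, which stays bounded even if \<open>u\<close> grows
    exponentially; \<open>I v\<close> is \<open>F\<close> along the curve recovered from it.\<close>
  define I where "I v s = F (p + exp (2 * L * s) *\<^sub>R apply_bcontfun v s)" for v s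
  have contI: "continuous_on S (I v)" for S v
    unfolding I_def by (rule continuous_on_compose2[OF contF]) (auto intro!: continuous_intros)
  have boundI: "norm (I v s) \<le> norm (F p) + L * norm v * exp (2 * L * s)" for v s
  proof -
    have "norm (I v s) \<le> norm (F p) + norm (I v s - F p)" by norm
    also have "norm (I v s - F p) \<le> L * norm (exp (2 * L * s) *\<^sub>R apply_bcontfun v s)"
      unfolding I_def using lip[of "p + exp (2 * L * s) *\<^sub>R apply_bcontfun v s" p] by simp
    also have "\<dots> = L * (norm (apply_bcontfun v s) * exp (2 * L * s))" by simp
    also have "\<dots> \<le> L * (norm v * exp (2 * L * s))"
      using L norm_bounded[of v s] by (intro mult_left_mono mult_right_mono) auto
    finally show ?thesis by (simp add: mult.assoc)
  qed
  \<comment> \<open>Bounded continuous functions live on the whole line; \<open>max 0 t\<close>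
    continues the operator by 0 to negative times.\<close>
  define P where "P v t = exp (- (2 * L * max 0 t)) *\<^sub>R integral {0..max 0 t} (I v)" for v t
  have derI: "((\<lambda>t. integral {0..t} (I v)) has_vector_derivative I v t) (at t within {0..})" if "0 \<le> t" for v t
  proof -
    have "((\<lambda>t. integral {0..t} (I v)) has_vector_derivative I v t) (at t within {0..t+1})"
      using that by (intro integral_has_vector_derivative contI) auto
    then show ?thesis
      by (subst (asm) at_within_nhd[where S="{..<t+1}" and U="{0..}"]) auto
  qed
  have contP: "continuous_on UNIV (P v)" for v
  proof -
    have "continuous_on {0..} (\<lambda>t. integral {0..t} (I v))"
      using derI has_vector_derivative_continuous by (force simp: continuous_on_eq_continuous_within)
    then have "continuous_on UNIV (\<lambda>t. integral {0..max 0 t} (I v))"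
      by (rule continuous_on_compose2[where f = "\<lambda>t::real. max 0 t"])
        (auto intro!: continuous_intros)
    then show ?thesis unfolding P_def by (intro continuous_intros)
  qed
  have Pb: "P v \<in> bcontfun" for v
  proof (rule bcontfun_normI[OF contP])
    fix t :: real
    define s where "s = max 0 t"
    have s: "0 \<le> s" by (simp add: s_def)
    have "norm (P v t) = exp (- (2 * L * s)) * norm (integral {0..s} (I v))"
      by (simp add: P_def s_def)
    also have "\<dots> \<le> exp (- (2 * L * s)) * (norm (F p) * s + norm v * (exp (2 * L * s) - 1) / 2)"
      by (intro mult_left_mono norm_integral_exp_bound[OF L s contI] boundI) auto
    also have "\<dots> = norm (F p) * (s * exp (- (2 * L * s))) + norm v * (1 - exp (- (2 * L * s))) / 2"
      by (simp add: algebra_simps exp_minus)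
    also have "\<dots> \<le> norm (F p) * (1 / (2 * L)) + norm v * 1 / 2"
      using t_exp_bound[OF L, of s] by (intro add_mono mult_left_mono divide_right_mono) auto
    finally show "norm (P v t) \<le> norm (F p) * (1 / (2 * L)) + norm v * 1 / 2" .
  qed
  have contr: "dist (Bcontfun (P v)) (Bcontfun (P w)) \<le> 1/2 * dist v w" for v w
  proof (rule dist_bound)
    fix t :: real
    define s where "s = max 0 t"
    have s: "0 \<le> s" by (simp add: s_def)
    have "dist (P v t) (P w t) = norm (exp (- (2 * L * s)) *\<^sub>R (integral {0..s} (I v) - integral {0..s} (I w)))"
      by (simp add: P_def s_def dist_norm scaleR_diff_right)
    also have "integral {0..s} (I v) - integral {0..s} (I w) = integral {0..s} (\<lambda>x. I v x - I w x)"
      by (intro integral_diff[symmetric] integrable_continuous_real contI)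
    also have "norm (exp (- (2 * L * s)) *\<^sub>R \<dots>) = exp (- (2 * L * s)) * norm (integral {0..s} (\<lambda>x. I v x - I w x))"
      by simp
    also have "\<dots> \<le> exp (- (2 * L * s)) * (0 * s + dist v w * (exp (2 * L * s) - 1) / 2)"
    proof (intro mult_left_mono norm_integral_exp_bound[OF L s])
      show "continuous_on {0..s} (\<lambda>x. I v x - I w x)" by (intro continuous_intros contI)
      fix x
      have "norm (I v x - I w x) \<le> L * norm (exp (2 * L * x) *\<^sub>R (apply_bcontfun v x - apply_bcontfun w x))"
        unfolding I_def by (rule order_trans[OF lip]) (simp flip: scaleR_diff_right)
      also have "\<dots> = L * (dist (apply_bcontfun v x) (apply_bcontfun w x) * exp (2 * L * x))"
        by (simp add: dist_norm)
      also have "\<dots> \<le> L * (dist v w * exp (2 * L * x))"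
        using L by (intro mult_left_mono mult_right_mono dist_bounded) auto
      finally show "norm (I v x - I w x) \<le> 0 + L * dist v w * exp (2 * L * x)" by (simp add: mult.assoc)
    qed auto
    also have "\<dots> = dist v w * (1 - exp (- (2 * L * s))) / 2"
      by (simp add: algebra_simps exp_minus)
    also have "\<dots> \<le> dist v w * 1 / 2"
      by (intro divide_right_mono mult_left_mono) auto
    finally show "dist (apply_bcontfun (Bcontfun (P v)) t) (apply_bcontfun (Bcontfun (P w)) t) \<le> 1/2 * dist v w"
      by (simp add: Bcontfun_inverse Pb)
  qed
  obtain v where v: "Bcontfun (P v) = v"
    using banach_fix_type[of "1/2" "\<lambda>v. Bcontfun (P v)"] contr by auto
  then have vt: "apply_bcontfun v t = P v t" for t
    by (metis Bcontfun_inverse Pb)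
  define u where "u t = p + integral {0..t} (I v)" for t
  have uI: "F (u t) = I v t" if "0 \<le> t" for t
    using that by (simp add: I_def vt P_def u_def exp_minus)
  have "u 0 = p" by (simp add: u_def)
  moreover have "(u has_vector_derivative F (u t)) (at t within {0..})" if "0 \<le> t" for t
    unfolding uI[OF that] unfolding u_def using derI[OF that, of v] by (auto intro!: derivative_eq_intros)
  ultimately show ?thesis by blast
qed

text \<open>The squared distance multiplied by \<open>exp (- (2 * L * t))\<close> does not increase.
  Derivatives are required at interior times only, and as functions of time rather than through a
  field, so that a curve can also be compared with the constant 0 or with a time shift.\<close>

lemma Gronwall_Lipschitz:
  fixes u v :: "real \<Rightarrow> 'a::real_inner"
  assumes ab: "a \<le> b" and cu: "continuous_on {a..b} u" and cv: "continuous_on {a..b} v"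
    and du: "\<And>t. a < t \<Longrightarrow> t < b \<Longrightarrow> (u has_vector_derivative u' t) (at t)"
    and dv: "\<And>t. a < t \<Longrightarrow> t < b \<Longrightarrow> (v has_vector_derivative v' t) (at t)"
    and lip: "\<And>t. a < t \<Longrightarrow> t < b \<Longrightarrow> norm (u' t - v' t) \<le> L * norm (u t - v t)"
  shows "norm (u b - v b) \<le> exp (L * (b - a)) * norm (u a - v a)"
proof -
  define w where "w t = u t - v t" for t
  define \<psi> where "\<psi> t = exp (- (2 * L * t)) * (w t \<bullet> w t)" for t
  have "\<psi> b \<le> \<psi> a"
  proof (rule DERIV_nonpos_imp_decreasing_open[OF ab])
    show "continuous_on {a..b} \<psi>"
      unfolding \<psi>_def w_def by (intro continuous_intros cu cv)
    fix t assume t: "a < t" "t < b"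
    have dw: "(w has_vector_derivative (u' t - v' t)) (at t)"
      unfolding w_def by (intro derivative_intros du dv t)
    have d: "(\<psi> has_real_derivative
       exp (- (2 * L * t)) * (2 * (w t \<bullet> (u' t - v' t)) - 2 * L * (w t \<bullet> w t))) (at t)"
      unfolding \<psi>_def has_field_derivative_def
      by (rule derivative_eq_intros dw[unfolded has_vector_derivative_def] refl)+
        (auto simp: algebra_simps inner_commute fun_eq_iff)
    have "w t \<bullet> (u' t - v' t) \<le> norm (w t) * norm (u' t - v' t)"
      by (rule norm_cauchy_schwarz)
    also have "\<dots> \<le> norm (w t) * (L * norm (w t))"
      unfolding w_def by (intro mult_left_mono lip t) auto
    also have "\<dots> = L * (w t \<bullet> w t)" by (simp add: dot_square_norm power2_eq_square)
    finally have "exp (- (2 * L * t)) * (2 * (w t \<bullet> (u' t - v' t)) - 2 * L * (w t \<bullet> w t)) \<le> 0"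
      by (intro mult_nonneg_nonpos) auto
    then show "\<exists>y. (\<psi> has_real_derivative y) (at t) \<and> y \<le> 0" using d by blast
  qed
  then have "exp (2 * L * b) * \<psi> b \<le> exp (2 * L * b) * \<psi> a" by simp
  then have "(norm (w b))\<^sup>2 \<le> exp (2 * L * b) * exp (- (2 * L * a)) * (norm (w a))\<^sup>2"
    by (simp add: \<psi>_def dot_square_norm flip: exp_add mult.assoc)
  also have "\<dots> = (exp (L * (b - a)) * norm (w a))\<^sup>2"
    by (simp add: power_mult_distrib power2_eq_square algebra_simps flip: exp_add)
  finally show ?thesis unfolding w_def by (rule power2_le_imp_le) simp
qed

subsection \<open>Trajectories of a piecewise smooth field\<close>

text \<open>
  Unlike \<open>trajectory\<close>, this notion mentions neither junction times nor the Filippov field: close to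
  the origin the switching line is crossed at every point except the origin, so that an orbit other
  than the equilibrium meets it only at isolated times. It is invariant under time reversal.
\<close>

definition itraj ::
    "(real^2 \<Rightarrow> real^2) \<Rightarrow> (real^2 \<Rightarrow> real^2) \<Rightarrow> (real^2) set \<Rightarrow> real set \<Rightarrow> (real \<Rightarrow> real^2) \<Rightarrow> bool" where
  "itraj X Y U I \<gamma> \<longleftrightarrow>
     is_interval I \<and> I \<noteq> {} \<and> continuous_on I \<gamma> \<and> \<gamma> ` I \<subseteq> U \<and>
     (\<forall>t\<in>I. \<gamma> t $ 2 > 0 \<longrightarrow> (\<gamma> has_vector_derivative X (\<gamma> t)) (at t within I)) \<and>
     (\<forall>t\<in>I. \<gamma> t $ 2 < 0 \<longrightarrow> (\<gamma> has_vector_derivative Y (\<gamma> t)) (at t within I)) \<and>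
     ((\<forall>t\<in>I. \<gamma> t = 0) \<or>
      (\<forall>t\<in>I. \<gamma> t \<noteq> 0) \<and> (\<forall>a b. {a..b} \<subseteq> I \<longrightarrow> finite {t\<in>{a..b}. \<gamma> t $ 2 = 0}))"

lemma itrajD:
  assumes "itraj X Y U I \<gamma>"
  shows "is_interval I" "I \<noteq> {}" "continuous_on I \<gamma>" "\<gamma> ` I \<subseteq> U"
    "\<And>t. t \<in> I \<Longrightarrow> \<gamma> t $ 2 > 0 \<Longrightarrow> (\<gamma> has_vector_derivative X (\<gamma> t)) (at t within I)"
    "\<And>t. t \<in> I \<Longrightarrow> \<gamma> t $ 2 < 0 \<Longrightarrow> (\<gamma> has_vector_derivative Y (\<gamma> t)) (at t within I)"
    "\<And>s t. s \<in> I \<Longrightarrow> t \<in> I \<Longrightarrow> \<gamma> s = 0 \<Longrightarrow> \<gamma> t = 0"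
    "\<And>t a b. t \<in> I \<Longrightarrow> \<gamma> t \<noteq> 0 \<Longrightarrow> {a..b} \<subseteq> I \<Longrightarrow> finite {t\<in>{a..b}. \<gamma> t $ 2 = 0}"
  using assms unfolding itraj_def by (blast, blast, blast, blast, blast, blast, blast, blast)

lemma itraj_mono: "itraj X Y U I \<gamma> \<Longrightarrow> \<gamma> ` I \<subseteq> V \<Longrightarrow> itraj X Y V I \<gamma>"
  unfolding itraj_def by blast

lemma itraj_fields_cong:
  assumes "itraj X Y U I \<gamma>" "\<And>p. p \<in> U \<Longrightarrow> X p = X' p" "\<And>p. p \<in> U \<Longrightarrow> Y p = Y' p"
  shows "itraj X' Y' U I \<gamma>"
proof -
  have "X (\<gamma> t) = X' (\<gamma> t)" "Y (\<gamma> t) = Y' (\<gamma> t)" if "t \<in> I" for t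
    using assms that unfolding itraj_def by blast+
  then show ?thesis using assms(1) unfolding itraj_def by simp
qed

lemma itraj_subinterval:
  assumes "itraj X Y U I \<gamma>" "J \<subseteq> I" "is_interval J" "J \<noteq> {}"
  shows "itraj X Y U J \<gamma>"
proof -
  have d: "(\<gamma> has_vector_derivative D) (at t within J)" if "(\<gamma> has_vector_derivative D) (at t within I)" for D t
    using that assms(2) by (rule has_vector_derivative_within_subset)
  have c: "continuous_on J \<gamma>" using assms unfolding itraj_def by (blast intro: continuous_on_subset)
  show ?thesis
    unfolding itraj_def
  proof (intro conjI)
    show "(\<forall>t\<in>J. \<gamma> t = 0) \<or>
      (\<forall>t\<in>J. \<gamma> t \<noteq> 0) \<and> (\<forall>a b. {a..b} \<subseteq> J \<longrightarrow> finite {t\<in>{a..b}. \<gamma> t $ 2 = 0})"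
    proof (cases "\<forall>t\<in>I. \<gamma> t = 0")
      case True then show ?thesis using assms(2) by blast
    next
      case False
      then have "(\<forall>t\<in>I. \<gamma> t \<noteq> 0) \<and> (\<forall>a b. {a..b} \<subseteq> I \<longrightarrow> finite {t\<in>{a..b}. \<gamma> t $ 2 = 0})"
        using assms(1) unfolding itraj_def by blast
      then show ?thesis using assms(2) by (meson order_trans subsetD)
    qed
  qed (use assms c in \<open>auto simp: itraj_def intro!: d\<close>)
qed

lemma itraj_cong:
  assumes g: "itraj X Y U I \<gamma>" and e: "\<And>t. t \<in> I \<Longrightarrow> \<delta> t = \<gamma> t"
  shows "itraj X Y U I \<delta>"
proof -
  have d: "(\<delta> has_vector_derivative D) (at t within I)"
    if "t \<in> I" "(\<gamma> has_vector_derivative D) (at t within I)" for D t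
    using has_vector_derivative_transform[OF that(1) e that(2)] by blast
  have c: "continuous_on I \<delta>"
    using g e by (simp add: itraj_def cong: continuous_on_cong)
  have f: "{t\<in>{a..b}. \<delta> t $ 2 = 0} = {t\<in>{a..b}. \<gamma> t $ 2 = 0}" if "{a..b} \<subseteq> I" for a b
    using that e by fastforce
  have z: "(\<forall>t\<in>I. \<delta> t = 0) \<or> (\<forall>t\<in>I. \<delta> t \<noteq> 0) \<and>
     (\<forall>a b. {a..b} \<subseteq> I \<longrightarrow> finite {t\<in>{a..b}. \<delta> t $ 2 = 0})"
    using g f e unfolding itraj_def by (elim conjE disjE) auto
  show ?thesis
    using g c d z unfolding itraj_def by (simp add: e subset_iff image_subset_iff)
qed

lemma itraj_zero:
  assumes "is_interval I" "I \<noteq> {}" "0 \<in> U"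
  shows "itraj X Y U I (\<lambda>t. 0)"
  using assms by (auto simp: itraj_def)

text \<open>Off the switching line the two one-sided derivatives at the junction are the same value
  of a field, hence they form a derivative within the larger interval. On the line
  \<open>itraj\<close> asks for no derivative.\<close>

lemma itraj_join:
  assumes ab: "a \<le> b" "b \<le> c" and g1: "itraj X Y U {a..b} \<gamma>" and g2: "itraj X Y U {b..c} \<gamma>"
  shows "itraj X Y U {a..c} \<gamma>"
proof -
  have un: "{a..c} = {a..b} \<union> {b..c}" using ab by auto
  have d: "(\<gamma> has_vector_derivative D) (at t within {a..c})"
    if t: "t \<in> {a..c}" and 1: "t \<in> {a..b} \<Longrightarrow> (\<gamma> has_vector_derivative D) (at t within {a..b})"
      and 2: "t \<in> {b..c} \<Longrightarrow> (\<gamma> has_vector_derivative D) (at t within {b..c})" for D t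
  proof -
    consider "t < b" | "t > b" | "t = b" by linarith
    then show ?thesis
    proof cases
      case 1
      then have "at t within {a..c} = at t within {a..b}"
        using ab by (intro at_within_nhd[where S="{..<b}"]) auto
      then show ?thesis using that(2) 1 t by auto
    next
      case 2
      then have "at t within {a..c} = at t within {b..c}"
        using ab by (intro at_within_nhd[where S="{b<..}"]) auto
      then show ?thesis using that(3) 2 t by auto
    next
      case 3
      have "(\<gamma> has_vector_derivative D) (at t within {a..b})" "(\<gamma> has_vector_derivative D) (at t within {b..c})"
        using 1 2 3 ab by auto
      then show ?thesis
        unfolding un has_vector_derivative_def has_derivative_within
        unfolding at_within_union by (auto intro: filterlim_sup)
    qed
  qed
  have c: "continuous_on {a..c} \<gamma>"
    unfolding un using g1 g2 by (intro continuous_on_closed_Un) (auto simp: itraj_def)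
  have z: "(\<forall>t\<in>{a..c}. \<gamma> t = 0) \<or> (\<forall>t\<in>{a..c}. \<gamma> t \<noteq> 0) \<and>
     (\<forall>a' b'. {a'..b'} \<subseteq> {a..c} \<longrightarrow> finite {t\<in>{a'..b'}. \<gamma> t $ 2 = 0})"
  proof (cases "\<gamma> b = 0")
    case True
    have "\<gamma> t = 0" if "t \<in> {a..c}" for t
      using that itrajD(7)[OF g1, of b t] itrajD(7)[OF g2, of b t] ab True
      by (cases "t \<le> b") auto
    then show ?thesis by blast
  next
    case False
    have nz: "\<gamma> t \<noteq> 0" if "t \<in> {a..c}" for t
      using that itrajD(7)[OF g1, of t b] itrajD(7)[OF g2, of t b] ab False
      by (cases "t \<le> b") auto
    have "finite ({t\<in>{a..b}. \<gamma> t $ 2 = 0} \<union> {t\<in>{b..c}. \<gamma> t $ 2 = 0})"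
      using itrajD(8)[OF g1 _ False, of a b] itrajD(8)[OF g2 _ False, of b c] ab by auto
    moreover have "{t\<in>{a'..b'}. \<gamma> t $ 2 = 0} \<subseteq> {t\<in>{a..b}. \<gamma> t $ 2 = 0} \<union> {t\<in>{b..c}. \<gamma> t $ 2 = 0}"
      if "{a'..b'} \<subseteq> {a..c}" for a' b' using that unfolding un by blast
    ultimately show ?thesis using nz by (meson finite_subset)
  qed
  show ?thesis
    unfolding itraj_def
  proof (intro conjI)
    show "\<forall>t\<in>{a..c}. \<gamma> t $ 2 > 0 \<longrightarrow> (\<gamma> has_vector_derivative X (\<gamma> t)) (at t within {a..c})"
      using itrajD(5)[OF g1] itrajD(5)[OF g2] d by blast
    show "\<forall>t\<in>{a..c}. \<gamma> t $ 2 < 0 \<longrightarrow> (\<gamma> has_vector_derivative Y (\<gamma> t)) (at t within {a..c})"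
      using itrajD(6)[OF g1] itrajD(6)[OF g2] d by blast
    show "\<gamma> ` {a..c} \<subseteq> U" unfolding un using itrajD(4)[OF g1] itrajD(4)[OF g2] by blast
  qed (use z ab c in auto)
qed

text \<open>Being a trajectory is local in time: near each \<open>t\<close> the interval
  \<open>I\<close> agrees with a compact \<open>{a..b}\<close> having its ends in \<open>I\<close>.
  Open and unbounded intervals are thereby reduced to compact ones.\<close>

lemma itraj_local:
  assumes I: "is_interval I" "I \<noteq> {}"
    and loc: "\<And>a b. a \<in> I \<Longrightarrow> b \<in> I \<Longrightarrow> a \<le> b \<Longrightarrow> itraj X Y U {a..b} \<gamma>"
  shows "itraj X Y U I \<gamma>"
proof -
  have sub: "{a..b} \<subseteq> I" if "a \<in> I" "b \<in> I" for a b
    using that I(1) by (meson atLeastAtMost_iff mem_is_interval_1_I subsetI)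
  \<comment> \<open>If \<open>t\<close> is the least element of \<open>I\<close>, then
    \<open>a\<close> is \<open>t\<close> itself, and likewise \<open>b\<close> at the other end; no
    point of \<open>I\<close> near \<open>t\<close> is missed.\<close>
  have nb: "\<exists>a b. a \<in> I \<and> b \<in> I \<and> a \<le> t \<and> t \<le> b \<and> at t within I = at t within {a..b}" if t: "t \<in> I" for t
  proof -
    obtain a A where a: "a \<in> I" "a \<le> t" "open A" "t \<in> A" "\<And>s. s \<in> I \<Longrightarrow> s \<in> A \<Longrightarrow> a \<le> s"
    proof (cases "\<exists>a\<in>I. a < t")
      case True then obtain a where "a \<in> I" "a < t" by blast
      then show ?thesis by (intro that[of a "{a<..}"]) auto
    next
      case False then show ?thesis by (intro that[of t UNIV]) (use t in \<open>auto simp: not_less\<close>)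
    qed
    obtain b B where b: "b \<in> I" "t \<le> b" "open B" "t \<in> B" "\<And>s. s \<in> I \<Longrightarrow> s \<in> B \<Longrightarrow> s \<le> b"
    proof (cases "\<exists>a\<in>I. a > t")
      case True then obtain a where "a \<in> I" "a > t" by blast
      then show ?thesis by (intro that[of a "{..<a}"]) auto
    next
      case False then show ?thesis by (intro that[of t UNIV]) (use t in \<open>auto simp: not_less\<close>)
    qed
    have "at t within I = at t within {a..b}"
      by (rule at_within_nhd[where S="A \<inter> B"]) (use a b sub[of a b] in auto)
    then show ?thesis using a b by blast
  qed
  have c: "continuous_on I \<gamma>"
    unfolding continuous_on_eq_continuous_within
  proof
    fix t assume "t \<in> I"
    then obtain a b where ab: "a \<in> I" "b \<in> I" "a \<le> t" "t \<le> b" "at t within I = at t within {a..b}"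
      using nb by blast
    then have "continuous_on {a..b} \<gamma>" using itrajD(3)[OF loc[of a b]] by auto
    then show "continuous (at t within I) \<gamma>"
      using ab by (simp add: continuous_on_eq_continuous_within)
  qed
  obtain t0 where t0: "t0 \<in> I" using I by blast
  have z: "(\<forall>t\<in>I. \<gamma> t = 0) \<or> (\<forall>t\<in>I. \<gamma> t \<noteq> 0) \<and>
     (\<forall>a' b'. {a'..b'} \<subseteq> I \<longrightarrow> finite {t\<in>{a'..b'}. \<gamma> t $ 2 = 0})"
  proof -
    have zz: "\<gamma> s = 0 \<longleftrightarrow> \<gamma> t = 0" if "s \<in> I" "t \<in> I" for s t
    proof (cases "s \<le> t")
      case True then show ?thesis using itrajD(7)[OF loc[OF that True], of s t] itrajD(7)[OF loc[OF that True], of t s] by (meson True atLeastAtMost_iff order_refl)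
    next
      case False
      then have ts: "t \<le> s" by simp
      show ?thesis using itrajD(7)[OF loc[OF that(2,1) ts], of s t] itrajD(7)[OF loc[OF that(2,1) ts], of t s]
        by (meson ts atLeastAtMost_iff order_refl)
    qed
    show ?thesis
    proof (cases "\<gamma> t0 = 0")
      case True then show ?thesis using zz t0 by blast
    next
      case False
      have "finite {t\<in>{a..b}. \<gamma> t $ 2 = 0}" if "{a..b} \<subseteq> I" for a b
      proof (cases "a \<le> b")
        case True
        then have "a \<in> I" "b \<in> I" using that by auto
        then show ?thesis using itrajD(8)[OF loc[of a b], of a a b] True zz[of a t0] False t0 by auto
      qed auto
      then show ?thesis using False zz t0 by blast
    qed
  qed
  show ?thesis
    unfolding itraj_def
  proof (intro conjI)
    show "\<gamma> ` I \<subseteq> U" using itrajD(4)[OF loc] by fastforce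
    show "\<forall>t\<in>I. \<gamma> t $ 2 > 0 \<longrightarrow> (\<gamma> has_vector_derivative X (\<gamma> t)) (at t within I)"
    proof (intro ballI impI)
      fix t assume t: "t \<in> I" "\<gamma> t $ 2 > 0"
      then obtain a b where ab: "a \<in> I" "b \<in> I" "a \<le> t" "t \<le> b" "at t within I = at t within {a..b}"
        using nb by blast
      then show "(\<gamma> has_vector_derivative X (\<gamma> t)) (at t within I)"
        using itrajD(5)[OF loc[of a b], of t] t by auto
    qed
    show "\<forall>t\<in>I. \<gamma> t $ 2 < 0 \<longrightarrow> (\<gamma> has_vector_derivative Y (\<gamma> t)) (at t within I)"
    proof (intro ballI impI)
      fix t assume t: "t \<in> I" "\<gamma> t $ 2 < 0"
      then obtain a b where ab: "a \<in> I" "b \<in> I" "a \<le> t" "t \<le> b" "at t within I = at t within {a..b}"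
        using nb by blast
      then show "(\<gamma> has_vector_derivative Y (\<gamma> t)) (at t within I)"
        using itrajD(6)[OF loc[of a b], of t] t by auto
    qed
  qed (use z I c in auto)
qed

text \<open>Lets a maximal trajectory absorb any other one through the same point, which is how a
  maximal trajectory is compared with a known orbit.\<close>

lemma itraj_glue:
  assumes g: "itraj X Y U I \<gamma>" and d: "itraj X Y U J \<delta>" and t0: "t0 \<in> I" "t0 \<in> J"
    and eq: "\<And>t. t \<in> I \<Longrightarrow> t \<in> J \<Longrightarrow> \<gamma> t = \<delta> t"
  shows "itraj X Y U (I \<union> J) (\<lambda>t. if t \<in> I then \<gamma> t else \<delta> t)"
proof -
  let ?w = "\<lambda>t. if t \<in> I then \<gamma> t else \<delta> t"
  have gI: "itraj X Y U I ?w" by (rule itraj_cong[OF g]) auto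
  have dJ: "itraj X Y U J ?w" by (rule itraj_cong[OF d]) (auto simp: eq)
  note iI = itrajD(1)[OF g] and iJ = itrajD(1)[OF d]
  have subI: "{a..b} \<subseteq> I" if "a \<in> I" "b \<in> I" for a b
    using that iI by (meson atLeastAtMost_iff mem_is_interval_1_I subsetI)
  have subJ: "{a..b} \<subseteq> J" if "a \<in> J" "b \<in> J" for a b
    using that iJ by (meson atLeastAtMost_iff mem_is_interval_1_I subsetI)
  have I1: "itraj X Y U {a..b} ?w" if "a \<in> I" "b \<in> I" "a \<le> b" for a b
    using that subI by (intro itraj_subinterval[OF gI]) auto
  have J1: "itraj X Y U {a..b} ?w" if "a \<in> J" "b \<in> J" "a \<le> b" for a b
    using that subJ by (intro itraj_subinterval[OF dJ]) auto
  show ?thesis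
  proof (rule itraj_local)
    have "connected (I \<union> J)"
      using iI iJ t0 by (intro connected_Un) (auto simp: is_interval_connected_1)
    then show "is_interval (I \<union> J)" by (simp add: is_interval_connected_1)
    show "I \<union> J \<noteq> {}" using t0 by auto
    fix a b assume a: "a \<in> I \<union> J" and b: "b \<in> I \<union> J" and ab: "a \<le> b"
    show "itraj X Y U {a..b} ?w"
    proof (cases "(a \<in> I \<and> b \<in> I) \<or> (a \<in> J \<and> b \<in> J)")
      case True then show ?thesis using I1 J1 ab by blast
    next
      case False
      \<comment> \<open>With one end in each part, the common time \<open>t0\<close> lies between
        the ends, and the curve is joined there.\<close>
      then consider "a \<in> I" "b \<in> J" "a \<notin> J" "b \<notin> I" | "a \<in> J" "b \<in> I" "a \<notin> I" "b \<notin> J" using a b by blast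
      then show ?thesis
      proof cases
        case 1
        have "a \<le> t0" using 1 subJ[of t0 b] t0 ab by (meson subsetD atLeastAtMost_iff linear)
        moreover have "t0 \<le> b" using 1 subI[of a t0] t0 ab by (meson subsetD atLeastAtMost_iff linear)
        ultimately
        show ?thesis using itraj_join[OF _ _ I1[of a t0] J1[of t0 b]] 1 t0 by auto
      next
        case 2
        have "a \<le> t0" using 2 subI[of t0 b] t0 ab by (meson subsetD atLeastAtMost_iff linear)
        moreover have "t0 \<le> b" using 2 subJ[of a t0] t0 ab by (meson subsetD atLeastAtMost_iff linear)
        ultimately
        show ?thesis using itraj_join[OF _ _ J1[of a t0] I1[of t0 b]] 2 t0 by auto
      qed
    qed
  qed
qed

text \<open>One transport lemma covers time shifts, time reversal combined with mirror images
  (\<open>e = -1\<close>), and piecewise linear changes of coordinates.\<close>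

lemma itraj_transform:
  assumes g: "itraj X Y U I \<gamma>" and A: "bounded_linear A" and B: "bounded_linear B"
    and e: "e = 1 \<or> e = -1" and cT: "continuous_on UNIV T"
    and TA: "\<And>p. p $ 2 > 0 \<Longrightarrow> T p = A p" and TB: "\<And>p. p $ 2 < 0 \<Longrightarrow> T p = B p"
    and T2: "\<And>p. T p $ 2 = p $ 2" and T0: "\<And>p. T p = 0 \<longleftrightarrow> p = 0"
    and X': "\<And>p. p $ 2 > 0 \<Longrightarrow> X' (T p) = e *\<^sub>R A (X p)"
    and Y': "\<And>p. p $ 2 < 0 \<Longrightarrow> Y' (T p) = e *\<^sub>R B (Y p)"
  shows "itraj X' Y' (T ` U) {t. e * t + r \<in> I} (\<lambda>t. T (\<gamma> (e * t + r)))"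
proof -
  define J where "J = {t. e * t + r \<in> I}"
  define f where "f t = e * t + r" for t
  note gD = itrajD[OF g]
  have ee: "e * (e * t) = t" for t using e by auto
  have fJ: "f ` J \<subseteq> I" by (auto simp: J_def f_def)
  have J: "is_interval J"
    unfolding is_interval_1
  proof (intro ballI allI impI)
    fix a b x assume *: "a \<in> J" "b \<in> J" "a \<le> x \<and> x \<le> b"
    have "f x \<in> closed_segment (f a) (f b)"
      using *(3) e by (auto simp: f_def closed_segment_eq_real_ivl)
    moreover have "closed_segment (f a) (f b) \<subseteq> I"
      using * fJ gD(1) by (intro closed_segment_subset) (auto simp: is_interval_convex)
    ultimately show "x \<in> J" by (auto simp: J_def f_def)
  qed
  have Jne: "J \<noteq> {}"
  proof -
    obtain u where "u \<in> I" using gD(2) by blast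
    then have "e * (u - r) \<in> J" by (simp add: J_def ee)
    then show ?thesis by blast
  qed
  have cf: "continuous_on J (\<lambda>t. \<gamma> (f t))"
    by (rule continuous_on_compose2[OF gD(3)]) (use fJ in \<open>auto simp: f_def intro!: continuous_intros\<close>)
  have c: "continuous_on J (\<lambda>t. T (\<gamma> (f t)))"
    by (rule continuous_on_compose2[OF cT cf]) auto
  have d1: "((\<lambda>t. \<gamma> (f t)) has_vector_derivative e *\<^sub>R D) (at t within J)"
    if "(\<gamma> has_vector_derivative D) (at (f t) within I)" for D t
  proof -
    have "(f has_vector_derivative e) (at t within J)"
      unfolding f_def by (auto intro!: derivative_eq_intros simp: has_real_derivative_iff_has_vector_derivative[symmetric])
    then have "(\<gamma> \<circ> f has_vector_derivative e *\<^sub>R D) (at t within J)"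
      using has_vector_derivative_within_subset[OF that fJ] by (rule vector_diff_chain_within)
    then show ?thesis by (simp add: o_def)
  qed
  \<comment> \<open>\<open>T\<close> is linear on each open side only; by continuity the curve stays
    on its side for nearby times, so that its image has the derivative of a linear image.\<close>
  have ev: "\<exists>d>0. \<forall>s\<in>J. dist s t < d \<longrightarrow> \<sigma> * \<gamma> (f s) $ 2 > 0"
    if t: "t \<in> J" and pos: "\<sigma> * \<gamma> (f t) $ 2 > 0" for t \<sigma>
  proof -
    have "continuous_on J (\<lambda>t. \<sigma> * \<gamma> (f t) $ 2)" by (intro continuous_intros cf)
    then have "\<forall>\<^sub>F s in at t within J. \<sigma> * \<gamma> (f s) $ 2 > 0"
      using t pos by (intro order_tendstoD(1)[where y="\<sigma> * \<gamma> (f t) $ 2"]) (auto simp: continuous_on_def)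
    then obtain d where "d>0" "\<forall>s\<in>J. s \<noteq> t \<and> dist s t < d \<longrightarrow> \<sigma> * \<gamma> (f s) $ 2 > 0"
      by (auto simp: eventually_at)
    then show ?thesis using pos by (intro exI[of _ d]) auto
  qed
  have dX: "((\<lambda>t. T (\<gamma> (f t))) has_vector_derivative X' (T (\<gamma> (f t)))) (at t within J)"
    if t: "t \<in> J" and pos: "\<gamma> (f t) $ 2 > 0" for t
  proof -
    have "((\<lambda>t. A (\<gamma> (f t))) has_vector_derivative A (e *\<^sub>R X (\<gamma> (f t)))) (at t within J)"
      using t pos fJ by (intro bounded_linear.has_vector_derivative[OF A] d1 gD(5)) auto
    then have d: "((\<lambda>t. A (\<gamma> (f t))) has_vector_derivative X' (T (\<gamma> (f t)))) (at t within J)"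
      using A pos by (simp add: X' bounded_linear.linear linear_scale)
    obtain d' where "d' > 0" "\<forall>s\<in>J. dist s t < d' \<longrightarrow> 1 * \<gamma> (f s) $ 2 > 0"
      using ev[of t 1] t pos by auto
    then show ?thesis
      by (intro has_vector_derivative_transform_within[OF d _ t, of d']) (auto simp: TA)
  qed
  have dY: "((\<lambda>t. T (\<gamma> (f t))) has_vector_derivative Y' (T (\<gamma> (f t)))) (at t within J)"
    if t: "t \<in> J" and pos: "\<gamma> (f t) $ 2 < 0" for t
  proof -
    have "((\<lambda>t. B (\<gamma> (f t))) has_vector_derivative B (e *\<^sub>R Y (\<gamma> (f t)))) (at t within J)"
      using t pos fJ by (intro bounded_linear.has_vector_derivative[OF B] d1 gD(6)) auto
    then have d: "((\<lambda>t. B (\<gamma> (f t))) has_vector_derivative Y' (T (\<gamma> (f t)))) (at t within J)"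
      using B pos by (simp add: Y' bounded_linear.linear linear_scale)
    obtain d' where "d' > 0" "\<forall>s\<in>J. dist s t < d' \<longrightarrow> (-1) * \<gamma> (f s) $ 2 > 0"
      using ev[of t "-1"] t pos by auto
    then show ?thesis
      by (intro has_vector_derivative_transform_within[OF d _ t, of d']) (auto simp: TB)
  qed
  have z: "(\<forall>t\<in>J. T (\<gamma> (f t)) = 0) \<or> (\<forall>t\<in>J. T (\<gamma> (f t)) \<noteq> 0) \<and>
     (\<forall>a b. {a..b} \<subseteq> J \<longrightarrow> finite {t\<in>{a..b}. T (\<gamma> (f t)) $ 2 = 0})"
  proof (cases "\<forall>t\<in>I. \<gamma> t = 0")
    case True then show ?thesis using fJ T0 by blast
  next
    case False
    then obtain t1 where t1: "t1 \<in> I" "\<gamma> t1 \<noteq> 0" by blast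
    then have nz: "\<forall>t\<in>I. \<gamma> t \<noteq> 0" using gD(7) by blast
    have "finite {t\<in>{a..b}. T (\<gamma> (f t)) $ 2 = 0}" if ab: "{a..b} \<subseteq> J" for a b
    proof -
      have cfab: "continuous_on {a..b} f" unfolding f_def by (intro continuous_intros)
      obtain a' b' where ab': "{a'..b'} = f ` {a..b}"
        using connected_compact_interval_1[of "f ` {a..b}"]
        by (metis compact_Icc compact_continuous_image connected_Icc connected_continuous_image cfab)
      have "finite {t\<in>{a'..b'}. \<gamma> t $ 2 = 0}"
        using ab' ab fJ by (intro gD(8)[OF t1]) blast
      moreover have "{t\<in>{a..b}. T (\<gamma> (f t)) $ 2 = 0} \<subseteq> (\<lambda>u. e * (u - r)) ` {t\<in>{a'..b'}. \<gamma> t $ 2 = 0}"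
      proof
        fix t assume t: "t \<in> {t\<in>{a..b}. T (\<gamma> (f t)) $ 2 = 0}"
        then have "f t \<in> {t\<in>{a'..b'}. \<gamma> t $ 2 = 0}" unfolding ab' by (auto simp: T2)
        moreover have "t = e * (f t - r)" by (simp add: f_def ee)
        ultimately show "t \<in> (\<lambda>u. e * (u - r)) ` {t\<in>{a'..b'}. \<gamma> t $ 2 = 0}" by blast
      qed
      ultimately show ?thesis by (meson finite_imageI finite_subset)
    qed
    then show ?thesis using nz fJ T0 by blast
  qed
  have "itraj X' Y' (T ` U) J (\<lambda>t. T (\<gamma> (f t)))"
    unfolding itraj_def
  proof (intro conjI)
    show "(\<lambda>t. T (\<gamma> (f t))) ` J \<subseteq> T ` U" using gD(4) fJ by blast
  qed (use J Jne c z dX dY T2 in simp_all)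
  then show ?thesis by (simp add: J_def f_def)
qed

lemma itraj_shift:
  assumes "itraj X Y U I \<gamma>"
  shows "itraj X Y U {t. t + r \<in> I} (\<lambda>t. \<gamma> (t + r))"
  using itraj_transform[OF assms bounded_linear_ident bounded_linear_ident, where e=1 and r=r and T="\<lambda>p. p"]
  by (simp add: continuous_on_id)

lemma itraj_reverse:
  assumes "itraj X Y U I \<gamma>"
  shows "itraj (\<lambda>p. - X p) (\<lambda>p. - Y p) U {t. - t \<in> I} (\<lambda>t. \<gamma> (- t))"
  using itraj_transform[OF assms bounded_linear_ident bounded_linear_ident, where e="-1" and r=0 and T="\<lambda>p. p"]
  by (simp add: continuous_on_id)

text \<open>The point reflection exchanges the sides and keeps the direction of time;
  \<open>itraj_transform\<close> does not cover it, because there every point keeps its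
  ordinate.\<close>

lemma itraj_flip:
  assumes "itraj X Y U I \<gamma>"
  shows "itraj (\<lambda>p. - Y (- p)) (\<lambda>p. - X (- p)) (uminus ` U) I (\<lambda>t. - \<gamma> t)"
proof -
  have "((\<lambda>t. - \<gamma> t) has_vector_derivative - D) (at t within I)"
    if "(\<gamma> has_vector_derivative D) (at t within I)" for D t
    using that by (auto intro!: derivative_eq_intros)
  then show ?thesis
    using assms unfolding itraj_def by (auto intro!: continuous_intros)
qed

lemma norm_Lipschitz_continuous_on:
  fixes F :: "'a::real_normed_vector \<Rightarrow> 'b::real_normed_vector"
  assumes "\<And>p q. p \<in> B \<Longrightarrow> q \<in> B \<Longrightarrow> norm (F p - F q) \<le> L * norm (p - q)"
  shows "continuous_on B F"
proof (rule lipschitz_on_continuous_on[of "max L 0"], rule lipschitz_onI)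
  fix p q assume pq: "p \<in> B" "q \<in> B"
  have "L * norm (p - q) \<le> max L 0 * norm (p - q)" by (intro mult_right_mono) auto
  then show "dist (F p) (F q) \<le> max L 0 * dist p q"
    using assms[OF pq] by (simp add: dist_norm)
qed simp

text \<open>At a crossing point both fields push to the side \<open>\<sigma>\<close>. As zeros of
  the ordinate are isolated, the curve is on one side just afterwards; on the wrong side the field
  acting there would drive it towards \<open>\<sigma>\<close>, although it started at height
  0.\<close>

lemma itraj_eventually_one_side:
  fixes X Y :: "real^2 \<Rightarrow> real^2"
  assumes g: "itraj X Y B {t..b} \<gamma>" and tb: "t < b" and nz: "\<gamma> t \<noteq> 0"
    and cX: "continuous_on B X" and cY: "continuous_on B Y"
    and \<sigma>: "\<sigma> = 1 \<or> \<sigma> = (-1::real)"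
    and side: "\<sigma> * \<gamma> t $ 2 > 0 \<or> \<gamma> t $ 2 = 0 \<and> \<sigma> * X (\<gamma> t) $ 2 > 0 \<and> \<sigma> * Y (\<gamma> t) $ 2 > 0"
  shows "\<exists>e>0. t + e \<le> b \<and> (\<forall>s. t < s \<and> s \<le> t + e \<longrightarrow> \<sigma> * \<gamma> s $ 2 > 0)"
proof -
  note gD = itrajD[OF g]
  have ev: "\<exists>e>0. t + e \<le> b \<and> (\<forall>s. t \<le> s \<and> s \<le> t + e \<longrightarrow> f s > 0)"
    if "continuous_on {t..b} f" "f t > 0" for f :: "real \<Rightarrow> real"
  proof -
    have "\<forall>\<^sub>F s in at t within {t..b}. f s > 0"
      using that tb by (intro order_tendstoD(1)[where y="f t"]) (auto simp: continuous_on_def)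
    then obtain d where d: "d>0" "\<forall>s\<in>{t..b}. s \<noteq> t \<and> dist s t < d \<longrightarrow> f s > 0"
      by (auto simp: eventually_at)
    have "f s > 0" if "t \<le> s" "s \<le> t + min (d/2) (b - t)" for s
      using d(2)[rule_format, of s] that d(1) \<open>f t > 0\<close>
      by (cases "s = t") (auto simp: dist_real_def min_def split: if_splits)
    then show ?thesis using d(1) tb by (intro exI[of _ "min (d/2) (b-t)"]) auto
  qed
  show ?thesis
  proof (cases "\<gamma> t $ 2 = 0")
    case False
    then show ?thesis
      using ev[of "\<lambda>s. \<sigma> * \<gamma> s $ 2"] side gD(3) by (fastforce intro!: continuous_intros)
  next
    case True
    \<comment> \<open>The field of the side opposite to \<open>\<sigma>\<close>, which would act if
      the curve went the wrong way.\<close>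
    define F where "F = (if \<sigma> = 1 then Y else X)"
    have cF: "continuous_on {t..b} (\<lambda>s. \<sigma> * F (\<gamma> s) $ 2)"
      unfolding F_def using cX cY gD(3,4)
      by (auto intro!: continuous_intros continuous_on_compose2[of B X _ \<gamma>] continuous_on_compose2[of B Y _ \<gamma>])
    obtain e1 where e1: "e1 > 0" "t + e1 \<le> b" "\<forall>s. t \<le> s \<and> s \<le> t + e1 \<longrightarrow> \<sigma> * F (\<gamma> s) $ 2 > 0"
    proof -
      have "\<sigma> * F (\<gamma> t) $ 2 > 0" using side True by (auto simp: F_def)
      from ev[OF cF this] that show ?thesis by blast
    qed
    have fin: "finite {s\<in>{t..b}. \<gamma> s $ 2 = 0}" using gD(8)[of t t b] tb nz by auto
    obtain e2 where e2: "e2 > 0" "\<forall>s\<in>{s\<in>{t..b}. \<gamma> s $ 2 = 0}. s \<noteq> t \<longrightarrow> e2 \<le> dist t s"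
      using finite_set_avoid[OF fin, of t] by blast
    define e where "e = min e1 (e2/2)"
    have e: "e > 0" "t + e \<le> b" "e \<le> e1" "e < e2" using e1 e2 by (auto simp: e_def)
    have nz2: "\<gamma> s $ 2 \<noteq> 0" if "t < s" "s \<le> t + e" for s
      using e2(2)[rule_format, of s] that e by (auto simp: dist_real_def)
    have pos: "\<sigma> * \<gamma> s $ 2 > 0" if s: "t < s" "s \<le> t + e" for s
    proof (rule ccontr)
      assume "\<not> ?thesis"
      then have neg: "\<sigma> * \<gamma> s $ 2 < 0" using nz2[OF s] \<sigma> by auto
      have negall: "\<sigma> * \<gamma> r $ 2 < 0" if r: "t < r" "r < s" for r
      proof (rule ccontr)
        assume "\<not> ?thesis"
        then have "\<exists>x\<ge>r. x \<le> s \<and> \<sigma> * \<gamma> x $ 2 = 0"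
          using r s e neg by (intro IVT2') (auto intro!: continuous_intros continuous_on_subset[OF gD(3)])
        then show False using nz2 r s \<sigma> by auto
      qed
      have "\<sigma> * \<gamma> t $ 2 < \<sigma> * \<gamma> s $ 2"
      proof (rule DERIV_pos_imp_increasing_open[OF s(1)])
        show "continuous_on {t..s} (\<lambda>x. \<sigma> * \<gamma> x $ 2)"
          using s e by (intro continuous_intros continuous_on_subset[OF gD(3)]) auto
        fix r assume r: "t < r" "r < s"
        have rI: "r \<in> {t..b}" using r s e by auto
        have "(\<gamma> has_vector_derivative F (\<gamma> r)) (at r within {t..b})"
          using gD(5)[OF rI] gD(6)[OF rI] negall[OF r] \<sigma> unfolding F_def by fastforce
        then have "(\<gamma> has_vector_derivative F (\<gamma> r)) (at r)"
          using at_within_Icc_at[of t r b] r s e by simp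
        then have "((\<lambda>x. \<gamma> x $ 2) has_vector_derivative F (\<gamma> r) $ 2) (at r)"
          by (rule bounded_linear.has_vector_derivative[OF bounded_linear_vec_nth])
        then have "((\<lambda>x. \<sigma> * \<gamma> x $ 2) has_real_derivative \<sigma> * F (\<gamma> r) $ 2) (at r)"
          unfolding has_real_derivative_iff_has_vector_derivative[symmetric] by (auto intro!: derivative_eq_intros)
        moreover have "\<sigma> * F (\<gamma> r) $ 2 > 0" using e1(3)[rule_format, of r] r s e by simp
        ultimately show "\<exists>y. ((\<lambda>x. \<sigma> * \<gamma> x $ 2) has_real_derivative y) (at r) \<and> y > 0" by blast
      qed
      then show False using neg True by simp
    qed
    then show ?thesis using e by blast
  qed
qed

text \<open>From a common point other than the origin both curves enter the same side, where they
  solve the same Lipschitz equation. At the origin the definition of \<open>itraj\<close> forces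
  both to rest.\<close>

lemma itraj_unique_right:
  fixes X Y :: "real^2 \<Rightarrow> real^2"
  assumes g: "itraj X Y B I \<gamma>" and d: "itraj X Y B J \<delta>"
    and lX: "\<And>p q. p \<in> B \<Longrightarrow> q \<in> B \<Longrightarrow> norm (X p - X q) \<le> L * norm (p - q)"
    and lY: "\<And>p q. p \<in> B \<Longrightarrow> q \<in> B \<Longrightarrow> norm (Y p - Y q) \<le> L * norm (p - q)"
    and cross: "\<And>p. p \<in> B \<Longrightarrow> p $ 2 = 0 \<Longrightarrow> p \<noteq> 0 \<Longrightarrow> X p $ 2 * Y p $ 2 > 0"
    and t: "t \<in> I" "t \<in> J" and eq: "\<gamma> t = \<delta> t"
  shows "\<exists>e>0. \<forall>s\<in>I \<inter> J. t \<le> s \<and> s < t + e \<longrightarrow> \<gamma> s = \<delta> s"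
proof (cases "\<exists>b. b \<in> I \<inter> J \<and> t < b")
  case False
  then show ?thesis using eq by (intro exI[of _ 1]) (force simp: not_less)
next
  case True
  then obtain b where b: "b \<in> I" "b \<in> J" "t < b" by auto
  have sub: "{t..b} \<subseteq> I" "{t..b} \<subseteq> J"
    using b t itrajD(1)[OF g] itrajD(1)[OF d]
    by (meson atLeastAtMost_iff mem_is_interval_1_I subsetI)+
  have g': "itraj X Y B {t..b} \<gamma>" and d': "itraj X Y B {t..b} \<delta>"
    using b by (auto intro!: itraj_subinterval[OF g] itraj_subinterval[OF d] sub)
  note gD = itrajD[OF g'] and dD = itrajD[OF d']
  have cX: "continuous_on B X"
    by (rule norm_Lipschitz_continuous_on[OF lX])
  have cY: "continuous_on B Y"
    by (rule norm_Lipschitz_continuous_on[OF lY])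
  show ?thesis
  proof (cases "\<gamma> t = 0")
    case True
    then have "\<gamma> s = \<delta> s" if "s \<in> I \<inter> J" for s
      using itrajD(7)[OF g t(1), of s] itrajD(7)[OF d t(2), of s] that eq by auto
    then show ?thesis by (intro exI[of _ 1]) auto
  next
    case False
    have tB: "\<gamma> t \<in> B" using gD(4) b by auto
    obtain \<sigma> where \<sigma>: "\<sigma> = 1 \<or> \<sigma> = (-1::real)"
      and side: "\<sigma> * \<gamma> t $ 2 > 0 \<or> \<gamma> t $ 2 = 0 \<and> \<sigma> * X (\<gamma> t) $ 2 > 0 \<and> \<sigma> * Y (\<gamma> t) $ 2 > 0"
    proof (cases "\<gamma> t $ 2 > 0 \<or> \<gamma> t $ 2 = 0 \<and> X (\<gamma> t) $ 2 > 0")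
      case True
      then show ?thesis using cross[OF tB _ False] by (intro that[of 1]) (auto simp: zero_less_mult_iff)
    next
      case F: False
      then show ?thesis using cross[OF tB _ False] by (intro that[of "-1"]) (auto simp: zero_less_mult_iff)
    qed
    obtain e1 where e1: "e1 > 0" "t + e1 \<le> b" "\<forall>s. t < s \<and> s \<le> t + e1 \<longrightarrow> \<sigma> * \<gamma> s $ 2 > 0"
      using itraj_eventually_one_side[OF g' b(3) False cX cY \<sigma> side] by blast
    obtain e2 where e2: "e2 > 0" "t + e2 \<le> b" "\<forall>s. t < s \<and> s \<le> t + e2 \<longrightarrow> \<sigma> * \<delta> s $ 2 > 0"
      using itraj_eventually_one_side[OF d' b(3) _ cX cY \<sigma>] side False eq by auto
    define e where "e = min e1 e2"
    define F where "F = (if \<sigma> = 1 then X else Y)"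
    have lF: "norm (F p - F q) \<le> L * norm (p - q)" if "p \<in> B" "q \<in> B" for p q
      using that lX lY by (simp add: F_def)
    have "\<gamma> s = \<delta> s" if s: "t \<le> s" "s \<le> t + e" for s
    proof -
      have seg: "{t..s} \<subseteq> {t..b}" using s e1 e2 by (auto simp: e_def)
      have dg: "(\<gamma> has_vector_derivative F (\<gamma> r)) (at r)" if r: "t < r" "r < s" for r
      proof -
        have "\<sigma> * \<gamma> r $ 2 > 0" using e1(3)[rule_format, of r] r s by (simp add: e_def)
        moreover have rI: "r \<in> {t..b}" using r seg by auto
        ultimately have "(\<gamma> has_vector_derivative F (\<gamma> r)) (at r within {t..b})"
          using gD(5)[OF rI] gD(6)[OF rI] \<sigma> unfolding F_def by fastforce
        then show ?thesis using at_within_Icc_at[of t r b] r s e1(2) by (simp add: e_def)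
      qed
      have dd: "(\<delta> has_vector_derivative F (\<delta> r)) (at r)" if r: "t < r" "r < s" for r
      proof -
        have "\<sigma> * \<delta> r $ 2 > 0" using e2(3)[rule_format, of r] r s by (simp add: e_def)
        moreover have rI: "r \<in> {t..b}" using r seg by auto
        ultimately have "(\<delta> has_vector_derivative F (\<delta> r)) (at r within {t..b})"
          using dD(5)[OF rI] dD(6)[OF rI] \<sigma> unfolding F_def by fastforce
        then show ?thesis using at_within_Icc_at[of t r b] r s e1(2) by (simp add: e_def)
      qed
      have "norm (\<gamma> s - \<delta> s) \<le> exp (L * (s - t)) * norm (\<gamma> t - \<delta> t)"
      proof (rule Gronwall_Lipschitz[OF s(1) _ _ dg dd])
        show "continuous_on {t..s} \<gamma>" "continuous_on {t..s} \<delta>"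
          using gD(3) dD(3) seg continuous_on_subset by blast+
        fix r assume "t < r" "r < s"
        then show "norm (F (\<gamma> r) - F (\<delta> r)) \<le> L * norm (\<gamma> r - \<delta> r)"
          using seg gD(4) dD(4) by (intro lF) (auto simp: image_subset_iff)
      qed
      then show ?thesis using eq by simp
    qed
    then show ?thesis using e1 e2 by (intro exI[of _ e]) (auto simp: e_def)
  qed
qed

text \<open>The set of agreement is closed and, by one-sided uniqueness for the curves and for their
  reversals, open in the common interval. Reversal negates both fields, so the product in the
  crossing condition is kept.\<close>

lemma itraj_unique:
  fixes X Y :: "real^2 \<Rightarrow> real^2"
  assumes g: "itraj X Y B I \<gamma>" and d: "itraj X Y B J \<delta>"
    and lX: "\<And>p q. p \<in> B \<Longrightarrow> q \<in> B \<Longrightarrow> norm (X p - X q) \<le> L * norm (p - q)"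
    and lY: "\<And>p q. p \<in> B \<Longrightarrow> q \<in> B \<Longrightarrow> norm (Y p - Y q) \<le> L * norm (p - q)"
    and cross: "\<And>p. p \<in> B \<Longrightarrow> p $ 2 = 0 \<Longrightarrow> p \<noteq> 0 \<Longrightarrow> X p $ 2 * Y p $ 2 > 0"
    and t0: "t0 \<in> I" "t0 \<in> J" and eq: "\<gamma> t0 = \<delta> t0" and t: "t \<in> I" "t \<in> J"
  shows "\<gamma> t = \<delta> t"
proof -
  define K where "K = I \<inter> J"
  define E where "E = {t\<in>K. \<gamma> t = \<delta> t}"
  have "is_interval K" using itrajD(1)[OF g] itrajD(1)[OF d] by (simp add: K_def is_interval_Int)
  then have conn: "connected K" by (simp add: is_interval_connected_1)
  have cg: "continuous_on K \<gamma>" "continuous_on K \<delta>"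
    using itrajD(3)[OF g] itrajD(3)[OF d] by (auto simp: K_def intro: continuous_on_subset)
  have "closedin (top_of_set K) {t\<in>K. \<gamma> t - \<delta> t = 0}"
    by (intro continuous_closedin_preimage_constant continuous_intros cg)
  then have cl: "closedin (top_of_set K) E" by (simp add: E_def)
  have op: "openin (top_of_set K) E"
    unfolding openin_euclidean_subtopology_iff
  proof (intro conjI ballI)
    show "E \<subseteq> K" by (auto simp: E_def)
    fix s assume "s \<in> E"
    then have s: "s \<in> I" "s \<in> J" "\<gamma> s = \<delta> s" by (auto simp: E_def K_def)
    obtain e1 where e1: "e1 > 0" "\<forall>r\<in>I \<inter> J. s \<le> r \<and> r < s + e1 \<longrightarrow> \<gamma> r = \<delta> r"
      using itraj_unique_right[OF g d lX lY cross s] by blast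
    obtain e2 where e2: "e2 > 0" "\<forall>r\<in>{t. - t \<in> I} \<inter> {t. - t \<in> J}. - s \<le> r \<and> r < - s + e2 \<longrightarrow> \<gamma> (- r) = \<delta> (- r)"
      using itraj_unique_right[OF itraj_reverse[OF g] itraj_reverse[OF d], of L "- s"]
        s lX lY cross by (auto simp: norm_minus_commute)
    show "\<exists>e>0. \<forall>x'\<in>K. dist x' s < e \<longrightarrow> x' \<in> E"
    proof (intro exI[of _ "min e1 e2"] conjI ballI impI)
      fix r assume r: "r \<in> K" "dist r s < min e1 e2"
      show "r \<in> E"
        using r e1(2)[rule_format, of r] e2(2)[rule_format, of "-r"]
        by (cases "s \<le> r") (auto simp: E_def K_def dist_real_def)
    qed (use e1 e2 in auto)
  qed
  have "E = {} \<or> E = K" using conn cl op by (simp add: connected_clopen)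
  moreover have "t0 \<in> E" using t0 eq by (simp add: E_def K_def)
  ultimately show ?thesis using t by (auto simp: E_def K_def)
qed

subsection \<open>Semiflows and exit points\<close>

text \<open>The forward estimate for reversed curves. It yields injectivity of the flow, and that no
  orbit starting off the origin reaches it in finite time.\<close>

lemma Gronwall_Lipschitz_backward:
  fixes u v :: "real \<Rightarrow> 'a::real_inner"
  assumes ab: "a \<le> b" and cu: "continuous_on {a..b} u" and cv: "continuous_on {a..b} v"
    and du: "\<And>t. a < t \<Longrightarrow> t < b \<Longrightarrow> (u has_vector_derivative u' t) (at t)"
    and dv: "\<And>t. a < t \<Longrightarrow> t < b \<Longrightarrow> (v has_vector_derivative v' t) (at t)"
    and lip: "\<And>t. a < t \<Longrightarrow> t < b \<Longrightarrow> norm (u' t - v' t) \<le> L * norm (u t - v t)"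
  shows "norm (u a - v a) \<le> exp (L * (b - a)) * norm (u b - v b)"
proof -
  have rev: "((\<lambda>t. w (- t)) has_vector_derivative - w' (- t)) (at t)"
    if "(w has_vector_derivative w' (- t)) (at (- t))" for w w' :: "real \<Rightarrow> 'a" and t
    using vector_diff_chain_at[OF has_vector_derivative_minus[OF has_vector_derivative_id], of w _ t] that
    by (auto simp: o_def)
  have "norm (u (- (- a)) - v (- (- a))) \<le> exp (L * (- a - (- b))) * norm (u (- (- b)) - v (- (- b)))"
  proof (rule Gronwall_Lipschitz[where u="\<lambda>t. u (- t)" and v="\<lambda>t. v (- t)"
        and u'="\<lambda>t. - u' (- t)" and v'="\<lambda>t. - v' (- t)"])
    show "continuous_on {- b..- a} (\<lambda>t. u (- t))" "continuous_on {- b..- a} (\<lambda>t. v (- t))"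
      using ab by (auto intro!: continuous_intros continuous_on_compose2[OF cu] continuous_on_compose2[OF cv])
    fix t assume t: "- b < t" "t < - a"
    show "((\<lambda>t. u (- t)) has_vector_derivative - u' (- t)) (at t)"
      "((\<lambda>t. v (- t)) has_vector_derivative - v' (- t)) (at t)"
      using t by (auto intro!: rev du dv)
    show "norm (- u' (- t) - - v' (- t)) \<le> L * norm (u (- t) - v (- t))"
      using lip[of "-t"] t by (simp add: norm_minus_commute)
  qed (use ab in auto)
  then show ?thesis by (simp add: algebra_simps)
qed

lemma first_zero:
  fixes f :: "real \<Rightarrow> real"
  assumes c: "continuous_on {0..b} f" and b: "0 \<le> b" "f 0 \<le> 0" "0 \<le> f b"
  shows "\<exists>T. 0 \<le> T \<and> T \<le> b \<and> f T = 0 \<and> (\<forall>t. 0 \<le> t \<and> t < T \<longrightarrow> f t < 0)"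
proof -
  define S where "S = {0..b} \<inter> f -` {0..}"
  have "closed S" unfolding S_def using c by (intro continuous_closed_preimage) auto
  then have "compact S" by (rule compact_Int_closed[of "{0..b}", OF compact_Icc, THEN back_subst[of compact]]) (auto simp: S_def)
  moreover have "S \<noteq> {}" using b by (auto simp: S_def)
  ultimately obtain T where T: "T \<in> S" "\<forall>t\<in>S. T \<le> t" using compact_attains_inf by blast
  have before: "f t < 0" if "0 \<le> t" "t < T" for t
    using T that by (force simp: S_def not_le[symmetric])
  have "f T = 0"
  proof (rule ccontr)
    assume "f T \<noteq> 0"
    then have "f T > 0" using T by (auto simp: S_def)
    moreover have "continuous_on {0..T} f" using T by (auto simp: S_def intro: continuous_on_subset[OF c])
    ultimately obtain x where "0 \<le> x" "x \<le> T" "f x = 0"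
      using IVT'[of f 0 0 T] b T by (auto simp: S_def)
    then show False using before[of x] \<open>f T \<noteq> 0\<close> by (cases "x = T") auto
  qed
  then show ?thesis using T before by (auto simp: S_def)
qed

text \<open>Splits at an exceptional point and recurses on both halves. It serves a function with a
  kink on the switching line, which an orbit crosses finitely often in compact time.\<close>

lemma DERIV_pos_finite_imp_less:
  fixes f :: "real \<Rightarrow> real"
  assumes "a < b" "finite D" "continuous_on {a..b} f"
    and "\<And>t. a < t \<Longrightarrow> t < b \<Longrightarrow> t \<notin> D \<Longrightarrow> \<exists>y. DERIV f t :> y \<and> y > 0"
  shows "f a < f b"
  using assms(2,1,3,4)
proof (induction D arbitrary: a b rule: finite_psubset_induct)
  case (psubset D)
  show ?case
  proof (cases "D \<inter> {a<..<b} = {}")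
    case True
    show ?thesis
    proof (rule DERIV_pos_imp_increasing_open[OF psubset.prems(1) _ psubset.prems(2)])
      show "\<exists>y. DERIV f t :> y \<and> y > 0" if "a < t" "t < b" for t
      proof -
        have "t \<notin> D" using True that by auto
        then show ?thesis by (rule psubset.prems(3)[OF that])
      qed
    qed
  next
    case False
    then obtain s where s: "s \<in> D" "a < s" "s < b" by auto
    have c: "continuous_on {a..s} f" "continuous_on {s..b} f"
      using s by (auto intro!: continuous_on_subset[OF psubset.prems(2)])
    have "f a < f s"
    proof (rule psubset.IH[OF _ s(2) c(1)])
      show "D \<inter> {a<..<s} \<subset> D" using s by auto
      show "\<exists>y. DERIV f t :> y \<and> y > 0" if "a < t" "t < s" "t \<notin> D \<inter> {a<..<s}" for t
        using psubset.prems(3)[of t] that s by auto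
    qed
    also have "f s < f b"
    proof (rule psubset.IH[OF _ s(3) c(2)])
      show "D \<inter> {s<..<b} \<subset> D" using s by auto
      show "\<exists>y. DERIV f t :> y \<and> y > 0" if "s < t" "t < b" "t \<notin> D \<inter> {s<..<b}" for t
        using psubset.prems(3)[of t] that s by auto
    qed
    finally show ?thesis .
  qed
qed

text \<open>Nothing is assumed about negative times: \<open>\<phi>\<close> is a family of forward
  solutions, and backward information comes from \<open>dist_ge\<close> and
  \<open>backward_unique\<close>.\<close>

locale lipflow =
  fixes F :: "real^2 \<Rightarrow> real^2" and L :: real and \<phi> :: "real^2 \<Rightarrow> real \<Rightarrow> real^2"
  assumes L: "L > 0" and lip: "\<And>p q. norm (F p - F q) \<le> L * norm (p - q)" and F0: "F 0 = 0"
    and init: "\<And>p. \<phi> p 0 = p"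
    and deriv: "\<And>p t. 0 \<le> t \<Longrightarrow> (\<phi> p has_vector_derivative F (\<phi> p t)) (at t within {0..})"
begin

lemma cont: "S \<subseteq> {0..} \<Longrightarrow> continuous_on S (\<phi> p)"
  by (meson deriv atLeast_iff continuous_on_eq_continuous_within continuous_on_subset
      has_vector_derivative_continuous)

lemma deriv_at: "0 < t \<Longrightarrow> (\<phi> p has_vector_derivative F (\<phi> p t)) (at t)"
  using deriv[of t p] at_within_open_subset[of t "{0<..}" "{0..}"] by (auto simp: subset_iff)

lemma DERIV_nth: "0 < t \<Longrightarrow> ((\<lambda>s. \<phi> p s $ i) has_real_derivative F (\<phi> p t) $ i) (at t)"
  unfolding has_real_derivative_iff_has_vector_derivative
  by (rule bounded_linear.has_vector_derivative[OF bounded_linear_vec_nth deriv_at])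

lemma DERIV_nth_within:
  "0 \<le> t \<Longrightarrow> ((\<lambda>s. \<phi> p s $ i) has_real_derivative F (\<phi> p t) $ i) (at t within {0..})"
  unfolding has_real_derivative_iff_has_vector_derivative
  by (rule bounded_linear.has_vector_derivative[OF bounded_linear_vec_nth deriv])

lemma dist_le:
  assumes "0 \<le> t" shows "norm (\<phi> p t - \<phi> q t) \<le> exp (L * t) * norm (p - q)"
proof -
  have "norm (\<phi> p t - \<phi> q t) \<le> exp (L * (t - 0)) * norm (\<phi> p 0 - \<phi> q 0)"
    by (rule Gronwall_Lipschitz[where u'="\<lambda>t. F (\<phi> p t)" and v'="\<lambda>t. F (\<phi> q t)"])
      (use assms in \<open>auto intro!: cont deriv_at lip\<close>)
  then show ?thesis by (simp add: init)
qed

lemma dist_ge: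
  assumes "0 \<le> t" shows "norm (p - q) \<le> exp (L * t) * norm (\<phi> p t - \<phi> q t)"
proof -
  have "norm (\<phi> p 0 - \<phi> q 0) \<le> exp (L * (t - 0)) * norm (\<phi> p t - \<phi> q t)"
    by (rule Gronwall_Lipschitz_backward[where u'="\<lambda>t. F (\<phi> p t)" and v'="\<lambda>t. F (\<phi> q t)"])
      (use assms in \<open>auto intro!: cont deriv_at lip\<close>)
  then show ?thesis by (simp add: init)
qed

lemma zero: "0 \<le> t \<Longrightarrow> \<phi> 0 t = 0"
proof -
  assume t: "0 \<le> t"
  have "norm (\<phi> 0 t - 0) \<le> exp (L * (t - 0)) * norm (\<phi> 0 0 - 0)"
    by (rule Gronwall_Lipschitz[where u'="\<lambda>t. F (\<phi> 0 t)" and v'="\<lambda>t. 0"])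
      (use t lip[of _ 0] in \<open>auto intro!: cont deriv_at simp: F0\<close>)
  then show ?thesis by (simp add: init)
qed

lemma norm_le: "0 \<le> t \<Longrightarrow> norm (\<phi> p t) \<le> exp (L * t) * norm p"
  using dist_le[of t p 0] by (simp add: zero)

lemma nonzero: "0 \<le> t \<Longrightarrow> p \<noteq> 0 \<Longrightarrow> \<phi> p t \<noteq> 0"
  using dist_ge[of t p 0] by (auto simp: zero)

lemma inj: "0 \<le> t \<Longrightarrow> p \<noteq> q \<Longrightarrow> \<phi> p t \<noteq> \<phi> q t"
  using dist_ge[of t p q] by auto

lemma backward_unique:
  assumes "0 \<le> s" "s \<le> t" "\<phi> p s = \<phi> q t"
  shows "p = \<phi> q (t - s)"
proof -
  have "norm (\<phi> p 0 - \<phi> q (0 + (t - s))) \<le> exp (L * (s - 0)) * norm (\<phi> p s - \<phi> q (s + (t - s)))"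
  proof (rule Gronwall_Lipschitz_backward[where u'="\<lambda>r. F (\<phi> p r)" and v'="\<lambda>r. F (\<phi> q (r + (t - s)))"])
    show "continuous_on {0..s} (\<phi> p)" by (rule cont) auto
    show "continuous_on {0..s} (\<lambda>r. \<phi> q (r + (t - s)))"
      using assms by (intro continuous_on_compose2[OF cont[of "{0..}"]] continuous_intros) auto
    fix r assume r: "0 < r" "r < s"
    show "(\<phi> p has_vector_derivative F (\<phi> p r)) (at r)" using r by (simp add: deriv_at)
    have "((\<lambda>r. r + (t - s)) has_vector_derivative 1) (at r)"
      by (auto intro!: derivative_eq_intros)
    from vector_diff_chain_at[OF this, of "\<phi> q"] deriv_at[of "r + (t - s)" q] r assms
    show "((\<lambda>r. \<phi> q (r + (t - s))) has_vector_derivative F (\<phi> q (r + (t - s)))) (at r)"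
      by (auto simp: o_def)
  qed (use assms lip in auto)
  then show ?thesis using assms by (simp add: init)
qed

text \<open>On the compact time interval \<open>k\<close> is bounded away from 0 by some
  \<open>\<mu>\<close>, while neighbouring orbits spread at most by the factor
  \<open>exp (L * b)\<close>.\<close>

lemma stays_negative:
  fixes k :: "real^2 \<Rightarrow> real"
  assumes k: "\<And>p q. \<bar>k p - k q\<bar> \<le> norm (p - q)" and a: "0 \<le> a"
    and neg: "\<And>t. a \<le> t \<Longrightarrow> t \<le> b \<Longrightarrow> k (\<phi> p t) < 0"
  shows "\<exists>d>0. \<forall>p' t. norm (p' - p) < d \<longrightarrow> a \<le> t \<longrightarrow> t \<le> b \<longrightarrow> k (\<phi> p' t) < 0"
proof (cases "a \<le> b")
  case True
  have ck: "continuous_on UNIV k"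
    by (rule norm_Lipschitz_continuous_on[of _ _ 1]) (use k in auto)
  have "continuous_on {a..b} (\<lambda>t. k (\<phi> p t))"
    using a by (intro continuous_on_compose2[OF ck cont]) auto
  then obtain s where s: "s \<in> {a..b}" "\<forall>t\<in>{a..b}. k (\<phi> p t) \<le> k (\<phi> p s)"
    using continuous_attains_sup[of "{a..b}" "\<lambda>t. k (\<phi> p t)"] True by auto
  define \<mu> where "\<mu> = - k (\<phi> p s)"
  have \<mu>: "\<mu> > 0" using neg s by (auto simp: \<mu>_def)
  show ?thesis
  proof (intro exI[of _ "\<mu> / exp (L * b)"] conjI allI impI)
    show "\<mu> / exp (L * b) > 0" using \<mu> by simp
    fix p' t assume p': "norm (p' - p) < \<mu> / exp (L * b)" and t: "a \<le> t" "t \<le> b"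
    have "\<bar>k (\<phi> p' t) - k (\<phi> p t)\<bar> \<le> exp (L * t) * norm (p' - p)"
      using k[of "\<phi> p' t" "\<phi> p t"] dist_le[of t p' p] a t by linarith
    also have "\<dots> \<le> exp (L * b) * norm (p' - p)"
      using t L by (intro mult_right_mono) auto
    also have "\<dots> < \<mu>" using p' by (simp add: field_simps)
    finally show "k (\<phi> p' t) < 0" using s(2) t by (force simp: \<mu>_def)
  qed
qed (auto intro: exI[of _ 1])

text \<open>\<open>k\<close> vanishes on the wall to be crossed, \<open>l\<close> keeps away from
  the other wall. By \<open>after\<close> the crossing is genuine: \<open>k\<close> is negative
  until shortly before \<open>T\<close> and positive at some time shortly after it. Both facts
  persist for nearby orbits, whose first zero is caught in between. Starting on the wall is allowed,
  with exit time 0.\<close>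

lemma exit_continuous:
  fixes k l :: "real^2 \<Rightarrow> real"
  assumes k: "\<And>p q. \<bar>k p - k q\<bar> \<le> norm (p - q)" and l: "\<And>p q. \<bar>l p - l q\<bar> \<le> norm (p - q)"
    and T: "0 \<le> T" and before: "\<And>t. 0 \<le> t \<Longrightarrow> t < T \<Longrightarrow> k (\<phi> p t) < 0 \<and> l (\<phi> p t) < 0"
    and kT: "k (\<phi> p T) = 0" and lT: "l (\<phi> p T) < 0"
    and after: "\<And>e. e > 0 \<Longrightarrow> \<exists>t. T < t \<and> t < T + e \<and> k (\<phi> p t) > 0"
    and e: "e > 0"
  shows "\<exists>d>0. \<forall>p'. norm (p' - p) < d \<longrightarrow> k p' \<le> 0 \<longrightarrow>
    (\<exists>T'\<ge>0. (\<forall>t. 0 \<le> t \<and> t < T' \<longrightarrow> k (\<phi> p' t) < 0 \<and> l (\<phi> p' t) < 0) \<and>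
       k (\<phi> p' T') = 0 \<and> l (\<phi> p' T') < 0 \<and> norm (\<phi> p' T' - \<phi> p T) < e)"
proof -
  have ck: "continuous_on UNIV k"
    by (rule norm_Lipschitz_continuous_on[of _ _ 1]) (use k in auto)
  have "continuous (at T within {0..}) (\<phi> p)"
    using cont[of "{0..}" p] T by (simp add: continuous_on_eq_continuous_within)
  then obtain \<eta>1 where \<eta>1: "\<eta>1 > 0" "\<forall>t\<in>{0..}. dist t T < \<eta>1 \<longrightarrow> dist (\<phi> p t) (\<phi> p T) < min (e/2) (- l (\<phi> p T))"
    unfolding continuous_within_eps_delta using e lT
    by (metis half_gt_zero min_less_iff_conj neg_0_less_iff_less)
  \<comment> \<open>The crossing is witnessed at one fixed time, since a strict inequality at a
    fixed time carries over to neighbouring orbits.\<close>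
  obtain t2 where t2: "T < t2" "t2 < T + \<eta>1" "k (\<phi> p t2) > 0" using after[OF \<eta>1(1)] by blast
  have near: "norm (\<phi> p t - \<phi> p T) < e/2" "l (\<phi> p t) < 0" if "0 \<le> t" "T - \<eta>1 < t" "t \<le> t2" for t
  proof -
    have "dist (\<phi> p t) (\<phi> p T) < min (e/2) (- l (\<phi> p T))"
      using \<eta>1 that t2 by (auto simp: dist_real_def)
    then show "norm (\<phi> p t - \<phi> p T) < e/2" "l (\<phi> p t) < 0"
      using l[of "\<phi> p t" "\<phi> p T"] by (auto simp: dist_norm)
  qed
  have lneg: "l (\<phi> p t) < 0" if "0 \<le> t" "t \<le> t2" for t
    using before[of t] near(2)[of t] that \<eta>1(1) by (cases "t < T") auto
  obtain d1 where d1: "d1 > 0" "\<forall>p' t. norm (p' - p) < d1 \<longrightarrow> 0 \<le> t \<longrightarrow> t \<le> t2 \<longrightarrow> l (\<phi> p' t) < 0"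
    using stays_negative[OF l order_refl, of t2 p] lneg by blast
  obtain d2 where d2: "d2 > 0"
    "\<forall>p' t. norm (p' - p) < d2 \<longrightarrow> 0 \<le> t \<longrightarrow> t \<le> T - \<eta>1 \<longrightarrow> k (\<phi> p' t) < 0"
    using stays_negative[OF k order_refl, of "T - \<eta>1" p] before \<eta>1(1) by force
  obtain d3 where d3: "d3 > 0"
    "\<forall>p' t. norm (p' - p) < d3 \<longrightarrow> t2 \<le> t \<longrightarrow> t \<le> t2 \<longrightarrow> - k (\<phi> p' t) < 0"
    using stays_negative[of "\<lambda>p. - k p" t2 t2 p] k t2 T by (force simp: abs_minus_commute)
  \<comment> \<open>Half of \<open>e\<close> is spent on the spreading of orbits up to
    \<open>t2\<close>, the other half on the difference of the two exit times.\<close>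
  define d4 where "d4 = (e/2) / exp (L * t2)"
  have d4: "d4 > 0" using e by (simp add: d4_def)
  show ?thesis
  proof (rule exI[of _ "min (min d1 d2) (min d3 d4)"], intro conjI allI impI)
    show "min (min d1 d2) (min d3 d4) > 0" using d1 d2 d3 d4 by auto
    fix p' assume p': "norm (p' - p) < min (min d1 d2) (min d3 d4)" and kp': "k p' \<le> 0"
    have "continuous_on {0..t2} (\<lambda>t. k (\<phi> p' t))"
      by (intro continuous_on_compose2[OF ck cont]) auto
    then obtain T' where T': "0 \<le> T'" "T' \<le> t2" "k (\<phi> p' T') = 0" "\<forall>t. 0 \<le> t \<and> t < T' \<longrightarrow> k (\<phi> p' t) < 0"
      using first_zero[of t2 "\<lambda>t. k (\<phi> p' t)"] t2 T kp' d3(2)[rule_format, of p' t2] p' by (auto simp: init)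
    have "T - \<eta>1 < T'" using d2(2)[rule_format, of p' T'] p' T' by force
    then have n1: "norm (\<phi> p T' - \<phi> p T) < e/2" using near T' by blast
    have "norm (\<phi> p' T' - \<phi> p T') \<le> exp (L * T') * norm (p' - p)" using dist_le T' by blast
    also have "\<dots> \<le> exp (L * t2) * norm (p' - p)" using T' L by (intro mult_right_mono) auto
    also have "\<dots> < exp (L * t2) * d4" using p' by simp
    also have "\<dots> = e/2" by (simp add: d4_def)
    finally have "norm (\<phi> p' T' - \<phi> p T) < e"
      using n1 norm_triangle_ineq[of "\<phi> p' T' - \<phi> p T'" "\<phi> p T' - \<phi> p T"] by simp
    then show "\<exists>T'\<ge>0. (\<forall>t. 0 \<le> t \<and> t < T' \<longrightarrow> k (\<phi> p' t) < 0 \<and> l (\<phi> p' t) < 0) \<and>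
       k (\<phi> p' T') = 0 \<and> l (\<phi> p' T') < 0 \<and> norm (\<phi> p' T' - \<phi> p T) < e"
      using T' d1(2) p' by (intro exI[of _ T']) auto
  qed
qed

end

lemma lipflow_exists:
  assumes "L > 0" "\<And>p q. norm (F p - F q) \<le> L * norm (p - q)" "F 0 = 0"
  shows "\<exists>\<phi>. lipflow F L \<phi>"
proof -
  have "\<forall>p. \<exists>u. u 0 = p \<and> (\<forall>t\<ge>0. (u has_vector_derivative F (u t)) (at t within {0..}))"
    using Lipschitz_solution_exists[OF assms(1,2)] by blast
  then obtain \<phi> where "\<forall>p. \<phi> p 0 = p \<and> (\<forall>t\<ge>0. (\<phi> p has_vector_derivative F (\<phi> p t)) (at t within {0..}))"
    by metis
  then show ?thesis using assms by (intro exI[of _ \<phi>]) (auto simp: lipflow_def)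
qed

subsection \<open>The right half-plane: exit coordinate\<close>

lemma vec2_eq_iff: "p = q \<longleftrightarrow> p $ 1 = q $ 1 \<and> p $ 2 = q $ 2" for p q :: "real^2"
  by (simp add: vec_eq_iff forall_2)

lemma norm_le_abs2: "norm p \<le> \<bar>p $ 1\<bar> + \<bar>p $ 2\<bar>" for p :: "real^2"
  using norm_le_l1_cart[of p] by (simp add: sum_2)

text \<open>Above, \<open>c\<close> bounds the angular speed from below, and \<open>\<delta>\<close>
  is a slope for which \<open>\<delta> * y - x\<close> grows in the first quadrant. Below,
  \<open>x - d * y\<close> plays the part of the stable left eigenvector: it is positive in the open
  fourth quadrant and decays at rate \<open>m\<close>. \<open>Y_cone\<close> says that along the
  difference of two solutions the square of the unstable form
  \<open>\<alpha> * x + \<beta> * y\<close> grows faster than that of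
  \<open>x - d * y\<close>.\<close>

locale right_half = U: lipflow X L \<phi> + V: lipflow Y L \<psi> for X L \<phi> Y \<psi> +
  fixes \<delta> d c m \<alpha> \<beta> :: real
  assumes param_pos: "\<delta> > 0" "d > 0" "c > 0" "m > 0"
    and X_g: "\<And>p. 0 \<le> p $ 1 \<Longrightarrow> 0 \<le> p $ 2 \<Longrightarrow> p \<noteq> 0 \<Longrightarrow> X p $ 1 < \<delta> * X p $ 2"
    and X_turn: "\<And>p. c * ((p $ 1)\<^sup>2 + (p $ 2)\<^sup>2) \<le> p $ 1 * X p $ 2 - p $ 2 * X p $ 1"
    and Y_v: "\<And>p. 0 \<le> p $ 1 \<Longrightarrow> p $ 2 \<le> 0 \<Longrightarrow> Y p $ 1 - d * Y p $ 2 \<le> - m * (p $ 1 - d * p $ 2)"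
    and Y_cross: "\<And>p. p $ 2 = 0 \<Longrightarrow> p $ 1 \<noteq> 0 \<Longrightarrow> p $ 1 * Y p $ 2 > 0"
    and Y_axis: "\<And>p. p $ 1 = 0 \<Longrightarrow> p $ 2 < 0 \<Longrightarrow> Y p $ 1 < 0"
    and Y_cone: "\<And>p q. p \<noteq> q \<Longrightarrow>
      ((p - q) $ 1 - d * (p - q) $ 2) * ((Y p - Y q) $ 1 - d * (Y p - Y q) $ 2)
      < (\<alpha> * (p - q) $ 1 + \<beta> * (p - q) $ 2) * (\<alpha> * (Y p - Y q) $ 1 + \<beta> * (Y p - Y q) $ 2)"
begin

lemma X_cross: assumes "p $ 2 = 0" "p $ 1 \<noteq> 0" shows "p $ 1 * X p $ 2 > 0"
proof -
  have "0 < c * (p $ 1)\<^sup>2" using param_pos assms by simp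
  then show ?thesis using X_turn[of p] assms by simp
qed

lemma X_axis: assumes "p $ 1 = 0" "p $ 2 > 0" shows "X p $ 1 < 0"
proof -
  have "0 < c * (p $ 2)\<^sup>2" using param_pos assms by simp
  then have "p $ 2 * X p $ 1 < 0" using X_turn[of p] assms by simp
  then show ?thesis using assms by (simp add: mult_less_0_iff)
qed

lemma cross: assumes "p $ 2 = 0" "p \<noteq> 0" shows "X p $ 2 * Y p $ 2 > 0"
proof -
  have "p $ 1 \<noteq> 0" using assms by (simp add: vec2_eq_iff)
  then have "p $ 1 * X p $ 2 > 0" "p $ 1 * Y p $ 2 > 0" using assms X_cross Y_cross by auto
  then show ?thesis by (auto simp: zero_less_mult_iff)
qed

text \<open>At the last zero before the ordinate became negative the abscissa is positive, so the
  field points upwards there.\<close>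

lemma upper_nonneg:
  assumes p: "0 \<le> p $ 2" and x: "\<And>s. 0 \<le> s \<Longrightarrow> s < t \<Longrightarrow> \<phi> p s $ 1 > 0" and t: "0 \<le> t"
  shows "0 \<le> \<phi> p t $ 2"
proof (rule ccontr)
  assume n: "\<not> ?thesis"
  \<comment> \<open>Time runs backwards from \<open>t\<close>, so that \<open>first_zero\<close>
    finds the last zero before \<open>t\<close>.\<close>
  have "continuous_on {0..t} (\<lambda>s. \<phi> p (t - s))"
    by (rule continuous_on_compose2[OF U.cont[of "{0..}"]]) (auto intro!: continuous_intros)
  then have "continuous_on {0..t} (\<lambda>s. \<phi> p (t - s) $ 2)" by (intro continuous_intros)
  then obtain s where s: "0 \<le> s" "s \<le> t" "\<phi> p (t - s) $ 2 = 0"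
      "\<forall>r. 0 \<le> r \<and> r < s \<longrightarrow> \<phi> p (t - r) $ 2 < 0"
    using first_zero[of t "\<lambda>s. \<phi> p (t - s) $ 2"] t n p by (auto simp: U.init)
  have "s \<noteq> 0" using s(3) n by auto
  then have s0: "s > 0" using s by simp
  define r where "r = t - s"
  have r: "0 \<le> r" "r < t" "\<phi> p r $ 2 = 0" using s s0 by (auto simp: r_def)
  have "\<phi> p r $ 1 > 0" using x r by simp
  then have "X (\<phi> p r) $ 2 > 0" using X_cross[of "\<phi> p r"] r by (simp add: zero_less_mult_iff)
  then obtain e where e: "e > 0" "\<And>h. h > 0 \<Longrightarrow> r + h \<in> {0..} \<Longrightarrow> h < e \<Longrightarrow> \<phi> p r $ 2 < \<phi> p (r + h) $ 2"
    using has_real_derivative_pos_inc_right[OF U.DERIV_nth_within[OF r(1)]] by blast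
  define h where "h = min (e/2) (s/2)"
  have "0 < \<phi> p (r + h) $ 2" using e(2)[of h] e(1) s0 r by (simp add: h_def)
  moreover have "\<phi> p (t - (s - h)) $ 2 < 0" using s(4)[rule_format, of "s - h"] s0 e(1) by (simp add: h_def)
  ultimately show False by (simp add: r_def algebra_simps)
qed

lemma upper_pos:
  assumes p: "0 \<le> p $ 2" and x: "\<And>s. 0 \<le> s \<Longrightarrow> s < b \<Longrightarrow> \<phi> p s $ 1 > 0" and t: "0 < t" "t < b"
  shows "0 < \<phi> p t $ 2"
proof (rule ccontr)
  assume "\<not> ?thesis"
  moreover have "0 \<le> \<phi> p t $ 2" using t x by (intro upper_nonneg[OF p]) auto
  ultimately have y: "\<phi> p t $ 2 = 0" by simp
  have "\<phi> p t $ 1 > 0" using x t by simp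
  then have "X (\<phi> p t) $ 2 > 0" using X_cross[of "\<phi> p t"] y by (simp add: zero_less_mult_iff)
  then obtain e where e: "e > 0" "\<And>h. h > 0 \<Longrightarrow> h < e \<Longrightarrow> \<phi> p (t - h) $ 2 < \<phi> p t $ 2"
    using DERIV_pos_inc_left[OF U.DERIV_nth[OF t(1)]] by blast
  define h where "h = min (e/2) (t/2)"
  have "\<phi> p (t - h) $ 2 < 0" using e(2)[of h] e(1) t y by (simp add: h_def)
  moreover have "0 \<le> \<phi> p (t - h) $ 2"
    using t e(1) x by (intro upper_nonneg[OF p]) (auto simp: h_def)
  ultimately show False by simp
qed

section \<open>Exit of the upper field from the first quadrant\<close>

definition X_exits :: "real^2 \<Rightarrow> real \<Rightarrow> bool" where
  "X_exits p T \<longleftrightarrow> 0 \<le> T \<and> \<phi> p T $ 1 = 0 \<and> (\<forall>t. 0 \<le> t \<and> t < T \<longrightarrow> \<phi> p t $ 1 > 0)"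

lemma X_exits_unique: assumes "X_exits p T" "X_exits p T'" shows "T = T'"
proof (rule ccontr)
  assume "T \<noteq> T'"
  then consider "T < T'" | "T' < T" by linarith
  then show False
    by cases (use assms in \<open>force simp: X_exits_def\<close>)+
qed

text \<open>\<open>(y - x) / (x + y)\<close> lies between \<open>-1\<close> and \<open>1\<close> on the first quadrant and has derivative at
  least \<open>c\<close>, so that the orbit leaves the quadrant within time \<open>2 / c\<close>.\<close>

lemma X_exits_exists:
  assumes p: "0 \<le> p $ 1" "0 \<le> p $ 2" "p \<noteq> 0"
  shows "\<exists>T. X_exits p T \<and> T \<le> 2 / c"
proof (cases "\<exists>t. 0 \<le> t \<and> t \<le> 2 / c \<and> \<phi> p t $ 1 \<le> 0")
  case True
  then obtain b where b: "0 \<le> b" "b \<le> 2 / c" "\<phi> p b $ 1 \<le> 0" by blast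
  have "continuous_on {0..b} (\<lambda>t. - \<phi> p t $ 1)" by (intro continuous_intros U.cont) auto
  then obtain T where "0 \<le> T" "T \<le> b" "- \<phi> p T $ 1 = 0" "\<forall>t. 0 \<le> t \<and> t < T \<longrightarrow> - \<phi> p t $ 1 < 0"
    using first_zero[of b "\<lambda>t. - \<phi> p t $ 1"] b p by (auto simp: U.init)
  then show ?thesis using b by (intro exI[of _ T]) (auto simp: X_exits_def)
next
  case False
  define T where "T = 2 / c"
  have T: "T > 0" using param_pos by (simp add: T_def)
  have x: "\<phi> p t $ 1 > 0" if t: "0 \<le> t" "t \<le> T" for t
  proof -
    have "\<not> (0 \<le> t \<and> t \<le> 2 / c \<and> \<phi> p t $ 1 \<le> 0)" using False by blast
    then show ?thesis using t unfolding T_def by linarith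
  qed
  have y: "\<phi> p t $ 2 \<ge> 0" if "0 \<le> t" "t \<le> T" for t using that x by (intro upper_nonneg p) auto
  define \<kappa> where "\<kappa> t = (\<phi> p t $ 2 - \<phi> p t $ 1) / (\<phi> p t $ 1 + \<phi> p t $ 2)" for t
  \<comment> \<open>Since \<open>c * T = 2\<close>, the quotient would have to gain at least 2,
    which its range does not allow.\<close>
  have "\<kappa> 0 - c * 0 \<le> \<kappa> T - c * T"
  proof (rule DERIV_nonneg_imp_increasing_open[of 0 T "\<lambda>t. \<kappa> t - c * t"])
    have "\<phi> p t $ 1 + \<phi> p t $ 2 \<noteq> 0" if "t \<in> {0..T}" for t using x[of t] y[of t] that by auto
    then show "continuous_on {0..T} (\<lambda>t. \<kappa> t - c * t)"
      unfolding \<kappa>_def by (intro continuous_intros U.cont) auto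
    fix t assume t: "0 < t" "t < T"
    define a b a' b' where ab: "a = \<phi> p t $ 1" "b = \<phi> p t $ 2" "a' = X (\<phi> p t) $ 1" "b' = X (\<phi> p t) $ 2"
    have ab0: "a > 0" "b \<ge> 0" using x y t by (auto simp: ab)
    have turn: "c * (a\<^sup>2 + b\<^sup>2) \<le> a * b' - b * a'" using X_turn by (simp add: ab)
    have D: "((\<lambda>t. \<kappa> t - c * t) has_real_derivative
        (((b' - a') * (a + b) - (b - a) * (a' + b')) / ((a + b) * (a + b)) - c)) (at t)"
      unfolding \<kappa>_def ab using ab0 t
      by (auto intro!: derivative_eq_intros U.DERIV_nth simp: ab)
    have "c * ((a + b) * (a + b)) \<le> c * (2 * (a\<^sup>2 + b\<^sup>2))"
      using param_pos sum_squares_bound[of a b] by (intro mult_left_mono) (auto simp: power2_eq_square algebra_simps)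
    \<comment> \<open>The right-hand side equals \<open>2 * (a * b' - b * a')\<close>, to which
      \<open>turn\<close> applies.\<close>
    also have "\<dots> \<le> (b' - a') * (a + b) - (b - a) * (a' + b')"
      using turn by (simp add: algebra_simps)
    finally have "((b' - a') * (a + b) - (b - a) * (a' + b')) / ((a + b) * (a + b)) - c \<ge> 0"
      using ab0 by (simp add: pos_le_divide_eq)
    then show "\<exists>y. ((\<lambda>t. \<kappa> t - c * t) has_real_derivative y) (at t) \<and> 0 \<le> y" using D by blast
  qed (use T in auto)
  moreover have "\<kappa> T < 1" using x[of T] y[of T] T by (simp add: \<kappa>_def divide_less_eq)
  moreover have "-1 \<le> \<kappa> 0" using x[of 0] y[of 0] T by (simp add: \<kappa>_def le_divide_eq)
  moreover have "c * T = 2" using param_pos by (simp add: T_def)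
  ultimately show ?thesis by simp
qed

lemma X_exits_y_pos:
  assumes p: "0 \<le> p $ 1" "0 \<le> p $ 2" "p \<noteq> 0" and T: "X_exits p T" and t: "0 < t \<or> t = T" "t \<le> T"
  shows "\<phi> p t $ 2 > 0"
proof (cases "t = T")
  case True
  have "\<phi> p T $ 2 \<ge> 0" using T by (intro upper_nonneg p) (auto simp: X_exits_def)
  moreover have "\<phi> p T \<noteq> 0" using T p by (intro U.nonzero) (auto simp: X_exits_def)
  ultimately show ?thesis using T True by (auto simp: X_exits_def vec2_eq_iff)
next
  case False
  then show ?thesis using T t by (intro upper_pos[of p T]) (auto simp: X_exits_def p)
qed

definition X_exit :: "real^2 \<Rightarrow> real" where
  "X_exit p = (if p = 0 then 0 else \<phi> p (THE T. X_exits p T) $ 2)"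

lemma X_exit_eq: assumes "X_exits p T" shows "X_exit p = \<phi> p T $ 2"
proof -
  have "(THE T. X_exits p T) = T" using assms X_exits_unique by blast
  then show ?thesis using assms U.zero by (auto simp: X_exit_def X_exits_def)
qed

lemma X_exit_pos: assumes "0 \<le> p $ 1" "0 \<le> p $ 2" "p \<noteq> 0" shows "X_exit p > 0"
  using X_exits_exists[OF assms] X_exits_y_pos[OF assms] X_exit_eq by (metis order_refl)

text \<open>Away from the origin the y-axis is crossed transversally, by \<open>X_axis\<close>. At
  the origin transversality fails, but exit times are at most \<open>2 / c\<close> and orbits grow
  at most exponentially, so small initial points exit at small heights.\<close>

lemma X_exit_continuous: "continuous_on {p. 0 \<le> p $ 1 \<and> 0 \<le> p $ 2} X_exit"
  unfolding continuous_on_iff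
proof (intro ballI allI impI)
  fix p :: "real^2" and e :: real
  assume p: "p \<in> {p. 0 \<le> p $ 1 \<and> 0 \<le> p $ 2}" and e: "0 < e"
  show "\<exists>d>0. \<forall>x'\<in>{p. 0 \<le> p $ 1 \<and> 0 \<le> p $ 2}. dist x' p < d \<longrightarrow> dist (X_exit x') (X_exit p) < e"
  proof (cases "p = 0")
    case True
    show ?thesis
    proof (intro exI[of _ "e / exp (L * (2 / c))"] conjI ballI impI)
      fix q :: "real^2" assume q: "q \<in> {p. 0 \<le> p $ 1 \<and> 0 \<le> p $ 2}" "dist q p < e / exp (L * (2 / c))"
      have "\<bar>X_exit q\<bar> < e"
      proof (cases "q = 0")
        case False
        then obtain T where T: "X_exits q T" "T \<le> 2 / c" using X_exits_exists q by blast
        have "\<bar>X_exit q\<bar> \<le> norm (\<phi> q T)" using X_exit_eq[OF T(1)] component_le_norm_cart by metis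
        also have "\<dots> \<le> exp (L * T) * norm q" using T U.norm_le by (auto simp: X_exits_def)
        also have "\<dots> \<le> exp (L * (2 / c)) * norm q"
          using mult_left_mono[OF T(2), of L] U.L by (intro mult_right_mono) auto
        also have "\<dots> < e" using q True by (simp add: field_simps)
        finally show ?thesis .
      qed (use e in \<open>simp add: X_exit_def\<close>)
      then show "dist (X_exit q) (X_exit p) < e" using True by (simp add: X_exit_def)
    qed (use e in simp)
  next
    case False
    then obtain T where T: "X_exits p T" using X_exits_exists p by blast
    then have T': "0 \<le> T" "\<phi> p T $ 1 = 0" "\<And>t. 0 \<le> t \<Longrightarrow> t < T \<Longrightarrow> \<phi> p t $ 1 > 0" by (auto simp: X_exits_def)
    have y: "\<phi> p T $ 2 > 0" using X_exits_y_pos[of p T T] T p False by auto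
    have "\<exists>d>0. \<forall>p'. norm (p' - p) < d \<longrightarrow> - p' $ 1 \<le> 0 \<longrightarrow>
      (\<exists>T'\<ge>0. (\<forall>t. 0 \<le> t \<and> t < T' \<longrightarrow> - \<phi> p' t $ 1 < 0 \<and> (-1::real) < 0) \<and>
       - \<phi> p' T' $ 1 = 0 \<and> (-1::real) < 0 \<and> norm (\<phi> p' T' - \<phi> p T) < e)"
    \<comment> \<open>There is a single wall to leave through; the constant -1 makes the second
      constraint trivial.\<close>
    proof (rule U.exit_continuous[of "\<lambda>p. - p $ 1" "\<lambda>p. -1"])
      show "\<bar>- p $ 1 - - q $ 1\<bar> \<le> norm (p - q)" for p q :: "real^2"
        using component_le_norm_cart[of "p - q" 1] by simp
      have "- X (\<phi> p T) $ 1 > 0" using X_axis[OF T'(2) y] by simp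
      moreover have "((\<lambda>s. - \<phi> p s $ 1) has_real_derivative - X (\<phi> p T) $ 1) (at T within {0..})"
        by (intro derivative_intros U.DERIV_nth_within T')
      ultimately obtain r where r: "r > 0" "\<And>h. h > 0 \<Longrightarrow> T + h \<in> {0..} \<Longrightarrow> h < r \<Longrightarrow> - \<phi> p T $ 1 < - \<phi> p (T + h) $ 1"
        using has_real_derivative_pos_inc_right by blast
      show "\<exists>t. T < t \<and> t < T + e' \<and> 0 < - \<phi> p t $ 1" if e': "e' > 0" for e'
      proof (intro exI[of _ "T + min (r/2) (e'/2)"] conjI)
        show "0 < - \<phi> p (T + min (r/2) (e'/2)) $ 1"
          using r(2)[of "min (r/2) (e'/2)"] r(1) T' e' by simp
      qed (use r(1) e' in auto)
    qed (use T' e in auto)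
    then obtain d where d: "d > 0" "\<And>p'. norm (p' - p) < d \<Longrightarrow> 0 \<le> p' $ 1 \<Longrightarrow>
      \<exists>T'\<ge>0. (\<forall>t. 0 \<le> t \<and> t < T' \<longrightarrow> \<phi> p' t $ 1 > 0) \<and> \<phi> p' T' $ 1 = 0 \<and> norm (\<phi> p' T' - \<phi> p T) < e"
      by auto
    show ?thesis
    proof (intro exI[of _ d] conjI ballI impI)
      fix q :: "real^2" assume q: "q \<in> {p. 0 \<le> p $ 1 \<and> 0 \<le> p $ 2}" "dist q p < d"
      then obtain T' where "X_exits q T'" "norm (\<phi> q T' - \<phi> p T) < e"
        using d(2)[of q] by (auto simp: dist_norm X_exits_def)
      then show "dist (X_exit q) (X_exit p) < e"
        using X_exit_eq[of q T'] X_exit_eq[OF T] component_le_norm_cart[of "\<phi> q T' - \<phi> p T" 2]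
        by (simp add: dist_real_def)
    qed (use d in simp)
  qed
qed

section \<open>Exit of the lower field from the fourth quadrant\<close>

definition Y_exits :: "real^2 \<Rightarrow> real \<Rightarrow> bool" where
  "Y_exits p T \<longleftrightarrow> 0 \<le> T \<and> (\<forall>t. 0 \<le> t \<and> t < T \<longrightarrow> \<psi> p t $ 1 > 0 \<and> \<psi> p t $ 2 < 0) \<and>
     (\<psi> p T $ 1 = 0 \<and> \<psi> p T $ 2 < 0 \<or> \<psi> p T $ 1 > 0 \<and> \<psi> p T $ 2 = 0)"

definition Y_stays :: "real^2 \<Rightarrow> bool" where
  "Y_stays p \<longleftrightarrow> (\<forall>t\<ge>0. \<psi> p t $ 1 > 0 \<and> \<psi> p t $ 2 < 0)"

lemma Y_exits_unique: assumes "Y_exits p T" "Y_exits p T'" shows "T = T'"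
proof (rule ccontr)
  assume "T \<noteq> T'"
  then consider "T < T'" | "T' < T" by linarith
  then show False
    by cases (use assms in \<open>force simp: Y_exits_def\<close>)+
qed

lemma Y_exits_not_stays: "Y_exits p T \<Longrightarrow> \<not> Y_stays p"
  unfolding Y_exits_def Y_stays_def by force

lemma Y_exits_or_stays:
  assumes p: "0 \<le> p $ 1" "p $ 2 \<le> 0" "p \<noteq> 0"
  shows "(\<exists>T. Y_exits p T) \<or> Y_stays p"
proof (cases "Y_stays p")
  case False
  then obtain b where b: "b \<ge> 0" "\<not> (\<psi> p b $ 1 > 0 \<and> \<psi> p b $ 2 < 0)" by (auto simp: Y_stays_def)
  \<comment> \<open>The maximum vanishes when the first of the two walls is reached; reaching both
    at once would mean reaching the origin.\<close>
  let ?f = "\<lambda>t. max (- \<psi> p t $ 1) (\<psi> p t $ 2)"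
  have "continuous_on {0..b} ?f" by (intro continuous_intros V.cont) auto
  then obtain T where T: "0 \<le> T" "?f T = 0" "\<forall>t. 0 \<le> t \<and> t < T \<longrightarrow> ?f t < 0"
  proof -
    have "0 \<le> ?f b" using b(2) by (auto simp: le_max_iff_disj not_less)
    moreover have "?f 0 \<le> 0" using p by (simp add: V.init)
    ultimately show ?thesis using first_zero[OF \<open>continuous_on {0..b} ?f\<close> b(1)] that by blast
  qed
  have "\<psi> p T \<noteq> 0" using T p by (intro V.nonzero)
  then have "Y_exits p T" using T unfolding Y_exits_def vec2_eq_iff by (auto simp: max_def split: if_splits)
  then show ?thesis by blast
qed simp

text \<open>\<open>Y_v\<close> makes \<open>exp (m * t)\<close> times \<open>x - d * y\<close>
  nonincreasing as long as the orbit is in the quadrant.\<close>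

lemma v_decay:
  assumes ab: "0 \<le> a" "a \<le> b" and q: "\<And>t. a \<le> t \<Longrightarrow> t < b \<Longrightarrow> 0 \<le> \<psi> p t $ 1 \<and> \<psi> p t $ 2 \<le> 0"
  shows "\<psi> p b $ 1 - d * \<psi> p b $ 2 \<le> exp (- m * (b - a)) * (\<psi> p a $ 1 - d * \<psi> p a $ 2)"
proof -
  define w where "w t = \<psi> p t $ 1 - d * \<psi> p t $ 2" for t
  have "exp (m * b) * w b \<le> exp (m * a) * w a"
  proof (rule DERIV_nonpos_imp_decreasing_open[OF ab(2), of "\<lambda>t. exp (m * t) * w t"])
    show "continuous_on {a..b} (\<lambda>t. exp (m * t) * w t)"
      unfolding w_def using ab by (intro continuous_intros V.cont) auto
    fix t assume t: "a < t" "t < b"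
    have dw: "(w has_real_derivative Y (\<psi> p t) $ 1 - d * Y (\<psi> p t) $ 2) (at t)"
      unfolding w_def using ab t by (auto intro!: derivative_eq_intros V.DERIV_nth)
    have "((\<lambda>t. exp (m * t) * w t) has_real_derivative
       exp (m * t) * (Y (\<psi> p t) $ 1 - d * Y (\<psi> p t) $ 2 + m * w t)) (at t)"
      by (auto intro!: derivative_eq_intros dw simp: algebra_simps)
    moreover have "exp (m * t) * (Y (\<psi> p t) $ 1 - d * Y (\<psi> p t) $ 2 + m * w t) \<le> 0"
      using Y_v[of "\<psi> p t"] q[of t] t by (intro mult_nonneg_nonpos) (auto simp: w_def)
    ultimately show "\<exists>y. ((\<lambda>t. exp (m * t) * w t) has_real_derivative y) (at t) \<and> y \<le> 0" by blast
  qed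
  then have "exp (- m * b) * (exp (m * b) * w b) \<le> exp (- m * b) * (exp (m * a) * w a)" by simp
  moreover have "exp (- m * b) * exp (m * b) = 1" "exp (- m * b) * exp (m * a) = exp (- m * (b - a))"
    by (simp_all add: exp_add[symmetric] algebra_simps)
  ultimately have "w b \<le> exp (- m * (b - a)) * w a" by (metis mult.assoc mult_1)
  then show ?thesis by (simp add: w_def)
qed

lemma abs_le_v:
  assumes "0 \<le> p $ 1" "p $ 2 \<le> 0"
  shows "\<bar>p $ 1\<bar> + \<bar>p $ 2\<bar> \<le> (1 + 1 / d) * (p $ 1 - d * p $ 2)"
proof -
  have "(1 + 1 / d) * (p $ 1 - d * p $ 2) = p $ 1 - p $ 2 + (p $ 1 / d - d * p $ 2)"
    using param_pos by (simp add: field_simps)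
  moreover have "0 \<le> p $ 1 / d" "d * p $ 2 \<le> 0"
    using assms param_pos by (auto simp: mult_nonneg_nonpos)
  ultimately show ?thesis using assms by simp
qed

lemma v_le_norm: "p $ 1 - d * p $ 2 \<le> (1 + d) * norm p"
proof -
  have "p $ 1 - d * p $ 2 \<le> \<bar>p $ 1\<bar> + d * \<bar>p $ 2\<bar>"
    using param_pos abs_le_D2[of "p $ 2" "\<bar>p $ 2\<bar>"] mult_left_mono[of "- p $ 2" "\<bar>p $ 2\<bar>" d] by linarith
  also have "\<dots> \<le> norm p + d * norm p"
    using param_pos by (intro add_mono mult_left_mono component_le_norm_cart) auto
  finally show ?thesis by (simp add: algebra_simps)
qed

text \<open>An orbit that never leaves is on the stable separatrix: in the quadrant
  \<open>x - d * y\<close> dominates the norm, and it decays exponentially.\<close>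

lemma Y_stays_tendsto: assumes "Y_stays p" shows "(\<psi> p \<longlongrightarrow> 0) at_top"
proof (rule Lim_null_comparison)
  have b: "norm (\<psi> p t) \<le> (1 + 1 / d) * (exp (- m * t) * (p $ 1 - d * p $ 2))" if t: "0 \<le> t" for t
  proof -
    have q: "\<psi> p s $ 1 > 0 \<and> \<psi> p s $ 2 < 0" if "0 \<le> s" for s using assms that by (auto simp: Y_stays_def)
    have "norm (\<psi> p t) \<le> \<bar>\<psi> p t $ 1\<bar> + \<bar>\<psi> p t $ 2\<bar>" by (rule norm_le_abs2)
    also have "\<dots> \<le> (1 + 1 / d) * (\<psi> p t $ 1 - d * \<psi> p t $ 2)" using q[OF t] by (intro abs_le_v) auto
    also have "\<dots> \<le> (1 + 1 / d) * (exp (- m * (t - 0)) * (\<psi> p 0 $ 1 - d * \<psi> p 0 $ 2))"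
      using param_pos t q by (intro mult_left_mono v_decay) (auto simp: less_imp_le)
    finally show ?thesis by (simp add: V.init)
  qed
  then show "\<forall>\<^sub>F t in at_top. norm (\<psi> p t) \<le> (1 + 1 / d) * (exp (- m * t) * (p $ 1 - d * p $ 2))"
    using eventually_ge_at_top[of 0] by (rule eventually_mono[rotated])
  have "((\<lambda>t. exp (- m * t)) \<longlongrightarrow> 0) at_top"
    using param_pos by real_asymp
  then show "((\<lambda>t. (1 + 1 / d) * (exp (- m * t) * (p $ 1 - d * p $ 2))) \<longlongrightarrow> 0) at_top"
    by (intro tendsto_mult_right_zero tendsto_mult_left_zero)
qed

text \<open>Exit points are \<open>(0, y)\<close> with \<open>y < 0\<close> or \<open>(x, 0)\<close>
  with \<open>x > 0\<close>, so the sum is a signed coordinate along the boundary of the quadrant,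
  increasing from the y-axis through the corner to the switching line. The default 0, the corner, is
  the limit of orbits that never exit.\<close>

definition Y_exit :: "real^2 \<Rightarrow> real" where
  "Y_exit p = (if \<exists>T. Y_exits p T then \<psi> p (THE T. Y_exits p T) $ 1 + \<psi> p (THE T. Y_exits p T) $ 2 else 0)"

lemma Y_exit_eq: assumes "Y_exits p T" shows "Y_exit p = \<psi> p T $ 1 + \<psi> p T $ 2"
proof -
  have "(THE T. Y_exits p T) = T" using assms Y_exits_unique by blast
  then show ?thesis using assms by (auto simp: Y_exit_def)
qed

lemma Y_exit_Y_stays: "Y_stays p \<Longrightarrow> Y_exit p = 0"
  using Y_exits_not_stays by (auto simp: Y_exit_def)

lemma not_Y_exits_0: "\<not> Y_exits 0 T"
  using V.zero[of T] by (auto simp: Y_exits_def)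

lemma Y_exit_0: "Y_exit 0 = 0"
  using not_Y_exits_0 by (simp add: Y_exit_def)

text \<open>The pair \<open>i\<close>, \<open>\<sigma>\<close> selects the wall:
  \<open>\<sigma> * p $ i\<close> is negative inside and 0 on it. \<open>Y_axis\<close> and
  \<open>Y_cross\<close> make the exit transversal. The accuracy is halved because
  \<open>Y_exit\<close> adds two coordinates.\<close>

lemma Y_exit_continuous_exit:
  assumes T: "Y_exits p T" and e: "0 < e" and i: "i = 1 \<and> \<sigma> = -1 \<or> i = 2 \<and> \<sigma> = (1::real)"
    and face: "\<psi> p T $ i = 0"
  shows "\<exists>d>0. \<forall>q. 0 \<le> q $ 1 \<and> q $ 2 \<le> 0 \<longrightarrow> dist q p < d \<longrightarrow> dist (Y_exit q) (Y_exit p) < e"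
proof -
  define j :: 2 where "j = (if i = 1 then 2 else 1)"
  have ij: "i = 1 \<and> j = 2 \<and> \<sigma> = -1 \<or> i = 2 \<and> j = 1 \<and> \<sigma> = 1" using i by (auto simp: j_def)
  have T': "0 \<le> T" "\<sigma> * \<psi> p T $ i = 0" "- \<sigma> * \<psi> p T $ j < 0"
    "\<And>t. 0 \<le> t \<Longrightarrow> t < T \<Longrightarrow> \<sigma> * \<psi> p t $ i < 0 \<and> - \<sigma> * \<psi> p t $ j < 0"
    using T face ij by (auto simp: Y_exits_def)
  have "\<exists>d>0. \<forall>p'. norm (p' - p) < d \<longrightarrow> \<sigma> * p' $ i \<le> 0 \<longrightarrow>
      (\<exists>T'\<ge>0. (\<forall>t. 0 \<le> t \<and> t < T' \<longrightarrow> \<sigma> * \<psi> p' t $ i < 0 \<and> - \<sigma> * \<psi> p' t $ j < 0) \<and>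
       \<sigma> * \<psi> p' T' $ i = 0 \<and> - \<sigma> * \<psi> p' T' $ j < 0 \<and> norm (\<psi> p' T' - \<psi> p T) < e / 2)"
  proof (rule V.exit_continuous[of "\<lambda>p. \<sigma> * p $ i" "\<lambda>p. - \<sigma> * p $ j"])
    show "\<bar>\<sigma> * p $ i - \<sigma> * q $ i\<bar> \<le> norm (p - q)" for p q :: "real^2"
      using component_le_norm_cart[of "p - q" i] ij by auto
    show "\<bar>- \<sigma> * p $ j - - \<sigma> * q $ j\<bar> \<le> norm (p - q)" for p q :: "real^2"
      using component_le_norm_cart[of "p - q" j] ij by auto
    have "\<sigma> * Y (\<psi> p T) $ i > 0"
      using ij Y_axis[of "\<psi> p T"] Y_cross[of "\<psi> p T"] T' by (auto simp: zero_less_mult_iff)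
    moreover have "((\<lambda>s. \<sigma> * \<psi> p s $ i) has_real_derivative \<sigma> * Y (\<psi> p T) $ i) (at T within {0..})"
      using V.DERIV_nth_within[OF T'(1), of p i] by (auto intro!: derivative_eq_intros)
    ultimately obtain r where r: "r > 0" "\<And>h. h > 0 \<Longrightarrow> T + h \<in> {0..} \<Longrightarrow> h < r \<Longrightarrow> \<sigma> * \<psi> p T $ i < \<sigma> * \<psi> p (T + h) $ i"
      using has_real_derivative_pos_inc_right by blast
    show "\<exists>t. T < t \<and> t < T + e' \<and> 0 < \<sigma> * \<psi> p t $ i" if e': "e' > 0" for e'
    proof (intro exI[of _ "T + min (r/2) (e'/2)"] conjI)
      show "0 < \<sigma> * \<psi> p (T + min (r/2) (e'/2)) $ i"
        using r(2)[of "min (r/2) (e'/2)"] r(1) T' e' by simp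
    qed (use r(1) e' in auto)
  qed (use T' e in auto)
  then obtain d where d: "d > 0" "\<And>p'. norm (p' - p) < d \<Longrightarrow> \<sigma> * p' $ i \<le> 0 \<Longrightarrow>
      \<exists>T'\<ge>0. (\<forall>t. 0 \<le> t \<and> t < T' \<longrightarrow> \<sigma> * \<psi> p' t $ i < 0 \<and> - \<sigma> * \<psi> p' t $ j < 0) \<and>
       \<sigma> * \<psi> p' T' $ i = 0 \<and> - \<sigma> * \<psi> p' T' $ j < 0 \<and> norm (\<psi> p' T' - \<psi> p T) < e / 2"
    by blast
  show ?thesis
  proof (intro exI[of _ d] conjI allI impI)
    fix q :: "real^2" assume q: "0 \<le> q $ 1 \<and> q $ 2 \<le> 0" "dist q p < d"
    have "\<sigma> * q $ i \<le> 0" using q ij by auto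
    then obtain T' where T': "0 \<le> T'" "\<forall>t. 0 \<le> t \<and> t < T' \<longrightarrow> \<sigma> * \<psi> q t $ i < 0 \<and> - \<sigma> * \<psi> q t $ j < 0"
       "\<sigma> * \<psi> q T' $ i = 0" "- \<sigma> * \<psi> q T' $ j < 0" and n: "norm (\<psi> q T' - \<psi> p T) < e / 2"
      using d(2)[of q] q by (auto simp: dist_norm)
    have "Y_exits q T'" using T' ij by (auto simp: Y_exits_def)
    then have "Y_exit q - Y_exit p = (\<psi> q T' - \<psi> p T) $ 1 + (\<psi> q T' - \<psi> p T) $ 2"
      by (simp add: Y_exit_eq[OF T] Y_exit_eq)
    then show "dist (Y_exit q) (Y_exit p) < e"
      using component_le_norm_cart[of "\<psi> q T' - \<psi> p T" 1] component_le_norm_cart[of "\<psi> q T' - \<psi> p T" 2] n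
      unfolding dist_real_def by linarith
  qed (use d in simp)
qed

text \<open>An orbit close to one that tends to the origin without leaving the quadrant gets close to the
  origin as well, and from there \<open>v_decay\<close> bounds its exit point.\<close>

lemma Y_exit_continuous_no_exit:
  assumes p: "p = 0 \<or> Y_stays p" and e: "0 < e"
  shows "\<exists>d>0. \<forall>q. 0 \<le> q $ 1 \<and> q $ 2 \<le> 0 \<longrightarrow> dist q p < d \<longrightarrow> dist (Y_exit q) (Y_exit p) < e"
proof -
  \<comment> \<open>The two factors are the constants that compare the norm with
    \<open>x - d * y\<close> in either direction.\<close>
  define C where "C = (1 + 1 / d) * (1 + d)"
  have C: "C > 0" using param_pos by (simp add: C_def add_pos_pos)
  have exit_p: "Y_exit p = 0" using p Y_exit_Y_stays Y_exit_0 by auto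
  \<comment> \<open>For \<open>p = 0\<close> neighbouring orbits may exit at once, so no waiting is
    allowed; otherwise \<open>t0\<close> is so late that the orbit of \<open>p\<close> is already
    close to the origin.\<close>
  obtain t0 where t0: "0 \<le> t0" "norm (\<psi> p t0) < e / (2 * C)" "p = 0 \<Longrightarrow> t0 = 0"
  proof (cases "p = 0")
    case True
    then show ?thesis using e C by (intro that[of 0]) (auto simp: V.init)
  next
    case False
    then have "\<forall>\<^sub>F t in at_top. norm (\<psi> p t - 0) < e / (2 * C)"
      using Y_stays_tendsto p e C unfolding tendsto_iff dist_norm by simp
    then have "\<forall>\<^sub>F t in at_top. norm (\<psi> p t) < e / (2 * C) \<and> 0 \<le> t"
      using eventually_ge_at_top[of 0] by eventually_elim auto
    then show ?thesis using that False by (auto dest: eventually_happens)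
  qed
  obtain d0 where d0: "d0 > 0" "\<And>q t. p \<noteq> 0 \<Longrightarrow> norm (q - p) < d0 \<Longrightarrow> 0 \<le> t \<Longrightarrow> t \<le> t0 \<Longrightarrow> \<psi> q t $ 1 > 0 \<and> \<psi> q t $ 2 < 0"
  proof (cases "p = 0")
    case True then show ?thesis by (intro that[of 1]) auto
  next
    case False
    then have Y_stays: "\<psi> p t $ 1 > 0" "\<psi> p t $ 2 < 0" if "0 \<le> t" for t using p that by (auto simp: Y_stays_def)
    have k1: "\<bar>- p $ 1 - - q $ 1\<bar> \<le> norm (p - q)" for p q :: "real^2"
      using component_le_norm_cart[of "p - q" 1] by simp
    have k2: "\<bar>p $ 2 - q $ 2\<bar> \<le> norm (p - q)" for p q :: "real^2"
      using component_le_norm_cart[of "p - q" 2] by simp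
    obtain d1 where d1: "d1 > 0" "\<forall>q t. norm (q - p) < d1 \<longrightarrow> 0 \<le> t \<longrightarrow> t \<le> t0 \<longrightarrow> - \<psi> q t $ 1 < 0"
      using V.stays_negative[OF k1 order_refl, of t0 p] Y_stays by auto
    obtain d2 where d2: "d2 > 0" "\<forall>q t. norm (q - p) < d2 \<longrightarrow> 0 \<le> t \<longrightarrow> t \<le> t0 \<longrightarrow> \<psi> q t $ 2 < 0"
      using V.stays_negative[OF k2 order_refl, of t0 p] Y_stays by auto
    show ?thesis by (rule that[of "min d1 d2"]) (use d1 d2 in auto)
  qed
  define d' where "d' = min d0 (e / (2 * C) / exp (L * t0))"
  show ?thesis
  proof (intro exI[of _ d'] conjI allI impI)
    show "d' > 0" using d0 e C by (simp add: d'_def)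
    fix q :: "real^2" assume q: "0 \<le> q $ 1 \<and> q $ 2 \<le> 0" "dist q p < d'"
    have qd: "norm (q - p) < d0" "norm (q - p) < e / (2 * C) / exp (L * t0)"
      using q by (auto simp: d'_def dist_norm)
    have "norm (\<psi> q t0) \<le> norm (\<psi> q t0 - \<psi> p t0) + norm (\<psi> p t0)" by norm
    also have "norm (\<psi> q t0 - \<psi> p t0) \<le> exp (L * t0) * norm (q - p)" using t0 by (intro V.dist_le)
    also have "\<dots> < e / (2 * C)" using qd(2) by (simp only: pos_less_divide_eq[OF exp_gt_zero] mult.commute)
    finally have n: "norm (\<psi> q t0) < e / C" using t0(2) by (simp add: field_simps)
    have "\<bar>Y_exit q\<bar> < e"
    proof (cases "\<exists>T. Y_exits q T")
      case False
      then show ?thesis using e by (simp add: Y_exit_def)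
    next
      case True
      then obtain T where T: "Y_exits q T" by blast
      have T0: "t0 \<le> T"
      proof (rule ccontr)
        assume "\<not> t0 \<le> T"
        moreover from this have "p \<noteq> 0" using t0(3) T by (auto simp: Y_exits_def)
        ultimately have "\<psi> q T $ 1 > 0 \<and> \<psi> q T $ 2 < 0" using d0(2)[OF _ qd(1), of T] T by (auto simp: Y_exits_def)
        then show False using T by (auto simp: Y_exits_def)
      qed
      have "\<bar>Y_exit q\<bar> \<le> \<bar>\<psi> q T $ 1\<bar> + \<bar>\<psi> q T $ 2\<bar>" unfolding Y_exit_eq[OF T] by simp
      also have "\<dots> \<le> (1 + 1 / d) * (\<psi> q T $ 1 - d * \<psi> q T $ 2)"
        using T by (intro abs_le_v) (auto simp: Y_exits_def)
      also have "\<dots> \<le> (1 + 1 / d) * (exp (- m * (T - t0)) * (\<psi> q t0 $ 1 - d * \<psi> q t0 $ 2))"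
        using param_pos t0 T0 T by (intro mult_left_mono v_decay) (auto simp: Y_exits_def less_imp_le)
      also have "\<dots> \<le> (1 + 1 / d) * (1 * ((1 + d) * norm (\<psi> q t0)))"
      proof (intro mult_left_mono mult_mono v_le_norm)
        show "exp (- m * (T - t0)) \<le> 1" using param_pos T0 by simp
        have "0 \<le> \<psi> q t0 $ 1 \<and> \<psi> q t0 $ 2 \<le> 0" using T T0 t0(1) by (cases "t0 = T") (auto simp: Y_exits_def less_imp_le)
        then show "0 \<le> \<psi> q t0 $ 1 - d * \<psi> q t0 $ 2"
          using param_pos mult_nonneg_nonpos[of d "\<psi> q t0 $ 2"] by auto
      qed (use param_pos in auto)
      also have "\<dots> = C * norm (\<psi> q t0)" by (simp add: C_def)
      also have "\<dots> < e" using n C by (simp add: field_simps)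
      finally show ?thesis .
    qed
    then show "dist (Y_exit q) (Y_exit p) < e" using exit_p by simp
  qed
qed

lemma Y_exit_continuous: "continuous_on {p. 0 \<le> p $ 1 \<and> p $ 2 \<le> 0} Y_exit"
  unfolding continuous_on_iff
proof (intro ballI allI impI)
  fix p :: "real^2" and e :: real
  assume p: "p \<in> {p. 0 \<le> p $ 1 \<and> p $ 2 \<le> 0}" and e: "0 < e"
  have "\<exists>d>0. \<forall>q. 0 \<le> q $ 1 \<and> q $ 2 \<le> 0 \<longrightarrow> dist q p < d \<longrightarrow> dist (Y_exit q) (Y_exit p) < e"
  proof (cases "p = 0 \<or> Y_stays p")
    case True then show ?thesis using Y_exit_continuous_no_exit e by blast
  next
    case False
    then obtain T where T: "Y_exits p T" using Y_exits_or_stays p by blast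
    then consider "\<psi> p T $ 1 = 0" | "\<psi> p T $ 2 = 0" by (auto simp: Y_exits_def)
    then show ?thesis
    proof cases
      case 1 then show ?thesis using Y_exit_continuous_exit[OF T e, of 1 "-1"] by simp
    next
      case 2 then show ?thesis using Y_exit_continuous_exit[OF T e, of 2 1] by simp
    qed
  qed
  then show "\<exists>d>0. \<forall>x'\<in>{p. 0 \<le> p $ 1 \<and> p $ 2 \<le> 0}. dist x' p < d \<longrightarrow> dist (Y_exit x') (Y_exit p) < e" by auto
qed

section \<open>The height of arrival on the y-axis\<close>

text \<open>Negative heights belong to orbits passing below the origin and positive ones to orbits
  passing above it; 0 is left for the separatrix and the origin.\<close>

definition h :: "real^2 \<Rightarrow> real" where
  "h p = (if 0 \<le> p $ 2 then X_exit p else if Y_exit p \<le> 0 then Y_exit p else X_exit (vector [Y_exit p, 0]))"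

lemma h_continuous: "continuous_on {p. 0 \<le> p $ 1} h"
proof -
  \<comment> \<open>\<open>k\<close> turns the boundary coordinate \<open>Y_exit\<close> into the
    height: its negative part lies on the y-axis already, from its positive part the first quadrant
    remains to be crossed.\<close>
  define k where "k e = (if e \<le> 0 then e else X_exit (vector [e, 0]))" for e
  have "continuous_on ({..0} \<union> {0..}) k"
    unfolding k_def
  proof (rule continuous_on_cases)
    have "continuous_on UNIV (\<lambda>e. vector [e, 0] :: real^2)"
    proof -
      have "(vector [e, 0] :: real^2) = e *\<^sub>R axis 1 1" for e by (simp add: vec2_eq_iff axis_def)
      then show ?thesis by (auto intro!: continuous_intros)
    qed
    then show "continuous_on {0..} (\<lambda>e. X_exit (vector [e, 0]))"
      by (intro continuous_on_compose2[OF X_exit_continuous]) (auto intro: continuous_on_subset)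
    have "(vector [0, 0] :: real^2) = 0" by (simp add: vec2_eq_iff)
    then show "\<forall>x. x \<in> {..0} \<and> \<not> x \<le> 0 \<or> x \<in> {0..} \<and> x \<le> 0 \<longrightarrow> x = X_exit (vector [x, 0])"
      by (auto simp: X_exit_def)
  qed (auto intro: continuous_intros)
  moreover have "{..0} \<union> {0..} = (UNIV :: real set)" by auto
  ultimately have ck: "continuous_on UNIV k" by simp
  have "continuous_on ({p. 0 \<le> p $ 1 \<and> 0 \<le> p $ 2} \<union> {p. 0 \<le> p $ 1 \<and> p $ 2 \<le> 0})
     (\<lambda>p. if 0 \<le> p $ 2 then X_exit p else k (Y_exit p))"
  proof (rule continuous_on_cases)
    show "closed {p::real^2. 0 \<le> p $ 1 \<and> 0 \<le> p $ 2}" "closed {p::real^2. 0 \<le> p $ 1 \<and> p $ 2 \<le> 0}"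
      by (intro closed_Collect_conj closed_Collect_le continuous_intros)+
    show "continuous_on {p. 0 \<le> p $ 1 \<and> p $ 2 \<le> 0} (\<lambda>p. k (Y_exit p))"
      by (rule continuous_on_compose2[OF ck Y_exit_continuous]) auto
    \<comment> \<open>The branches agree on the switching line, because there the lower orbit exits
      at time 0.\<close>
    have "X_exit p = k (Y_exit p)" if p: "0 \<le> p $ 1" "p $ 2 = 0" for p
    proof (cases "p = 0")
      case True then show ?thesis by (simp add: Y_exit_0 X_exit_def k_def)
    next
      case False
      then have "p $ 1 > 0" using p by (simp add: vec2_eq_iff)
      moreover from this have "Y_exits p 0" using p by (auto simp: Y_exits_def V.init)
      ultimately have "Y_exit p = p $ 1" "p = vector [p $ 1, 0]" using Y_exit_eq[of p 0] p by (auto simp: V.init vec2_eq_iff)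
      then show ?thesis using \<open>p $ 1 > 0\<close> by (simp add: k_def)
    qed
    then show "\<forall>x. x \<in> {p. 0 \<le> p $ 1 \<and> 0 \<le> p $ 2} \<and> \<not> 0 \<le> x $ 2 \<or>
      x \<in> {p. 0 \<le> p $ 1 \<and> p $ 2 \<le> 0} \<and> 0 \<le> x $ 2 \<longrightarrow> X_exit x = k (Y_exit x)"
      by auto
  qed (rule X_exit_continuous)
  moreover have "{p. 0 \<le> p $ 1 \<and> 0 \<le> p $ 2} \<union> {p. 0 \<le> p $ 1 \<and> p $ 2 \<le> 0} = {p::real^2. 0 \<le> p $ 1}" by auto
  ultimately show ?thesis by (simp add: h_def k_def cong: if_cong)
qed

end

subsection \<open>The right half-plane: chart\<close>

context right_half begin

text \<open>Only the two end times can be zeros of the ordinate, so the solution of the upper field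
  alone is a trajectory of the pair.\<close>

lemma itraj_flow_X:
  assumes T: "0 \<le> T" and p: "p \<noteq> 0"
    and x: "\<And>t. 0 \<le> t \<Longrightarrow> t \<le> T \<Longrightarrow> 0 \<le> \<phi> p t $ 1" and y: "\<And>t. 0 \<le> t \<Longrightarrow> t \<le> T \<Longrightarrow> 0 \<le> \<phi> p t $ 2"
    and pos: "\<And>t. 0 < t \<Longrightarrow> t < T \<Longrightarrow> 0 < \<phi> p t $ 2"
  shows "itraj X Y {q. 0 \<le> q $ 1} {0..T} (\<phi> p)"
  unfolding itraj_def
proof (intro conjI disjI2)
  show "\<forall>t\<in>{0..T}. \<phi> p t $ 2 > 0 \<longrightarrow> (\<phi> p has_vector_derivative X (\<phi> p t)) (at t within {0..T})"
    by (auto intro!: has_vector_derivative_within_subset[OF U.deriv])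
  show "\<forall>t\<in>{0..T}. \<phi> p t $ 2 < 0 \<longrightarrow> (\<phi> p has_vector_derivative Y (\<phi> p t)) (at t within {0..T})"
    using y by (force simp: not_less[symmetric])
  have "finite {t \<in> {a..b}. \<phi> p t $ 2 = 0}" if ab: "{a..b} \<subseteq> {0..T}" for a b
  proof (rule finite_subset[of _ "{0, T}"])
    show "{t \<in> {a..b}. \<phi> p t $ 2 = 0} \<subseteq> {0, T}"
    proof
      fix t assume t: "t \<in> {t \<in> {a..b}. \<phi> p t $ 2 = 0}"
      then have "t \<in> {0..T}" using ab by blast
      then have "0 \<le> t" "t \<le> T" by auto
      then show "t \<in> {0, T}" using pos[of t] t by fastforce
    qed
  qed simp
  then show "\<forall>a b. {a..b} \<subseteq> {0..T} \<longrightarrow> finite {t \<in> {a..b}. \<phi> p t $ 2 = 0}" by blast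
  show "\<forall>t\<in>{0..T}. \<phi> p t \<noteq> 0" using U.nonzero p by simp
  show "continuous_on {0..T} (\<phi> p)" by (rule U.cont) auto
  show "\<phi> p ` {0..T} \<subseteq> {q. 0 \<le> q $ 1}" by (rule image_subsetI) (simp add: x)
qed (use T in \<open>simp_all add: is_interval_cc\<close>)

lemma itraj_flow_Y:
  assumes T: "0 \<le> T" and p: "p \<noteq> 0"
    and x: "\<And>t. 0 \<le> t \<Longrightarrow> t \<le> T \<Longrightarrow> 0 \<le> \<psi> p t $ 1" and y: "\<And>t. 0 \<le> t \<Longrightarrow> t \<le> T \<Longrightarrow> \<psi> p t $ 2 \<le> 0"
    and neg: "\<And>t. 0 < t \<Longrightarrow> t < T \<Longrightarrow> \<psi> p t $ 2 < 0"
  shows "itraj X Y {q. 0 \<le> q $ 1} {0..T} (\<psi> p)"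
  unfolding itraj_def
proof (intro conjI disjI2)
  show "\<forall>t\<in>{0..T}. \<psi> p t $ 2 < 0 \<longrightarrow> (\<psi> p has_vector_derivative Y (\<psi> p t)) (at t within {0..T})"
    by (auto intro!: has_vector_derivative_within_subset[OF V.deriv])
  show "\<forall>t\<in>{0..T}. \<psi> p t $ 2 > 0 \<longrightarrow> (\<psi> p has_vector_derivative X (\<psi> p t)) (at t within {0..T})"
    using y by (force simp: not_less[symmetric])
  have "finite {t \<in> {a..b}. \<psi> p t $ 2 = 0}" if ab: "{a..b} \<subseteq> {0..T}" for a b
  proof (rule finite_subset[of _ "{0, T}"])
    show "{t \<in> {a..b}. \<psi> p t $ 2 = 0} \<subseteq> {0, T}"
    proof
      fix t assume t: "t \<in> {t \<in> {a..b}. \<psi> p t $ 2 = 0}"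
      then have "t \<in> {0..T}" using ab by blast
      then have "0 \<le> t" "t \<le> T" by auto
      then show "t \<in> {0, T}" using neg[of t] t by fastforce
    qed
  qed simp
  then show "\<forall>a b. {a..b} \<subseteq> {0..T} \<longrightarrow> finite {t \<in> {a..b}. \<psi> p t $ 2 = 0}" by blast
  show "\<forall>t\<in>{0..T}. \<psi> p t \<noteq> 0" using V.nonzero p by simp
  show "continuous_on {0..T} (\<psi> p)" by (rule V.cont) auto
  show "\<psi> p ` {0..T} \<subseteq> {q. 0 \<le> q $ 1}" by (rule image_subsetI) (simp add: x)
qed (use T in \<open>simp_all add: is_interval_cc\<close>)

lemma traj_unique:
  assumes "itraj X Y S I \<gamma>" "itraj X Y S' J \<gamma>'" "t0 \<in> I" "t0 \<in> J" "\<gamma> t0 = \<gamma>' t0" "t \<in> I" "t \<in> J"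
  shows "\<gamma> t = \<gamma>' t"
proof (rule itraj_unique[where B = UNIV and L = L])
  show "itraj X Y UNIV I \<gamma>" "itraj X Y UNIV J \<gamma>'" using assms(1,2) by (auto intro: itraj_mono)
qed (use assms U.lip V.lip cross in auto)

lemma upper_traj:
  assumes p: "0 \<le> p $ 1" "0 \<le> p $ 2" "p \<noteq> 0"
  shows "\<exists>T\<ge>0. \<exists>\<gamma>. itraj X Y {q. 0 \<le> q $ 1} {0..T} \<gamma> \<and> \<gamma> 0 = p \<and> \<gamma> T = vector [0, X_exit p] \<and>
    (\<forall>t. 0 \<le> t \<and> t < T \<longrightarrow> \<gamma> t $ 1 > 0)"
proof -
  obtain T where T: "X_exits p T" using X_exits_exists[OF p] by blast
  have T': "0 \<le> T" "\<phi> p T $ 1 = 0" "\<And>t. 0 \<le> t \<Longrightarrow> t < T \<Longrightarrow> \<phi> p t $ 1 > 0" using T by (auto simp: X_exits_def)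
  have y: "0 < \<phi> p t $ 2" if "0 < t" "t \<le> T" for t using X_exits_y_pos[OF p T, of t] that by simp
  have "itraj X Y {q. 0 \<le> q $ 1} {0..T} (\<phi> p)"
  proof (rule itraj_flow_X[OF T'(1) p(3)])
    show "0 \<le> \<phi> p t $ 1" if "0 \<le> t" "t \<le> T" for t
      using T'(2) T'(3)[of t] that by (cases "t = T") auto
    show "0 \<le> \<phi> p t $ 2" if "0 \<le> t" "t \<le> T" for t
      using y[of t] that p by (cases "t = 0") (auto simp: U.init)
  qed (use y in auto)
  moreover have "\<phi> p T = vector [0, X_exit p]" using X_exit_eq[OF T] T' by (simp add: vec2_eq_iff)
  ultimately show ?thesis using T' U.init by blast
qed

text \<open>An orbit that leaves the fourth quadrant through the switching line is continued by the
  upper field. Positivity of the abscissa before \<open>T\<close> makes \<open>T\<close> the first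
  time of arrival.\<close>

lemma h_traj:
  assumes p: "0 \<le> p $ 1" and hp: "h p \<noteq> 0"
  shows "\<exists>T\<ge>0. \<exists>\<gamma>. itraj X Y {q. 0 \<le> q $ 1} {0..T} \<gamma> \<and> \<gamma> 0 = p \<and> \<gamma> T = vector [0, h p] \<and>
    (\<forall>t. 0 \<le> t \<and> t < T \<longrightarrow> \<gamma> t $ 1 > 0)"
proof (cases "0 \<le> p $ 2")
  case True
  then have "p \<noteq> 0" using hp by (auto simp: h_def X_exit_def)
  then show ?thesis using upper_traj[OF p True] True by (simp add: h_def)
next
  case False
  then have nz: "Y_exit p \<noteq> 0" using hp by (auto simp: h_def)
  have "\<exists>T. Y_exits p T"
  proof (rule ccontr)
    assume "\<nexists>T. Y_exits p T"
    then show False using nz by (simp add: Y_exit_def)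
  qed
  then obtain T where T: "Y_exits p T" by blast
  have T': "0 \<le> T" "\<And>t. 0 \<le> t \<Longrightarrow> t < T \<Longrightarrow> \<psi> p t $ 1 > 0 \<and> \<psi> p t $ 2 < 0" using T by (auto simp: Y_exits_def)
  have p0: "p \<noteq> 0" using False by auto
  have tr: "itraj X Y {q. 0 \<le> q $ 1} {0..T} (\<psi> p)"
  proof (rule itraj_flow_Y[OF T'(1) p0])
    show "0 \<le> \<psi> p t $ 1" if "0 \<le> t" "t \<le> T" for t
      using T T'(2)[of t] that by (cases "t = T") (auto simp: Y_exits_def)
    show "\<psi> p t $ 2 \<le> 0" if "0 \<le> t" "t \<le> T" for t
      using T T'(2)[of t] that by (cases "t = T") (auto simp: Y_exits_def)
  qed (use T' in auto)
  from T consider "\<psi> p T $ 1 = 0" "\<psi> p T $ 2 < 0" | "\<psi> p T $ 1 > 0" "\<psi> p T $ 2 = 0" by (auto simp: Y_exits_def)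
  then show ?thesis
  proof cases
    case 1
    then have "\<psi> p T = vector [0, h p]"
      using Y_exit_eq[OF T] False by (simp add: h_def vec2_eq_iff)
    then show ?thesis using tr T' V.init by blast
  next
    case 2
    define q where "q = \<psi> p T"
    have qv: "q = vector [Y_exit p, 0]" "Y_exit p > 0" using Y_exit_eq[OF T] 2 by (auto simp: q_def vec2_eq_iff)
    then have "h p = X_exit q" using False by (simp add: h_def)
    moreover have "q \<noteq> 0" using qv by (auto simp: vec2_eq_iff)
    ultimately have hq: "h p = X_exit q" "q \<noteq> 0" by auto
    obtain T2 \<gamma> where \<gamma>: "0 \<le> T2" "itraj X Y {q. 0 \<le> q $ 1} {0..T2} \<gamma>" "\<gamma> 0 = q" "\<gamma> T2 = vector [0, h p]"
      "\<forall>t. 0 \<le> t \<and> t < T2 \<longrightarrow> \<gamma> t $ 1 > 0"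
      using upper_traj[of q] hq 2 by (auto simp: q_def)
    define w where "w t = (if t \<le> T then \<psi> p t else \<gamma> (t - T))" for t
    have "itraj X Y {q. 0 \<le> q $ 1} {0..T + T2} w"
    proof (rule itraj_join[of 0 T])
      show "itraj X Y {q. 0 \<le> q $ 1} {0..T} w"
        by (rule itraj_cong[OF tr]) (simp add: w_def)
      have "{t. t + - T \<in> {0..T2}} = {T..T + T2}" by auto
      with itraj_shift[OF \<gamma>(2), of "- T"] have "itraj X Y {q. 0 \<le> q $ 1} {T..T + T2} (\<lambda>t. \<gamma> (t + - T))" by simp
      then show "itraj X Y {q. 0 \<le> q $ 1} {T..T + T2} w"
        by (rule itraj_cong) (auto simp: w_def q_def \<gamma>(3))
    qed (use T' \<gamma> in auto)
    moreover have "w 0 = p" using T' by (simp add: w_def V.init)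
    moreover have "w (T + T2) = vector [0, h p]"
      using \<gamma> by (cases "T2 = 0") (auto simp: w_def q_def)
    moreover have "w t $ 1 > 0" if "0 \<le> t" "t < T + T2" for t
      using T'(2)[of t] 2 that \<gamma>(5)[rule_format, of "t - T"] by (cases "t = T") (auto simp: w_def)
    ultimately show ?thesis using T' \<gamma>(1) by (intro exI[of _ "T + T2"] conjI exI[of _ w]) auto
  qed
qed

lemma h_zero_Y_stays:
  assumes p: "0 \<le> p $ 1" "p \<noteq> 0" and hp: "h p = 0"
  shows "Y_stays p"
proof (cases "0 \<le> p $ 2")
  case True
  then show ?thesis using X_exit_pos[OF p(1) True p(2)] hp by (simp add: h_def)
next
  case False
  have "\<not> Y_exits p T" for T
  proof
    assume T: "Y_exits p T"
    then consider "Y_exit p < 0" | "Y_exit p > 0" using Y_exit_eq[OF T] by (auto simp: Y_exits_def)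
    then show False
    proof cases
      case 1 then show False using hp False by (simp add: h_def)
    next
      case 2
      then have "X_exit (vector [Y_exit p, 0]) > 0" by (intro X_exit_pos) (auto simp: vec2_eq_iff)
      then show False using hp False 2 by (simp add: h_def)
    qed
  qed
  then show ?thesis using Y_exits_or_stays[OF p(1) _ p(2)] False by auto
qed

lemma Y_stays_itraj: assumes "Y_stays p" shows "itraj X Y {q. 0 \<le> q $ 1} {0..} (\<psi> p)"
proof (rule itraj_local)
  have p: "\<And>t. 0 \<le> t \<Longrightarrow> \<psi> p t $ 1 > 0 \<and> \<psi> p t $ 2 < 0" using assms by (auto simp: Y_stays_def)
  have p0: "p \<noteq> 0" using p[of 0] by (auto simp: V.init)
  fix a b :: real assume "a \<in> {0..}" "b \<in> {0..}" "a \<le> b"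
  have "itraj X Y {q. 0 \<le> q $ 1} {0..b} (\<psi> p)"
  proof (rule itraj_flow_Y[OF _ p0])
    show "0 \<le> b" using \<open>b \<in> {0..}\<close> by simp
    show "0 \<le> \<psi> p t $ 1" "\<psi> p t $ 2 \<le> 0" if "0 \<le> t" for t using p[OF that] by simp_all
    show "\<psi> p t $ 2 < 0" if "0 < t" for t using p[of t] that by simp
  qed
  then show "itraj X Y {q. 0 \<le> q $ 1} {a..b} (\<psi> p)"
    by (rule itraj_subinterval) (use \<open>a \<in> {0..}\<close> \<open>a \<le> b\<close> in \<open>auto simp: is_interval_cc\<close>)
qed (auto simp: is_interval_ci)

text \<open>Characterises the height by trajectories alone: two of them from one point agree while
  both last, so the one that arrives first forces the other to have arrived.\<close>

lemma h_unique:
  assumes g: "itraj X Y S {0..T} \<gamma>" and T: "0 \<le> T" and e: "\<gamma> T = vector [0, k]" and k: "k \<noteq> 0"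
    and x: "\<And>t. 0 \<le> t \<Longrightarrow> t < T \<Longrightarrow> \<gamma> t $ 1 > 0"
  shows "h (\<gamma> 0) = k"
proof -
  have "\<gamma> T \<noteq> 0" using e k by (simp add: vec2_eq_iff)
  then have p0: "\<gamma> 0 \<noteq> 0" using itrajD(7)[OF g, of 0 T] T by auto
  have p1: "0 \<le> \<gamma> 0 $ 1" using x[of 0] e T by (cases "T = 0") auto
  show ?thesis
  proof (cases "h (\<gamma> 0) = 0")
    case True
    then have Y_stays: "Y_stays (\<gamma> 0)" using h_zero_Y_stays p0 p1 by blast
    have "\<gamma> T = \<psi> (\<gamma> 0) T"
      by (rule traj_unique[OF g Y_stays_itraj[OF Y_stays], of 0]) (use T in \<open>auto simp: V.init\<close>)
    moreover have "\<psi> (\<gamma> 0) T $ 1 > 0" using Y_stays T by (simp add: Y_stays_def)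
    moreover have "\<gamma> T $ 1 = 0" using e by simp
    ultimately show ?thesis by simp
  next
    case False
    obtain T' \<gamma>' where \<gamma>': "0 \<le> T'" "itraj X Y {q. 0 \<le> q $ 1} {0..T'} \<gamma>'" "\<gamma>' 0 = \<gamma> 0"
      "\<gamma>' T' = vector [0, h (\<gamma> 0)]" "\<forall>t. 0 \<le> t \<and> t < T' \<longrightarrow> \<gamma>' t $ 1 > 0"
      using h_traj[OF p1 False] by blast
    have eq: "\<gamma> t = \<gamma>' t" if "0 \<le> t" "t \<le> T" "t \<le> T'" for t
      by (rule traj_unique[OF g \<gamma>'(2), of 0]) (use that \<gamma>' in auto)
    have "\<gamma> T $ 1 = 0" "\<gamma>' T' $ 1 = 0" using e \<gamma>'(4) by simp_all
    then have "\<not> T < T'" "\<not> T' < T"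
      using eq[of T] \<gamma>'(5)[rule_format, of T] T eq[of T'] x[of T'] \<gamma>'(1) by auto
    then have "T = T'" by simp
    then show ?thesis using eq[of T] e \<gamma>'(4) T by (simp add: vec2_eq_iff)
  qed
qed

lemma h_along:
  assumes g: "itraj X Y S {0..T} \<gamma>" and e: "\<gamma> T = vector [0, k]" and k: "k \<noteq> 0"
    and x: "\<And>t. 0 \<le> t \<Longrightarrow> t < T \<Longrightarrow> \<gamma> t $ 1 > 0" and t: "0 \<le> t" "t \<le> T"
  shows "h (\<gamma> t) = k"
proof -
  have "itraj X Y S {0..T - t} (\<lambda>s. \<gamma> (s + t))"
    by (rule itraj_subinterval[OF itraj_shift[OF g, of t]]) (use t in \<open>auto simp: is_interval_cc\<close>)
  from h_unique[OF this _ _ k] show ?thesis using e t x by simp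
qed

text \<open>A later point of nonzero height would reach the y-axis, but its trajectory is a part of
  an orbit with positive abscissa.\<close>

lemma h_along_Y_stays:
  assumes Y_stays: "Y_stays p" and t: "0 \<le> t"
  shows "h (\<psi> p t) = 0"
proof (rule ccontr)
  assume n: "h (\<psi> p t) \<noteq> 0"
  have p1: "0 \<le> \<psi> p t $ 1" using Y_stays t by (auto simp: Y_stays_def less_imp_le)
  obtain T \<gamma> where \<gamma>: "0 \<le> T" "itraj X Y {q. 0 \<le> q $ 1} {0..T} \<gamma>" "\<gamma> 0 = \<psi> p t"
      "\<gamma> T = vector [0, h (\<psi> p t)]"
    using h_traj[OF p1 n] by blast
  have "\<gamma> T = \<psi> p (T + t)"
    by (rule traj_unique[OF \<gamma>(2) itraj_shift[OF Y_stays_itraj[OF Y_stays], of t], of 0]) (use \<gamma> t in auto)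
  moreover have "\<psi> p (T + t) $ 1 > 0" using Y_stays t \<gamma>(1) by (auto simp: Y_stays_def)
  moreover have "\<gamma> T $ 1 = 0" using \<gamma>(4) by simp
  ultimately show False by simp
qed

section \<open>A function that increases along orbits\<close>

text \<open>Below, this is minus the form \<open>x - d * y\<close> that decays by
  \<open>Y_v\<close>; above, the slope is the one of \<open>X_g\<close>. Both branches are
  \<open>- x\<close> on the switching line, so \<open>g\<close> is continuous with a kink
  there.\<close>

definition g :: "real^2 \<Rightarrow> real" where
  "g p = \<delta> * max (p $ 2) 0 + d * min (p $ 2) 0 - p $ 1"

lemma g_continuous: "continuous_on S g"
  unfolding g_def by (intro continuous_intros)

lemma g_increasing:
  assumes tr: "itraj X Y {q. 0 \<le> q $ 1} I \<gamma>" and st: "s \<in> I" "t \<in> I" "s < t" and nz: "\<gamma> s \<noteq> 0"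
  shows "g (\<gamma> s) < g (\<gamma> t)"
proof -
  note D = itrajD[OF tr]
  have sub: "{s..t} \<subseteq> I"
    using st D(1) by (meson atLeastAtMost_iff mem_is_interval_1_I subsetI)
  then have subo: "{s<..<t} \<subseteq> I" by auto
  have at: "at r within I = at r" if "s < r" "r < t" for r
    by (rule at_within_open_subset[of _ "{s<..<t}"]) (use that subo in auto)
  have c: "continuous_on {s..t} \<gamma>" "continuous_on {s<..<t} \<gamma>"
    using D(3) sub subo continuous_on_subset by blast+
  \<comment> \<open>Treats both sides at once: \<open>\<sigma>\<close> selects the side,
    \<open>k\<close> is the slope of \<open>g\<close> and \<open>F\<close> the field there.\<close>
  have half: "((\<lambda>r. g (\<gamma> r)) has_real_derivative k * F (\<gamma> r) $ 2 - F (\<gamma> r) $ 1) (at r)"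
    if r: "s < r" "r < t" "\<sigma> * \<gamma> r $ 2 > 0" and der: "(\<gamma> has_vector_derivative F (\<gamma> r)) (at r within I)"
      and gk: "\<And>p. \<sigma> * p $ 2 > 0 \<Longrightarrow> g p = k * p $ 2 - p $ 1" for r \<sigma> k F
  proof -
    define W where "W = {r \<in> {s<..<t}. \<sigma> * \<gamma> r $ 2 > 0}"
    have "open ({s<..<t} \<inter> (\<lambda>r. \<sigma> * \<gamma> r $ 2) -` {0<..})"
      by (rule continuous_open_preimage) (use c in \<open>auto intro!: continuous_intros\<close>)
    moreover have "{s<..<t} \<inter> (\<lambda>r. \<sigma> * \<gamma> r $ 2) -` {0<..} = W" by (auto simp: W_def)
    ultimately have W: "open W" "r \<in> W" using r by (auto simp: W_def)
    have n: "((\<lambda>r. \<gamma> r $ i) has_real_derivative F (\<gamma> r) $ i) (at r)" for i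
      unfolding has_real_derivative_iff_has_vector_derivative
      by (rule bounded_linear.has_vector_derivative[OF bounded_linear_vec_nth])
        (use der at r in simp)
    have "((\<lambda>r. k * \<gamma> r $ 2 - \<gamma> r $ 1) has_real_derivative k * F (\<gamma> r) $ 2 - F (\<gamma> r) $ 1) (at r)"
      by (auto intro!: derivative_eq_intros n)
    then show ?thesis
      by (rule has_field_derivative_transform_within_open[OF _ W]) (auto simp: W_def gk)
  qed
  show ?thesis
  proof (rule DERIV_pos_finite_imp_less[OF st(3), of "{r\<in>{s..t}. \<gamma> r $ 2 = 0}" "\<lambda>r. g (\<gamma> r)"])
    show "finite {r\<in>{s..t}. \<gamma> r $ 2 = 0}" by (rule D(8)[OF st(1) nz sub])
    show "continuous_on {s..t} (\<lambda>r. g (\<gamma> r))"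
      by (rule continuous_on_compose2[OF g_continuous c(1)]) auto
    fix r assume r: "s < r" "r < t" "r \<notin> {r\<in>{s..t}. \<gamma> r $ 2 = 0}"
    then have rI: "r \<in> I" using subo by auto
    then have "\<gamma> r \<in> {q. 0 \<le> q $ 1}" using D(4) by blast
    then have x: "0 \<le> \<gamma> r $ 1" by simp
    consider "\<gamma> r $ 2 > 0" | "\<gamma> r $ 2 < 0" using r by force
    then show "\<exists>y. ((\<lambda>r. g (\<gamma> r)) has_real_derivative y) (at r) \<and> y > 0"
    proof cases
      case 1
      have "((\<lambda>r. g (\<gamma> r)) has_real_derivative \<delta> * X (\<gamma> r) $ 2 - X (\<gamma> r) $ 1) (at r)"
        by (rule half[of r 1]) (use r 1 D(5)[OF rI] in \<open>auto simp: g_def\<close>)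
      moreover have "\<delta> * X (\<gamma> r) $ 2 - X (\<gamma> r) $ 1 > 0"
        using X_g[OF x] 1 by (force simp: less_imp_le)
      ultimately show ?thesis by blast
    next
      case 2
      have "((\<lambda>r. g (\<gamma> r)) has_real_derivative d * Y (\<gamma> r) $ 2 - Y (\<gamma> r) $ 1) (at r)"
        by (rule half[of r "-1"]) (use r 2 D(6)[OF rI] in \<open>auto simp: g_def\<close>)
      moreover have "0 < m * (\<gamma> r $ 1 - d * \<gamma> r $ 2)"
        using x 2 param_pos by (intro mult_pos_pos) (auto simp: mult_pos_neg add_nonneg_pos diff_conv_add_uminus simp del: add_uminus_conv_diff)
      then have "d * Y (\<gamma> r) $ 2 - Y (\<gamma> r) $ 1 > 0"
        using Y_v[OF x] 2 by simp
      ultimately show ?thesis by blast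
    qed
  qed
qed

text \<open>
  \<open>V\<close> increases strictly along the difference of two solutions by \<open>Y_cone\<close>, and it is initially
  nonnegative because \<open>x - d y\<close> agrees at the two points; hence not both solutions tend to the origin.
\<close>

lemma Y_stays_separate:
  assumes p: "Y_stays p" and q: "Y_stays q" and v: "p $ 1 - d * p $ 2 = q $ 1 - d * q $ 2"
  shows "p = q"
proof (rule ccontr)
  assume pq: "p \<noteq> q"
  define w where "w t = \<psi> p t - \<psi> q t" for t
  define V where "V t = (\<alpha> * w t $ 1 + \<beta> * w t $ 2)\<^sup>2 - (w t $ 1 - d * w t $ 2)\<^sup>2" for t
  have twice: "0 < 2 * a * b - 2 * a' * b'" if "a' * b' < a * b" for a b a' b' :: real
    using that by (simp add: mult.assoc)
  have inc: "V s < V t" if st: "0 \<le> s" "s < t" for s t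
  proof (rule DERIV_pos_imp_increasing_open[OF st(2)])
    show "continuous_on {s..t} V"
      unfolding V_def w_def using st by (intro continuous_intros V.cont) auto
    fix r assume r: "s < r" "r < t"
    define w' where "w' = Y (\<psi> p r) - Y (\<psi> q r)"
    have dw: "((\<lambda>r. w r $ i) has_real_derivative w' $ i) (at r)" for i
      unfolding w_def w'_def using st r by (auto intro!: derivative_eq_intros V.DERIV_nth)
    have D: "(V has_real_derivative 2 * (\<alpha> * w r $ 1 + \<beta> * w r $ 2) * (\<alpha> * w' $ 1 + \<beta> * w' $ 2)
        - 2 * (w r $ 1 - d * w r $ 2) * (w' $ 1 - d * w' $ 2)) (at r)"
      unfolding V_def by ((rule derivative_eq_intros dw refl | simp)+, simp add: algebra_simps)
    have ne: "\<psi> p r \<noteq> \<psi> q r" using V.inj[OF _ pq] st r by simp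
    show "\<exists>y. (V has_real_derivative y) (at r) \<and> y > 0"
    proof (intro exI conjI)
      show "0 < 2 * (\<alpha> * w r $ 1 + \<beta> * w r $ 2) * (\<alpha> * w' $ 1 + \<beta> * w' $ 2)
        - 2 * (w r $ 1 - d * w r $ 2) * (w' $ 1 - d * w' $ 2)"
        by (rule twice[OF Y_cone[OF ne, folded w_def w'_def]])
    qed (rule D)
  qed
  have "w 0 $ 1 - d * w 0 $ 2 = 0" using v by (simp add: w_def V.init algebra_simps)
  then have "0 \<le> V 0" by (simp add: V_def)
  then have V1: "V 1 > 0" using inc[of 0 1] by simp
  have "(w \<longlongrightarrow> 0 - 0) at_top"
    unfolding w_def by (intro tendsto_intros Y_stays_tendsto p q)
  then have "((\<lambda>t. w t $ i) \<longlongrightarrow> 0) at_top" for i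
    using tendsto_vec_nth[of w 0 at_top i] by simp
  then have "(V \<longlongrightarrow> (\<alpha> * 0 + \<beta> * 0)\<^sup>2 - (0 - d * 0)\<^sup>2) at_top"
    unfolding V_def by (intro tendsto_intros)
  then have "\<forall>\<^sub>F t in at_top. V t < V 1" using V1 by (intro order_tendstoD(2)) auto
  then have "\<forall>\<^sub>F t in at_top. V t < V 1 \<and> 1 < t" using eventually_gt_at_top[of 1] by eventually_elim auto
  then obtain t where "V t < V 1" "1 < t" using eventually_happens by fastforce
  then show False using inc[of 1 t] by simp
qed

text \<open>For nonzero height both orbits arrive at the same point, so one of \<open>p\<close>,
  \<open>q\<close> lies on the orbit of the other, along which \<open>g\<close> grows strictly. For
  height 0 there is no common arrival in finite time; both points are then below the switching line,
  where equal \<open>g\<close> means equal \<open>x - d * y\<close>, and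
  \<open>Y_stays_separate\<close> applies.\<close>

lemma gh_injective:
  assumes p: "0 \<le> p $ 1" and q: "0 \<le> q $ 1" and geq: "g p = g q" and heq: "h p = h q"
  shows "p = q"
proof (cases "h p = 0")
  case True
  have neg: "g r < 0 \<and> g r = - (r $ 1 - d * r $ 2)" if "Y_stays r" for r
  proof -
    have "r $ 1 > 0" "r $ 2 < 0" using that by (auto simp: Y_stays_def dest: spec[of _ 0] simp: V.init)
    then show ?thesis using mult_pos_neg[of d "r $ 2"] param_pos by (auto simp: g_def)
  qed
  have g0: "g 0 = 0" by (simp add: g_def)
  show ?thesis
  proof (cases "p = 0 \<or> q = 0")
    case True
    then show ?thesis using neg[of p] neg[of q] h_zero_Y_stays[OF p] h_zero_Y_stays[OF q] \<open>h p = 0\<close> heq geq g0 by force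
  next
    case False
    then have Y_stays: "Y_stays p" "Y_stays q" using h_zero_Y_stays p q True heq by auto
    then show ?thesis using neg geq by (intro Y_stays_separate) auto
  qed
next
  case False
  \<comment> \<open>Followed backwards from the common end the trajectories coincide, so
    \<open>p'\<close> is the point reached from \<open>q'\<close> after time \<open>T' - T\<close>;
    equality of \<open>g\<close> makes this time 0.\<close>
  have main: "p' = q'" if "0 \<le> T" "T \<le> T'" "g p' = g q'" "q' \<noteq> 0"
    and \<gamma>: "itraj X Y {q. 0 \<le> q $ 1} {0..T} \<gamma>" "\<gamma> 0 = p'"
    and \<gamma>': "itraj X Y {q. 0 \<le> q $ 1} {0..T'} \<gamma>'" "\<gamma>' 0 = q'" and e: "\<gamma> T = \<gamma>' T'" for p' q' T T' \<gamma> \<gamma>'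
  proof -
    have "\<gamma> 0 = \<gamma>' (0 + (T' - T))"
      by (rule traj_unique[OF \<gamma>(1) itraj_shift[OF \<gamma>'(1), of "T' - T"], of T])
        (use that in auto)
    moreover have "\<not> 0 < T' - T"
    proof
      assume "0 < T' - T"
      then have "g (\<gamma>' 0) < g (\<gamma>' (T' - T))"
        using that by (intro g_increasing[OF \<gamma>'(1)]) auto
      then show False using calculation that by simp
    qed
    then have "T' - T = 0" using \<open>T \<le> T'\<close> by linarith
    ultimately show ?thesis using \<gamma>(2) \<gamma>'(2) by simp
  qed
  obtain T \<gamma> where \<gamma>: "0 \<le> T" "itraj X Y {q. 0 \<le> q $ 1} {0..T} \<gamma>" "\<gamma> 0 = p" "\<gamma> T = vector [0, h p]"
    using h_traj[OF p False] by blast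
  obtain T' \<gamma>' where \<gamma>': "0 \<le> T'" "itraj X Y {q. 0 \<le> q $ 1} {0..T'} \<gamma>'" "\<gamma>' 0 = q" "\<gamma>' T' = vector [0, h q]"
    using h_traj[OF q] False heq by auto
  have "h 0 = 0" by (simp add: h_def X_exit_def)
  then have ne: "p \<noteq> 0" "q \<noteq> 0" using False heq by auto
  show ?thesis
  proof (cases "T \<le> T'")
    case True
    show ?thesis
      by (rule main[OF \<gamma>(1) True geq ne(2) \<gamma>(2,3) \<gamma>'(2,3)]) (simp only: \<gamma>(4) \<gamma>'(4) heq)
  next
    case F: False
    then have "T' \<le> T" by simp
    then have "q = p"
      by (rule main[OF \<gamma>'(1) _ geq[symmetric] ne(1) \<gamma>'(2,3) \<gamma>(2,3)]) (simp only: \<gamma>(4) \<gamma>'(4) heq)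
    then show ?thesis by simp
  qed
qed

section \<open>Normalising the chart along the switching line\<close>

definition h0 :: "real \<Rightarrow> real" where
  "h0 x = h (vector [x, 0])"

lemma h0_0: "h0 0 = 0"
proof -
  have "(vector [0, 0] :: real^2) = 0" by (simp add: vec2_eq_iff)
  then show ?thesis by (simp add: h0_def h_def X_exit_def)
qed

lemma h0_pos: "0 < x \<Longrightarrow> 0 < h0 x"
  unfolding h0_def h_def by (auto intro!: X_exit_pos simp: vec2_eq_iff)

lemma h0_continuous: "continuous_on {0..} h0"
proof -
  have "(vector [e, 0] :: real^2) = e *\<^sub>R axis 1 1" for e by (simp add: vec2_eq_iff axis_def)
  then have "continuous_on {0..} (\<lambda>e. vector [e, 0] :: real^2)" by (auto intro!: continuous_intros)
  then show ?thesis unfolding h0_def by (intro continuous_on_compose2[OF h_continuous]) auto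
qed

text \<open>Equal heights put one point on the forward orbit of the other, but an orbit that starts
  on the switching line is above it at all later times up to its exit.\<close>

lemma h0_inj: assumes "0 < x" "0 < x'" "h0 x = h0 x'" shows "x = x'"
proof -
  have main: "x = x'" if x: "0 < x" "0 < x'" and T: "X_exits (vector [x, 0]) T" "X_exits (vector [x', 0]) T'" "T \<le> T'"
    and e: "\<phi> (vector [x, 0]) T = \<phi> (vector [x', 0]) T'" for x x' T T'
  proof -
    have T0: "0 \<le> T" using T by (simp add: X_exits_def)
    have eq: "vector [x, 0] = \<phi> (vector [x', 0]) (T' - T)"
      by (rule U.backward_unique) (use T0 T e in auto)
    have "\<not> 0 < T' - T"
    proof
      assume "0 < T' - T"
      then have "\<phi> (vector [x', 0]) (T' - T) $ 2 > 0"
        using x T T0 by (intro X_exits_y_pos) (auto simp: vec2_eq_iff)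
      then show False using eq[symmetric] by simp
    qed
    then have "T' - T = 0" using T by simp
    then have "(vector [x, 0] :: real^2) = vector [x', 0]" using eq by (simp add: U.init)
    then show ?thesis by (simp add: vec2_eq_iff)
  qed
  obtain T where T: "X_exits (vector [x, 0]) T" using X_exits_exists[of "vector [x, 0]"] assms by (auto simp: vec2_eq_iff)
  obtain T' where T': "X_exits (vector [x', 0]) T'" using X_exits_exists[of "vector [x', 0]"] assms by (auto simp: vec2_eq_iff)
  have "\<phi> (vector [x, 0]) T = \<phi> (vector [x', 0]) T'"
    using assms(3) X_exit_eq[OF T] X_exit_eq[OF T'] T T' by (simp add: h0_def h_def X_exits_def vec2_eq_iff)
  then show ?thesis
    using main[OF assms(1,2) T T'] main[OF assms(2,1) T' T] by (cases "T \<le> T'") auto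
qed

text \<open>Continuity and injectivity leave two directions of monotonicity; \<open>h0_0\<close> and
  \<open>h0_pos\<close> decide.\<close>

lemma h0_strict_mono: assumes "0 \<le> x" "x < x'" shows "h0 x < h0 x'"
proof (cases "x = 0")
  case True then show ?thesis using h0_0 h0_pos assms by simp
next
  case False
  have inj: "inj_on h0 {0..x'}"
  proof (rule inj_onI)
    fix a b assume ab: "a \<in> {0..x'}" "b \<in> {0..x'}" "h0 a = h0 b"
    then show "a = b" using h0_inj[of a b] h0_pos[of a] h0_pos[of b] h0_0
      by (cases "a = 0"; cases "b = 0") auto
  qed
  have "continuous_on {0..x'} h0" using h0_continuous by (rule continuous_on_subset) auto
  then have "(h0 0 < h0 x \<and> h0 x < h0 x') \<or> (h0 x' < h0 x \<and> h0 x < h0 0)"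
    using continuous_inj_imp_mono[of 0 x x' h0] inj assms False by simp
  moreover have "h0 x > 0" using h0_pos[of x] False assms by simp
  ultimately show ?thesis using h0_0 by linarith
qed

text \<open>
  The scaling is chosen so that \<open>G = f (- x) - f (\<delta> * h) = - h / 2 - h / 2\<close> at a point \<open>(x, 0)\<close> of the
  switching line.
\<close>

definition f :: "real \<Rightarrow> real" where
  "f s = max 0 s / (2 * \<delta>) - h0 (max 0 (- s)) / 2"

lemma f_continuous: "continuous_on S f"
  unfolding f_def
  by (intro continuous_intros continuous_on_compose2[OF h0_continuous]) (use param_pos in auto)

lemma f_strict_mono: assumes "s < t" shows "f s < f t"
proof -
  have 1: "max 0 s / (2 * \<delta>) \<le> max 0 t / (2 * \<delta>)" "0 < t \<Longrightarrow> max 0 s / (2 * \<delta>) < max 0 t / (2 * \<delta>)"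
    using param_pos assms by (auto intro!: divide_right_mono divide_strict_right_mono)
  have 2: "h0 (max 0 (- t)) \<le> h0 (max 0 (- s))" "t \<le> 0 \<Longrightarrow> h0 (max 0 (- t)) < h0 (max 0 (- s))"
    using h0_strict_mono[of "max 0 (- t)" "max 0 (- s)"] assms
    by (cases "max 0 (- t) = max 0 (- s)", auto simp: max_def split: if_splits)
  show ?thesis using 1 2 by (cases "0 < t") (auto simp: f_def)
qed

text \<open>Subtracting the value at the arrival point puts the end of every orbit at
  \<open>G = 0\<close>, where the mirrored chart can take over. On a single orbit only a constant is
  subtracted, so \<open>G\<close> still increases.\<close>

definition G :: "real^2 \<Rightarrow> real" where
  "G p = f (g p) - f (g (vector [0, h p]))"

lemma G_continuous: "continuous_on {p. 0 \<le> p $ 1} G"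
proof -
  have "(vector [0, e] :: real^2) = e *\<^sub>R axis 2 1" for e by (simp add: vec2_eq_iff axis_def)
  then have c: "continuous_on {p::real^2. 0 \<le> p $ 1} (\<lambda>p. vector [0, h p] :: real^2)"
    by (auto intro!: continuous_intros h_continuous)
  show ?thesis
    unfolding G_def
    by (intro continuous_intros continuous_on_compose2[OF f_continuous[of UNIV]] g_continuous
        continuous_on_compose2[OF g_continuous[of UNIV] c]) auto
qed

lemma h_section: "h (vector [0, y]) = y"
proof (cases "y < 0")
  case True
  then have "Y_exits (vector [0, y]) 0" by (simp add: Y_exits_def V.init)
  from Y_exit_eq[OF this] show ?thesis using True by (simp add: h_def V.init)
next
  case False
  have "X_exits (vector [0, y]) 0" by (simp add: X_exits_def U.init)
  from X_exit_eq[OF this] show ?thesis using False by (simp add: h_def U.init)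
qed

lemma G_neg: assumes "0 < p $ 1" shows "G p < 0"
proof (cases "h p = 0")
  case True
  have "p \<noteq> 0" using assms by auto
  then have "Y_stays p" using h_zero_Y_stays True assms by auto
  then have "p $ 2 < 0" by (auto simp: Y_stays_def dest: spec[of _ 0] simp: V.init)
  then have "g p < g (vector [0, h p])" using assms True mult_pos_neg[of d "p $ 2"] param_pos by (simp add: g_def)
  then show ?thesis using f_strict_mono by (simp add: G_def)
next
  case False
  then obtain T \<gamma> where \<gamma>: "0 \<le> T" "itraj X Y {q. 0 \<le> q $ 1} {0..T} \<gamma>" "\<gamma> 0 = p" "\<gamma> T = vector [0, h p]"
    using h_traj[of p] assms by auto
  have "\<gamma> T $ 1 = 0" using \<gamma>(4) by simp
  then have "T \<noteq> 0" using \<gamma>(3) assms by auto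
  have p0: "p \<noteq> 0" using assms by auto
  then have "g p < g (vector [0, h p])"
    using g_increasing[OF \<gamma>(2), of 0 T] \<gamma>(1,3,4) p0 \<open>T \<noteq> 0\<close> by auto
  then show ?thesis using f_strict_mono by (simp add: G_def)
qed

lemma G_section: assumes "p $ 1 = 0" shows "G p = 0"
proof -
  have "p = vector [0, p $ 2]" using assms by (simp add: vec2_eq_iff)
  then have "vector [0, h p] = p" using h_section by metis
  then show ?thesis by (simp add: G_def)
qed

lemma G_Sigma: assumes "0 < x" shows "G (vector [x, 0]) = - h (vector [x, 0])"
proof -
  have "0 < h (vector [x, 0])" using h0_pos[OF assms] by (simp add: h0_def)
  then show ?thesis using assms param_pos h0_0 by (simp add: G_def f_def g_def flip: h0_def)
qed

text \<open>At constant height \<open>G\<close> differs from \<open>f (g p)\<close> by a constant,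
  hence grows along the trajectory, which is cut off where the intermediate value theorem finds the
  value \<open>s\<close>.\<close>

lemma G_along:
  assumes tr: "itraj X Y {q. 0 \<le> q $ 1} {0..T} \<gamma>" and T: "0 \<le> T" and nz: "\<gamma> 0 \<noteq> 0"
    and hc: "\<And>t. 0 \<le> t \<Longrightarrow> t \<le> T \<Longrightarrow> h (\<gamma> t) = k" and s: "G (\<gamma> 0) \<le> s" "s \<le> G (\<gamma> T)"
  shows "\<exists>T\<ge>0. \<exists>\<gamma>'. itraj X Y {q. 0 \<le> q $ 1} {0..T} \<gamma>' \<and> \<gamma>' 0 = \<gamma> 0 \<and>
    (\<forall>t\<in>{0..T}. h (\<gamma>' t) = k) \<and> strict_mono_on {0..T} (\<lambda>t. G (\<gamma>' t)) \<and> G (\<gamma>' T) = s"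
proof -
  have "continuous_on {0..T} (\<lambda>t. G (\<gamma> t))"
    by (rule continuous_on_compose2[OF G_continuous itrajD(3)[OF tr]]) (use itrajD(4)[OF tr] in auto)
  then obtain T' where T': "0 \<le> T'" "T' \<le> T" "G (\<gamma> T') = s"
    using IVT'[of "\<lambda>t. G (\<gamma> t)" 0 s T] s T by auto
  have tr': "itraj X Y {q. 0 \<le> q $ 1} {0..T'} \<gamma>"
    by (rule itraj_subinterval[OF tr]) (use T' in \<open>auto simp: is_interval_cc\<close>)
  have "strict_mono_on {0..T'} (\<lambda>t. G (\<gamma> t))"
  proof (rule strict_mono_onI)
    fix a b assume ab: "a \<in> {0..T'}" "b \<in> {0..T'}" "a < b"
    have "\<gamma> a \<noteq> 0" using itrajD(7)[OF tr', of a 0] ab nz T' by auto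
    then have "g (\<gamma> a) < g (\<gamma> b)" using g_increasing[OF tr'] ab by blast
    then show "G (\<gamma> a) < G (\<gamma> b)" using f_strict_mono ab T' by (simp add: G_def hc)
  qed
  then show ?thesis using T' tr' hc by (intro exI[of _ T'] conjI exI[of _ \<gamma>]) auto
qed

text \<open>An orbit of nonzero height attains \<open>G = 0\<close> on the y-axis; the separatrix
  only tends to the origin, so there every negative \<open>s\<close> is passed but 0 is not
  reached.\<close>

lemma G_reaches:
  assumes p: "0 \<le> p $ 1" and s: "G p \<le> s" "s \<le> 0" "h p = 0 \<Longrightarrow> s < 0"
  shows "\<exists>T\<ge>0. \<exists>\<gamma>. itraj X Y {q. 0 \<le> q $ 1} {0..T} \<gamma> \<and> \<gamma> 0 = p \<and>
    (\<forall>t\<in>{0..T}. h (\<gamma> t) = h p) \<and> strict_mono_on {0..T} (\<lambda>t. G (\<gamma> t)) \<and> G (\<gamma> T) = s"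
proof (cases "h p = 0")
  case True
  then have "p \<noteq> 0" using G_section[of 0] s by auto
  then have Y_stays: "Y_stays p" using h_zero_Y_stays p True by blast
  have "((\<lambda>t. f (g (\<psi> p t))) \<longlongrightarrow> f (g 0)) at_top"
    using continuous_on_compose2[OF f_continuous[of UNIV] g_continuous[of UNIV]] Y_stays_tendsto[OF Y_stays]
    by (intro continuous_on_tendsto_compose[of UNIV "\<lambda>p. f (g p)" "\<psi> p"]) auto
  moreover have "f (g 0) = 0" by (simp add: f_def g_def h0_0)
  ultimately have "\<forall>\<^sub>F t in at_top. f (g (\<psi> p t)) > s" using s True by (intro order_tendstoD(1)) auto
  then have "\<forall>\<^sub>F t in at_top. f (g (\<psi> p t)) > s \<and> 0 \<le> t" using eventually_ge_at_top[of 0] by eventually_elim auto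
  then obtain T where T: "f (g (\<psi> p T)) > s" "0 \<le> T" using eventually_happens by fastforce
  have "g (vector [0, 0]) = 0" by (simp add: g_def)
  then have "G (\<psi> p T) = f (g (\<psi> p T))" using h_along_Y_stays[OF Y_stays T(2)] by (simp add: G_def f_def h0_0)
  moreover have "itraj X Y {q. 0 \<le> q $ 1} {0..T} (\<psi> p)"
    by (rule itraj_subinterval[OF Y_stays_itraj[OF Y_stays]]) (use T in \<open>auto simp: is_interval_cc\<close>)
  ultimately show ?thesis
    using G_along[where T = T and \<gamma> = "\<psi> p" and k = 0 and s = s] T s \<open>p \<noteq> 0\<close> h_along_Y_stays[OF Y_stays] True by (simp add: V.init)
next
  case False
  have "h 0 = 0" by (simp add: h_def X_exit_def)
  then have "p \<noteq> 0" using False by auto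
  obtain T \<gamma> where \<gamma>: "0 \<le> T" "itraj X Y {q. 0 \<le> q $ 1} {0..T} \<gamma>" "\<gamma> 0 = p" "\<gamma> T = vector [0, h p]"
      "\<forall>t. 0 \<le> t \<and> t < T \<longrightarrow> \<gamma> t $ 1 > 0"
    using h_traj[OF p False] by blast
  have "G (\<gamma> T) = 0" using \<gamma> by (intro G_section) simp
  moreover have "h (\<gamma> t) = h p" if "0 \<le> t" "t \<le> T" for t
    using h_along[OF \<gamma>(2,4) False _ that] \<gamma>(5) by blast
  ultimately show ?thesis
    using G_along[OF \<gamma>(2,1), where k = "h p" and s = s] \<gamma> s \<open>p \<noteq> 0\<close> by simp
qed

end

subsection \<open>Flow charts near the origin\<close>

text \<open>Flows and constants of \<open>right_half\<close> are forgotten, so that one chart for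
  the field and one for its mirror image can be combined although they come from different
  constants.\<close>

definition half_chart ::
    "(real^2 \<Rightarrow> real^2) \<Rightarrow> (real^2 \<Rightarrow> real^2) \<Rightarrow> (real^2 \<Rightarrow> real) \<Rightarrow> (real^2 \<Rightarrow> real) \<Rightarrow> bool" where
  "half_chart X Y G h \<longleftrightarrow>
     continuous_on {p. 0 \<le> p $ 1} G \<and> continuous_on {p. 0 \<le> p $ 1} h \<and>
     (\<forall>p q. 0 \<le> p $ 1 \<longrightarrow> 0 \<le> q $ 1 \<longrightarrow> G p = G q \<longrightarrow> h p = h q \<longrightarrow> p = q) \<and>
     (\<forall>p. 0 < p $ 1 \<longrightarrow> G p < 0) \<and> (\<forall>p. p $ 1 = 0 \<longrightarrow> G p = 0) \<and> (\<forall>y. h (vector [0, y]) = y) \<and>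
     (\<forall>x>0. G (vector [x, 0]) = - h (vector [x, 0])) \<and>
     (\<forall>p s. 0 \<le> p $ 1 \<longrightarrow> G p \<le> s \<longrightarrow> s \<le> 0 \<longrightarrow> (h p = 0 \<longrightarrow> s < 0) \<longrightarrow>
       (\<exists>T\<ge>0. \<exists>\<gamma>. itraj X Y {q. 0 \<le> q $ 1} {0..T} \<gamma> \<and> \<gamma> 0 = p \<and>
         (\<forall>t\<in>{0..T}. h (\<gamma> t) = h p) \<and> strict_mono_on {0..T} (\<lambda>t. G (\<gamma> t)) \<and> G (\<gamma> T) = s))"

lemma (in right_half) half_chart: "half_chart X Y G h"
proof -
  have "p = q" if "0 \<le> p $ 1" "0 \<le> q $ 1" "G p = G q" "h p = h q" for p q
  proof (rule gh_injective[OF that(1,2) _ that(4)])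
    have "f (g p) = f (g q)" using that by (simp add: G_def)
    then show "g p = g q" using f_strict_mono by (metis less_irrefl linorder_neqE_linordered_idom)
  qed
  then show ?thesis
    unfolding half_chart_def
    using G_continuous h_continuous G_neg G_section h_section G_Sigma G_reaches by blast
qed

definition mirror :: "real^2 \<Rightarrow> real^2" where
  "mirror p = vector [- p $ 1, p $ 2]"

lemma mirror_nth [simp]: "mirror p $ 1 = - p $ 1" "mirror p $ 2 = p $ 2"
  by (simp_all add: mirror_def)

lemma mirror_mirror [simp]: "mirror (mirror p) = p"
  by (simp add: vec2_eq_iff)

lemma bounded_linear_mirror: "bounded_linear mirror"
  by (rule linear_conv_bounded_linear[THEN iffD1]) (auto intro!: linearI simp: vec2_eq_iff)

lemma continuous_on_mirror: "continuous_on S mirror"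
  using bounded_linear_mirror by (rule linear_continuous_on)

text \<open>The mirror image of the time reversal of a field.\<close>

definition mirror_field :: "(real^2 \<Rightarrow> real^2) \<Rightarrow> real^2 \<Rightarrow> real^2" where
  "mirror_field X p = - mirror (X (mirror p))"

definition square :: "real \<Rightarrow> (real^2) set" where
  "square a = {q. \<bar>q $ 1\<bar> < a \<and> \<bar>q $ 2\<bar> < a}"

lemma square_subset_ball: "square a \<subseteq> ball 0 (2 * a)"
proof
  fix q assume "q \<in> square a"
  then show "q \<in> ball 0 (2 * a)" using norm_le_abs2[of q] by (auto simp: square_def)
qed

lemma open_square: "open (square a)"
  unfolding square_def by (intro open_Collect_conj open_Collect_less continuous_intros)

text \<open>A chart in which orbits are the horizontal segments, run through from left to right, except that
  the one at height \<open>0\<close> is broken up by the equilibrium at the origin.\<close>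

definition connected_by ::
    "(real^2 \<Rightarrow> real^2) \<Rightarrow> (real^2 \<Rightarrow> real^2) \<Rightarrow> (real^2) set \<Rightarrow> (real^2 \<Rightarrow> real^2) \<Rightarrow> real^2 \<Rightarrow> real^2 \<Rightarrow> bool"
  where
  "connected_by X Y U \<Phi> p q \<longleftrightarrow> (\<exists>T\<ge>0. \<exists>\<gamma>. itraj X Y U {0..T} \<gamma> \<and> \<gamma> 0 = p \<and> \<gamma> T = q \<and>
     (\<forall>t\<in>{0..T}. \<Phi> (\<gamma> t) $ 2 = \<Phi> p $ 2) \<and> strict_mono_on {0..T} (\<lambda>t. \<Phi> (\<gamma> t) $ 1))"

text \<open>At height 0 two points are connected only if they lie on the same side of the
  equilibrium, as the positive product demands. The image of the switching line is prescribed so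
  that it is the same for all fields.\<close>

definition flow_chart ::
    "(real^2 \<Rightarrow> real^2) \<Rightarrow> (real^2 \<Rightarrow> real^2) \<Rightarrow> real \<Rightarrow> (real^2) set \<Rightarrow> (real^2 \<Rightarrow> real^2) \<Rightarrow> (real^2 \<Rightarrow> real^2) \<Rightarrow> bool"
  where
  "flow_chart X Y a U \<Phi> \<Phi>' \<longleftrightarrow> open U \<and> 0 \<in> U \<and> homeomorphism U (square a) \<Phi> \<Phi>' \<and> \<Phi> 0 = 0 \<and>
     \<Phi> ` {p\<in>U. p $ 2 = 0} = {q\<in>square a. q $ 2 = \<bar>q $ 1\<bar>} \<and>
     (\<forall>p\<in>U. \<forall>q\<in>U. \<Phi> p $ 1 < \<Phi> q $ 1 \<longrightarrow> \<Phi> p $ 2 = \<Phi> q $ 2 \<longrightarrow>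
        (\<Phi> p $ 2 = 0 \<longrightarrow> \<Phi> p $ 1 * \<Phi> q $ 1 > 0) \<longrightarrow> connected_by X Y U \<Phi> p q)"

text \<open>The domain fits into any given ball, where a modified field is still the original one,
  and every sufficiently small half-width \<open>a\<close> occurs, so that charts of two fields can
  be given the same square.\<close>

definition has_flow_charts :: "(real^2 \<Rightarrow> real^2) \<Rightarrow> (real^2 \<Rightarrow> real^2) \<Rightarrow> bool" where
  "has_flow_charts X Y \<longleftrightarrow> (\<forall>\<epsilon>>0. \<exists>a0>0. \<forall>a. 0 < a \<and> a < a0 \<longrightarrow>
     (\<exists>U \<Phi> \<Phi>'. U \<subseteq> ball 0 \<epsilon> \<and> flow_chart X Y a U \<Phi> \<Phi>'))"

lemma connected_by_trans:
  assumes pq: "connected_by X Y U \<Phi> p q" and qr: "connected_by X Y U \<Phi> q r"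
  shows "connected_by X Y U \<Phi> p r"
proof -
  obtain T \<gamma> where \<gamma>: "T \<ge> 0" "itraj X Y U {0..T} \<gamma>" "\<gamma> 0 = p" "\<gamma> T = q"
     "\<forall>t\<in>{0..T}. \<Phi> (\<gamma> t) $ 2 = \<Phi> p $ 2" "strict_mono_on {0..T} (\<lambda>t. \<Phi> (\<gamma> t) $ 1)"
    using pq unfolding connected_by_def by blast
  obtain T' \<gamma>' where \<gamma>': "T' \<ge> 0" "itraj X Y U {0..T'} \<gamma>'" "\<gamma>' 0 = q" "\<gamma>' T' = r"
     "\<forall>t\<in>{0..T'}. \<Phi> (\<gamma>' t) $ 2 = \<Phi> q $ 2" "strict_mono_on {0..T'} (\<lambda>t. \<Phi> (\<gamma>' t) $ 1)"
    using qr unfolding connected_by_def by blast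
  define w where "w t = (if t \<le> T then \<gamma> t else \<gamma>' (t - T))" for t
  have wT: "w t = \<gamma>' (t - T)" if "T \<le> t" for t using that \<gamma>(4) \<gamma>'(3) by (cases "t = T") (auto simp: w_def)
  have 1: "itraj X Y U {0..T + T'} w"
  proof (rule itraj_join[of 0 T])
    show "itraj X Y U {0..T} w" by (rule itraj_cong[OF \<gamma>(2)]) (simp add: w_def)
    have "{t. t + - T \<in> {0..T'}} = {T..T + T'}" by auto
    with itraj_shift[OF \<gamma>'(2), of "- T"] have "itraj X Y U {T..T + T'} (\<lambda>t. \<gamma>' (t + - T))" by simp
    then show "itraj X Y U {T..T + T'} w" by (rule itraj_cong) (simp add: wT)
  qed (use \<gamma> \<gamma>' in auto)
  have 2: "\<Phi> (w t) $ 2 = \<Phi> p $ 2" if "t \<in> {0..T + T'}" for t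
  proof (cases "t \<le> T")
    case True then show ?thesis using \<gamma>(5) that by (simp add: w_def)
  next
    case False
    then have "\<Phi> (w t) $ 2 = \<Phi> q $ 2" using \<gamma>'(5) that by (simp add: w_def)
    moreover have "\<Phi> q $ 2 = \<Phi> p $ 2" using \<gamma>(1,4,5) by force
    ultimately show ?thesis by simp
  qed
  have 3: "strict_mono_on {0..T + T'} (\<lambda>t. \<Phi> (w t) $ 1)"
  proof (rule strict_mono_onI)
    fix s t assume st: "s \<in> {0..T + T'}" "t \<in> {0..T + T'}" "s < t"
    have a: "\<Phi> (w x) $ 1 < \<Phi> (w y) $ 1" if "0 \<le> x" "x < y" "y \<le> T" for x y
      using strict_mono_onD[OF \<gamma>(6), of x y] that by (simp add: w_def)
    have b: "\<Phi> (w x) $ 1 < \<Phi> (w y) $ 1" if "T \<le> x" "x < y" "y \<le> T + T'" for x y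
      using strict_mono_onD[OF \<gamma>'(6), of "x - T" "y - T"] that by (simp add: wT)
    consider "t \<le> T" | "T \<le> s" | "s < T" "T < t" by linarith
    then show "\<Phi> (w s) $ 1 < \<Phi> (w t) $ 1"
    proof cases
      case 1 then show ?thesis using a st by simp
    next
      case 2 then show ?thesis using b st by simp
    next
      case 3
      have "\<Phi> (w s) $ 1 < \<Phi> (w T) $ 1" using a[of s T] st 3 by simp
      also have "\<dots> < \<Phi> (w t) $ 1" using b[of T t] st 3 by simp
      finally show ?thesis .
    qed
  qed
  have "w 0 = p" "w (T + T') = r" using \<gamma> \<gamma>' wT[of "T + T'"] by (auto simp: w_def)
  then show ?thesis
    unfolding connected_by_def using 1 2 3 \<gamma>(1) \<gamma>'(1)
    by (intro exI[of _ "T + T'"] conjI exI[of _ w]) auto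
qed

text \<open>In the chart the trajectory runs monotonically along a horizontal segment, so it stays
  in \<open>U\<close> as soon as \<open>U\<close> contains everything over that segment.\<close>

lemma connected_by_mono:
  assumes c: "connected_by X Y UNIV \<Phi> p q"
    and U: "\<And>r. \<Phi> p $ 1 \<le> \<Phi> r $ 1 \<Longrightarrow> \<Phi> r $ 1 \<le> \<Phi> q $ 1 \<Longrightarrow> \<Phi> r $ 2 = \<Phi> p $ 2 \<Longrightarrow> r \<in> U"
  shows "connected_by X Y U \<Phi> p q"
proof -
  obtain T \<gamma> where \<gamma>: "T \<ge> 0" "itraj X Y UNIV {0..T} \<gamma>" "\<gamma> 0 = p" "\<gamma> T = q"
     "\<forall>t\<in>{0..T}. \<Phi> (\<gamma> t) $ 2 = \<Phi> p $ 2" "strict_mono_on {0..T} (\<lambda>t. \<Phi> (\<gamma> t) $ 1)"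
    using c unfolding connected_by_def by blast
  have "\<gamma> t \<in> U" if t: "t \<in> {0..T}" for t
  proof (rule U)
    have "mono_on {0..T} (\<lambda>t. \<Phi> (\<gamma> t) $ 1)" using \<gamma>(6) by (rule strict_mono_on_imp_mono_on)
    then show "\<Phi> p $ 1 \<le> \<Phi> (\<gamma> t) $ 1" "\<Phi> (\<gamma> t) $ 1 \<le> \<Phi> q $ 1"
      using mono_onD[of "{0..T}" "\<lambda>t. \<Phi> (\<gamma> t) $ 1" 0 t] mono_onD[of "{0..T}" "\<lambda>t. \<Phi> (\<gamma> t) $ 1" t T] t \<gamma>(1,3,4)
      by auto
    show "\<Phi> (\<gamma> t) $ 2 = \<Phi> p $ 2" using \<gamma>(5) t by blast
  qed
  then have "itraj X Y U {0..T} \<gamma>" by (intro itraj_mono[OF \<gamma>(2)]) auto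
  then show ?thesis unfolding connected_by_def using \<gamma> by blast
qed

lemma continuous_on_vector2:
  fixes a b :: "'a::topological_space \<Rightarrow> real"
  assumes "continuous_on S a" "continuous_on S b"
  shows "continuous_on S (\<lambda>x. vector [a x, b x] :: real^2)"
proof -
  have "(vector [a x, b x] :: real^2) = a x *\<^sub>R axis 1 1 + b x *\<^sub>R axis 2 1" for x
    by (simp add: vec2_eq_iff axis_def)
  then show ?thesis using assms by (auto intro!: continuous_intros)
qed

lemma half_chartD:
  assumes R: "half_chart X Y G h"
  shows "continuous_on {p. 0 \<le> p $ 1} G" "continuous_on {p. 0 \<le> p $ 1} h"
    "\<And>p q. 0 \<le> p $ 1 \<Longrightarrow> 0 \<le> q $ 1 \<Longrightarrow> G p = G q \<Longrightarrow> h p = h q \<Longrightarrow> p = q"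
    "\<And>p. 0 < p $ 1 \<Longrightarrow> G p < 0" "\<And>p. p $ 1 = 0 \<Longrightarrow> G p = 0" "\<And>p. p $ 1 = 0 \<Longrightarrow> h p = p $ 2"
    "\<And>x. x > 0 \<Longrightarrow> G (vector [x, 0]) = - h (vector [x, 0])"
proof -
  have axis: "h (vector [0, y]) = y" for y using R unfolding half_chart_def by blast
  show "h p = p $ 2" if "p $ 1 = 0" for p
  proof -
    have "p = vector [0, p $ 2]" using that by (simp add: vec2_eq_iff)
    then show ?thesis using axis[of "p $ 2"] by simp
  qed
qed (use R in \<open>unfold half_chart_def, blast\<close>)+

lemma half_chart_reaches:
  assumes "half_chart X Y G h" "0 \<le> p $ 1" "G p \<le> s" "s \<le> 0" "h p = 0 \<longrightarrow> s < 0"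
  shows "\<exists>T\<ge>0. \<exists>\<gamma>. itraj X Y {q. 0 \<le> q $ 1} {0..T} \<gamma> \<and> \<gamma> 0 = p \<and>
    (\<forall>t\<in>{0..T}. h (\<gamma> t) = h p) \<and> strict_mono_on {0..T} (\<lambda>t. G (\<gamma> t)) \<and> G (\<gamma> T) = s"
  using assms unfolding half_chart_def by simp

section \<open>Gluing the charts of the two half-planes\<close>

locale two_charts =
  fixes X Y G h G' h'
  assumes R: "half_chart X Y G h" and Lf: "half_chart (mirror_field X) (mirror_field Y) G' h'"
begin

text \<open>The left half is the mirror image under time reversal, along which \<open>G'\<close>
  decreases; hence the minus sign. On the y-axis both branches agree: \<open>G\<close> and
  \<open>G'\<close> vanish there, and both heights are the ordinate.\<close>

definition \<Phi> :: "real^2 \<Rightarrow> real^2" where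
  "\<Phi> p = (if 0 \<le> p $ 1 then vector [G p, h p] else vector [- G' (mirror p), h' (mirror p)])"

lemmas RD = half_chartD[OF R]
lemmas LD = half_chartD[OF Lf]

lemma \<Phi>_right: assumes "0 \<le> p $ 1" shows "\<Phi> p $ 1 = G p" "\<Phi> p $ 2 = h p"
  using assms by (simp_all add: \<Phi>_def)

lemma \<Phi>_left: assumes "p $ 1 \<le> 0" shows "\<Phi> p $ 1 = - G' (mirror p)" "\<Phi> p $ 2 = h' (mirror p)"
  using assms RD(5,6)[of p] LD(5,6)[of "mirror p"] by (auto simp: \<Phi>_def)

text \<open>Orbits cross the plane from right to left but the chart from left to right, so the chart
  exchanges the half-planes.\<close>

lemma \<Phi>_sign: "\<Phi> p $ 1 < 0 \<longleftrightarrow> 0 < p $ 1" "\<Phi> p $ 1 > 0 \<longleftrightarrow> p $ 1 < 0"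
proof -
  consider "p $ 1 > 0" | "p $ 1 = 0" | "p $ 1 < 0" by linarith
  then have "(\<Phi> p $ 1 < 0 \<longleftrightarrow> 0 < p $ 1) \<and> (\<Phi> p $ 1 > 0 \<longleftrightarrow> p $ 1 < 0)"
  proof cases
    case 1 then show ?thesis using RD(4)[of p] \<Phi>_right[of p] by simp
  next
    case 2 then show ?thesis using RD(5)[of p] \<Phi>_right[of p] by simp
  next
    case 3 then show ?thesis using LD(4)[of "mirror p"] \<Phi>_left[of p] by simp
  qed
  then show "\<Phi> p $ 1 < 0 \<longleftrightarrow> 0 < p $ 1" "\<Phi> p $ 1 > 0 \<longleftrightarrow> p $ 1 < 0" by blast+
qed

lemma \<Phi>_continuous: "continuous_on UNIV \<Phi>"
proof -
  have m: "continuous_on {p. p $ 1 \<le> 0} (\<lambda>p. k (mirror p))"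
    if "continuous_on {p. 0 \<le> p $ 1} k" for k :: "real^2 \<Rightarrow> real"
    by (rule continuous_on_compose2[OF that continuous_on_mirror]) auto
  have "continuous_on ({p. 0 \<le> p $ 1} \<union> {p. p $ 1 \<le> 0}) \<Phi>"
    unfolding \<Phi>_def
  proof (rule continuous_on_cases)
    show "closed {p::real^2. 0 \<le> p $ 1}" "closed {p::real^2. p $ 1 \<le> 0}"
      by (intro closed_Collect_le continuous_intros)+
    show "continuous_on {p. 0 \<le> p $ 1} (\<lambda>p. vector [G p, h p] :: real^2)"
      by (intro continuous_on_vector2 RD(1,2))
    show "continuous_on {p. p $ 1 \<le> 0} (\<lambda>p. vector [- G' (mirror p), h' (mirror p)] :: real^2)"
      by (intro continuous_on_vector2 continuous_on_minus m LD(1,2))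
    show "\<forall>p. p \<in> {p. 0 \<le> p $ 1} \<and> \<not> 0 \<le> p $ 1 \<or> p \<in> {p. p $ 1 \<le> 0} \<and> 0 \<le> p $ 1 \<longrightarrow>
      (vector [G p, h p] :: real^2) = vector [- G' (mirror p), h' (mirror p)]"
    proof (intro allI impI)
      fix p :: "real^2"
      assume "p \<in> {p. 0 \<le> p $ 1} \<and> \<not> 0 \<le> p $ 1 \<or> p \<in> {p. p $ 1 \<le> 0} \<and> 0 \<le> p $ 1"
      then have "p $ 1 = 0" by auto
      then show "(vector [G p, h p] :: real^2) = vector [- G' (mirror p), h' (mirror p)]"
        using RD(5,6)[of p] LD(5,6)[of "mirror p"] by simp
    qed
  qed
  moreover have "{p. 0 \<le> p $ 1} \<union> {p. p $ 1 \<le> 0} = (UNIV :: (real^2) set)" by auto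
  ultimately show ?thesis by simp
qed

lemma \<Phi>_inj: assumes e: "\<Phi> p = \<Phi> q" shows "p = q"
proof (cases "0 \<le> p $ 1")
  case True
  then have "0 \<le> q $ 1" using \<Phi>_sign[of p] \<Phi>_sign[of q] e by (simp add: not_less[symmetric])
  then show ?thesis using RD(3)[OF True] \<Phi>_right[OF True] \<Phi>_right[of q] e by simp
next
  case False
  then have "q $ 1 < 0" using \<Phi>_sign[of p] \<Phi>_sign[of q] e by simp
  then have "mirror p = mirror q" using LD(3)[of "mirror p" "mirror q"] \<Phi>_left[of p] \<Phi>_left[of q] e False by simp
  then show ?thesis by (metis mirror_mirror)
qed

lemma \<Phi>_0: "\<Phi> 0 = 0"
  using RD(5,6)[of 0] \<Phi>_right[of 0] by (simp add: vec2_eq_iff)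

lemma \<Phi>_Sigma: assumes p: "p $ 2 = 0" shows "\<Phi> p $ 2 = \<bar>\<Phi> p $ 1\<bar>"
proof -
  consider "p $ 1 > 0" | "p $ 1 = 0" | "p $ 1 < 0" by linarith
  then show ?thesis
  proof cases
    case 1
    have "p = vector [p $ 1, 0]" using p by (simp add: vec2_eq_iff)
    then have "G p = - h p" using RD(7)[OF 1] by simp
    then show ?thesis using \<Phi>_right[of p] RD(4)[OF 1] 1 by simp
  next
    case 2
    then have "p = 0" using p by (simp add: vec2_eq_iff)
    then show ?thesis using \<Phi>_0 by simp
  next
    case 3
    have "mirror p = vector [- p $ 1, 0]" using p by (simp add: vec2_eq_iff)
    then have "G' (mirror p) = - h' (mirror p)" using LD(7)[of "- p $ 1"] 3 by simp
    then show ?thesis using \<Phi>_left[of p] LD(4)[of "mirror p"] 3 by simp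
  qed
qed

text \<open>Along the half-line selected by \<open>s\<close> the height is continuous, 0 at the
  origin and positive at distance 1, so it takes all small values; \<open>\<Phi>_Sigma\<close> and
  \<open>\<Phi>_sign\<close> then fix the other coordinate.\<close>

lemma \<Phi>_Sigma_onto_aux:
  assumes s: "s = 1 \<or> s = (-1::real)"
  shows "\<exists>c0>0. \<forall>c. 0 \<le> c \<and> c < c0 \<longrightarrow> (\<exists>p. p $ 2 = 0 \<and> \<Phi> p = vector [- s * c, c])"
proof -
  define k where "k x = \<Phi> (vector [s * x, 0]) $ 2" for x
  have cont: "continuous_on {0..1} k"
    unfolding k_def
    by (intro continuous_intros continuous_on_compose2[OF \<Phi>_continuous] continuous_on_vector2) auto
  have k1: "\<Phi> (vector [s * x, 0]) $ 1 = - s * k x" if x: "0 \<le> x" for x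
  proof -
    have a: "k x = \<bar>\<Phi> (vector [s * x, 0]) $ 1\<bar>" unfolding k_def by (rule \<Phi>_Sigma) simp
    have sg: "\<Phi> (vector [s * x, 0]) $ 1 < 0 \<longleftrightarrow> 0 < s * x" "\<Phi> (vector [s * x, 0]) $ 1 > 0 \<longleftrightarrow> s * x < 0"
      using \<Phi>_sign[of "vector [s * x, 0]"] by simp_all
    show ?thesis using a sg s x by (elim disjE) auto
  qed
  have pos: "k 1 > 0"
  proof -
    have "\<Phi> (vector [s * 1, 0]) $ 1 \<noteq> 0" using \<Phi>_sign[of "vector [s * 1, 0]"] s by auto
    moreover have "k 1 = \<bar>\<Phi> (vector [s * 1, 0]) $ 1\<bar>" unfolding k_def by (rule \<Phi>_Sigma) simp
    ultimately show ?thesis by simp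
  qed
  have "(vector [s * 0, 0] :: real^2) = 0" by (simp add: vec2_eq_iff)
  then have k0: "k 0 = 0" using \<Phi>_0 by (simp add: k_def)
  show ?thesis
  proof (intro exI[of _ "k 1"] conjI allI impI pos)
    fix c assume c: "0 \<le> c \<and> c < k 1"
    then obtain x where x: "0 \<le> x" "x \<le> 1" "k x = c" using IVT'[of k 0 c 1] cont k0 by auto
    then have "\<Phi> (vector [s * x, 0]) = vector [- s * c, c]"
      using k1[of x] by (simp add: vec2_eq_iff k_def)
    then show "\<exists>p. p $ 2 = 0 \<and> \<Phi> p = vector [- s * c, c]" by (intro exI[of _ "vector [s * x, 0]"]) simp
  qed
qed

lemma \<Phi>_Sigma_onto:
  "\<exists>c0>0. \<forall>q. q $ 2 = \<bar>q $ 1\<bar> \<and> q $ 2 < c0 \<longrightarrow> (\<exists>p. p $ 2 = 0 \<and> \<Phi> p = q)"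
proof -
  obtain c1 where c1: "c1 > 0" "\<And>c. 0 \<le> c \<Longrightarrow> c < c1 \<Longrightarrow> \<exists>p. p $ 2 = 0 \<and> \<Phi> p = vector [- c, c]"
    using \<Phi>_Sigma_onto_aux[of 1] by auto
  obtain c2 where c2: "c2 > 0" "\<And>c. 0 \<le> c \<Longrightarrow> c < c2 \<Longrightarrow> \<exists>p. p $ 2 = 0 \<and> \<Phi> p = vector [c, c]"
    using \<Phi>_Sigma_onto_aux[of "-1"] by auto
  show ?thesis
  proof (intro exI[of _ "min c1 c2"] conjI allI impI)
    fix q :: "real^2" assume q: "q $ 2 = \<bar>q $ 1\<bar> \<and> q $ 2 < min c1 c2"
    show "\<exists>p. p $ 2 = 0 \<and> \<Phi> p = q"
    proof (cases "q $ 1 \<le> 0")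
      case True
      then have "q = vector [- (q $ 2), q $ 2]" using q by (simp add: vec2_eq_iff)
      then show ?thesis using c1(2)[of "q $ 2"] q by auto
    next
      case False
      then have "q = vector [q $ 2, q $ 2]" using q by (simp add: vec2_eq_iff)
      then show ?thesis using c2(2)[of "q $ 2"] q by auto
    qed
  qed (use c1 c2 in simp)
qed

text \<open>The half chart provides a trajectory from \<open>p\<close> to the abscissa of
  \<open>\<Phi> q\<close> at the same height; its end has the chart value of \<open>q\<close> and is
  \<open>q\<close> by injectivity.\<close>

lemma right_connected:
  assumes lt: "\<Phi> p $ 1 < \<Phi> q $ 1" and eq: "\<Phi> p $ 2 = \<Phi> q $ 2"
    and z: "\<Phi> p $ 2 = 0 \<longrightarrow> \<Phi> q $ 1 < 0" and q: "\<Phi> q $ 1 \<le> 0"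
  shows "connected_by X Y UNIV \<Phi> p q"
proof -
  have p1: "0 \<le> p $ 1" using \<Phi>_sign(1)[of p] lt q by linarith
  have "\<exists>T\<ge>0. \<exists>\<gamma>. itraj X Y {q. 0 \<le> q $ 1} {0..T} \<gamma> \<and> \<gamma> 0 = p \<and>
         (\<forall>t\<in>{0..T}. h (\<gamma> t) = h p) \<and> strict_mono_on {0..T} (\<lambda>t. G (\<gamma> t)) \<and> G (\<gamma> T) = \<Phi> q $ 1"
    by (rule half_chart_reaches[OF R p1]) (use \<Phi>_right[OF p1] lt q z in auto)
  then obtain T \<gamma> where \<gamma>: "T \<ge> 0" "itraj X Y {q. 0 \<le> q $ 1} {0..T} \<gamma>" "\<gamma> 0 = p"
     "\<And>t. t \<in> {0..T} \<Longrightarrow> h (\<gamma> t) = h p" "strict_mono_on {0..T} (\<lambda>t. G (\<gamma> t))" "G (\<gamma> T) = \<Phi> q $ 1"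
    by blast
  have rt: "0 \<le> \<gamma> t $ 1" if "t \<in> {0..T}" for t using itrajD(4)[OF \<gamma>(2)] that by blast
  have \<Phi>\<gamma>: "\<Phi> (\<gamma> t) $ 1 = G (\<gamma> t)" "\<Phi> (\<gamma> t) $ 2 = \<Phi> p $ 2" if "t \<in> {0..T}" for t
    using \<Phi>_right[OF rt[OF that]] \<gamma>(4)[OF that] \<Phi>_right[OF p1] by simp_all
  have "\<Phi> (\<gamma> T) = \<Phi> q" using \<Phi>\<gamma>[of T] \<gamma>(1,6) eq by (simp add: vec2_eq_iff)
  then have "\<gamma> T = q" by (rule \<Phi>_inj)
  moreover have "strict_mono_on {0..T} (\<lambda>t. \<Phi> (\<gamma> t) $ 1)"
    by (rule strict_mono_onI) (simp add: \<Phi>\<gamma>(1) strict_mono_onD[OF \<gamma>(5)])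
  moreover have "itraj X Y UNIV {0..T} \<gamma>" by (rule itraj_mono[OF \<gamma>(2)]) simp
  ultimately show ?thesis
    unfolding connected_by_def using \<gamma>(1,3) \<Phi>\<gamma>(2) by blast
qed

text \<open>For the mirrored and reversed field the trajectory runs from \<open>mirror q\<close> to
  \<open>mirror p\<close>; reflecting and reversing it exchanges the ends.\<close>

lemma left_connected:
  assumes lt: "\<Phi> p $ 1 < \<Phi> q $ 1" and eq: "\<Phi> p $ 2 = \<Phi> q $ 2"
    and z: "\<Phi> p $ 2 = 0 \<longrightarrow> \<Phi> p $ 1 > 0" and p: "\<Phi> p $ 1 \<ge> 0"
  shows "connected_by X Y UNIV \<Phi> p q"
proof -
  have q1: "q $ 1 \<le> 0" using \<Phi>_sign(2)[of q] lt p by linarith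
  then have mq: "0 \<le> mirror q $ 1" by simp
  note Lq = \<Phi>_left[OF q1]
  have "\<exists>T\<ge>0. \<exists>\<gamma>. itraj (mirror_field X) (mirror_field Y) {q. 0 \<le> q $ 1} {0..T} \<gamma> \<and> \<gamma> 0 = mirror q \<and>
         (\<forall>t\<in>{0..T}. h' (\<gamma> t) = h' (mirror q)) \<and> strict_mono_on {0..T} (\<lambda>t. G' (\<gamma> t)) \<and> G' (\<gamma> T) = - \<Phi> p $ 1"
    by (rule half_chart_reaches[OF Lf mq]) (use Lq lt eq z p in auto)
  then obtain T \<gamma> where \<gamma>: "T \<ge> 0" "itraj (mirror_field X) (mirror_field Y) {q. 0 \<le> q $ 1} {0..T} \<gamma>" "\<gamma> 0 = mirror q"
     "\<And>t. t \<in> {0..T} \<Longrightarrow> h' (\<gamma> t) = h' (mirror q)" "strict_mono_on {0..T} (\<lambda>t. G' (\<gamma> t))" "G' (\<gamma> T) = - \<Phi> p $ 1"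
    by blast
  define w where "w t = mirror (\<gamma> (-1 * t + T))" for t
  have "itraj X Y (mirror ` {q. 0 \<le> q $ 1}) {t. -1 * t + T \<in> {0..T}} w"
    unfolding w_def
    by (rule itraj_transform[OF \<gamma>(2) bounded_linear_mirror bounded_linear_mirror])
      (auto simp: mirror_field_def continuous_on_mirror vec2_eq_iff)
  moreover have "{t. -1 * t + T \<in> {0..T}} = {0..T}" by auto
  ultimately have w: "itraj X Y UNIV {0..T} w" by (auto intro: itraj_mono)
  have rt: "0 \<le> \<gamma> t $ 1" if "t \<in> {0..T}" for t using itrajD(4)[OF \<gamma>(2)] that by blast
  have \<Phi>w: "\<Phi> (w t) $ 1 = - G' (\<gamma> (T - t))" "\<Phi> (w t) $ 2 = \<Phi> q $ 2" if "t \<in> {0..T}" for t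
  proof -
    have "T - t \<in> {0..T}" using that by auto
    then show "\<Phi> (w t) $ 1 = - G' (\<gamma> (T - t))" "\<Phi> (w t) $ 2 = \<Phi> q $ 2"
      using \<Phi>_left[of "w t"] rt[of "T - t"] \<gamma>(4)[of "T - t"] Lq by (simp_all add: w_def)
  qed
  have "\<Phi> (w 0) = \<Phi> p" using \<Phi>w[of 0] \<gamma>(1,6) eq by (simp add: vec2_eq_iff)
  then have "w 0 = p" by (rule \<Phi>_inj)
  moreover have "w T = q" using \<gamma>(3) by (simp add: w_def)
  moreover have "strict_mono_on {0..T} (\<lambda>t. \<Phi> (w t) $ 1)"
    by (rule strict_mono_onI) (simp add: \<Phi>w(1) strict_mono_onD[OF \<gamma>(5)])
  ultimately show ?thesis
    unfolding connected_by_def using \<gamma>(1) w \<Phi>w(2) eq by (metis (no_types, lifting))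
qed

lemma all_connected:
  assumes lt: "\<Phi> p $ 1 < \<Phi> q $ 1" and eq: "\<Phi> p $ 2 = \<Phi> q $ 2"
    and z: "\<Phi> p $ 2 = 0 \<longrightarrow> \<Phi> p $ 1 * \<Phi> q $ 1 > 0"
  shows "connected_by X Y UNIV \<Phi> p q"
proof -
  consider "\<Phi> q $ 1 \<le> 0" | "\<Phi> p $ 1 \<ge> 0" | "\<Phi> p $ 1 < 0" "\<Phi> q $ 1 > 0" by linarith
  then show ?thesis
  proof cases
    case 1 then show ?thesis using z by (intro right_connected lt eq) (auto simp: zero_less_mult_iff)
  next
    case 2 then show ?thesis using z by (intro left_connected lt eq) (auto simp: zero_less_mult_iff)
  next
    case 3
    \<comment> \<open>Points on opposite sides have nonzero height, and their orbit passes the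
      y-axis at that height.\<close>
    define m :: "real^2" where "m = vector [0, \<Phi> p $ 2]"
    have m: "\<Phi> m $ 1 = 0" "\<Phi> m $ 2 = \<Phi> p $ 2" using \<Phi>_right[of m] RD(5,6)[of m] by (simp_all add: m_def)
    have nz: "\<Phi> p $ 2 \<noteq> 0" using z 3 by (auto simp: zero_less_mult_iff)
    have "connected_by X Y UNIV \<Phi> p m" using 3 m nz by (intro right_connected) auto
    moreover have "connected_by X Y UNIV \<Phi> m q" using 3 m nz eq by (intro left_connected) auto
    ultimately show ?thesis by (rule connected_by_trans)
  qed
qed

lemma has_flow_charts: "has_flow_charts X Y"
  unfolding has_flow_charts_def
proof (intro allI impI)
  fix \<epsilon> :: real assume \<epsilon>: "\<epsilon> > 0"
  have inj: "inj_on \<Phi> S" for S by (rule inj_onI) (rule \<Phi>_inj)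
  have cont: "continuous_on S \<Phi>" for S by (rule continuous_on_subset[OF \<Phi>_continuous]) simp
  \<comment> \<open>Invariance of domain replaces an explicit inverse: the image of the ball is
    open, so it contains a small square.\<close>
  have "open (\<Phi> ` ball 0 \<epsilon>)" by (rule invariance_of_domain_gen[OF open_ball cont inj]) simp
  moreover have "0 \<in> \<Phi> ` ball 0 \<epsilon>" using \<epsilon> \<Phi>_0 by (metis centre_in_ball imageI)
  ultimately obtain r where r: "r > 0" "ball 0 r \<subseteq> \<Phi> ` ball 0 \<epsilon>" by (meson open_contains_ball)
  obtain c0 where c0: "c0 > 0" "\<And>q. q $ 2 = \<bar>q $ 1\<bar> \<Longrightarrow> q $ 2 < c0 \<Longrightarrow> \<exists>p. p $ 2 = 0 \<and> \<Phi> p = q"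
    using \<Phi>_Sigma_onto by blast
  show "\<exists>a0>0. \<forall>a. 0 < a \<and> a < a0 \<longrightarrow> (\<exists>U \<Phi> \<Phi>'. U \<subseteq> ball 0 \<epsilon> \<and> flow_chart X Y a U \<Phi> \<Phi>')"
  \<comment> \<open>A square of half-width \<open>a\<close> fits into the ball of radius
    \<open>2 * a\<close>, hence \<open>r / 2\<close>; \<open>c0\<close> ensures that the switching
    line covers the whole graph of the absolute value within the square.\<close>
  proof (rule exI[of _ "min (r / 2) c0"], rule conjI, goal_cases)
    case 1 then show ?case using r c0 by simp
  next
    case 2
    show ?case
    proof (intro allI impI)
      fix a assume a: "0 < a \<and> a < min (r / 2) c0"
      define U where "U = \<Phi> -` square a"
      have sq: "square a \<subseteq> \<Phi> ` ball 0 \<epsilon>"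
        using square_subset_ball[of a] r(2) a subset_ball[of "2 * a" r "0 :: real^2"] by auto
      have img: "\<Phi> ` U = square a" using sq by (auto simp: U_def)
      have oU: "open U" unfolding U_def by (rule open_vimage[OF open_square \<Phi>_continuous])
      have U\<epsilon>: "U \<subseteq> ball 0 \<epsilon>"
      proof
        fix p assume "p \<in> U"
        then have "\<Phi> p \<in> \<Phi> ` ball 0 \<epsilon>" using sq by (auto simp: U_def)
        then show "p \<in> ball 0 \<epsilon>" using \<Phi>_inj by blast
      qed
      obtain \<Phi>' where hom: "homeomorphism U (square a) \<Phi> \<Phi>'"
        using invariance_of_domain_homeomorphism[OF oU cont _ inj] img by auto
      have "flow_chart X Y a U \<Phi> \<Phi>'"
        unfolding flow_chart_def
      proof (intro conjI ballI impI)
        show "0 \<in> U" using a \<Phi>_0 by (simp add: U_def square_def)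
        show "\<Phi> ` {p \<in> U. p $ 2 = 0} = {q \<in> square a. q $ 2 = \<bar>q $ 1\<bar>}"
        proof (intro set_eqI iffI)
          fix q assume "q \<in> \<Phi> ` {p \<in> U. p $ 2 = 0}"
          then show "q \<in> {q \<in> square a. q $ 2 = \<bar>q $ 1\<bar>}" using \<Phi>_Sigma by (auto simp: U_def)
        next
          fix q assume q: "q \<in> {q \<in> square a. q $ 2 = \<bar>q $ 1\<bar>}"
          then have "q $ 2 < c0" using a by (auto simp: square_def)
          then obtain p where "p $ 2 = 0" "\<Phi> p = q" using c0(2)[of q] q by blast
          then show "q \<in> \<Phi> ` {p \<in> U. p $ 2 = 0}" using q by (auto simp: U_def)
        qed
        fix p q assume pq: "p \<in> U" "q \<in> U" "\<Phi> p $ 1 < \<Phi> q $ 1" "\<Phi> p $ 2 = \<Phi> q $ 2"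
          "\<Phi> p $ 2 = 0 \<longrightarrow> 0 < \<Phi> p $ 1 * \<Phi> q $ 1"
        show "connected_by X Y U \<Phi> p q"
        proof (rule connected_by_mono[OF all_connected[OF pq(3-5)]])
          fix r assume "\<Phi> p $ 1 \<le> \<Phi> r $ 1" "\<Phi> r $ 1 \<le> \<Phi> q $ 1" "\<Phi> r $ 2 = \<Phi> p $ 2"
          then show "r \<in> U" using pq(1,2) by (auto simp: U_def square_def)
        qed
      qed (use oU hom \<Phi>_0 in auto)
      then show "\<exists>U \<Phi> \<Phi>'. U \<subseteq> ball 0 \<epsilon> \<and> flow_chart X Y a U \<Phi> \<Phi>'" using U\<epsilon> by blast
    qed
  qed
qed

end

section \<open>Change of field and of coordinates\<close>

lemma connected_by_cong:
  assumes "connected_by X Y U \<Phi> p q" "\<And>p. p \<in> U \<Longrightarrow> X p = X' p" "\<And>p. p \<in> U \<Longrightarrow> Y p = Y' p"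
  shows "connected_by X' Y' U \<Phi> p q"
  using assms itraj_fields_cong[of X Y U _ _ X' Y'] unfolding connected_by_def by blast

lemma has_flow_charts_cong:
  assumes c: "has_flow_charts X Y" and r: "r > 0"
    and X: "\<And>p. p \<in> ball 0 r \<Longrightarrow> X p = X' p" and Y: "\<And>p. p \<in> ball 0 r \<Longrightarrow> Y p = Y' p"
  shows "has_flow_charts X' Y'"
  unfolding has_flow_charts_def
proof (intro allI impI)
  fix \<epsilon> :: real assume "\<epsilon> > 0"
  then have "min \<epsilon> r > 0" using r by simp
  then obtain a0 where a0: "a0 > 0" "\<And>a. 0 < a \<and> a < a0 \<Longrightarrow>
      \<exists>U \<Phi> \<Phi>'. U \<subseteq> ball 0 (min \<epsilon> r) \<and> flow_chart X Y a U \<Phi> \<Phi>'"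
    using c unfolding has_flow_charts_def by blast
  have "\<exists>U \<Phi> \<Phi>'. U \<subseteq> ball 0 \<epsilon> \<and> flow_chart X' Y' a U \<Phi> \<Phi>'" if a: "0 < a \<and> a < a0" for a
  proof -
    obtain U \<Phi> \<Phi>' where U: "U \<subseteq> ball 0 (min \<epsilon> r)" "flow_chart X Y a U \<Phi> \<Phi>'" using a0(2)[OF a] by blast
    have sub: "U \<subseteq> ball 0 \<epsilon>" "U \<subseteq> ball 0 r"
      using U(1) subset_ball[of "min \<epsilon> r" \<epsilon> "0::real^2"] subset_ball[of "min \<epsilon> r" r "0::real^2"] by auto
    have "connected_by X' Y' U \<Phi> p q" if "connected_by X Y U \<Phi> p q" for p q
      by (rule connected_by_cong[OF that]) (use sub X Y in auto)
    then have "flow_chart X' Y' a U \<Phi> \<Phi>'" using U(2) unfolding flow_chart_def by blast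
    then show ?thesis using sub by blast
  qed
  then show "\<exists>a0>0. \<forall>a. 0 < a \<and> a < a0 \<longrightarrow> (\<exists>U \<Phi> \<Phi>'. U \<subseteq> ball 0 \<epsilon> \<and> flow_chart X' Y' a U \<Phi> \<Phi>')"
    using a0(1) by blast
qed

lemma has_flow_charts_transport:
  assumes c: "has_flow_charts X' Y'" and T: "homeomorphism UNIV UNIV T T'" and T0: "T 0 = 0"
    and T2: "\<And>p. T p $ 2 = 0 \<longleftrightarrow> p $ 2 = 0"
    and tr: "\<And>U I \<gamma>. itraj X' Y' U I \<gamma> \<Longrightarrow> itraj X Y (T' ` U) I (\<lambda>t. T' (\<gamma> t))"
  shows "has_flow_charts X Y"
  unfolding has_flow_charts_def
proof (intro allI impI)
  fix \<epsilon> :: real assume \<epsilon>: "\<epsilon> > 0"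
  have TT: "T (T' p) = p" "T' (T p) = p" for p using T by (auto simp: homeomorphism_def)
  have T'0: "T' 0 = 0" using TT T0 by metis
  have cT: "continuous_on UNIV T" "continuous_on UNIV T'" using T by (auto simp: homeomorphism_def)
  have "open (T' -` ball 0 \<epsilon>)" by (rule open_vimage[OF open_ball cT(2)])
  moreover have "0 \<in> T' -` ball 0 \<epsilon>" using \<epsilon> T'0 by simp
  ultimately obtain \<epsilon>' where \<epsilon>': "\<epsilon>' > 0" "ball 0 \<epsilon>' \<subseteq> T' -` ball 0 \<epsilon>" by (meson open_contains_ball)
  obtain a0 where a0: "a0 > 0" "\<And>a. 0 < a \<and> a < a0 \<Longrightarrow>
      \<exists>U \<Phi> \<Phi>'. U \<subseteq> ball 0 \<epsilon>' \<and> flow_chart X' Y' a U \<Phi> \<Phi>'"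
    using c \<epsilon>'(1) unfolding has_flow_charts_def by blast
  have "\<exists>U \<Phi> \<Phi>'. U \<subseteq> ball 0 \<epsilon> \<and> flow_chart X Y a U \<Phi> \<Phi>'" if a: "0 < a \<and> a < a0" for a
  proof -
    obtain U \<Phi> \<Phi>' where U: "U \<subseteq> ball 0 \<epsilon>'" and fc: "flow_chart X' Y' a U \<Phi> \<Phi>'" using a0(2)[OF a] by blast
    have fcD: "open U" "0 \<in> U" "homeomorphism U (square a) \<Phi> \<Phi>'" "\<Phi> 0 = 0"
      "\<Phi> ` {p\<in>U. p $ 2 = 0} = {q\<in>square a. q $ 2 = \<bar>q $ 1\<bar>}"
      "\<And>p q. p \<in> U \<Longrightarrow> q \<in> U \<Longrightarrow> \<Phi> p $ 1 < \<Phi> q $ 1 \<Longrightarrow> \<Phi> p $ 2 = \<Phi> q $ 2 \<Longrightarrow>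
        (\<Phi> p $ 2 = 0 \<longrightarrow> \<Phi> p $ 1 * \<Phi> q $ 1 > 0) \<Longrightarrow> connected_by X' Y' U \<Phi> p q"
      using fc unfolding flow_chart_def by blast+
    have im: "T' ` U = T -` U"
    proof (intro set_eqI iffI)
      fix p assume "p \<in> T -` U"
      then show "p \<in> T' ` U" using TT(2)[of p] by (metis imageI vimageD)
    qed (auto simp: TT)
    have hom: "homeomorphism (T' ` U) U T T'"
      by (rule homeomorphismI) (use TT cT in \<open>auto intro: continuous_on_subset simp: image_image\<close>)
    have S: "T ` {p \<in> T' ` U. p $ 2 = 0} = {p\<in>U. p $ 2 = 0}"
    proof (intro set_eqI iffI)
      fix p assume "p \<in> {p\<in>U. p $ 2 = 0}"
      then have "T' p \<in> T' ` U" "T' p $ 2 = 0" using T2[of "T' p"] unfolding TT by auto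
      then show "p \<in> T ` {p \<in> T' ` U. p $ 2 = 0}" by (intro image_eqI[of _ _ "T' p"]) (simp_all add: TT)
    next
      fix q assume "q \<in> T ` {p \<in> T' ` U. p $ 2 = 0}"
      then obtain r where "r \<in> U" "T' r $ 2 = 0" "q = r" by (auto simp: TT)
      then show "q \<in> {p\<in>U. p $ 2 = 0}" using T2[of "T' r"] unfolding TT by auto
    qed
    have "flow_chart X Y a (T' ` U) (\<Phi> \<circ> T) (T' \<circ> \<Phi>')"
      unfolding flow_chart_def
    proof (intro conjI ballI impI)
      show "open (T' ` U)" unfolding im by (rule open_vimage[OF fcD(1) cT(1)])
      show "0 \<in> T' ` U" using fcD(2) T'0 by (metis imageI)
      show "homeomorphism (T' ` U) (square a) (\<Phi> \<circ> T) (T' \<circ> \<Phi>')"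
        by (rule homeomorphism_compose[OF hom fcD(3)])
      show "(\<Phi> \<circ> T) 0 = 0" using fcD(4) T0 by simp
      show "(\<Phi> \<circ> T) ` {p \<in> T' ` U. p $ 2 = 0} = {q\<in>square a. q $ 2 = \<bar>q $ 1\<bar>}"
        unfolding image_comp[symmetric] S by (rule fcD(5))
      fix p q assume pq: "p \<in> T' ` U" "q \<in> T' ` U" "(\<Phi> \<circ> T) p $ 1 < (\<Phi> \<circ> T) q $ 1"
        "(\<Phi> \<circ> T) p $ 2 = (\<Phi> \<circ> T) q $ 2" "(\<Phi> \<circ> T) p $ 2 = 0 \<longrightarrow> 0 < (\<Phi> \<circ> T) p $ 1 * (\<Phi> \<circ> T) q $ 1"
      have "connected_by X' Y' U \<Phi> (T p) (T q)"
        using pq by (intro fcD(6)) (auto simp: TT)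
      then obtain S \<gamma> where \<gamma>: "S \<ge> 0" "itraj X' Y' U {0..S} \<gamma>" "\<gamma> 0 = T p" "\<gamma> S = T q"
         "\<forall>t\<in>{0..S}. \<Phi> (\<gamma> t) $ 2 = \<Phi> (T p) $ 2" "strict_mono_on {0..S} (\<lambda>t. \<Phi> (\<gamma> t) $ 1)"
        unfolding connected_by_def by blast
      show "connected_by X Y (T' ` U) (\<Phi> \<circ> T) p q"
        unfolding connected_by_def
      proof (rule exI[of _ S], rule conjI[OF \<gamma>(1)], rule exI[of _ "\<lambda>t. T' (\<gamma> t)"], intro conjI)
        show "itraj X Y (T' ` U) {0..S} (\<lambda>t. T' (\<gamma> t))" by (rule tr[OF \<gamma>(2)])
        show "T' (\<gamma> 0) = p" "T' (\<gamma> S) = q" by (simp_all only: \<gamma>(3,4) TT)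
        show "\<forall>t\<in>{0..S}. (\<Phi> \<circ> T) (T' (\<gamma> t)) $ 2 = (\<Phi> \<circ> T) p $ 2"
          using \<gamma>(5) by (simp only: o_apply TT)
        show "strict_mono_on {0..S} (\<lambda>t. (\<Phi> \<circ> T) (T' (\<gamma> t)) $ 1)"
          using \<gamma>(6) by (simp only: o_apply TT)
      qed
    qed
    moreover have "T' ` U \<subseteq> ball 0 \<epsilon>" using U \<epsilon>'(2) by auto
    ultimately show ?thesis by blast
  qed
  then show "\<exists>a0>0. \<forall>a. 0 < a \<and> a < a0 \<longrightarrow> (\<exists>U \<Phi> \<Phi>'. U \<subseteq> ball 0 \<epsilon> \<and> flow_chart X Y a U \<Phi> \<Phi>')"
    using a0(1) by blast
qed

subsection \<open>Linear normal forms\<close>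

lemma norm2_sq: "(norm p)\<^sup>2 = (p $ 1)\<^sup>2 + (p $ 2)\<^sup>2" for p :: "real^2"
  by (simp add: norm_vec_def L2_set_def sum_2)

definition lin2 :: "real \<Rightarrow> real \<Rightarrow> real \<Rightarrow> real \<Rightarrow> real^2 \<Rightarrow> real^2" where
  "lin2 a b c d p = vector [a * p $ 1 + b * p $ 2, c * p $ 1 + d * p $ 2]"

lemma lin2_nth [simp]:
  "lin2 a b c d p $ 1 = a * p $ 1 + b * p $ 2" "lin2 a b c d p $ 2 = c * p $ 1 + d * p $ 2"
  by (simp_all add: lin2_def)

lemma bounded_linear_lin2: "bounded_linear (lin2 a b c d)"
  by (rule linear_conv_bounded_linear[THEN iffD1])
    (auto intro!: linearI simp: vec2_eq_iff algebra_simps)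

lemma norm_lin2_le: "norm (lin2 a b c d p) \<le> (\<bar>a\<bar> + \<bar>b\<bar> + \<bar>c\<bar> + \<bar>d\<bar>) * norm p"
proof -
  have m: "\<bar>k * p $ i\<bar> \<le> \<bar>k\<bar> * norm p" for k i
    unfolding abs_mult by (intro mult_left_mono component_le_norm_cart) simp
  have "norm (lin2 a b c d p) \<le> \<bar>a * p $ 1 + b * p $ 2\<bar> + \<bar>c * p $ 1 + d * p $ 2\<bar>"
    using norm_le_abs2[of "lin2 a b c d p"] by simp
  also have "\<dots> \<le> \<bar>a\<bar> * norm p + \<bar>b\<bar> * norm p + (\<bar>c\<bar> * norm p + \<bar>d\<bar> * norm p)"
    by (intro add_mono order_trans[OF abs_triangle_ineq] m)
  finally show ?thesis by (simp add: algebra_simps)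
qed

text \<open>The remainder has Lipschitz constant \<open>\<epsilon>\<close> on the whole plane. This
  makes the field globally Lipschitz, so that its forward flow exists, and it controls differences
  of solutions as the cone condition requires.\<close>

definition near_linear :: "real \<Rightarrow> real \<Rightarrow> real \<Rightarrow> real \<Rightarrow> real \<Rightarrow> (real^2 \<Rightarrow> real^2) \<Rightarrow> bool" where
  "near_linear \<epsilon> a b c d X \<longleftrightarrow> X 0 = 0 \<and>
     (\<forall>p q. norm (X p - X q - lin2 a b c d (p - q)) \<le> \<epsilon> * norm (p - q))"

lemma near_linear_mono: "near_linear \<epsilon> a b c d X \<Longrightarrow> \<epsilon> \<le> \<epsilon>' \<Longrightarrow> near_linear \<epsilon>' a b c d X"
  unfolding near_linear_def by (meson mult_right_mono norm_ge_zero order_trans)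

lemma near_linear_Lipschitz:
  assumes "near_linear \<epsilon> a b c d X"
  shows "norm (X p - X q) \<le> (\<bar>a\<bar> + \<bar>b\<bar> + \<bar>c\<bar> + \<bar>d\<bar> + \<epsilon>) * norm (p - q)"
proof -
  have "norm (X p - X q) \<le> norm (lin2 a b c d (p - q)) + norm (X p - X q - lin2 a b c d (p - q))"
    by norm
  also have "\<dots> \<le> (\<bar>a\<bar> + \<bar>b\<bar> + \<bar>c\<bar> + \<bar>d\<bar>) * norm (p - q) + \<epsilon> * norm (p - q)"
    using assms by (intro add_mono norm_lin2_le) (simp add: near_linear_def)
  finally show ?thesis by (simp add: algebra_simps)
qed

lemma near_linearE:
  assumes "near_linear \<epsilon> a b c d X"
  obtains r where "X p - X q = lin2 a b c d (p - q) + r"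
    "\<bar>r $ 1\<bar> \<le> \<epsilon> * norm (p - q)" "\<bar>r $ 2\<bar> \<le> \<epsilon> * norm (p - q)"
proof -
  define r where "r = X p - X q - lin2 a b c d (p - q)"
  have "norm r \<le> \<epsilon> * norm (p - q)" using assms by (simp add: near_linear_def r_def)
  then show ?thesis
    using that[of r] component_le_norm_cart[of r 1] component_le_norm_cart[of r 2] by (simp add: r_def)
qed

lemma near_linearE0:
  assumes "near_linear \<epsilon> a b c d X"
  obtains r where "X p = lin2 a b c d p + r" "\<bar>r $ 1\<bar> \<le> \<epsilon> * norm p" "\<bar>r $ 2\<bar> \<le> \<epsilon> * norm p"
  using near_linearE[OF assms, of p 0] assms that by (auto simp: near_linear_def)

section \<open>Estimates for the focus and the saddle\<close>

lemma quadratic_form_bound: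
  fixes a b d :: real
  assumes a: "a > 0" and d: "d > 0" and disc: "b\<^sup>2 < 4 * a * d"
  shows "\<exists>k>0. \<forall>x y. k * (x\<^sup>2 + y\<^sup>2) \<le> a * x\<^sup>2 + b * x * y + d * y\<^sup>2"
proof -
  \<comment> \<open>Determinant over trace of the symmetric matrix of the form, a lower bound of its
    smaller eigenvalue.\<close>
  define k where "k = (4 * a * d - b\<^sup>2) / (4 * (a + d))"
  have k: "k > 0" using assms by (simp add: k_def)
  have kk: "4 * k * (a + d) = 4 * a * d - b\<^sup>2" using a d by (simp add: k_def field_simps)
  have "4 * a * d - b\<^sup>2 < 4 * a * (a + d)"
  proof -
    have "4 * a * (a + d) - (4 * a * d - b\<^sup>2) = 4 * (a * a) + b\<^sup>2" by (simp add: algebra_simps)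
    then show ?thesis using zero_le_power2[of b] mult_pos_pos[OF a a] by linarith
  qed
  then have ka: "k < a" using a d by (simp add: k_def pos_divide_less_eq algebra_simps)
  show ?thesis
  proof (intro exI[of _ k] conjI allI k)
    fix x y :: real
    have e: "4 * (a - k) * ((a - k) * x\<^sup>2 + b * x * y + (d - k) * y\<^sup>2) =
        (2 * (a - k) * x + b * y)\<^sup>2 + (4 * (a - k) * (d - k) - b\<^sup>2) * y\<^sup>2"
      by (simp add: power2_eq_square algebra_simps)
    \<comment> \<open>For this \<open>k\<close> the remaining form, with coefficients
      \<open>a - k\<close>, \<open>b\<close> and \<open>d - k\<close>, has a nonpositive
      discriminant, so completing the square shows it to be nonnegative.\<close>
    have "4 * (a - k) * (d - k) - b\<^sup>2 = 4 * k\<^sup>2"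
      using kk by (simp add: power2_eq_square algebra_simps)
    then have "0 \<le> 4 * (a - k) * ((a - k) * x\<^sup>2 + b * x * y + (d - k) * y\<^sup>2)"
      unfolding e by simp
    then have "0 \<le> (a - k) * x\<^sup>2 + b * x * y + (d - k) * y\<^sup>2"
      using ka by (simp add: zero_le_mult_iff)
    then show "k * (x\<^sup>2 + y\<^sup>2) \<le> a * x\<^sup>2 + b * x * y + d * y\<^sup>2" by (simp add: algebra_simps)
  qed
qed

text \<open>For the linear part, the turning form is
  \<open>Q * x\<^sup>2 + S * x * y + P * y\<^sup>2\<close>. It is positive definite exactly because
  the eigenvalues are not real, which is what the condition on \<open>S\<close> says. Half of the
  lower bound is given up to the remainder.\<close>

lemma focus_estimates:
  fixes P Q S :: real
  assumes P: "P > 0" and Q: "Q > 0" and S: "S\<^sup>2 < 4 * P * Q"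
  shows "\<exists>\<epsilon>>0. \<exists>\<delta>>0. \<exists>c>0. \<forall>X. near_linear \<epsilon> 0 (- P) Q S X \<longrightarrow>
     (\<forall>p. 0 \<le> p $ 1 \<longrightarrow> 0 \<le> p $ 2 \<longrightarrow> p \<noteq> 0 \<longrightarrow> X p $ 1 < \<delta> * X p $ 2) \<and>
     (\<forall>p. c * ((p $ 1)\<^sup>2 + (p $ 2)\<^sup>2) \<le> p $ 1 * X p $ 2 - p $ 2 * X p $ 1)"
proof -
  obtain k where k: "k > 0" "\<And>x y. k * (x\<^sup>2 + y\<^sup>2) \<le> Q * x\<^sup>2 + S * x * y + P * y\<^sup>2"
    using quadratic_form_bound[OF Q P, of S] S by (auto simp: mult.commute mult.left_commute)
  \<comment> \<open>So small that the shear term \<open>\<delta> * S * y\<close>, whose sign is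
    unknown, costs at most half of \<open>P * y\<close>.\<close>
  define \<delta> where "\<delta> = P / (2 * (\<bar>S\<bar> + 1))"
  have \<delta>: "\<delta> > 0" using P by (simp add: \<delta>_def)
  have \<delta>S: "\<delta> * \<bar>S\<bar> \<le> P / 2" using P by (simp add: \<delta>_def field_simps)
  \<comment> \<open>The first bound lets the remainder use half of the turning form; the second one
    leaves \<open>P / 4\<close> and half of \<open>\<delta> * Q\<close> in the estimate of
    \<open>\<delta> * y - x\<close>.\<close>
  define \<epsilon> where "\<epsilon> = min (k / 4) (min (P / 2) (\<delta> * Q) / (2 * (1 + \<delta>)))"
  have \<epsilon>: "\<epsilon> > 0" using k \<delta> P Q by (simp add: \<epsilon>_def)
  have \<epsilon>1: "(1 + \<delta>) * \<epsilon> \<le> P / 4" "(1 + \<delta>) * \<epsilon> \<le> \<delta> * Q / 2" "\<epsilon> \<le> k / 4"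
  proof -
    have "\<epsilon> \<le> min (P / 2) (\<delta> * Q) / (2 * (1 + \<delta>))" by (simp add: \<epsilon>_def)
    then have "(1 + \<delta>) * \<epsilon> \<le> min (P / 2) (\<delta> * Q) / 2" using \<delta> by (simp add: field_simps)
    then show "(1 + \<delta>) * \<epsilon> \<le> P / 4" "(1 + \<delta>) * \<epsilon> \<le> \<delta> * Q / 2" by (auto simp: min_def split: if_splits)
  qed (unfold \<epsilon>_def, rule min.cobounded1)
  show ?thesis
  proof (rule exI[of _ \<epsilon>], rule conjI[OF \<epsilon>], rule exI[of _ \<delta>], rule conjI[OF \<delta>], rule exI[of _ "k / 2"],
      rule conjI, goal_cases)
    case 1 show ?case using k by simp
  next
    case 2
    show ?case
    proof (intro allI impI conjI)
      fix X p assume nl: "near_linear \<epsilon> 0 (- P) Q S X"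
      obtain r where r: "X p = lin2 0 (- P) Q S p + r" "\<bar>r $ 1\<bar> \<le> \<epsilon> * norm p" "\<bar>r $ 2\<bar> \<le> \<epsilon> * norm p"
        by (rule near_linearE0[OF nl])
      {
        assume p: "0 \<le> p $ 1" "0 \<le> p $ 2" "p \<noteq> 0"
        have n: "norm p \<le> p $ 1 + p $ 2" using norm_le_abs2[of p] p by simp
        have "\<delta> * \<bar>r $ 2\<bar> \<le> \<delta> * (\<epsilon> * norm p)" using \<delta> r by (intro mult_left_mono) auto
        moreover have "\<bar>\<delta> * r $ 2\<bar> = \<delta> * \<bar>r $ 2\<bar>" using \<delta> by (simp add: abs_mult)
        moreover have "(1 + \<delta>) * \<epsilon> * norm p = \<epsilon> * norm p + \<delta> * (\<epsilon> * norm p)" by (simp add: algebra_simps)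
        ultimately have "\<bar>\<delta> * r $ 2\<bar> + \<bar>r $ 1\<bar> \<le> (1 + \<delta>) * \<epsilon> * norm p"
          using r(2) by linarith
        also have "\<dots> \<le> (1 + \<delta>) * \<epsilon> * (p $ 1 + p $ 2)"
          using \<epsilon> \<delta> n by (intro mult_left_mono) auto
        also have "\<dots> = (1 + \<delta>) * \<epsilon> * p $ 1 + (1 + \<delta>) * \<epsilon> * p $ 2" by (simp add: algebra_simps)
        also have "\<dots> \<le> \<delta> * Q / 2 * p $ 1 + P / 4 * p $ 2"
          using \<epsilon>1 p by (intro add_mono mult_right_mono) auto
        finally have err: "\<bar>\<delta> * r $ 2\<bar> + \<bar>r $ 1\<bar> \<le> \<delta> * Q / 2 * p $ 1 + P / 4 * p $ 2" .
        have "- (\<delta> * S * p $ 2) \<le> \<delta> * \<bar>S\<bar> * p $ 2"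
          using \<delta> p by (cases "S \<ge> 0") (auto intro!: mult_nonneg_nonneg)
        also have "\<dots> \<le> P / 2 * p $ 2" using \<delta>S p by (intro mult_right_mono) auto
        finally have s: "- (\<delta> * S * p $ 2) \<le> P / 2 * p $ 2" .
        have "0 < \<delta> * Q / 2 * p $ 1 + P / 4 * p $ 2"
        proof -
          consider "p $ 1 > 0" | "p $ 2 > 0" using p by (force simp: vec2_eq_iff)
          then show ?thesis
          proof cases
            case 1 then show ?thesis using p \<delta> P Q by (intro add_pos_nonneg) auto
          next
            case 2 then show ?thesis using p \<delta> P Q by (intro add_nonneg_pos) auto
          qed
        qed
        moreover have "\<delta> * X p $ 2 - X p $ 1 = P * p $ 2 + \<delta> * Q * p $ 1 + \<delta> * S * p $ 2 + \<delta> * r $ 2 - r $ 1"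
          using r(1) by (simp add: algebra_simps)
        moreover have "P * p $ 2 = P / 2 * p $ 2 + P / 4 * p $ 2 + P / 4 * p $ 2"
          "\<delta> * Q * p $ 1 = \<delta> * Q / 2 * p $ 1 + \<delta> * Q / 2 * p $ 1" by simp_all
        ultimately show "X p $ 1 < \<delta> * X p $ 2" using err s by linarith
      }
      have "\<bar>p $ 1 * r $ 2\<bar> \<le> norm p * (\<epsilon> * norm p)" "\<bar>p $ 2 * r $ 1\<bar> \<le> norm p * (\<epsilon> * norm p)"
        unfolding abs_mult using r \<epsilon> by (auto intro!: mult_mono component_le_norm_cart)
      then have "\<bar>p $ 1 * r $ 2\<bar> + \<bar>p $ 2 * r $ 1\<bar> \<le> 2 * \<epsilon> * (norm p)\<^sup>2"
        by (simp add: power2_eq_square algebra_simps)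
      also have "\<dots> \<le> 2 * (k / 4) * (norm p)\<^sup>2" using \<epsilon>1 by (intro mult_right_mono) auto
      finally have err: "\<bar>p $ 1 * r $ 2\<bar> + \<bar>p $ 2 * r $ 1\<bar> \<le> k / 2 * ((p $ 1)\<^sup>2 + (p $ 2)\<^sup>2)"
        by (simp add: norm2_sq)
      have "p $ 1 * X p $ 2 - p $ 2 * X p $ 1 =
          Q * (p $ 1)\<^sup>2 + S * p $ 1 * p $ 2 + P * (p $ 2)\<^sup>2 + p $ 1 * r $ 2 - p $ 2 * r $ 1"
        using r(1) by (simp add: power2_eq_square algebra_simps)
      then show "k / 2 * ((p $ 1)\<^sup>2 + (p $ 2)\<^sup>2) \<le> p $ 1 * X p $ 2 - p $ 2 * X p $ 1"
        using k(2)[of "p $ 1" "p $ 2"] err by (simp add: field_simps)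
    qed
  qed
qed

text \<open>\<open>l\<close> and \<open>- \<mu>\<close> are the eigenvalues of the matrix with rows
  \<open>(0, P)\<close> and \<open>(Q, S)\<close>.\<close>

lemma saddle_eigenvalues:
  fixes P Q S :: real
  assumes "P > 0" "Q > 0"
  obtains l \<mu> where "l > 0" "\<mu> > 0" "l - \<mu> = S" "l * \<mu> = P * Q"
proof -
  define r where "r = sqrt (S\<^sup>2 + 4 * P * Q)"
  have r2: "r * r = S\<^sup>2 + 4 * P * Q" using assms by (simp add: r_def)
  have "r > sqrt (S\<^sup>2)" unfolding r_def using assms by (intro real_sqrt_less_mono) simp
  then have r: "r > \<bar>S\<bar>" by simp
  show ?thesis
  proof (rule that[of "(r + S) / 2" "(r - S) / 2"])
    show "(r + S) / 2 * ((r - S) / 2) = P * Q"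
      using r2 by (simp add: field_simps power2_eq_square)
  qed (use r in \<open>auto simp: field_simps\<close>)
qed

text \<open>\<open>v = x - d * y\<close> with \<open>d = \<mu> / Q\<close> and
  \<open>u = Q * x + l * y\<close> are left eigenvectors: for the linear part
  \<open>v' = - \<mu> * v\<close> and \<open>u' = l * u\<close>. So
  \<open>u * u' - v * v' = l * u\<^sup>2 + \<mu> * v\<^sup>2\<close> is positive definite, which is
  the cone condition with room for the remainder.\<close>

lemma saddle_estimates:
  fixes P Q S :: real
  assumes P: "P > 0" and Q: "Q > 0"
  shows "\<exists>\<epsilon>>0. \<exists>d>0. \<exists>m>0. \<exists>\<alpha> \<beta>. \<forall>Y. near_linear \<epsilon> 0 P Q S Y \<longrightarrow>
     (\<forall>p. 0 \<le> p $ 1 \<longrightarrow> p $ 2 \<le> 0 \<longrightarrow> Y p $ 1 - d * Y p $ 2 \<le> - m * (p $ 1 - d * p $ 2)) \<and>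
     (\<forall>p. p $ 2 = 0 \<longrightarrow> p $ 1 \<noteq> 0 \<longrightarrow> p $ 1 * Y p $ 2 > 0) \<and>
     (\<forall>p. p $ 1 = 0 \<longrightarrow> p $ 2 < 0 \<longrightarrow> Y p $ 1 < 0) \<and>
     (\<forall>p q. p \<noteq> q \<longrightarrow>
      ((p - q) $ 1 - d * (p - q) $ 2) * ((Y p - Y q) $ 1 - d * (Y p - Y q) $ 2)
      < (\<alpha> * (p - q) $ 1 + \<beta> * (p - q) $ 2) * (\<alpha> * (Y p - Y q) $ 1 + \<beta> * (Y p - Y q) $ 2))"
proof -
  obtain l \<mu> where l: "l > 0" "\<mu> > 0" "l - \<mu> = S" "l * \<mu> = P * Q"
    using saddle_eigenvalues[OF P Q] by blast
  define d where "d = \<mu> / Q"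
  have d: "d > 0" using l Q by (simp add: d_def)
  have Qd: "Q * d = \<mu>" using Q by (simp add: d_def)
  have S: "S = l - \<mu>" using l by simp
  have Pl: "P = l * d" using l(4) Q by (simp add: d_def field_simps)
  \<comment> \<open>The discriminant condition for \<open>l * u\<^sup>2 + \<mu> * v\<^sup>2\<close>
    in the variables \<open>x\<close>, \<open>y\<close>; the gap is \<open>4 * (l * \<mu>)\<close>
    times the squared determinant of the forms \<open>u\<close> and \<open>v\<close>.\<close>
  have "(2 * l\<^sup>2 * Q - 2 * \<mu> * d)\<^sup>2 < 4 * (l * Q\<^sup>2 + \<mu>) * (l * l\<^sup>2 + \<mu> * d\<^sup>2)"
  proof -
    have "4 * (l * Q\<^sup>2 + \<mu>) * (l * l\<^sup>2 + \<mu> * d\<^sup>2) - (2 * l\<^sup>2 * Q - 2 * \<mu> * d)\<^sup>2 = 4 * (l * \<mu>) * (Q * d + l)\<^sup>2"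
      by (simp add: power2_eq_square algebra_simps)
    moreover have "Q * d + l > 0" using l Q d by (simp add: add_pos_pos)
    then have "0 < 4 * (l * \<mu>) * (Q * d + l)\<^sup>2" by (intro mult_pos_pos zero_less_power) (use l in auto)
    ultimately show ?thesis by linarith
  qed
  moreover have "l * Q\<^sup>2 + \<mu> > 0" "l * l\<^sup>2 + \<mu> * d\<^sup>2 > 0" using l Q d by (simp_all add: add_pos_pos)
  ultimately obtain k where k: "k > 0" "\<And>x y. k * (x\<^sup>2 + y\<^sup>2) \<le>
      (l * Q\<^sup>2 + \<mu>) * x\<^sup>2 + (2 * l\<^sup>2 * Q - 2 * \<mu> * d) * x * y + (l * l\<^sup>2 + \<mu> * d\<^sup>2) * y\<^sup>2"
    using quadratic_form_bound by blast
  \<comment> \<open>\<open>K\<close> bounds the products of \<open>u\<close> and \<open>v\<close>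
    with their remainders, and \<open>D\<close> bounds the remainder in the decay of
    \<open>v\<close>.\<close>
  define K where "K = (Q + l)\<^sup>2 + (1 + d)\<^sup>2"
  have K: "K > 0" using l Q by (simp add: K_def add_pos_nonneg)
  define D where "D = (1 + d) * (1 + 1 / d)"
  have D: "D > 0" using d by (simp add: D_def add_pos_pos)
  define \<epsilon> where "\<epsilon> = min (min (P / 2) (Q / 2)) (min (k / (2 * K)) (\<mu> / (2 * D)))"
  have \<epsilon>: "\<epsilon> > 0" using P Q k K l D by (simp add: \<epsilon>_def)
  have \<epsilon>1: "\<epsilon> < P" "\<epsilon> < Q" "\<epsilon> * K < k" "\<epsilon> * D \<le> \<mu> / 2"
  proof -
    show "\<epsilon> < P" "\<epsilon> < Q" using P Q by (auto simp: \<epsilon>_def min_def)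
    have "\<epsilon> \<le> k / (2 * K)" "\<epsilon> \<le> \<mu> / (2 * D)" by (auto simp: \<epsilon>_def)
    then have "\<epsilon> * K \<le> k / 2" "\<epsilon> * D \<le> \<mu> / 2" using K D by (simp_all add: field_simps)
    then show "\<epsilon> * K < k" "\<epsilon> * D \<le> \<mu> / 2" using k by auto
  qed
  show ?thesis
  proof (rule exI[of _ \<epsilon>], rule conjI[OF \<epsilon>], rule exI[of _ d], rule conjI[OF d], rule exI[of _ "\<mu> / 2"],
      rule conjI, goal_cases)
    case 1 show ?case using l by simp
  next
    case 2
    show ?case
    \<comment> \<open>\<open>\<alpha>\<close> and \<open>\<beta>\<close> are the coefficients of the
      unstable left eigenvector \<open>u\<close>.\<close>
    proof (rule exI[of _ Q], rule exI[of _ l], intro allI impI, intro conjI)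
      fix Y assume nl: "near_linear \<epsilon> 0 P Q S Y"
      show "\<forall>p. 0 \<le> p $ 1 \<longrightarrow> p $ 2 \<le> 0 \<longrightarrow> Y p $ 1 - d * Y p $ 2 \<le> - (\<mu> / 2) * (p $ 1 - d * p $ 2)"
      proof (intro allI impI)
        fix p :: "real^2" assume p: "0 \<le> p $ 1" "p $ 2 \<le> 0"
        obtain r where r: "Y p = lin2 0 P Q S p + r" "\<bar>r $ 1\<bar> \<le> \<epsilon> * norm p" "\<bar>r $ 2\<bar> \<le> \<epsilon> * norm p"
          by (rule near_linearE0[OF nl])
        have v: "norm p \<le> (1 + 1 / d) * (p $ 1 - d * p $ 2)"
        proof -
          have "(1 + 1 / d) * (p $ 1 - d * p $ 2) = p $ 1 - p $ 2 + (p $ 1 / d - d * p $ 2)"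
            using d by (simp add: field_simps)
          moreover have "0 \<le> p $ 1 / d" "d * p $ 2 \<le> 0" using p d by (auto simp: mult_nonneg_nonpos)
          ultimately show ?thesis using norm_le_abs2[of p] p by simp
        qed
        have v0: "0 \<le> p $ 1 - d * p $ 2" using p d mult_nonneg_nonpos[of d "p $ 2"] by simp
        have "d * \<bar>r $ 2\<bar> \<le> d * (\<epsilon> * norm p)" using d r by (intro mult_left_mono) auto
        moreover have "\<bar>d * r $ 2\<bar> = d * \<bar>r $ 2\<bar>" using d by (simp add: abs_mult)
        moreover have "(1 + d) * \<epsilon> * norm p = \<epsilon> * norm p + d * (\<epsilon> * norm p)" by (simp add: algebra_simps)
        ultimately have "r $ 1 - d * r $ 2 \<le> (1 + d) * \<epsilon> * norm p"
          using r(2) by linarith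
        also have "\<dots> \<le> (1 + d) * \<epsilon> * ((1 + 1 / d) * (p $ 1 - d * p $ 2))"
          using \<epsilon> d v by (intro mult_left_mono) auto
        also have "\<dots> = \<epsilon> * D * (p $ 1 - d * p $ 2)" by (simp add: D_def)
        also have "\<dots> \<le> \<mu> / 2 * (p $ 1 - d * p $ 2)" using \<epsilon>1 v0 by (intro mult_right_mono) auto
        finally have "r $ 1 - d * r $ 2 \<le> \<mu> / 2 * (p $ 1 - d * p $ 2)" .
        moreover have "Y p $ 1 - d * Y p $ 2 = - \<mu> * (p $ 1 - d * p $ 2) + (r $ 1 - d * r $ 2)"
        proof -
          have "P * p $ 2 - d * (Q * p $ 1 + S * p $ 2) = - (Q * d) * p $ 1 + (l * d - d * (l - \<mu>)) * p $ 2"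
            unfolding Pl S by (simp add: algebra_simps)
          also have "\<dots> = - \<mu> * (p $ 1 - d * p $ 2)" unfolding Qd by (simp add: algebra_simps)
          finally show ?thesis using r(1) by (simp add: algebra_simps)
        qed
        ultimately show "Y p $ 1 - d * Y p $ 2 \<le> - (\<mu> / 2) * (p $ 1 - d * p $ 2)" by (simp add: field_simps)
      qed
      show "\<forall>p. p $ 2 = 0 \<longrightarrow> p $ 1 \<noteq> 0 \<longrightarrow> p $ 1 * Y p $ 2 > 0"
      proof (intro allI impI)
        fix p :: "real^2" assume p: "p $ 2 = 0" "p $ 1 \<noteq> 0"
        obtain r where r: "Y p = lin2 0 P Q S p + r" "\<bar>r $ 1\<bar> \<le> \<epsilon> * norm p" "\<bar>r $ 2\<bar> \<le> \<epsilon> * norm p"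
          by (rule near_linearE0[OF nl])
        have "norm p \<le> \<bar>p $ 1\<bar>" using norm_le_abs2[of p] p by simp
        then have "\<bar>r $ 2\<bar> \<le> \<epsilon> * \<bar>p $ 1\<bar>" using r(3) \<epsilon> mult_left_mono[of "norm p" "\<bar>p $ 1\<bar>" \<epsilon>] by linarith
        then have "\<bar>p $ 1 * r $ 2\<bar> \<le> \<bar>p $ 1\<bar> * (\<epsilon> * \<bar>p $ 1\<bar>)" unfolding abs_mult by (intro mult_left_mono) auto
        also have "\<dots> = \<epsilon> * (p $ 1)\<^sup>2" by (simp add: power2_eq_square)
        also have "\<dots> < Q * (p $ 1)\<^sup>2" using \<epsilon>1 p by (intro mult_strict_right_mono) auto
        finally show "p $ 1 * Y p $ 2 > 0" using r(1) p by (simp add: power2_eq_square algebra_simps)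
      qed
      show "\<forall>p. p $ 1 = 0 \<longrightarrow> p $ 2 < 0 \<longrightarrow> Y p $ 1 < 0"
      proof (intro allI impI)
        fix p :: "real^2" assume p: "p $ 1 = 0" "p $ 2 < 0"
        obtain r where r: "Y p = lin2 0 P Q S p + r" "\<bar>r $ 1\<bar> \<le> \<epsilon> * norm p" "\<bar>r $ 2\<bar> \<le> \<epsilon> * norm p"
          by (rule near_linearE0[OF nl])
        have "norm p \<le> - p $ 2" using norm_le_abs2[of p] p by simp
        then have "\<bar>r $ 1\<bar> \<le> \<epsilon> * (- p $ 2)" using r(2) \<epsilon> mult_left_mono[of "norm p" "- p $ 2" \<epsilon>] by linarith
        also have "\<dots> < P * (- p $ 2)" using \<epsilon>1 p by (intro mult_strict_right_mono) auto
        finally show "Y p $ 1 < 0" using r(1) p by simp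
      qed
      show "\<forall>p q. p \<noteq> q \<longrightarrow>
        ((p - q) $ 1 - d * (p - q) $ 2) * ((Y p - Y q) $ 1 - d * (Y p - Y q) $ 2)
        < (Q * (p - q) $ 1 + l * (p - q) $ 2) * (Q * (Y p - Y q) $ 1 + l * (Y p - Y q) $ 2)"
      proof (intro allI impI)
        fix p q :: "real^2" assume pq: "p \<noteq> q"
        define w where "w = p - q"
        obtain r where r: "Y p - Y q = lin2 0 P Q S w + r" "\<bar>r $ 1\<bar> \<le> \<epsilon> * norm w" "\<bar>r $ 2\<bar> \<le> \<epsilon> * norm w"
          using near_linearE[OF nl, of p q] by (auto simp: w_def)
        define u v ur vr where "u = Q * w $ 1 + l * w $ 2" and "v = w $ 1 - d * w $ 2"
          and "ur = Q * r $ 1 + l * r $ 2" and "vr = r $ 1 - d * r $ 2"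
        have lin: "\<bar>a * z1 + b * z2\<bar> \<le> (a + b) * M"
          if "0 \<le> a" "0 \<le> b" "\<bar>z1\<bar> \<le> M" "\<bar>z2\<bar> \<le> M" for a b z1 z2 M :: real
        proof -
          have "\<bar>a * z1 + b * z2\<bar> \<le> a * \<bar>z1\<bar> + b * \<bar>z2\<bar>"
            using that abs_triangle_ineq[of "a * z1" "b * z2"] by (simp add: abs_mult)
          also have "\<dots> \<le> a * M + b * M" using that by (intro add_mono mult_left_mono) auto
          finally show ?thesis by (simp add: algebra_simps)
        qed
        have b: "\<bar>u\<bar> \<le> (Q + l) * norm w" "\<bar>ur\<bar> \<le> (Q + l) * (\<epsilon> * norm w)"
          unfolding u_def ur_def using Q l(1) r(2,3) by (auto intro!: lin simp: component_le_norm_cart)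
        have "\<bar>1 * w $ 1 + d * (- w $ 2)\<bar> \<le> (1 + d) * norm w"
          by (rule lin) (use d in \<open>auto simp: component_le_norm_cart\<close>)
        moreover have "\<bar>1 * r $ 1 + d * (- r $ 2)\<bar> \<le> (1 + d) * (\<epsilon> * norm w)"
          by (rule lin) (use d r(2,3) in auto)
        ultimately have b': "\<bar>v\<bar> \<le> (1 + d) * norm w" "\<bar>vr\<bar> \<le> (1 + d) * (\<epsilon> * norm w)"
          by (simp_all add: v_def vr_def)
        have "\<bar>u * ur\<bar> \<le> (Q + l) * norm w * ((Q + l) * (\<epsilon> * norm w))"
          unfolding abs_mult using b b' Q l by (intro mult_mono) auto
        moreover have "\<bar>v * vr\<bar> \<le> (1 + d) * norm w * ((1 + d) * (\<epsilon> * norm w))"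
          unfolding abs_mult using b b' d by (intro mult_mono) auto
        ultimately have "\<bar>u * ur\<bar> + \<bar>v * vr\<bar> \<le> \<epsilon> * K * (norm w)\<^sup>2"
          by (simp add: K_def power2_eq_square algebra_simps)
        also have "\<dots> < k * (norm w)\<^sup>2" using \<epsilon>1 pq by (intro mult_strict_right_mono) (auto simp: w_def)
        also have "\<dots> = k * ((w $ 1)\<^sup>2 + (w $ 2)\<^sup>2)" by (simp only: norm2_sq)
        also have "\<dots> \<le> (l * Q\<^sup>2 + \<mu>) * (w $ 1)\<^sup>2 + (2 * l\<^sup>2 * Q - 2 * \<mu> * d) * w $ 1 * w $ 2
            + (l * l\<^sup>2 + \<mu> * d\<^sup>2) * (w $ 2)\<^sup>2"
          by (rule k(2))
        also have "\<dots> = l * u\<^sup>2 + \<mu> * v\<^sup>2"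
          by (simp add: u_def v_def power2_eq_square algebra_simps)
        finally have err: "\<bar>u * ur\<bar> + \<bar>v * vr\<bar> < l * u\<^sup>2 + \<mu> * v\<^sup>2" .
        have "Q * (Y p - Y q) $ 1 + l * (Y p - Y q) $ 2 = l * u + ur"
        proof -
          have "Q * (P * w $ 2) + l * (Q * w $ 1 + S * w $ 2) = l * Q * w $ 1 + (l * \<mu> + l * (l - \<mu>)) * w $ 2"
            unfolding l(4) S by (simp add: algebra_simps)
          also have "\<dots> = l * u" by (simp add: u_def algebra_simps)
          finally show ?thesis unfolding r(1) by (simp add: ur_def algebra_simps)
        qed
        moreover have "(Y p - Y q) $ 1 - d * (Y p - Y q) $ 2 = - \<mu> * v + vr"
        proof -
          have "P * w $ 2 - d * (Q * w $ 1 + S * w $ 2) = - (Q * d) * w $ 1 + (l * d - d * (l - \<mu>)) * w $ 2"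
            unfolding Pl S by (simp add: algebra_simps)
          also have "\<dots> = - \<mu> * v" unfolding Qd by (simp add: v_def algebra_simps)
          finally show ?thesis unfolding r(1) by (simp add: vr_def algebra_simps)
        qed
        moreover have "v * (- \<mu> * v + vr) < u * (l * u + ur)"
        proof -
          have "v * vr \<le> \<bar>v * vr\<bar>" "- (u * ur) \<le> \<bar>u * ur\<bar>" by auto
          then have "v * vr - u * ur < l * u\<^sup>2 + \<mu> * v\<^sup>2" using err by linarith
          then show ?thesis by (simp add: power2_eq_square algebra_simps)
        qed
        ultimately show "((p - q) $ 1 - d * (p - q) $ 2) * ((Y p - Y q) $ 1 - d * (Y p - Y q) $ 2)
          < (Q * (p - q) $ 1 + l * (p - q) $ 2) * (Q * (Y p - Y q) $ 1 + l * (Y p - Y q) $ 2)"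
          by (simp only: u_def v_def w_def)
      qed
    qed
  qed
qed

lemma half_chart_exists:
  fixes P Q S P' Q' S' :: real
  assumes "P > 0" "Q > 0" "S\<^sup>2 < 4 * P * Q" "P' > 0" "Q' > 0"
  shows "\<exists>\<epsilon>>0. \<forall>X Y. near_linear \<epsilon> 0 (- P) Q S X \<longrightarrow> near_linear \<epsilon> 0 P' Q' S' Y \<longrightarrow> (\<exists>G h. half_chart X Y G h)"
proof -
  obtain e1 \<delta> c where f: "e1 > 0" "\<delta> > 0" "c > 0" "\<And>X. near_linear e1 0 (- P) Q S X \<Longrightarrow>
     (\<forall>p. 0 \<le> p $ 1 \<longrightarrow> 0 \<le> p $ 2 \<longrightarrow> p \<noteq> 0 \<longrightarrow> X p $ 1 < \<delta> * X p $ 2) \<and>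
     (\<forall>p. c * ((p $ 1)\<^sup>2 + (p $ 2)\<^sup>2) \<le> p $ 1 * X p $ 2 - p $ 2 * X p $ 1)"
    using focus_estimates[OF assms(1-3)] by blast
  obtain e2 d m \<alpha> \<beta> where s: "e2 > 0" "d > 0" "m > 0" "\<And>Y. near_linear e2 0 P' Q' S' Y \<Longrightarrow>
     (\<forall>p. 0 \<le> p $ 1 \<longrightarrow> p $ 2 \<le> 0 \<longrightarrow> Y p $ 1 - d * Y p $ 2 \<le> - m * (p $ 1 - d * p $ 2)) \<and>
     (\<forall>p. p $ 2 = 0 \<longrightarrow> p $ 1 \<noteq> 0 \<longrightarrow> p $ 1 * Y p $ 2 > 0) \<and>
     (\<forall>p. p $ 1 = 0 \<longrightarrow> p $ 2 < 0 \<longrightarrow> Y p $ 1 < 0) \<and>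
     (\<forall>p q. p \<noteq> q \<longrightarrow>
      ((p - q) $ 1 - d * (p - q) $ 2) * ((Y p - Y q) $ 1 - d * (Y p - Y q) $ 2)
      < (\<alpha> * (p - q) $ 1 + \<beta> * (p - q) $ 2) * (\<alpha> * (Y p - Y q) $ 1 + \<beta> * (Y p - Y q) $ 2))"
    using saddle_estimates[OF assms(4,5), of S'] by blast
  define \<epsilon> where "\<epsilon> = min e1 e2"
  \<comment> \<open>The sum of the Lipschitz constants of the two fields, since their flows have to
    share one.\<close>
  define L where "L = (P + Q + \<bar>S\<bar> + \<epsilon>) + (P' + Q' + \<bar>S'\<bar> + \<epsilon>)"
  have \<epsilon>: "\<epsilon> > 0" using f s by (simp add: \<epsilon>_def)
  have L: "L > 0" using assms \<epsilon> by (simp add: L_def add_pos_pos add_nonneg_pos)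
  show ?thesis
  proof (intro exI[of _ \<epsilon>] conjI allI impI \<epsilon>)
    fix X Y assume nX: "near_linear \<epsilon> 0 (- P) Q S X" and nY: "near_linear \<epsilon> 0 P' Q' S' Y"
    have X: "near_linear e1 0 (- P) Q S X" and Y: "near_linear e2 0 P' Q' S' Y"
      using near_linear_mono nX nY by (auto simp: \<epsilon>_def)
    have lX: "norm (X p - X q) \<le> L * norm (p - q)" for p q
    proof -
      have "norm (X p - X q) \<le> (P + Q + \<bar>S\<bar> + \<epsilon>) * norm (p - q)"
        using near_linear_Lipschitz[OF nX, of p q] assms by simp
      also have "\<dots> \<le> L * norm (p - q)" using assms \<epsilon> by (intro mult_right_mono) (auto simp: L_def)
      finally show ?thesis .
    qed
    have lY: "norm (Y p - Y q) \<le> L * norm (p - q)" for p q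
    proof -
      have "norm (Y p - Y q) \<le> (P' + Q' + \<bar>S'\<bar> + \<epsilon>) * norm (p - q)"
        using near_linear_Lipschitz[OF nY, of p q] assms by simp
      also have "\<dots> \<le> L * norm (p - q)" using assms \<epsilon> by (intro mult_right_mono) (auto simp: L_def)
      finally show ?thesis .
    qed
    have X0: "X 0 = 0" and Y0: "Y 0 = 0" using nX nY by (auto simp: near_linear_def)
    obtain \<phi> where \<phi>: "lipflow X L \<phi>" using lipflow_exists[OF L lX X0] by blast
    obtain \<psi> where \<psi>: "lipflow Y L \<psi>" using lipflow_exists[OF L lY Y0] by blast
    have "right_half X L \<phi> Y \<psi> \<delta> d c m \<alpha> \<beta>"
      unfolding right_half_def right_half_axioms_def using \<phi> \<psi> f(2,3) s(2,3) f(4)[OF X] s(4)[OF Y] by blast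
    then show "\<exists>G h. half_chart X Y G h" using right_half.half_chart by blast
  qed
qed

text \<open>The reflection negates the off-diagonal entries and time reversal negates all of them,
  so the former survive and the trace changes sign. The conditions for a focus and a saddle do not
  see that sign.\<close>

lemma near_linear_mirror:
  assumes "near_linear \<epsilon> 0 b c d X"
  shows "near_linear \<epsilon> 0 b c (- d) (mirror_field X)"
proof -
  have nm: "norm (mirror w) = norm w" for w
    by (rule power2_eq_imp_eq) (simp_all add: norm2_sq)
  have "norm (mirror_field X p - mirror_field X q - lin2 0 b c (- d) (p - q)) \<le> \<epsilon> * norm (p - q)" for p q
  proof -
    have "mirror_field X p - mirror_field X q - lin2 0 b c (- d) (p - q) =
      - mirror (X (mirror p) - X (mirror q) - lin2 0 b c d (mirror p - mirror q))"
      by (simp add: vec2_eq_iff mirror_field_def algebra_simps)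
    then have "norm (mirror_field X p - mirror_field X q - lin2 0 b c (- d) (p - q)) =
      norm (X (mirror p) - X (mirror q) - lin2 0 b c d (mirror p - mirror q))" by (simp add: nm)
    also have "\<dots> \<le> \<epsilon> * norm (mirror p - mirror q)" using assms by (simp add: near_linear_def)
    also have "mirror p - mirror q = mirror (p - q)" by (simp add: vec2_eq_iff)
    finally show ?thesis by (simp add: nm)
  qed
  moreover have "mirror 0 = 0" by (simp add: vec2_eq_iff)
  ultimately show ?thesis using assms by (simp add: near_linear_def mirror_field_def)
qed

lemma normal_form_has_flow_charts:
  fixes P Q S P' Q' S' :: real
  assumes P: "P > 0" "Q > 0" "S\<^sup>2 < 4 * P * Q" "P' > 0" "Q' > 0"
  shows "\<exists>\<epsilon>>0. \<forall>X Y. near_linear \<epsilon> 0 (- P) Q S X \<longrightarrow> near_linear \<epsilon> 0 P' Q' S' Y \<longrightarrow> has_flow_charts X Y"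
proof -
  obtain e1 where e1: "e1 > 0" "\<And>X Y. near_linear e1 0 (- P) Q S X \<Longrightarrow> near_linear e1 0 P' Q' S' Y \<Longrightarrow>
      \<exists>G h. half_chart X Y G h"
    using half_chart_exists[OF P, of S'] by blast
  obtain e2 where e2: "e2 > 0" "\<And>X Y. near_linear e2 0 (- P) Q (- S) X \<Longrightarrow> near_linear e2 0 P' Q' (- S') Y \<Longrightarrow>
      \<exists>G h. half_chart X Y G h"
    using half_chart_exists[OF P(1,2) _ P(4,5), of "- S" "- S'"] P(3) by auto
  show ?thesis
  proof (intro exI[of _ "min e1 e2"] conjI allI impI)
    fix X Y assume nl: "near_linear (min e1 e2) 0 (- P) Q S X" "near_linear (min e1 e2) 0 P' Q' S' Y"
    obtain G h where 1: "half_chart X Y G h"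
      using e1(2)[of X Y] near_linear_mono[OF nl(1), of e1] near_linear_mono[OF nl(2), of e1] by auto
    obtain G' h' where 2: "half_chart (mirror_field X) (mirror_field Y) G' h'"
      using e2(2)[of "mirror_field X" "mirror_field Y"] near_linear_mono[OF near_linear_mirror[OF nl(1)], of e2]
        near_linear_mono[OF near_linear_mirror[OF nl(2)], of e2] by auto
    show "has_flow_charts X Y" by (rule two_charts.has_flow_charts[OF two_charts.intro[OF 1 2]])
  qed (use e1 e2 in simp)
qed

section \<open>Reduction to the normal form\<close>

text \<open>Strict differentiability at the origin: the two points vary independently, so that the
  remainder has a small Lipschitz constant near the origin and is not merely small.\<close>

definition strong_derivative_0 :: "(real^2 \<Rightarrow> real^2) \<Rightarrow> real \<Rightarrow> real \<Rightarrow> real \<Rightarrow> real \<Rightarrow> bool" where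
  "strong_derivative_0 X a b c d \<longleftrightarrow> X 0 = 0 \<and>
     (\<forall>\<epsilon>>0. \<exists>r>0. \<forall>p\<in>cball 0 r. \<forall>q\<in>cball 0 r. norm (X p - X q - lin2 a b c d (p - q)) \<le> \<epsilon> * norm (p - q))"

lemma lin2_diff: "lin2 a b c d (p - q) = lin2 a b c d p - lin2 a b c d q"
  by (simp add: vec2_eq_iff algebra_simps)

text \<open>Composing the remainder with the projection onto a small ball makes the field near linear on
  the whole plane without changing it on that ball.\<close>

lemma near_linear_extension:
  assumes "strong_derivative_0 X a b c d" "\<epsilon> > 0"
  shows "\<exists>r>0. \<exists>X'. near_linear \<epsilon> a b c d X' \<and> (\<forall>p\<in>ball 0 r. X' p = X p)"
proof -
  obtain r where r: "r > 0" "\<And>p q. p \<in> cball 0 r \<Longrightarrow> q \<in> cball 0 r \<Longrightarrow>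
      norm (X p - X q - lin2 a b c d (p - q)) \<le> \<epsilon> * norm (p - q)"
    using assms unfolding strong_derivative_0_def by meson
  \<comment> \<open>The projection onto a ball does not increase distances, so the remainder keeps
    its Lipschitz constant on the whole plane.\<close>
  define \<pi> where "\<pi> = closest_point (cball (0::real^2) r)"
  have ne: "cball (0::real^2) r \<noteq> {}" using r(1) by simp
  have \<pi>: "\<pi> p \<in> cball 0 r" "norm (\<pi> p - \<pi> q) \<le> norm (p - q)" for p q
    unfolding \<pi>_def using closest_point_in_set[OF closed_cball ne, of p]
      closest_point_lipschitz[OF convex_cball closed_cball ne, of p q] by (auto simp: dist_norm)
  define X' where "X' p = lin2 a b c d p + (X (\<pi> p) - lin2 a b c d (\<pi> p))" for p
  have eq: "X' p = X p" if "p \<in> cball 0 r" for p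
    using that by (simp add: X'_def \<pi>_def closest_point_self)
  have "norm (X' p - X' q - lin2 a b c d (p - q)) \<le> \<epsilon> * norm (p - q)" for p q
  proof -
    have "X' p - X' q - lin2 a b c d (p - q) = X (\<pi> p) - X (\<pi> q) - lin2 a b c d (\<pi> p - \<pi> q)"
      by (simp add: X'_def lin2_diff)
    then have "norm (X' p - X' q - lin2 a b c d (p - q)) \<le> \<epsilon> * norm (\<pi> p - \<pi> q)" using r(2) \<pi>(1) by simp
    also have "\<dots> \<le> \<epsilon> * norm (p - q)" using \<pi>(2) assms(2) by (intro mult_left_mono) auto
    finally show ?thesis .
  qed
  moreover have "X' 0 = 0" using eq[of 0] r(1) assms(1) by (simp add: strong_derivative_0_def)
  ultimately show ?thesis using eq r(1) by (intro exI[of _ r] conjI exI[of _ X']) (auto simp: near_linear_def)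
qed

text \<open>With \<open>k = a / c\<close> the conjugated matrix has upper left entry 0, and
  \<open>\<sigma> = -1\<close> reflects the abscissa to make its lower left entry positive. On the
  switching line the map is multiplication by \<open>\<sigma>\<close>, whatever \<open>k\<close>
  is.\<close>

definition shear :: "real \<Rightarrow> real \<Rightarrow> real^2 \<Rightarrow> real^2" where
  "shear \<sigma> k = lin2 \<sigma> (- \<sigma> * k) 0 1"

definition unshear :: "real \<Rightarrow> real \<Rightarrow> real^2 \<Rightarrow> real^2" where
  "unshear \<sigma> k = lin2 \<sigma> k 0 1"

text \<open>Conjugation keeps trace and determinant, which together with the two entries
  \<open>0\<close> and \<open>\<sigma> * c\<close> fix the new matrix. Each of the two maps
  multiplies norms by at most \<open>2 + \<bar>k\<bar>\<close>, hence the square.\<close>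

lemma near_linear_shear:
  assumes nl: "near_linear \<epsilon> a b c d X" and \<sigma>: "\<sigma> = 1 \<or> \<sigma> = -1" and c: "c \<noteq> 0" and k: "k = a / c"
    and \<epsilon>: "0 \<le> \<epsilon>"
  shows "near_linear ((2 + \<bar>k\<bar>)\<^sup>2 * \<epsilon>) 0 (- (\<sigma> * (a * d - b * c) / c)) (\<sigma> * c) (a + d)
     (\<lambda>p. shear \<sigma> k (X (unshear \<sigma> k p)))"
proof -
  have n1: "norm (shear \<sigma> k w) \<le> (2 + \<bar>k\<bar>) * norm w" "norm (unshear \<sigma> k w) \<le> (2 + \<bar>k\<bar>) * norm w" for w
    using norm_lin2_le[of \<sigma> "- \<sigma> * k" 0 1 w] norm_lin2_le[of \<sigma> k 0 1 w] \<sigma>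
    by (auto simp: shear_def unshear_def abs_mult)
  have kc: "k * c = a" using k c by simp
  have "norm (shear \<sigma> k (X (unshear \<sigma> k p)) - shear \<sigma> k (X (unshear \<sigma> k q)) -
      lin2 0 (- (\<sigma> * (a * d - b * c) / c)) (\<sigma> * c) (a + d) (p - q)) \<le> (2 + \<bar>k\<bar>)\<^sup>2 * \<epsilon> * norm (p - q)" for p q
  proof -
    define w where "w = p - q"
    have "shear \<sigma> k (lin2 a b c d (unshear \<sigma> k w)) = lin2 0 (- (\<sigma> * (a * d - b * c) / c)) (\<sigma> * c) (a + d) w"
    proof -
      have 1: "\<sigma> * (a * (\<sigma> * w $ 1 + k * w $ 2) + b * w $ 2) - \<sigma> * k * (c * (\<sigma> * w $ 1 + k * w $ 2) + d * w $ 2)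
         = (\<sigma> * \<sigma>) * (a - k * c) * w $ 1 + \<sigma> * ((a - k * c) * k + b - k * d) * w $ 2"
        by (simp add: algebra_simps)
      have 2: "\<sigma> * ((a - k * c) * k + b - k * d) = - (\<sigma> * (a * d - b * c) / c)"
        unfolding kc using k c by (simp add: field_simps)
      have 3: "c * (\<sigma> * w $ 1 + k * w $ 2) + d * w $ 2 = \<sigma> * c * w $ 1 + (k * c + d) * w $ 2"
        by (simp add: algebra_simps)
      show ?thesis
        unfolding vec2_eq_iff shear_def unshear_def
        using 1 2 3 kc by simp
    qed
    then have "shear \<sigma> k (X (unshear \<sigma> k p)) - shear \<sigma> k (X (unshear \<sigma> k q)) -
        lin2 0 (- (\<sigma> * (a * d - b * c) / c)) (\<sigma> * c) (a + d) w =
      shear \<sigma> k (X (unshear \<sigma> k p) - X (unshear \<sigma> k q) - lin2 a b c d (unshear \<sigma> k p - unshear \<sigma> k q))"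
      by (simp add: shear_def unshear_def lin2_diff w_def)
    then have "norm (shear \<sigma> k (X (unshear \<sigma> k p)) - shear \<sigma> k (X (unshear \<sigma> k q)) -
        lin2 0 (- (\<sigma> * (a * d - b * c) / c)) (\<sigma> * c) (a + d) w) \<le>
      (2 + \<bar>k\<bar>) * norm (X (unshear \<sigma> k p) - X (unshear \<sigma> k q) - lin2 a b c d (unshear \<sigma> k p - unshear \<sigma> k q))"
      using n1(1) by metis
    also have "\<dots> \<le> (2 + \<bar>k\<bar>) * (\<epsilon> * norm (unshear \<sigma> k p - unshear \<sigma> k q))"
      using nl by (intro mult_left_mono) (auto simp: near_linear_def)
    also have "unshear \<sigma> k p - unshear \<sigma> k q = unshear \<sigma> k w" by (simp add: unshear_def lin2_diff w_def)
    also have "(2 + \<bar>k\<bar>) * (\<epsilon> * norm (unshear \<sigma> k w)) \<le> (2 + \<bar>k\<bar>) * (\<epsilon> * ((2 + \<bar>k\<bar>) * norm w))"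
      using \<epsilon> n1(2) by (intro mult_left_mono) auto
    finally show ?thesis by (simp add: w_def power2_eq_square mult_ac)
  qed
  moreover have "lin2 a b c d 0 = 0" for a b c d by (simp add: vec2_eq_iff)
  ultimately show ?thesis using nl by (simp add: near_linear_def shear_def unshear_def)
qed

text \<open>Because \<open>c\<close> and \<open>c'\<close> have the same sign, one reflection
  \<open>\<sigma>\<close> serves both sides; the signs of the two determinants then give
  \<open>P > 0\<close> and \<open>P' > 0\<close>.\<close>

lemma flow_charts_focus_above:
  assumes X: "strong_derivative_0 X a b c d" and Y: "strong_derivative_0 Y a' b' c' d'"
    and focus: "(a + d)\<^sup>2 < 4 * (a * d - b * c)" and saddle: "a' * d' - b' * c' < 0" and cc: "c * c' > 0"
  shows "has_flow_charts X Y"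
proof -
  obtain \<sigma> :: real where \<sigma>: "\<sigma> = 1 \<or> \<sigma> = -1" "\<sigma> * c > 0" "\<sigma> * c' > 0"
    using cc that[of 1] that[of "-1"] by (auto simp: zero_less_mult_iff)
  have c0: "c \<noteq> 0" "c' \<noteq> 0" using cc by auto
  have ss: "\<sigma> * \<sigma> = 1" using \<sigma> by auto
  have "0 < 4 * (a * d - b * c)" by (rule le_less_trans[OF zero_le_power2 focus])
  then have det: "a * d - b * c > 0" by simp
  have quot: "\<sigma> * x / y = x / (\<sigma> * y)" for x y using \<sigma>(1) by auto
  define P Q P' Q' where "P = \<sigma> * (a * d - b * c) / c" and "Q = \<sigma> * c"
    and "P' = - (\<sigma> * (a' * d' - b' * c') / c')" and "Q' = \<sigma> * c'"
  have PQ: "P > 0" "Q > 0" "P' > 0" "Q' > 0"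
    using \<sigma> det saddle by (simp_all add: P_def Q_def P'_def Q'_def quot divide_neg_pos)
  have "P * Q = (\<sigma> * \<sigma>) * (a * d - b * c)" using c0 by (simp add: P_def Q_def)
  then have f: "(a + d)\<^sup>2 < 4 * P * Q" using focus ss by simp
  obtain \<epsilon> where \<epsilon>: "\<epsilon> > 0" "\<And>X Y. near_linear \<epsilon> 0 (- P) Q (a + d) X \<Longrightarrow>
      near_linear \<epsilon> 0 P' Q' (a' + d') Y \<Longrightarrow> has_flow_charts X Y"
    using normal_form_has_flow_charts[OF PQ(1,2) f PQ(3,4)] by blast
  define k k' where "k = a / c" and "k' = a' / c'"
  \<comment> \<open>Chosen so that the distortion by the shears leaves exactly the tolerance
    \<open>\<epsilon>\<close> of the normal form.\<close>
  define e e' where "e = \<epsilon> / (2 + \<bar>k\<bar>)\<^sup>2" and "e' = \<epsilon> / (2 + \<bar>k'\<bar>)\<^sup>2"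
  have pos: "(2 + \<bar>k\<bar>)\<^sup>2 > 0" "(2 + \<bar>k'\<bar>)\<^sup>2 > 0" by (simp_all add: add_pos_nonneg)
  have e: "e > 0" "e' > 0" "(2 + \<bar>k\<bar>)\<^sup>2 * e = \<epsilon>" "(2 + \<bar>k'\<bar>)\<^sup>2 * e' = \<epsilon>" using \<epsilon> pos by (simp_all add: e_def e'_def)
  obtain r X1 where X1: "r > 0" "near_linear e a b c d X1" "\<forall>p\<in>ball 0 r. X1 p = X p"
    using near_linear_extension[OF X e(1)] by blast
  obtain r' Y1 where Y1: "r' > 0" "near_linear e' a' b' c' d' Y1" "\<forall>p\<in>ball 0 r'. Y1 p = Y p"
    using near_linear_extension[OF Y e(2)] by blast
  define X2 where "X2 p = shear \<sigma> k (X1 (unshear \<sigma> k p))" for p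
  define Y2 where "Y2 p = shear \<sigma> k' (Y1 (unshear \<sigma> k' p))" for p
  have "near_linear \<epsilon> 0 (- P) Q (a + d) X2"
    using near_linear_shear[OF X1(2) \<sigma>(1) c0(1) k_def] e unfolding X2_def P_def Q_def by simp
  moreover have "near_linear \<epsilon> 0 P' Q' (a' + d') Y2"
    using near_linear_shear[OF Y1(2) \<sigma>(1) c0(2) k'_def] e unfolding Y2_def P'_def Q'_def by simp
  ultimately have 2: "has_flow_charts X2 Y2" by (rule \<epsilon>(2))
  \<comment> \<open>The maximum and the minimum select the shear parameter of the side; both vanish
    on the switching line, so the two linear maps fit together continuously.\<close>
  define T :: "real^2 \<Rightarrow> real^2" where "T p = vector [\<sigma> * (p $ 1 - k * max (p $ 2) 0 - k' * min (p $ 2) 0), p $ 2]" for p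
  define T' :: "real^2 \<Rightarrow> real^2" where "T' p = vector [\<sigma> * p $ 1 + k * max (p $ 2) 0 + k' * min (p $ 2) 0, p $ 2]" for p
  have \<sigma>\<sigma>: "\<sigma> * (\<sigma> * x) = x" for x using \<sigma>(1) by auto
  have TT: "T (T' p) = p" "T' (T p) = p" for p
    by (simp_all add: T_def T'_def vec2_eq_iff \<sigma>\<sigma>)
  have cT: "continuous_on UNIV T" "continuous_on UNIV T'"
    unfolding T_def T'_def by (intro continuous_on_vector2 continuous_intros)+
  have inv: "unshear \<sigma> j (shear \<sigma> j p) = p" for j p
    using \<sigma>(1) by (auto simp: shear_def unshear_def vec2_eq_iff algebra_simps)
  have 1: "has_flow_charts X1 Y1"
  proof (rule has_flow_charts_transport[OF 2, of T T'])
    show "homeomorphism UNIV UNIV T T'"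
      by (rule homeomorphismI[OF cT]) (auto simp: TT)
    show "T 0 = 0" by (simp add: T_def vec2_eq_iff)
    show "T p $ 2 = 0 \<longleftrightarrow> p $ 2 = 0" for p by (simp add: T_def)
    fix U I \<gamma> assume g: "itraj X2 Y2 U I \<gamma>"
    have "itraj X1 Y1 (T' ` U) {t. 1 * t + 0 \<in> I} (\<lambda>t. T' (\<gamma> (1 * t + 0)))"
    proof (rule itraj_transform[OF g])
      show "bounded_linear (unshear \<sigma> k)" "bounded_linear (unshear \<sigma> k')"
        unfolding unshear_def by (rule bounded_linear_lin2)+
      show up: "T' p = unshear \<sigma> k p" if "p $ 2 > 0" for p
        using that by (simp add: T'_def unshear_def vec2_eq_iff)
      show dn: "T' p = unshear \<sigma> k' p" if "p $ 2 < 0" for p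
        using that by (simp add: T'_def unshear_def vec2_eq_iff)
      show "T' p $ 2 = p $ 2" for p by (simp add: T'_def)
      show "T' p = 0 \<longleftrightarrow> p = 0" for p
        using \<sigma>(1) by (auto simp: T'_def vec2_eq_iff)
      show "X1 (T' p) = 1 *\<^sub>R unshear \<sigma> k (X2 p)" if "p $ 2 > 0" for p
        using up[OF that] by (simp add: X2_def inv)
      show "Y1 (T' p) = 1 *\<^sub>R unshear \<sigma> k' (Y2 p)" if "p $ 2 < 0" for p
        using dn[OF that] by (simp add: Y2_def inv)
    qed (use cT in auto)
    then show "itraj X1 Y1 (T' ` U) I (\<lambda>t. T' (\<gamma> t))" by simp
  qed
  show ?thesis
    by (rule has_flow_charts_cong[OF 1, of "min r r'"]) (use X1 Y1 in auto)
qed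

text \<open>Conjugation by \<open>- 1\<close> changes the sign of the derivative twice, so the
  matrix stays the same.\<close>

lemma strong_derivative_0_flip:
  assumes "strong_derivative_0 X a b c d"
  shows "strong_derivative_0 (\<lambda>p. - X (- p)) a b c d"
proof -
  have n: "norm (- X (- p) - - X (- q) - lin2 a b c d (p - q)) =
     norm (X (- p) - X (- q) - lin2 a b c d (- p - - q))" for p q
  proof -
    have "lin2 a b c d (- p - - q) = - lin2 a b c d (p - q)" by (simp add: vec2_eq_iff algebra_simps)
    then have "- X (- p) - - X (- q) - lin2 a b c d (p - q) =
      - (X (- p) - X (- q) - lin2 a b c d (- p - - q))" by simp
    then show ?thesis by (metis norm_minus_cancel)
  qed
  have m: "norm (- p - - q) = norm (p - q)" for p q :: "real^2" by (simp add: norm_minus_commute)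
  show ?thesis
    unfolding strong_derivative_0_def
  proof (intro conjI allI impI)
    show "- X (- 0) = 0" using assms by (simp add: strong_derivative_0_def)
    fix \<epsilon> :: real assume "\<epsilon> > 0"
    then obtain r where r: "r > 0" "\<And>p q. p \<in> cball 0 r \<Longrightarrow> q \<in> cball 0 r \<Longrightarrow>
        norm (X p - X q - lin2 a b c d (p - q)) \<le> \<epsilon> * norm (p - q)"
      using assms unfolding strong_derivative_0_def by meson
    have "norm (- X (- p) - - X (- q) - lin2 a b c d (p - q)) \<le> \<epsilon> * norm (p - q)"
      if "p \<in> cball 0 r" "q \<in> cball 0 r" for p q
      unfolding n using r(2)[of "- p" "- q"] that unfolding m by simp
    then show "\<exists>r>0. \<forall>p\<in>cball 0 r. \<forall>q\<in>cball 0 r.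
        norm (- X (- p) - - X (- q) - lin2 a b c d (p - q)) \<le> \<epsilon> * norm (p - q)"
      using r(1) by blast
  qed
qed

lemma flow_charts_focus_below:
  assumes X: "strong_derivative_0 X a b c d" and Y: "strong_derivative_0 Y a' b' c' d'"
    and focus: "(a' + d')\<^sup>2 < 4 * (a' * d' - b' * c')" and saddle: "a * d - b * c < 0" and cc: "c * c' > 0"
  shows "has_flow_charts X Y"
proof (rule has_flow_charts_transport[of "\<lambda>p. - Y (- p)" "\<lambda>p. - X (- p)" uminus uminus])
  show "has_flow_charts (\<lambda>p. - Y (- p)) (\<lambda>p. - X (- p))"
    using cc by (intro flow_charts_focus_above[OF strong_derivative_0_flip[OF Y] strong_derivative_0_flip[OF X] focus saddle])
      (simp add: mult.commute)
  show "homeomorphism UNIV UNIV uminus (uminus :: real^2 \<Rightarrow> real^2)"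
    by (rule homeomorphismI) (auto intro!: continuous_intros)
  fix U I \<gamma> assume "itraj (\<lambda>p. - Y (- p)) (\<lambda>p. - X (- p)) U I \<gamma>"
  from itraj_flip[OF this] show "itraj X Y (uminus ` U) I (\<lambda>t. - \<gamma> t)" by simp
qed auto

subsection \<open>Filippov trajectories and orbits in a flow chart\<close>

lemma Z_Sigma_0: "X 0 = 0 \<Longrightarrow> Y 0 = 0 \<Longrightarrow> Z_Sigma \<U> (X, Y) 0 = 0"
  by (simp add: Z_Sigma_def)

text \<open>Where both fields cross, the Filippov field is one of them, so no orbit can run along
  the switching line there.\<close>

lemma Z_Sigma_crossing: "X p $ 2 * Y p $ 2 > 0 \<Longrightarrow> Z_Sigma \<U> (X, Y) p $ 2 \<noteq> 0"
  by (auto simp: Z_Sigma_def)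

lemma nonzero_constant_sign:
  fixes f :: "real \<Rightarrow> real"
  assumes c: "continuous_on {a<..<b} f" and nz: "\<And>t. a < t \<Longrightarrow> t < b \<Longrightarrow> f t \<noteq> 0"
  shows "(\<forall>t\<in>{a<..<b}. f t > 0) \<or> (\<forall>t\<in>{a<..<b}. f t < 0)"
proof (rule ccontr)
  assume "\<not> ?thesis"
  then obtain s t where st: "s \<in> {a<..<b}" "t \<in> {a<..<b}" "f s \<le> 0" "0 \<le> f t" by (meson not_less)
  have "connected (f ` {a<..<b})" by (rule connected_continuous_image[OF c]) simp
  then have "0 \<in> f ` {a<..<b}" using st by (intro connectedD_interval[of _ "f s" "f t" 0]) auto
  then show False using nz by auto
qed

text \<open>The zeros of the ordinate serve as junction times, and between them its sign is
  constant. The equilibrium is a single piece inside the switching line, as the Filippov field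
  vanishes at the origin.\<close>

lemma itraj_imp_trajectory:
  assumes g: "itraj X Y U I \<gamma>" and U: "U \<subseteq> \<U>" and X0: "X 0 = 0" and Y0: "Y 0 = 0"
  shows "trajectory \<U> (X, Y) U I \<gamma>"
proof -
  note D = itrajD[OF g]
  have "\<exists>D. (\<forall>a b. {a..b} \<subseteq> I \<longrightarrow> finite (D \<inter> {a..b})) \<and>
          (\<forall>a b. a < b \<and> {a<..<b} \<subseteq> I - D \<longrightarrow> orbit_piece \<U> (X, Y) a b \<gamma>)"
  proof (cases "\<forall>t\<in>I. \<gamma> t = 0")
    case True
    have "orbit_piece \<U> (X, Y) a b \<gamma>" if "{a<..<b} \<subseteq> I" for a b
    proof -
      have "\<gamma> t \<in> Sigma_line \<U> \<and> (\<gamma> has_vector_derivative Z_Sigma \<U> (X, Y) (\<gamma> t)) (at t)"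
        if t: "t \<in> {a<..<b}" for t
      proof
        have tI: "t \<in> I" using t \<open>{a<..<b} \<subseteq> I\<close> by blast
        then have z: "\<gamma> t = 0" using True by blast
        have "\<gamma> t \<in> \<U>" using D(4) U tI by blast
        then show "\<gamma> t \<in> Sigma_line \<U>" using z by (simp add: Sigma_line_def)
        have "((\<lambda>t. 0) has_vector_derivative 0) (at t)" by (rule has_vector_derivative_const)
        then have "(\<gamma> has_vector_derivative 0) (at t)"
          by (rule has_vector_derivative_transform_within_open[of _ _ _ "{a<..<b}"])
            (use t True \<open>{a<..<b} \<subseteq> I\<close> in auto)
        then show "(\<gamma> has_vector_derivative Z_Sigma \<U> (X, Y) (\<gamma> t)) (at t)"
          using Z_Sigma_0[where X = X and Y = Y, OF X0 Y0] z by simp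
      qed
      then show ?thesis unfolding orbit_piece_def by blast
    qed
    then show ?thesis by (intro exI[of _ "{}"]) auto
  next
    case False
    then obtain t0 where t0: "t0 \<in> I" "\<gamma> t0 \<noteq> 0" by blast
    define E where "E = {t\<in>I. \<gamma> t $ 2 = 0}"
    have "finite (E \<inter> {a..b})" if "{a..b} \<subseteq> I" for a b
      by (rule finite_subset[OF _ D(8)[OF t0 that]]) (auto simp: E_def)
    moreover have "orbit_piece \<U> (X, Y) a b \<gamma>" if ab: "{a<..<b} \<subseteq> I - E" for a b
    proof -
      have sub: "{a<..<b} \<subseteq> I" using ab by blast
      have at: "at t within I = at t" if "t \<in> {a<..<b}" for t
        by (rule at_within_open_subset[OF that _ sub]) simp
      have "continuous_on {a<..<b} (\<lambda>t. \<gamma> t $ 2)"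
        using D(3) sub by (intro continuous_intros) (rule continuous_on_subset)
      moreover have "\<gamma> t $ 2 \<noteq> 0" if "a < t" "t < b" for t
      proof -
        have "t \<in> I - E" using ab that by auto
        then show ?thesis by (simp add: E_def)
      qed
      ultimately have "(\<forall>t\<in>{a<..<b}. \<gamma> t $ 2 > 0) \<or> (\<forall>t\<in>{a<..<b}. \<gamma> t $ 2 < 0)"
        by (rule nonzero_constant_sign)
      moreover have "\<gamma> t \<in> \<U>" if "t \<in> {a<..<b}" for t using D(4) U sub that by blast
      moreover have "(\<gamma> has_vector_derivative X (\<gamma> t)) (at t)" if "t \<in> {a<..<b}" "\<gamma> t $ 2 > 0" for t
        using D(5)[of t] that sub at[OF that(1)] by auto
      moreover have "(\<gamma> has_vector_derivative Y (\<gamma> t)) (at t)" if "t \<in> {a<..<b}" "\<gamma> t $ 2 < 0" for t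
        using D(6)[of t] that sub at[OF that(1)] by auto
      ultimately show ?thesis
        unfolding orbit_piece_def Sigma_pos_def Sigma_neg_def fst_conv snd_conv by blast
    qed
    ultimately show ?thesis by blast
  qed
  then show ?thesis unfolding trajectory_def using D(1-4) by blast
qed

lemma derivative_increment_bound:
  fixes \<gamma> :: "real \<Rightarrow> 'a::real_normed_vector"
  assumes ab: "a < b" and c: "continuous_on {a..b} \<gamma>"
    and d: "\<And>s. a < s \<Longrightarrow> s < b \<Longrightarrow> (\<gamma> has_vector_derivative F s) (at s) \<and> norm (F s - v) \<le> \<epsilon>"
  shows "norm (\<gamma> b - \<gamma> a - (b - a) *\<^sub>R v) \<le> \<epsilon> * (b - a)"
proof -
  have "norm ((\<gamma> b - b *\<^sub>R v) - (\<gamma> a - a *\<^sub>R v)) \<le> \<epsilon> * b - \<epsilon> * a"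
  proof (rule differentiable_bound_general[OF ab, where f' = "\<lambda>s. F s - v" and \<phi>' = "\<lambda>s. \<epsilon>"])
    show "continuous_on {a..b} (\<lambda>s. \<gamma> s - s *\<^sub>R v)" by (intro continuous_intros c)
    show "continuous_on {a..b} ((*) \<epsilon>)" by (intro continuous_intros)
    fix s assume s: "a < s" "s < b"
    show "((\<lambda>s. \<gamma> s - s *\<^sub>R v) has_vector_derivative F s - v) (at s)"
      using d[OF s] by (auto intro!: derivative_eq_intros)
    show "((*) \<epsilon> has_vector_derivative \<epsilon>) (at s)"
      by (auto intro!: derivative_eq_intros simp: has_real_derivative_iff_has_vector_derivative[symmetric])
    show "norm (F s - v) \<le> \<epsilon>" using d[OF s] by blast
  qed
  then show ?thesis by (simp add: algebra_simps)
qed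

text \<open>If a continuous curve has derivative \<open>F (\<gamma> s)\<close> on both sides of
  \<open>t\<close>, continuity of \<open>F\<close> along it and the mean value inequality give the
  derivative at \<open>t\<close>.\<close>

lemma removable_derivative:
  fixes \<gamma> :: "real \<Rightarrow> 'a::real_normed_vector"
  assumes I: "is_interval I" "t \<in> I" and c: "continuous_on I \<gamma>" and lim: "((\<lambda>s. F (\<gamma> s)) \<longlongrightarrow> F (\<gamma> t)) (at t within I)"
    and R: "\<And>b. b \<in> I \<Longrightarrow> t < b \<Longrightarrow> \<exists>e>0. t + e \<le> b \<and> (\<forall>s. t < s \<and> s < t + e \<longrightarrow> (\<gamma> has_vector_derivative F (\<gamma> s)) (at s))"
    and Lf: "\<And>b. b \<in> I \<Longrightarrow> b < t \<Longrightarrow> \<exists>e>0. b \<le> t - e \<and> (\<forall>s. t - e < s \<and> s < t \<longrightarrow> (\<gamma> has_vector_derivative F (\<gamma> s)) (at s))"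
  shows "(\<gamma> has_vector_derivative F (\<gamma> t)) (at t within I)"
  unfolding has_vector_derivative_def has_derivative_within_alt
proof (intro conjI allI impI)
  show "bounded_linear (\<lambda>x. x *\<^sub>R F (\<gamma> t))" by (rule bounded_linear_scaleR_left)
  fix \<epsilon> :: real assume \<epsilon>: "\<epsilon> > 0"
  obtain d where d: "d > 0" "\<And>s. s \<in> I \<Longrightarrow> s \<noteq> t \<Longrightarrow> \<bar>s - t\<bar> < d \<Longrightarrow> norm (F (\<gamma> s) - F (\<gamma> t)) < \<epsilon>"
    using lim \<epsilon> unfolding tendsto_iff eventually_at dist_norm by (auto simp: real_norm_def)
  have sub: "{a..b} \<subseteq> I" if "a \<in> I" "b \<in> I" for a b
    using that I(1) by (meson atLeastAtMost_iff mem_is_interval_1_I subsetI)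
  obtain e1 where e1: "e1 > 0" "\<And>b. b \<in> I \<Longrightarrow> t < b \<Longrightarrow> b < t + e1 \<Longrightarrow>
     norm (\<gamma> b - \<gamma> t - (b - t) *\<^sub>R F (\<gamma> t)) \<le> \<epsilon> * (b - t)"
  proof (cases "\<exists>b\<in>I. t < b")
    case True
    then obtain b0 where "b0 \<in> I" "t < b0" by blast
    from R[OF this] obtain e where e: "e > 0" "t + e \<le> b0" "\<forall>s. t < s \<and> s < t + e \<longrightarrow> (\<gamma> has_vector_derivative F (\<gamma> s)) (at s)" by blast
    show ?thesis
    proof (rule that[of "min e d"])
      fix b assume b: "b \<in> I" "t < b" "b < t + min e d"
      show "norm (\<gamma> b - \<gamma> t - (b - t) *\<^sub>R F (\<gamma> t)) \<le> \<epsilon> * (b - t)"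
      proof (rule derivative_increment_bound[OF b(2), where F = "\<lambda>s. F (\<gamma> s)"])
        show "continuous_on {t..b} \<gamma>" using c sub[OF I(2) b(1)] by (rule continuous_on_subset)
        fix s assume s: "t < s" "s < b"
        have "s \<in> I" using sub[OF I(2) b(1)] s by auto
        then show "(\<gamma> has_vector_derivative F (\<gamma> s)) (at s) \<and> norm (F (\<gamma> s) - F (\<gamma> t)) \<le> \<epsilon>"
          using e(3)[rule_format, of s] d(2)[of s] s b by (auto simp: less_imp_le)
      qed
    qed (use e d in simp)
  next
    case False
    then show ?thesis by (intro that[of 1]) auto
  qed
  obtain e2 where e2: "e2 > 0" "\<And>b. b \<in> I \<Longrightarrow> b < t \<Longrightarrow> t - e2 < b \<Longrightarrow>
     norm (\<gamma> t - \<gamma> b - (t - b) *\<^sub>R F (\<gamma> t)) \<le> \<epsilon> * (t - b)"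
  proof (cases "\<exists>b\<in>I. b < t")
    case True
    then obtain b0 where "b0 \<in> I" "b0 < t" by blast
    from Lf[OF this] obtain e where e: "e > 0" "b0 \<le> t - e" "\<forall>s. t - e < s \<and> s < t \<longrightarrow> (\<gamma> has_vector_derivative F (\<gamma> s)) (at s)" by blast
    show ?thesis
    proof (rule that[of "min e d"])
      fix b assume b: "b \<in> I" "b < t" "t - min e d < b"
      show "norm (\<gamma> t - \<gamma> b - (t - b) *\<^sub>R F (\<gamma> t)) \<le> \<epsilon> * (t - b)"
      proof (rule derivative_increment_bound[OF b(2), where F = "\<lambda>s. F (\<gamma> s)"])
        show "continuous_on {b..t} \<gamma>" using c sub[OF b(1) I(2)] by (rule continuous_on_subset)
        fix s assume s: "b < s" "s < t"
        have "s \<in> I" using sub[OF b(1) I(2)] s by auto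
        then show "(\<gamma> has_vector_derivative F (\<gamma> s)) (at s) \<and> norm (F (\<gamma> s) - F (\<gamma> t)) \<le> \<epsilon>"
          using e(3)[rule_format, of s] d(2)[of s] s b by (auto simp: less_imp_le)
      qed
    qed (use e d in simp)
  next
    case False
    then show ?thesis by (intro that[of 1]) auto
  qed
  show "\<exists>d>0. \<forall>y\<in>I. norm (y - t) < d \<longrightarrow> norm (\<gamma> y - \<gamma> t - (y - t) *\<^sub>R F (\<gamma> t)) \<le> \<epsilon> * norm (y - t)"
  proof (intro exI[of _ "min e1 e2"] conjI ballI impI)
    fix y assume y: "y \<in> I" "norm (y - t) < min e1 e2"
    consider "y = t" | "t < y" | "y < t" by linarith
    then show "norm (\<gamma> y - \<gamma> t - (y - t) *\<^sub>R F (\<gamma> t)) \<le> \<epsilon> * norm (y - t)"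
    proof cases
      case 2 then show ?thesis using e1(2)[OF y(1)] y by simp
    next
      case 3
      have "\<gamma> y - \<gamma> t - (y - t) *\<^sub>R F (\<gamma> t) = - (\<gamma> t - \<gamma> y - (t - y) *\<^sub>R F (\<gamma> t))" by (simp add: algebra_simps)
      then have "norm (\<gamma> y - \<gamma> t - (y - t) *\<^sub>R F (\<gamma> t)) = norm (\<gamma> t - \<gamma> y - (t - y) *\<^sub>R F (\<gamma> t))"
        by (metis norm_minus_cancel)
      then show ?thesis using e2(2)[OF y(1)] y 3 by simp
    qed simp
  qed (use e1 e2 in simp)
qed

lemma trajectory_imp_itraj:
  assumes tr: "trajectory \<U> (X, Y) U I \<gamma>" and zU: "0 \<in> U" and X0: "X 0 = 0" and Y0: "Y 0 = 0"
    and lX: "\<And>p q. p \<in> U \<Longrightarrow> q \<in> U \<Longrightarrow> norm (X p - X q) \<le> L * norm (p - q)"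
    and lY: "\<And>p q. p \<in> U \<Longrightarrow> q \<in> U \<Longrightarrow> norm (Y p - Y q) \<le> L * norm (p - q)"
    and cross: "\<And>p. p \<in> U \<Longrightarrow> p $ 2 = 0 \<Longrightarrow> p \<noteq> 0 \<Longrightarrow> X p $ 2 * Y p $ 2 > 0"
  shows "itraj X Y U I \<gamma>"
proof -
  have I: "is_interval I" "I \<noteq> {}" and c: "continuous_on I \<gamma>" and im: "\<gamma> ` I \<subseteq> U"
    using tr by (auto simp: trajectory_def)
  obtain D where D: "\<And>a b. {a..b} \<subseteq> I \<Longrightarrow> finite (D \<inter> {a..b})"
      "\<And>a b. a < b \<Longrightarrow> {a<..<b} \<subseteq> I - D \<Longrightarrow> orbit_piece \<U> (X, Y) a b \<gamma>"
    using tr unfolding trajectory_def by blast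
  have sub: "{a..b} \<subseteq> I" if "a \<in> I" "b \<in> I" for a b
    using that I(1) by (meson atLeastAtMost_iff mem_is_interval_1_I subsetI)
  have cX: "continuous_on U X" and cY: "continuous_on U Y"
    using norm_Lipschitz_continuous_on[of U X L] norm_Lipschitz_continuous_on[of U Y L] lX lY by blast+
  define up where "up a b \<longleftrightarrow> (\<forall>t. a < t \<and> t < b \<longrightarrow> \<gamma> t $ 2 > 0 \<and> (\<gamma> has_vector_derivative X (\<gamma> t)) (at t))" for a b
  define down where "down a b \<longleftrightarrow> (\<forall>t. a < t \<and> t < b \<longrightarrow> \<gamma> t $ 2 < 0 \<and> (\<gamma> has_vector_derivative Y (\<gamma> t)) (at t))" for a b
  define rest where "rest a b \<longleftrightarrow> (\<forall>t. a < t \<and> t < b \<longrightarrow> \<gamma> t = 0)" for a b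
  have piece: "up a b \<or> down a b \<or> rest a b" if ab: "a < b" "{a<..<b} \<subseteq> I - D" for a b
  proof -
    \<comment> \<open>The ordinate is constant on the piece, while the Filippov field has a vertical
      component at every crossing point; only the origin remains.\<close>
    have "rest a b" if s: "\<forall>t\<in>{a<..<b}. \<gamma> t \<in> Sigma_line \<U> \<and> (\<gamma> has_vector_derivative Z_Sigma \<U> (X, Y) (\<gamma> t)) (at t)"
      unfolding rest_def
    proof (intro allI impI)
      fix t assume t: "a < t \<and> t < b"
      have "(\<gamma> has_vector_derivative Z_Sigma \<U> (X, Y) (\<gamma> t)) (at t)" using s t by auto
      then have "((\<lambda>s. \<gamma> s $ 2) has_real_derivative Z_Sigma \<U> (X, Y) (\<gamma> t) $ 2) (at t)"
        unfolding has_real_derivative_iff_has_vector_derivative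
        by (rule bounded_linear.has_vector_derivative[OF bounded_linear_vec_nth])
      moreover have "((\<lambda>s. \<gamma> s $ 2) has_real_derivative 0) (at t)"
      proof (rule has_field_derivative_transform_within_open[of "\<lambda>_. 0" _ _ "{a<..<b}"])
        show "0 = \<gamma> y $ 2" if "y \<in> {a<..<b}" for y using s that by (auto simp: Sigma_line_def)
      qed (use t in auto)
      ultimately have "Z_Sigma \<U> (X, Y) (\<gamma> t) $ 2 = 0" by (rule DERIV_unique)
      then have "\<not> X (\<gamma> t) $ 2 * Y (\<gamma> t) $ 2 > 0" using Z_Sigma_crossing by metis
      moreover have "t \<in> I" using ab(2) t by (auto dest: subsetD)
      then have "\<gamma> t \<in> U" using im by blast
      moreover have "\<gamma> t $ 2 = 0" using s t by (auto simp: Sigma_line_def)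
      ultimately show "\<gamma> t = 0" using cross by blast
    qed
    then show ?thesis
      using D(2)[OF ab] unfolding orbit_piece_def up_def down_def Sigma_pos_def Sigma_neg_def by auto
  qed
  have right: "\<exists>e>0. t + e \<le> b \<and> (up t (t + e) \<or> down t (t + e) \<or> rest t (t + e))"
    if t: "t \<in> I" "b \<in> I" "t < b" for t b
  proof -
    have fin: "finite (D \<inter> {t..b})" using D(1) sub t by blast
    obtain e where e: "e > 0" "\<forall>s\<in>D \<inter> {t..b}. s \<noteq> t \<longrightarrow> e \<le> dist t s" using finite_set_avoid[OF fin, of t] by blast
    define e' where "e' = min e (b - t)"
    have "{t<..<t + e'} \<subseteq> I - D"
    proof
      fix s assume s: "s \<in> {t<..<t + e'}"
      then have sb: "s \<in> {t..b}" by (auto simp: e'_def)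
      then have "s \<in> I" using sub[OF t(1,2)] by blast
      moreover have "s \<notin> D" using e(2)[rule_format, of s] sb s by (auto simp: e'_def dist_real_def)
      ultimately show "s \<in> I - D" by blast
    qed
    then show ?thesis using piece[of t "t + e'"] e(1) t by (intro exI[of _ e']) (auto simp: e'_def)
  qed
  have left: "\<exists>e>0. b \<le> t - e \<and> (up (t - e) t \<or> down (t - e) t \<or> rest (t - e) t)"
    if t: "t \<in> I" "b \<in> I" "b < t" for t b
  proof -
    have fin: "finite (D \<inter> {b..t})" using D(1) sub t by blast
    obtain e where e: "e > 0" "\<forall>s\<in>D \<inter> {b..t}. s \<noteq> t \<longrightarrow> e \<le> dist t s" using finite_set_avoid[OF fin, of t] by blast
    define e' where "e' = min e (t - b)"
    have "{t - e'<..<t} \<subseteq> I - D"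
    proof
      fix s assume s: "s \<in> {t - e'<..<t}"
      then have sb: "s \<in> {b..t}" by (auto simp: e'_def)
      then have "s \<in> I" using sub[OF t(2,1)] by blast
      moreover have "s \<notin> D" using e(2)[rule_format, of s] sb s by (auto simp: e'_def dist_real_def)
      ultimately show "s \<in> I - D" by blast
    qed
    then show ?thesis using piece[of "t - e'" t] e(1) t by (intro exI[of _ e']) (auto simp: e'_def)
  qed
  \<comment> \<open>Gronwall against the constant solution 0: a piece off the line that starts at
    the origin would have to stay there.\<close>
  have zero_right: "\<gamma> b = 0"
    if ab: "a < b" "{a..b} \<subseteq> I" and z: "\<gamma> a = 0"
      and F: "F = X \<or> F = Y" "\<And>s. a < s \<Longrightarrow> s < b \<Longrightarrow> (\<gamma> has_vector_derivative F (\<gamma> s)) (at s)" for a b F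
  proof -
    have "norm (\<gamma> b - 0) \<le> exp (L * (b - a)) * norm (\<gamma> a - 0)"
    proof (rule Gronwall_Lipschitz[where u' = "\<lambda>s. F (\<gamma> s)" and v = "\<lambda>_. 0" and v' = "\<lambda>_. 0"])
      fix s assume s: "a < s" "s < b"
      then have "s \<in> {a..b}" by simp
      then have "\<gamma> s \<in> U" using ab im by blast
      then show "norm (F (\<gamma> s) - 0) \<le> L * norm (\<gamma> s - 0)"
        using F(1) lX[of "\<gamma> s" 0] lY[of "\<gamma> s" 0] zU X0 Y0 by auto
    qed (use ab F c in \<open>auto intro: continuous_on_subset\<close>)
    then show ?thesis using z by simp
  qed
  have zero_left: "\<gamma> a = 0"
    if ab: "a < b" "{a..b} \<subseteq> I" and z: "\<gamma> b = 0"
      and F: "F = X \<or> F = Y" "\<And>s. a < s \<Longrightarrow> s < b \<Longrightarrow> (\<gamma> has_vector_derivative F (\<gamma> s)) (at s)" for a b F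
  proof -
    have "norm (\<gamma> a - 0) \<le> exp (L * (b - a)) * norm (\<gamma> b - 0)"
    proof (rule Gronwall_Lipschitz_backward[where u' = "\<lambda>s. F (\<gamma> s)" and v = "\<lambda>_. 0" and v' = "\<lambda>_. 0"])
      fix s assume s: "a < s" "s < b"
      then have "s \<in> {a..b}" by simp
      then have "\<gamma> s \<in> U" using ab im by blast
      then show "norm (F (\<gamma> s) - 0) \<le> L * norm (\<gamma> s - 0)"
        using F(1) lX[of "\<gamma> s" 0] lY[of "\<gamma> s" 0] zU X0 Y0 by auto
    qed (use ab F c in \<open>auto intro: continuous_on_subset\<close>)
    then show ?thesis using z by simp
  qed
  have rest_right: "\<exists>e>0. \<forall>s\<in>I. t \<le> s \<and> s < t + e \<longrightarrow> \<gamma> s = 0" if t: "t \<in> I" "\<gamma> t = 0" for t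
  proof (cases "\<exists>b\<in>I. t < b")
    case True
    then obtain b where b: "b \<in> I" "t < b" by blast
    obtain e where e: "e > 0" "t + e \<le> b" "up t (t + e) \<or> down t (t + e) \<or> rest t (t + e)"
      using right[OF t(1) b] by blast
    have m: "t < t + e / 2" "{t..t + e / 2} \<subseteq> I" using e sub[OF t(1) b(1)] by auto
    have "\<not> up t (t + e)"
    proof
      assume u: "up t (t + e)"
      have "\<gamma> (t + e / 2) = 0" by (rule zero_right[OF m t(2), of X]) (use u e in \<open>auto simp: up_def\<close>)
      moreover have "\<gamma> (t + e / 2) $ 2 > 0" using u e(1) by (simp add: up_def)
      ultimately show False by simp
    qed
    moreover have "\<not> down t (t + e)"
    proof
      assume u: "down t (t + e)"
      have "\<gamma> (t + e / 2) = 0" by (rule zero_right[OF m t(2), of Y]) (use u e in \<open>auto simp: down_def\<close>)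
      moreover have "\<gamma> (t + e / 2) $ 2 < 0" using u e(1) by (simp add: down_def)
      ultimately show False by simp
    qed
    ultimately have "rest t (t + e)" using e by blast
    then show ?thesis using e(1) t(2) by (intro exI[of _ e]) (auto simp: rest_def less_le)
  next
    case False
    then show ?thesis using t(2) by (intro exI[of _ 1]) (force simp: not_less)
  qed
  have rest_left: "\<exists>e>0. \<forall>s\<in>I. s \<le> t \<and> t - e < s \<longrightarrow> \<gamma> s = 0" if t: "t \<in> I" "\<gamma> t = 0" for t
  proof (cases "\<exists>b\<in>I. b < t")
    case True
    then obtain b where b: "b \<in> I" "b < t" by blast
    obtain e where e: "e > 0" "b \<le> t - e" "up (t - e) t \<or> down (t - e) t \<or> rest (t - e) t"
      using left[OF t(1) b] by blast
    have m: "t - e / 2 < t" "{t - e / 2..t} \<subseteq> I" using e sub[OF b(1) t(1)] by auto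
    have "\<not> up (t - e) t"
    proof
      assume u: "up (t - e) t"
      have "\<gamma> (t - e / 2) = 0" by (rule zero_left[OF m t(2), of X]) (use u e in \<open>auto simp: up_def\<close>)
      moreover have "\<gamma> (t - e / 2) $ 2 > 0" using u e(1) by (simp add: up_def)
      ultimately show False by simp
    qed
    moreover have "\<not> down (t - e) t"
    proof
      assume u: "down (t - e) t"
      have "\<gamma> (t - e / 2) = 0" by (rule zero_left[OF m t(2), of Y]) (use u e in \<open>auto simp: down_def\<close>)
      moreover have "\<gamma> (t - e / 2) $ 2 < 0" using u e(1) by (simp add: down_def)
      ultimately show False by simp
    qed
    ultimately have "rest (t - e) t" using e by blast
    then show ?thesis using e(1) t(2) by (intro exI[of _ e]) (auto simp: rest_def le_less)
  next
    case False
    then show ?thesis using t(2) by (intro exI[of _ 1]) (force simp: not_less)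
  qed
  \<comment> \<open>Closed by continuity and open by \<open>rest_right\<close> and
    \<open>rest_left\<close>, so the curve is either constantly 0 or never 0.\<close>
  define K where "K = {t\<in>I. \<gamma> t = 0}"
  have "closedin (top_of_set I) K" unfolding K_def by (rule continuous_closedin_preimage_constant[OF c])
  moreover have "openin (top_of_set I) K"
    unfolding openin_euclidean_subtopology_iff
  proof (intro conjI ballI)
    show "K \<subseteq> I" by (auto simp: K_def)
    fix t assume "t \<in> K"
    then have t: "t \<in> I" "\<gamma> t = 0" by (auto simp: K_def)
    obtain e1 where e1: "e1 > 0" "\<forall>s\<in>I. t \<le> s \<and> s < t + e1 \<longrightarrow> \<gamma> s = 0" using rest_right[OF t] by blast
    obtain e2 where e2: "e2 > 0" "\<forall>s\<in>I. s \<le> t \<and> t - e2 < s \<longrightarrow> \<gamma> s = 0" using rest_left[OF t] by blast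
    show "\<exists>e>0. \<forall>s\<in>I. dist s t < e \<longrightarrow> s \<in> K"
    proof (intro exI[of _ "min e1 e2"] conjI ballI impI)
      fix s assume s: "s \<in> I" "dist s t < min e1 e2"
      show "s \<in> K"
        using e1(2)[rule_format, of s] e2(2)[rule_format, of s] s
        by (cases "t \<le> s") (auto simp: K_def dist_real_def)
    qed (use e1 e2 in simp)
  qed
  moreover have "connected I" using I(1) by (simp add: is_interval_connected_1)
  ultimately have K: "K = {} \<or> K = I" by (auto simp: connected_clopen)
  show ?thesis
  proof (cases "K = I")
    case True
    then have z: "\<gamma> t = 0" if "t \<in> I" for t using that by (auto simp: K_def)
    show ?thesis unfolding itraj_def using I c im z by auto
  next
    case False
    then have nz: "\<gamma> t \<noteq> 0" if "t \<in> I" for t using K that by (auto simp: K_def)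
    have nrest: "\<not> rest a b" if "a < b" "{a..b} \<subseteq> I" for a b
    proof
      assume "rest a b"
      then have "\<gamma> ((a + b) / 2) = 0" using that(1) by (auto simp: rest_def)
      moreover have "(a + b) / 2 \<in> I" using that by (intro subsetD[OF that(2)]) auto
      ultimately show False using nz by blast
    qed
    \<comment> \<open>An interior zero of the ordinate outside \<open>D\<close> would lie inside a
      piece, and only resting pieces contain zeros.\<close>
    have fin: "finite {t\<in>{a..b}. \<gamma> t $ 2 = 0}" if ab: "{a..b} \<subseteq> I" for a b
    proof (rule finite_subset[of _ "(D \<inter> {a..b}) \<union> {a, b}"])
      show "finite ((D \<inter> {a..b}) \<union> {a, b})" using D(1)[OF ab] by simp
      show "{t\<in>{a..b}. \<gamma> t $ 2 = 0} \<subseteq> (D \<inter> {a..b}) \<union> {a, b}"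
      proof (rule subsetI, rule ccontr)
        fix t assume t: "t \<in> {t\<in>{a..b}. \<gamma> t $ 2 = 0}" "t \<notin> (D \<inter> {a..b}) \<union> {a, b}"
        then have t': "a < t" "t < b" "\<gamma> t $ 2 = 0" "t \<notin> D" by auto
        obtain e where e: "e > 0" "\<forall>s\<in>D \<inter> {a..b}. s \<noteq> t \<longrightarrow> e \<le> dist t s"
          using finite_set_avoid[OF D(1)[OF ab], of t] by blast
        define e' where "e' = min e (min (t - a) (b - t))"
        have e': "e' > 0" using e t' by (simp add: e'_def)
        have s1: "{t - e'<..<t + e'} \<subseteq> {a..b}" by (auto simp: e'_def)
        have "{t - e'<..<t + e'} \<subseteq> I - D"
        proof
          fix s assume s: "s \<in> {t - e'<..<t + e'}"
          then have sb: "s \<in> {a..b}" using s1 by blast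
          then have "s \<in> I" using ab by blast
          moreover have "s \<notin> D"
            using e(2)[rule_format, of s] sb s t'(4) by (cases "s = t") (auto simp: e'_def dist_real_def)
          ultimately show "s \<in> I - D" by blast
        qed
        then have "up (t - e') (t + e') \<or> down (t - e') (t + e') \<or> rest (t - e') (t + e')"
          using piece[of "t - e'" "t + e'"] e' by auto
        moreover have "\<gamma> t \<noteq> 0" using ab t' by (intro nz) auto
        ultimately show False
          using e' t'(3) by (auto simp: up_def down_def rest_def dest: spec[of _ t])
      qed
    qed
    have near: "\<exists>e>0. \<forall>s\<in>I. \<bar>s - t\<bar> < e \<longrightarrow> \<sigma> * \<gamma> s $ 2 > 0" if t: "t \<in> I" "\<sigma> * \<gamma> t $ 2 > 0" for t \<sigma>
    proof -
      have "continuous_on I (\<lambda>s. \<sigma> * \<gamma> s $ 2)" by (intro continuous_intros c)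
      then have "\<forall>\<^sub>F s in at t within I. \<sigma> * \<gamma> s $ 2 > 0"
        using t by (intro order_tendstoD(1)[where y="\<sigma> * \<gamma> t $ 2"]) (auto simp: continuous_on_def)
      then obtain d where "d>0" "\<forall>s\<in>I. s \<noteq> t \<and> dist s t < d \<longrightarrow> \<sigma> * \<gamma> s $ 2 > 0"
        by (auto simp: eventually_at)
      then show ?thesis using t(2) by (intro exI[of _ d]) (auto simp: dist_real_def)
    qed
    \<comment> \<open>Near \<open>t\<close> the sign of the ordinate admits one kind of piece only,
      before as well as after \<open>t\<close>; the gap at \<open>t\<close> is closed by
      \<open>removable_derivative\<close>.\<close>
    have deriv: "(\<gamma> has_vector_derivative F (\<gamma> t)) (at t within I)"
      if t: "t \<in> I" "\<sigma> * \<gamma> t $ 2 > 0" and F: "\<sigma> = 1 \<and> F = X \<or> \<sigma> = -1 \<and> F = Y" for t \<sigma> F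
    proof -
      obtain d where d: "d > 0" "\<forall>s\<in>I. \<bar>s - t\<bar> < d \<longrightarrow> \<sigma> * \<gamma> s $ 2 > 0" using near[OF t] by blast
      have good: "(\<gamma> has_vector_derivative F (\<gamma> s)) (at s)"
        if ab: "a < b" "{a..b} \<subseteq> I" "t - d < a" "b < t + d" "up a b \<or> down a b \<or> rest a b" and s: "a < s" "s < b" for a b s
      proof -
        have "\<not> rest a b" by (rule nrest[OF ab(1,2)])
        moreover have "\<sigma> * \<gamma> s $ 2 > 0" using d(2)[rule_format, of s] ab s by (auto simp: subset_iff)
        ultimately show ?thesis using ab(5) s F by (auto simp: up_def down_def)
      qed
      show ?thesis
      proof (rule removable_derivative[OF I(1) t(1) c])
        have "continuous_on I (\<lambda>s. F (\<gamma> s))"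
          using F cX cY im by (auto intro!: continuous_on_compose2[OF _ c])
        then show "((\<lambda>s. F (\<gamma> s)) \<longlongrightarrow> F (\<gamma> t)) (at t within I)" using t(1) by (simp add: continuous_on_def)
        fix b assume b: "b \<in> I"
        {
          assume tb: "t < b"
          obtain e where e: "e > 0" "t + e \<le> b" "up t (t + e) \<or> down t (t + e) \<or> rest t (t + e)"
            using right[OF t(1) b tb] by blast
          define e' where "e' = min e (d / 2)"
          have e': "e' > 0" "e' \<le> e" "e' < d" using e(1) d(1) by (auto simp: e'_def)
          have "{t..t + e'} \<subseteq> {t..b}" using e' e(2) by auto
          then have si: "{t..t + e'} \<subseteq> I" using sub[OF t(1) b] by blast
          have "up t (t + e') \<or> down t (t + e') \<or> rest t (t + e')"
            using e(3) e' by (auto simp: up_def down_def rest_def)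
          then have "(\<gamma> has_vector_derivative F (\<gamma> s)) (at s)" if "t < s" "s < t + e'" for s
            using good[of t "t + e'" s] e' si d(1) that by simp
          then show "\<exists>e>0. t + e \<le> b \<and> (\<forall>s. t < s \<and> s < t + e \<longrightarrow> (\<gamma> has_vector_derivative F (\<gamma> s)) (at s))"
            using e' e(2) by (intro exI[of _ e']) auto
        }
        {
          assume tb: "b < t"
          obtain e where e: "e > 0" "b \<le> t - e" "up (t - e) t \<or> down (t - e) t \<or> rest (t - e) t"
            using left[OF t(1) b tb] by blast
          define e' where "e' = min e (d / 2)"
          have e': "e' > 0" "e' \<le> e" "e' < d" using e(1) d(1) by (auto simp: e'_def)
          have "{t - e'..t} \<subseteq> {b..t}" using e' e(2) by auto
          then have si: "{t - e'..t} \<subseteq> I" using sub[OF b t(1)] by blast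
          have "up (t - e') t \<or> down (t - e') t \<or> rest (t - e') t"
            using e(3) e' by (auto simp: up_def down_def rest_def)
          then have "(\<gamma> has_vector_derivative F (\<gamma> s)) (at s)" if "t - e' < s" "s < t" for s
            using good[of "t - e'" t s] e' si d(1) that by simp
          then show "\<exists>e>0. b \<le> t - e \<and> (\<forall>s. t - e < s \<and> s < t \<longrightarrow> (\<gamma> has_vector_derivative F (\<gamma> s)) (at s))"
            using e' e(2) by (intro exI[of _ e']) auto
        }
      qed
    qed
    show ?thesis
      unfolding itraj_def
    proof (intro conjI disjI2)
      show "\<forall>t\<in>I. \<gamma> t $ 2 > 0 \<longrightarrow> (\<gamma> has_vector_derivative X (\<gamma> t)) (at t within I)" using deriv[of _ 1 X] by simp
      show "\<forall>t\<in>I. \<gamma> t $ 2 < 0 \<longrightarrow> (\<gamma> has_vector_derivative Y (\<gamma> t)) (at t within I)" using deriv[of _ "-1" Y] by simp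
    qed (use I c im nz fin in auto)
  qed
qed

section \<open>Maximal orbits in a flow chart\<close>

definition max_itraj ::
    "(real^2 \<Rightarrow> real^2) \<Rightarrow> (real^2 \<Rightarrow> real^2) \<Rightarrow> (real^2) set \<Rightarrow> real set \<Rightarrow> (real \<Rightarrow> real^2) \<Rightarrow> bool" where
  "max_itraj X Y U I \<gamma> \<longleftrightarrow> itraj X Y U I \<gamma> \<and>
     (\<forall>J \<delta>. itraj X Y U J \<delta> \<and> I \<subseteq> J \<and> (\<forall>t\<in>I. \<delta> t = \<gamma> t) \<longrightarrow> J = I)"

text \<open>The orbits other than the equilibrium in chart coordinates, with height \<open>c\<close>
  and range of abscissae \<open>S\<close>; height 0 carries two of them, the separatrices.\<close>

definition segment :: "real \<Rightarrow> real \<Rightarrow> real set \<Rightarrow> bool" where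
  "segment a c S \<longleftrightarrow> \<bar>c\<bar> < a \<and>
     (c \<noteq> 0 \<and> S = {-a<..<a} \<or> c = 0 \<and> S = {-a<..<0} \<or> c = 0 \<and> S = {0<..<a})"

lemma segment_cases:
  assumes "q \<in> square a" "q \<noteq> 0"
  shows "\<exists>S. segment a (q $ 2) S \<and> q $ 1 \<in> S"
proof -
  have q: "\<bar>q $ 1\<bar> < a" "\<bar>q $ 2\<bar> < a" using assms by (auto simp: square_def)
  have "q $ 1 \<noteq> 0 \<or> q $ 2 \<noteq> 0" using assms(2) by (auto simp: vec2_eq_iff)
  then have "q $ 2 \<noteq> 0 \<or> q $ 2 = 0 \<and> q $ 1 < 0 \<or> q $ 2 = 0 \<and> q $ 1 > 0" by arith
  then show ?thesis
  proof (elim disjE conjE)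
    assume "q $ 2 \<noteq> 0"
    then show ?thesis using q by (intro exI[of _ "{-a<..<a}"]) (simp add: segment_def abs_less_iff)
  next
    assume "q $ 2 = 0" "q $ 1 < 0"
    then show ?thesis using q by (intro exI[of _ "{-a<..<0}"]) (simp add: segment_def abs_less_iff)
  next
    assume "q $ 2 = 0" "q $ 1 > 0"
    then show ?thesis using q by (intro exI[of _ "{0<..<a}"]) (simp add: segment_def abs_less_iff)
  qed
qed

text \<open>Besides the chart only uniqueness enters, so the description of the maximal orbits does
  not look at the fields again.\<close>

locale orbit_chart =
  fixes X Y a U \<Phi> \<Phi>'
  assumes chart: "flow_chart X Y a U \<Phi> \<Phi>'"
    and uniq: "\<And>I J \<gamma> \<delta> t0 t. itraj X Y U I \<gamma> \<Longrightarrow> itraj X Y U J \<delta> \<Longrightarrow> t0 \<in> I \<Longrightarrow> t0 \<in> J \<Longrightarrow>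
      \<gamma> t0 = \<delta> t0 \<Longrightarrow> t \<in> I \<Longrightarrow> t \<in> J \<Longrightarrow> \<gamma> t = \<delta> t"
begin

lemma hom: "homeomorphism U (square a) \<Phi> \<Phi>'" and zU: "0 \<in> U" and \<Phi>0: "\<Phi> 0 = 0"
  using chart by (auto simp: flow_chart_def)

lemma \<Phi>_sq: "p \<in> U \<Longrightarrow> \<Phi> p \<in> square a"
  and \<Phi>'_U: "q \<in> square a \<Longrightarrow> \<Phi>' q \<in> U"
  and \<Phi>'\<Phi>: "p \<in> U \<Longrightarrow> \<Phi>' (\<Phi> p) = p"
  and \<Phi>\<Phi>': "q \<in> square a \<Longrightarrow> \<Phi> (\<Phi>' q) = q"
  using hom by (auto simp: homeomorphism_def)

lemma \<Phi>_inj: "p \<in> U \<Longrightarrow> q \<in> U \<Longrightarrow> \<Phi> p = \<Phi> q \<Longrightarrow> p = q"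
  using \<Phi>'\<Phi> by metis

definition pt :: "real \<Rightarrow> real \<Rightarrow> real^2" where
  "pt c s = \<Phi>' (vector [s, c])"

lemma pt:
  assumes "segment a c S" "s \<in> S"
  shows "pt c s \<in> U" "\<Phi> (pt c s) $ 1 = s" "\<Phi> (pt c s) $ 2 = c" "pt c s \<noteq> 0"
proof -
  have "vector [s, c] \<in> square a" using assms by (auto simp: segment_def square_def)
  then show 1: "pt c s \<in> U" "\<Phi> (pt c s) $ 1 = s" "\<Phi> (pt c s) $ 2 = c"
    using \<Phi>'_U \<Phi>\<Phi>' by (auto simp: pt_def)
  have "s \<noteq> 0 \<or> c \<noteq> 0" using assms by (auto simp: segment_def)
  then show "pt c s \<noteq> 0" using 1(2,3) \<Phi>0 by auto
qed

lemma pt_\<Phi>: "p \<in> U \<Longrightarrow> pt (\<Phi> p $ 2) (\<Phi> p $ 1) = p"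
proof -
  assume p: "p \<in> U"
  have "vector [\<Phi> p $ 1, \<Phi> p $ 2] = \<Phi> p" by (simp add: vec2_eq_iff)
  then show ?thesis using \<Phi>'\<Phi>[OF p] by (simp add: pt_def)
qed

definition arc :: "real \<Rightarrow> real \<Rightarrow> real \<Rightarrow> real \<Rightarrow> (real \<Rightarrow> real^2) \<Rightarrow> bool" where
  "arc c s s' T \<gamma> \<longleftrightarrow> 0 \<le> T \<and> itraj X Y U {0..T} \<gamma> \<and> \<gamma> 0 = pt c s \<and> \<gamma> T = pt c s' \<and>
     (\<forall>t\<in>{0..T}. \<Phi> (\<gamma> t) $ 2 = c) \<and> strict_mono_on {0..T} (\<lambda>t. \<Phi> (\<gamma> t) $ 1)"

lemma arc_exists:
  assumes S: "segment a c S" and s: "s \<in> S" "s' \<in> S" "s < s'"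
  shows "\<exists>T \<gamma>. arc c s s' T \<gamma>"
proof -
  have "connected_by X Y U \<Phi> (pt c s) (pt c s')"
  proof -
    have "c = 0 \<longrightarrow> s * s' > 0" using S s by (auto simp: segment_def mult_neg_neg)
    then show ?thesis
      using chart pt[OF S s(1)] pt[OF S s(2)] s(3) unfolding flow_chart_def by (metis (no_types, lifting))
  qed
  then show ?thesis using pt[OF S s(1)] unfolding connected_by_def arc_def by metis
qed

text \<open>The shorter arc agrees with the longer one, which would then visit its end point twice,
  against strict monotonicity of the abscissa.\<close>

lemma arc_unique:
  assumes "arc c s s' T \<gamma>" "arc c s s' T' \<gamma>'"
  shows "T = T'"
proof -
  have main: "\<not> T < T'" if A: "arc c s s' T \<gamma>" "arc c s s' T' \<gamma>'" for T T' \<gamma> \<gamma>'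
  proof
    assume lt: "T < T'"
    have 1: "0 \<le> T" "itraj X Y U {0..T} \<gamma>" "\<gamma> 0 = pt c s" "\<gamma> T = pt c s'" using A(1) by (auto simp: arc_def)
    have 2: "itraj X Y U {0..T'} \<gamma>'" "\<gamma>' 0 = pt c s" "\<gamma>' T' = pt c s'"
      "strict_mono_on {0..T'} (\<lambda>t. \<Phi> (\<gamma>' t) $ 1)" using A(2) by (auto simp: arc_def)
    have "\<gamma> T = \<gamma>' T" by (rule uniq[OF 1(2) 2(1), of 0]) (use 1 2 lt in auto)
    then show False using strict_mono_onD[OF 2(4), of T T'] 1 2 lt by auto
  qed
  show ?thesis using main[OF assms] main[OF assms(2,1)] by simp
qed

lemma arc_inner:
  assumes A: "arc c s s' T \<gamma>" and S: "segment a c S" and s: "s \<in> S" "s' \<in> S" and r: "0 \<le> r" "r \<le> T"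
  shows "\<Phi> (\<gamma> r) $ 1 \<in> {s..s'}" "\<gamma> r = pt c (\<Phi> (\<gamma> r) $ 1)" "arc c s (\<Phi> (\<gamma> r) $ 1) r \<gamma>"
    "arc c (\<Phi> (\<gamma> r) $ 1) s' (T - r) (\<lambda>t. \<gamma> (t + r))"
proof -
  have A': "0 \<le> T" "itraj X Y U {0..T} \<gamma>" "\<gamma> 0 = pt c s" "\<gamma> T = pt c s'"
     "\<And>t. t \<in> {0..T} \<Longrightarrow> \<Phi> (\<gamma> t) $ 2 = c" "strict_mono_on {0..T} (\<lambda>t. \<Phi> (\<gamma> t) $ 1)"
    using A by (auto simp: arc_def)
  have "mono_on {0..T} (\<lambda>t. \<Phi> (\<gamma> t) $ 1)" using A'(6) by (rule strict_mono_on_imp_mono_on)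
  then show "\<Phi> (\<gamma> r) $ 1 \<in> {s..s'}"
    using mono_onD[of "{0..T}" "\<lambda>t. \<Phi> (\<gamma> t) $ 1" 0 r] mono_onD[of "{0..T}" "\<lambda>t. \<Phi> (\<gamma> t) $ 1" r T]
      pt[OF S s(1)] pt[OF S s(2)] A' r by auto
  have rU: "\<gamma> r \<in> U" using itrajD(4)[OF A'(2)] r by auto
  show e: "\<gamma> r = pt c (\<Phi> (\<gamma> r) $ 1)" using pt_\<Phi>[OF rU] A'(5)[of r] r by simp
  have i1: "itraj X Y U {0..r} \<gamma>" by (rule itraj_subinterval[OF A'(2)]) (use r in \<open>auto simp: is_interval_cc\<close>)
  have m1: "strict_mono_on {0..r} (\<lambda>t. \<Phi> (\<gamma> t) $ 1)" by (rule monotone_on_subset[OF A'(6)]) (use r in auto)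
  have c1: "\<forall>t\<in>{0..r}. \<Phi> (\<gamma> t) $ 2 = c" using A'(5) r by auto
  show "arc c s (\<Phi> (\<gamma> r) $ 1) r \<gamma>" unfolding arc_def using i1 m1 c1 A'(3) e r(1) by blast
  have i2: "itraj X Y U {0..T - r} (\<lambda>t. \<gamma> (t + r))"
    by (rule itraj_subinterval[OF itraj_shift[OF A'(2), of r]]) (use r in \<open>auto simp: is_interval_cc\<close>)
  have m2: "strict_mono_on {0..T - r} (\<lambda>t. \<Phi> (\<gamma> (t + r)) $ 1)"
  proof (rule strict_mono_onI)
    fix x y assume "x \<in> {0..T - r}" "y \<in> {0..T - r}" "x < y"
    then show "\<Phi> (\<gamma> (x + r)) $ 1 < \<Phi> (\<gamma> (y + r)) $ 1"
      using strict_mono_onD[OF A'(6), of "x + r" "y + r"] r by simp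
  qed
  have c2: "\<forall>t\<in>{0..T - r}. \<Phi> (\<gamma> (t + r)) $ 2 = c" using A'(5) r by auto
  show "arc c (\<Phi> (\<gamma> r) $ 1) s' (T - r) (\<lambda>t. \<gamma> (t + r))"
    unfolding arc_def using i2 m2 c2 A'(4) e r(2) by simp
qed

text \<open>The travel time between two abscissae at height \<open>c\<close>. It is additive, so
  measured from a base point it parametrises the whole orbit by time.\<close>

definition dur :: "real \<Rightarrow> real \<Rightarrow> real \<Rightarrow> real" where
  "dur c s s' = (THE T. \<exists>\<gamma>. arc c s s' T \<gamma>)"

lemma dur_eq: "arc c s s' T \<gamma> \<Longrightarrow> dur c s s' = T"
  unfolding dur_def using arc_unique by blast

lemma dur_pos:
  assumes S: "segment a c S" and s: "s \<in> S" "s' \<in> S" "s < s'"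
  shows "dur c s s' > 0"
proof -
  obtain T \<gamma> where A: "arc c s s' T \<gamma>" using arc_exists[OF assms] by blast
  have "T \<noteq> 0"
  proof
    assume "T = 0"
    then have "pt c s = pt c s'" using A by (auto simp: arc_def)
    then show False using pt(2)[OF S s(1)] pt(2)[OF S s(2)] s(3) by simp
  qed
  then show ?thesis using A dur_eq[OF A] by (auto simp: arc_def)
qed

lemma dur_add:
  assumes S: "segment a c S" and s: "s \<in> S" "s' \<in> S" "s'' \<in> S" "s < s'" "s' < s''"
  shows "dur c s s'' = dur c s s' + dur c s' s''"
proof -
  obtain T \<gamma> where A: "arc c s s'' T \<gamma>" using arc_exists[OF S s(1,3)] s by auto
  have tr: "0 \<le> T" "itraj X Y U {0..T} \<gamma>" "\<gamma> 0 = pt c s" "\<gamma> T = pt c s''" using A by (auto simp: arc_def)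
  have "continuous_on {0..T} (\<lambda>t. \<Phi> (\<gamma> t))"
    by (rule continuous_on_compose2[OF homeomorphism_cont1[OF hom] itrajD(3)[OF tr(2)]]) (rule itrajD(4)[OF tr(2)])
  then have "continuous_on {0..T} (\<lambda>t. \<Phi> (\<gamma> t) $ 1)" by (intro continuous_intros)
  then obtain r where r: "0 \<le> r" "r \<le> T" "\<Phi> (\<gamma> r) $ 1 = s'"
    using IVT'[of "\<lambda>t. \<Phi> (\<gamma> t) $ 1" 0 s' T] tr pt(2)[OF S s(1)] pt(2)[OF S s(3)] s by auto
  note B = arc_inner[OF A S s(1,3) r(1,2), unfolded r(3)]
  show ?thesis using dur_eq[OF A] dur_eq[OF B(3)] dur_eq[OF B(4)] by simp
qed

lemma segment_open: assumes "segment a c S" "s \<in> S" shows "\<exists>s1\<in>S. \<exists>s2\<in>S. s1 < s \<and> s < s2"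
proof -
  have gl: "\<exists>s1\<in>{x<..<y}. \<exists>s2\<in>{x<..<y}. s1 < s \<and> s < s2" if "s \<in> {x<..<y}" for x y :: real
    using that by (intro bexI[of _ "(x + s) / 2"] bexI[of _ "(s + y) / 2"]) auto
  show ?thesis using assms gl unfolding segment_def by blast
qed

lemma segment_convex: "segment a c S \<Longrightarrow> s \<in> S \<Longrightarrow> s' \<in> S \<Longrightarrow> {s..s'} \<subseteq> S"
  by (auto simp: segment_def)

text \<open>Travel time from a base point is a strictly increasing bijection of \<open>S\<close>
  onto the interval \<open>I\<close>. No extension exists: at a limit time it would still be in the
  open square, at height \<open>c\<close> and off the origin, hence at an abscissa in the open
  interval \<open>S\<close>, so that this time belongs to \<open>I\<close> already.\<close>

lemma segment_orbit:
  assumes S: "segment a c S"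
  shows "\<exists>I \<Gamma> T. max_itraj X Y U I \<Gamma> \<and> strict_mono_on S T \<and> T ` S = I \<and> (\<forall>s\<in>S. \<Gamma> (T s) = pt c s)"
proof -
  have "S \<noteq> {}" using S by (auto simp: segment_def dest: equalityD1)
  then obtain b where b: "b \<in> S" by blast
  \<comment> \<open>Signed travel time: negative to the left of the base point
    \<open>b\<close>.\<close>
  define T where "T s = (if b < s then dur c b s else if s < b then - dur c s b else 0)" for s
  have Tdiff: "T s' - T s = dur c s s'" if "s \<in> S" "s' \<in> S" "s < s'" for s s'
  proof -
    consider "b < s" | "b = s" | "s < b" "b < s'" | "b = s'" | "s' < b" using \<open>s < s'\<close> by linarith
    then show ?thesis
    proof cases
      case 1 then show ?thesis using dur_add[OF S b that(1,2)] that by (simp add: T_def)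
    next
      case 3 then show ?thesis using dur_add[OF S that(1) b that(2)] that by (simp add: T_def)
    next
      case 5 then show ?thesis using dur_add[OF S that(1,2) b] that by (simp add: T_def)
    qed (use that in \<open>auto simp: T_def\<close>)
  qed
  have Tmono: "strict_mono_on S T"
    by (rule strict_mono_onI) (use Tdiff dur_pos[OF S] in \<open>force simp: algebra_simps\<close>)
  then have Tinj: "inj_on T S" by (rule strict_mono_on_imp_inj_on)
  define I where "I = T ` S"
  define \<Gamma> where "\<Gamma> t = pt c (inv_into S T t)" for t
  have \<Gamma>T: "\<Gamma> (T s) = pt c s" if "s \<in> S" for s
    using inv_into_f_f[OF Tinj that] by (simp add: \<Gamma>_def)
  have Tle: "T s \<le> T s' \<longleftrightarrow> s \<le> s'" if "s \<in> S" "s' \<in> S" for s s'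
    using strict_mono_on_leD[OF Tmono] strict_mono_onD[OF Tmono] that by (meson not_le)
  have seg: "\<exists>\<gamma>. arc c s s' (T s' - T s) \<gamma> \<and> (\<forall>t\<in>{T s..T s'}. t \<in> I \<and> \<Gamma> t = \<gamma> (t - T s))"
    if s: "s \<in> S" "s' \<in> S" "s < s'" for s s'
  proof -
    obtain d \<gamma> where A: "arc c s s' d \<gamma>" using arc_exists[OF S s] by blast
    have d: "d = T s' - T s" using dur_eq[OF A] Tdiff[OF s] by simp
    have "t \<in> I \<and> \<Gamma> t = \<gamma> (t - T s)" if t: "t \<in> {T s..T s'}" for t
    proof -
      define r where "r = t - T s"
      have r: "0 \<le> r" "r \<le> d" using t by (auto simp: r_def d)
      define \<sigma> where "\<sigma> = \<Phi> (\<gamma> r) $ 1"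
      note B = arc_inner[OF A S s(1,2) r, folded \<sigma>_def]
      have \<sigma>S: "\<sigma> \<in> S" using B(1) segment_convex[OF S s(1,2)] by blast
      have "T \<sigma> - T s = r"
      proof (cases "\<sigma> = s")
        case True
        have "strict_mono_on {0..d} (\<lambda>t. \<Phi> (\<gamma> t) $ 1)" "\<gamma> 0 = pt c s" using A by (auto simp: arc_def)
        have "\<not> 0 < r"
        proof
          assume "0 < r"
          then have "\<Phi> (\<gamma> 0) $ 1 < \<Phi> (\<gamma> r) $ 1"
            using strict_mono_onD[OF \<open>strict_mono_on {0..d} _\<close>, of 0 r] r by simp
          then show False using \<open>\<gamma> 0 = pt c s\<close> True pt(2)[OF S s(1)] by (simp add: \<sigma>_def)
        qed
        then show ?thesis using True r by simp
      next
        case False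
        then have "s < \<sigma>" using B(1) by auto
        then show ?thesis using Tdiff[OF s(1) \<sigma>S] dur_eq[OF B(3)] by simp
      qed
      then have "t = T \<sigma>" by (simp add: r_def)
      then show ?thesis using \<sigma>S \<Gamma>T[OF \<sigma>S] B(2) by (auto simp: I_def r_def)
    qed
    then show ?thesis using A d by blast
  qed
  have big: "itraj X Y U {T s..T s'} \<Gamma>" if s: "s \<in> S" "s' \<in> S" "s < s'" for s s'
  proof -
    obtain \<gamma> where \<gamma>: "arc c s s' (T s' - T s) \<gamma>" "\<forall>t\<in>{T s..T s'}. t \<in> I \<and> \<Gamma> t = \<gamma> (t - T s)"
      using seg[OF s] by blast
    have "itraj X Y U {0..T s' - T s} \<gamma>" using \<gamma>(1) by (simp add: arc_def)
    from itraj_shift[OF this, of "- T s"]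
    have "itraj X Y U {t. t + - T s \<in> {0..T s' - T s}} (\<lambda>t. \<gamma> (t + - T s))" .
    moreover have "{t. t + - T s \<in> {0..T s' - T s}} = {T s..T s'}" by auto
    ultimately have "itraj X Y U {T s..T s'} (\<lambda>t. \<gamma> (t + - T s))" by simp
    then show ?thesis by (rule itraj_cong) (use \<gamma>(2) in simp)
  qed
  have Isub: "{T s..T s'} \<subseteq> I" if "s \<in> S" "s' \<in> S" "s < s'" for s s'
    using seg[OF that] by blast
  have Iint: "is_interval I"
    unfolding is_interval_1
  proof (intro ballI allI impI)
    fix x y z assume x: "x \<in> I" and y: "y \<in> I" and z: "x \<le> z \<and> z \<le> y"
    obtain s s' where s: "s \<in> S" "s' \<in> S" "x = T s" "y = T s'" using x y by (auto simp: I_def)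
    show "z \<in> I"
    proof (cases "s < s'")
      case True then show ?thesis using Isub[OF s(1,2)] s z by auto
    next
      case False
      then have "y \<le> x" using Tle[OF s(2,1)] s by simp
      then have "z = x" using z by simp
      then show ?thesis using x by simp
    qed
  qed
  have Iopen: "open I"
    unfolding open_contains_ball
  proof
    fix t assume "t \<in> I"
    then obtain s where s: "s \<in> S" "t = T s" by (auto simp: I_def)
    obtain s1 s2 where s12: "s1 \<in> S" "s2 \<in> S" "s1 < s" "s < s2" using segment_open[OF S s(1)] by blast
    have lt: "T s1 < t" "t < T s2" using strict_mono_onD[OF Tmono] s s12 by auto
    have "ball t (min (t - T s1) (T s2 - t)) \<subseteq> {T s1..T s2}" by (auto simp: dist_real_def)
    then have "ball t (min (t - T s1) (T s2 - t)) \<subseteq> I" using Isub[OF s12(1,2)] s12 by auto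
    then show "\<exists>e>0. ball t e \<subseteq> I" using lt by (intro exI[of _ "min (t - T s1) (T s2 - t)"]) auto
  qed
  have tr: "itraj X Y U I \<Gamma>"
  proof (rule itraj_local[OF Iint])
    show "I \<noteq> {}" using b by (auto simp: I_def)
    fix x y assume x: "x \<in> I" and y: "y \<in> I" and xy: "x \<le> y"
    obtain s s' where s: "s \<in> S" "s' \<in> S" "x = T s" "y = T s'" using x y by (auto simp: I_def)
    obtain s2 where s2: "s2 \<in> S" "s' < s2" using segment_open[OF S s(2)] by blast
    have "s \<le> s'" using Tle[OF s(1,2)] xy s by simp
    then have "itraj X Y U {T s..T s2} \<Gamma>" using big[OF s(1) s2(1)] s2 by simp
    moreover have "T s' \<le> T s2" using Tle[OF s(2) s2(1)] s2 by simp
    ultimately show "itraj X Y U {x..y} \<Gamma>"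
      by (elim itraj_subinterval) (use s xy in \<open>auto simp: is_interval_cc\<close>)
  qed
  have "J = I" if J: "itraj X Y U J \<delta>" "I \<subseteq> J" "\<forall>t\<in>I. \<delta> t = \<Gamma> t" for J \<delta>
  proof -
    have Jint: "connected J" using itrajD(1)[OF J(1)] by (simp add: is_interval_connected_1)
    have bI: "T b \<in> I" using b by (simp add: I_def)
    have nz: "\<delta> t \<noteq> 0" if "t \<in> J" for t
      using itrajD(7)[OF J(1) that, of "T b"] J(2,3) bI \<Gamma>T[OF b] pt(4)[OF S b] by auto
    have c1: "continuous_on J (\<lambda>t. \<Phi> (\<delta> t))"
      by (rule continuous_on_compose2[OF homeomorphism_cont1[OF hom] itrajD(3)[OF J(1)]]) (rule itrajD(4)[OF J(1)])
    have "closedin (top_of_set J) I"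
      unfolding closedin_limpt
    proof (intro conjI allI impI)
      show "I \<subseteq> J" by (rule J(2))
      fix t assume "t islimpt I \<and> t \<in> J"
      then obtain x where xt: "(\<forall>n. x n \<in> I) \<and> t \<in> J \<and> x \<longlonglongrightarrow> t"
        unfolding islimpt_sequential by blast
      have "\<forall>n. \<exists>s. s \<in> S \<and> x n = T s"
      proof
        fix n
        have "x n \<in> T ` S" using xt by (simp add: I_def)
        then show "\<exists>s. s \<in> S \<and> x n = T s" by blast
      qed
      from choice[OF this] obtain \<sigma> where \<sigma>: "\<And>n. \<sigma> n \<in> S" "\<And>n. x n = T (\<sigma> n)" by blast
      have xJ: "\<And>n. x n \<in> J" using xt J(2) by blast
      have "(\<lambda>n. \<Phi> (\<delta> (x n))) \<longlonglongrightarrow> \<Phi> (\<delta> t)"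
        by (rule continuous_on_tendsto_compose[OF c1]) (use xt xJ in auto)
      moreover have \<delta>x: "\<delta> (x n) = pt c (\<sigma> n)" for n using J(3) xt \<Gamma>T[OF \<sigma>(1)] \<sigma>(2) by metis
      ultimately have l: "(\<lambda>n. \<Phi> (pt c (\<sigma> n))) \<longlonglongrightarrow> \<Phi> (\<delta> t)" by simp
      have l1: "\<sigma> \<longlonglongrightarrow> \<Phi> (\<delta> t) $ 1"
        using tendsto_vec_nth[OF l, of 1] pt(2)[OF S \<sigma>(1)] by simp
      have "(\<lambda>n. c) \<longlonglongrightarrow> \<Phi> (\<delta> t) $ 2"
        using tendsto_vec_nth[OF l, of 2] pt(3)[OF S \<sigma>(1)] by simp
      then have l2: "\<Phi> (\<delta> t) $ 2 = c" by (simp add: LIMSEQ_const_iff)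
      define s where "s = \<Phi> (\<delta> t) $ 1"
      have \<delta>U: "\<delta> t \<in> U" using itrajD(4)[OF J(1)] xt by blast
      then have sa: "\<bar>s\<bar> < a" using \<Phi>_sq[of "\<delta> t"] by (auto simp: square_def s_def)
      have "\<Phi> (\<delta> t) \<noteq> 0" using nz[of t] \<Phi>_inj[OF \<delta>U zU] \<Phi>0 xt by auto
      then have s0: "c = 0 \<Longrightarrow> s \<noteq> 0" using l2 by (auto simp: s_def vec2_eq_iff)
      \<comment> \<open>As a limit, \<open>s\<close> is in the closure of \<open>S\<close>; the edge
        of the square is excluded by \<open>sa\<close>, the equilibrium by
        \<open>s0\<close>.\<close>
      have "s \<in> S"
      proof -
        consider "c \<noteq> 0" "S = {-a<..<a}" | "c = 0" "S = {-a<..<0}" | "c = 0" "S = {0<..<a}"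
          using S by (auto simp: segment_def)
        then show ?thesis
        proof cases
          case 1 then show ?thesis using sa by auto
        next
          case 2
          have "s \<le> 0" unfolding s_def
            by (rule LIMSEQ_le_const2[OF l1]) (use \<sigma>(1) 2 in \<open>auto simp: less_imp_le\<close>)
          then show ?thesis using 2 s0 sa by auto
        next
          case 3
          have "0 \<le> s" unfolding s_def
            by (rule LIMSEQ_le_const[OF l1]) (use \<sigma>(1) 3 in \<open>auto simp: less_imp_le\<close>)
          then show ?thesis using 3 s0 sa by auto
        qed
      qed
      then obtain s1 s2 where s12: "s1 \<in> S" "s2 \<in> S" "s1 < s" "s < s2" using segment_open[OF S] by blast
      have "\<forall>\<^sub>F n in sequentially. s1 < \<sigma> n \<and> \<sigma> n < s2"
        using order_tendstoD[OF l1[folded s_def]] s12 by (auto intro: eventually_conj)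
      then have ev: "\<forall>\<^sub>F n in sequentially. T s1 \<le> x n \<and> x n \<le> T s2"
        by eventually_elim (use Tle[OF s12(1) \<sigma>(1)] Tle[OF \<sigma>(1) s12(2)] \<sigma>(2) in \<open>simp add: less_imp_le\<close>)
      have "T s1 \<le> t" "t \<le> T s2"
        using xt tendsto_lowerbound[of x t sequentially "T s1"] tendsto_upperbound[of x t sequentially "T s2"] ev
        by (auto simp: eventually_conj_iff)
      then show "t \<in> I" using Isub[OF s12(1,2)] s12 by auto
    qed
    moreover have "openin (top_of_set J) I" using Iopen J(2) by (simp add: open_subset)
    ultimately have "I = {} \<or> I = J" using Jint by (auto simp: connected_clopen)
    then show ?thesis using bI by blast
  qed
  then have "max_itraj X Y U I \<Gamma>" using tr unfolding max_itraj_def by blast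
  then show ?thesis using Tmono \<Gamma>T unfolding I_def by blast
qed

lemma zero_orbit: "max_itraj X Y U UNIV (\<lambda>t. 0)"
  unfolding max_itraj_def using itraj_zero[of UNIV U X Y] zU by auto

text \<open>Through every point of \<open>U\<close> other than the origin passes an orbit of
  \<open>segment_orbit\<close>. Shifted in time so that both are there at \<open>t0\<close>, each of
  the two maximal trajectories contains the other.\<close>

lemma max_itraj_cases:
  assumes m: "max_itraj X Y U I \<gamma>"
  shows "(I = UNIV \<and> (\<forall>t. \<gamma> t = 0)) \<or>
    (\<exists>c S T. segment a c S \<and> strict_mono_on S T \<and> T ` S = I \<and> (\<forall>s\<in>S. \<gamma> (T s) = pt c s))"
proof -
  have tr: "itraj X Y U I \<gamma>" and mx: "\<And>J \<delta>. itraj X Y U J \<delta> \<Longrightarrow> I \<subseteq> J \<Longrightarrow> \<forall>t\<in>I. \<delta> t = \<gamma> t \<Longrightarrow> J = I"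
    using m by (auto simp: max_itraj_def)
  obtain t0 where t0: "t0 \<in> I" using itrajD(2)[OF tr] by blast
  show ?thesis
  proof (cases "\<gamma> t0 = 0")
    case True
    then have z: "\<gamma> t = 0" if "t \<in> I" for t using itrajD(7)[OF tr t0 that] by blast
    have "UNIV = I" by (rule mx[of UNIV "\<lambda>t. 0"]) (use itraj_zero[of UNIV U X Y] zU z in auto)
    then show ?thesis using z by auto
  next
    case False
    have p: "\<gamma> t0 \<in> U" using itrajD(4)[OF tr] t0 by blast
    have "\<Phi> (\<gamma> t0) \<noteq> 0" using False \<Phi>_inj[OF p zU] \<Phi>0 by auto
    then obtain S where S: "segment a (\<Phi> (\<gamma> t0) $ 2) S" "\<Phi> (\<gamma> t0) $ 1 \<in> S"
      using segment_cases[OF \<Phi>_sq[OF p]] by blast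
    define c s where "c = \<Phi> (\<gamma> t0) $ 2" and "s = \<Phi> (\<gamma> t0) $ 1"
    have S': "segment a c S" "s \<in> S" and ps: "pt c s = \<gamma> t0" using S pt_\<Phi>[OF p] by (auto simp: c_def s_def)
    obtain I' \<Gamma> T where \<Gamma>: "max_itraj X Y U I' \<Gamma>" "strict_mono_on S T" "T ` S = I'" "\<forall>s\<in>S. \<Gamma> (T s) = pt c s"
      using segment_orbit[OF S'(1)] by blast
    have tr': "itraj X Y U I' \<Gamma>" and mx': "\<And>J \<delta>. itraj X Y U J \<delta> \<Longrightarrow> I' \<subseteq> J \<Longrightarrow> \<forall>t\<in>I'. \<delta> t = \<Gamma> t \<Longrightarrow> J = I'"
      using \<Gamma>(1) by (auto simp: max_itraj_def)
    define r where "r = T s - t0"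
    define I2 where "I2 = {t. t + r \<in> I'}"
    define \<Gamma>2 where "\<Gamma>2 t = \<Gamma> (t + r)" for t
    have tr2: "itraj X Y U I2 \<Gamma>2" unfolding I2_def \<Gamma>2_def by (rule itraj_shift[OF tr'])
    have t02: "t0 \<in> I2" using \<Gamma>(3) S'(2) by (auto simp: I2_def r_def)
    have e0: "\<gamma> t0 = \<Gamma>2 t0" using \<Gamma>(4) S'(2) ps by (simp add: \<Gamma>2_def r_def)
    have agree: "\<gamma> t = \<Gamma>2 t" if "t \<in> I" "t \<in> I2" for t
      by (rule uniq[OF tr tr2 t0 t02 e0 that])
    define w where "w t = (if t \<in> I then \<gamma> t else \<Gamma>2 t)" for t
    have w: "itraj X Y U (I \<union> I2) w"
      unfolding w_def by (rule itraj_glue[OF tr tr2 t0 t02 agree])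
    \<comment> \<open>Maximality of \<open>\<gamma>\<close> gives this inclusion; that of
      \<open>\<Gamma>\<close> gives the converse below.\<close>
    have "I \<union> I2 = I" by (rule mx[OF w]) (auto simp: w_def)
    then have sub: "I2 \<subseteq> I" by blast
    have "{t. t + - r \<in> I} = I'"
    proof (rule mx'[OF itraj_shift[OF tr, of "- r"]])
      show "I' \<subseteq> {t. t + - r \<in> I}" using sub by (auto simp: I2_def)
      show "\<forall>t\<in>I'. \<gamma> (t + - r) = \<Gamma> t"
      proof
        fix t assume "t \<in> I'"
        then have "t - r \<in> I2" by (simp add: I2_def)
        then show "\<gamma> (t + - r) = \<Gamma> t" using agree[of "t - r"] sub by (auto simp: \<Gamma>2_def)
      qed
    qed
    then have II: "t \<in> I \<longleftrightarrow> t + r \<in> I'" for t by (metis (no_types, lifting) add.assoc add.right_neutral add.right_inverse mem_Collect_eq)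
    have "strict_mono_on S (\<lambda>s. T s - r)"
      by (rule strict_mono_onI) (use strict_mono_onD[OF \<Gamma>(2)] in simp)
    moreover have "(\<lambda>s. T s - r) ` S = I"
    proof (intro set_eqI iffI)
      fix t assume "t \<in> I"
      then have "t + r \<in> T ` S" using II \<Gamma>(3) by simp
      then show "t \<in> (\<lambda>s. T s - r) ` S" by (auto simp: image_iff algebra_simps)
    next
      fix t assume "t \<in> (\<lambda>s. T s - r) ` S"
      then show "t \<in> I" using II \<Gamma>(3) by auto
    qed
    moreover have "\<gamma> (T s - r) = pt c s" if "s \<in> S" for s
    proof -
      have "T s - r \<in> I2" using that \<Gamma>(3) by (auto simp: I2_def)
      then show ?thesis using agree[of "T s - r"] sub \<Gamma>(4) that by (auto simp: \<Gamma>2_def)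
    qed
    ultimately show ?thesis using S'(1) by blast
  qed
qed

end

text \<open>Both orbits are parametrised by the same abscissae, so the time change is
  \<open>T2\<close> after the inverse of \<open>T1\<close>.\<close>

lemma maps_oriented_segments:
  fixes S :: "real set"
  assumes T1: "strict_mono_on S T1" "T1 ` S = I" and T2: "strict_mono_on S T2" "T2 ` S = J"
    and eq: "\<And>s. s \<in> S \<Longrightarrow> H (\<gamma> (T1 s)) = \<delta> (T2 s)"
  shows "maps_oriented H I \<gamma> J \<delta>"
proof -
  have inj: "inj_on T1 S" using T1(1) by (rule strict_mono_on_imp_inj_on)
  define \<tau> where "\<tau> t = T2 (inv_into S T1 t)" for t
  have \<tau>: "\<tau> (T1 s) = T2 s" if "s \<in> S" for s using inv_into_f_f[OF inj that] by (simp add: \<tau>_def)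
  have lt: "s < s'" if "s \<in> S" "s' \<in> S" "T1 s < T1 s'" for s s'
    using strict_mono_on_leD[OF T1(1)] that by (meson not_le)
  have "strict_mono_on I \<tau>"
  proof (rule strict_mono_onI)
    fix x y assume xy: "x \<in> I" "y \<in> I" "x < y"
    then obtain s s' where s: "s \<in> S" "s' \<in> S" "x = T1 s" "y = T1 s'" using T1(2) by auto
    then show "\<tau> x < \<tau> y" using lt[OF s(1,2)] strict_mono_onD[OF T2(1) s(1,2)] xy \<tau> by simp
  qed
  moreover have "\<tau> ` I = J" using T1(2)[symmetric] T2(2)[symmetric] \<tau> by (auto simp: image_image)
  moreover have "H (\<gamma> t) = \<delta> (\<tau> t)" if "t \<in> I" for t
    using that eq \<tau> unfolding T1(2)[symmetric] by auto
  ultimately show ?thesis unfolding maps_oriented_def by blast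
qed

lemma maps_oriented_zero: "H 0 = 0 \<Longrightarrow> \<forall>t. \<gamma> t = 0 \<Longrightarrow> \<forall>t. \<delta> t = 0 \<Longrightarrow> maps_oriented H UNIV \<gamma> UNIV \<delta>"
  unfolding maps_oriented_def by (intro exI[of _ "\<lambda>t. t"]) (auto intro: strict_mono_onI)

text \<open>As both charts map onto the same square, \<open>\<Psi>' \<circ> \<Phi>\<close> preserves
  height and abscissa and matches the orbits with equal \<open>c\<close> and
  \<open>S\<close>.\<close>

lemma orbit_charts_correspond:
  assumes C1: "orbit_chart X1 Y1 a U \<Phi> \<Phi>'" and C2: "orbit_chart X2 Y2 a V \<Psi> \<Psi>'"
  shows "max_itraj X1 Y1 U I \<gamma> \<Longrightarrow> \<exists>J \<delta>. max_itraj X2 Y2 V J \<delta> \<and> maps_oriented (\<Psi>' \<circ> \<Phi>) I \<gamma> J \<delta>"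
    and "max_itraj X2 Y2 V J \<delta> \<Longrightarrow> \<exists>I \<gamma>. max_itraj X1 Y1 U I \<gamma> \<and> maps_oriented (\<Psi>' \<circ> \<Phi>) I \<gamma> J \<delta>"
proof -
  interpret A: orbit_chart X1 Y1 a U \<Phi> \<Phi>' by (rule C1)
  interpret B: orbit_chart X2 Y2 a V \<Psi> \<Psi>' by (rule C2)
  have H0: "(\<Psi>' \<circ> \<Phi>) 0 = 0" using A.\<Phi>0 B.\<Phi>0 B.\<Phi>'\<Phi>[OF B.zU] by simp
  have Hpt: "(\<Psi>' \<circ> \<Phi>) (A.pt c s) = B.pt c s" if "segment a c S" "s \<in> S" for c s S
  proof -
    have "\<Phi> (A.pt c s) = vector [s, c]" using A.pt[OF that] by (simp add: vec2_eq_iff)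
    then show ?thesis by (simp add: B.pt_def)
  qed
  {
    assume m: "max_itraj X1 Y1 U I \<gamma>"
    from A.max_itraj_cases[OF m] show "\<exists>J \<delta>. max_itraj X2 Y2 V J \<delta> \<and> maps_oriented (\<Psi>' \<circ> \<Phi>) I \<gamma> J \<delta>"
    proof (elim disjE exE conjE)
      assume "I = UNIV" "\<forall>t. \<gamma> t = 0"
      then show ?thesis using B.zero_orbit maps_oriented_zero[where H = "\<Psi>' \<circ> \<Phi>" and \<gamma> = \<gamma> and \<delta> = "\<lambda>t. 0", OF H0] by auto
    next
      fix c S T assume s: "segment a c S" "strict_mono_on S T" "T ` S = I" "\<forall>s\<in>S. \<gamma> (T s) = A.pt c s"
      obtain J \<delta> T2 where d: "max_itraj X2 Y2 V J \<delta>" "strict_mono_on S T2" "T2 ` S = J" "\<forall>s\<in>S. \<delta> (T2 s) = B.pt c s"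
        using B.segment_orbit[OF s(1)] by blast
      have "maps_oriented (\<Psi>' \<circ> \<Phi>) I \<gamma> J \<delta>"
        by (rule maps_oriented_segments[OF s(2,3) d(2,3)]) (use s(4) d(4) Hpt[OF s(1)] in simp)
      then show ?thesis using d(1) by blast
    qed
  }
  {
    assume m: "max_itraj X2 Y2 V J \<delta>"
    from B.max_itraj_cases[OF m] show "\<exists>I \<gamma>. max_itraj X1 Y1 U I \<gamma> \<and> maps_oriented (\<Psi>' \<circ> \<Phi>) I \<gamma> J \<delta>"
    proof (elim disjE exE conjE)
      assume "J = UNIV" "\<forall>t. \<delta> t = 0"
      then show ?thesis using A.zero_orbit maps_oriented_zero[where H = "\<Psi>' \<circ> \<Phi>" and \<gamma> = "\<lambda>t. 0" and \<delta> = \<delta>, OF H0] by auto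
    next
      fix c S T assume s: "segment a c S" "strict_mono_on S T" "T ` S = J" "\<forall>s\<in>S. \<delta> (T s) = B.pt c s"
      obtain I \<gamma> T2 where d: "max_itraj X1 Y1 U I \<gamma>" "strict_mono_on S T2" "T2 ` S = I" "\<forall>s\<in>S. \<gamma> (T2 s) = A.pt c s"
        using A.segment_orbit[OF s(1)] by blast
      have "maps_oriented (\<Psi>' \<circ> \<Phi>) I \<gamma> J \<delta>"
        by (rule maps_oriented_segments[OF d(2,3) s(2,3)]) (use s(4) d(4) Hpt[OF s(1)] in simp)
      then show ?thesis using d(1) by blast
    qed
  }
qed

subsection \<open>Equivalence with the model field\<close>

lemma matrix_vector_mult_lin2: "A *v h = lin2 (A $ 1 $ 1) (A $ 1 $ 2) (A $ 2 $ 1) (A $ 2 $ 2) h"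
  for A :: "real^2^2"
  by (simp add: vec2_eq_iff matrix_vector_mult_def sum_2)

text \<open>The mean value inequality for the field minus its linear part on a small ball, where
  continuity of the Jacobian matrix makes the derivative of the difference small.\<close>

lemma C1_field_strong_derivative:
  assumes U: "open \<U>" "0 \<in> \<U>" and C: "C1_field \<U> X" and X0: "X 0 = 0" and J: "J = jacobian X (at 0)"
  shows "strong_derivative_0 X (J $ 1 $ 1) (J $ 1 $ 2) (J $ 2 $ 1) (J $ 2 $ 2)"
  unfolding strong_derivative_0_def
proof (intro conjI allI impI X0)
  fix \<epsilon> :: real assume \<epsilon>: "\<epsilon> > 0"
  define A where "A p = jacobian X (at p)" for p
  have cA: "continuous_on \<U> A" using C unfolding C1_field_def A_def by blast
  \<comment> \<open>A quarter of \<open>\<epsilon>\<close>, because \<open>norm_lin2_le\<close> adds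
    the absolute values of four entries.\<close>
  obtain r1 where r1: "r1 > 0" "\<And>p. p \<in> \<U> \<Longrightarrow> dist p 0 < r1 \<Longrightarrow> dist (A p) (A 0) < \<epsilon> / 4"
    using cA U(2) \<epsilon> unfolding continuous_on_iff by (metis divide_pos_pos zero_less_numeral)
  obtain r2 where r2: "r2 > 0" "ball 0 r2 \<subseteq> \<U>" using U by (meson open_contains_ball)
  define r where "r = min r1 r2 / 2"
  have r: "r > 0" "r < r1" "r < r2" using r1 r2 by (auto simp: r_def)
  define l where "l = lin2 (J $ 1 $ 1) (J $ 1 $ 2) (J $ 2 $ 1) (J $ 2 $ 2)"
  have "norm ((X p - l p) - (X q - l q)) \<le> \<epsilon> * norm (p - q)" if pq: "p \<in> cball 0 r" "q \<in> cball 0 r" for p q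
  proof (rule differentiable_bound[OF convex_cball _ _ pq])
    fix x :: "real^2" assume x: "x \<in> cball 0 r"
    then have xU: "x \<in> \<U>" using r r2 by (auto simp: subset_iff)
    have "(X has_derivative (\<lambda>h. A x *v h)) (at x)"
      using C xU unfolding C1_field_def A_def by (simp add: jacobian_works)
    moreover have "(l has_derivative l) (at x)"
      unfolding l_def by (rule bounded_linear_imp_has_derivative[OF bounded_linear_lin2])
    ultimately have "((\<lambda>p. X p - l p) has_derivative (\<lambda>h. A x *v h - l h)) (at x)" by (rule has_derivative_diff)
    then show "((\<lambda>p. X p - l p) has_derivative (\<lambda>h. A x *v h - l h)) (at x within cball 0 r)"
      by (rule has_derivative_at_withinI)
    define M where "M = A x - A 0"
    have M: "\<bar>M $ i $ j\<bar> \<le> \<epsilon> / 4" for i j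
    proof -
      have "\<bar>M $ i $ j\<bar> \<le> norm (M $ i)" by (rule component_le_norm_cart)
      also have "\<dots> \<le> norm M" by (rule Finite_Cartesian_Product.norm_nth_le)
      also have "\<dots> \<le> \<epsilon> / 4" using r1(2)[OF xU] x r by (simp add: M_def dist_norm)
      finally show ?thesis .
    qed
    show "onorm (\<lambda>h. A x *v h - l h) \<le> \<epsilon>"
    proof (rule onorm_bound)
      fix h :: "real^2"
      have "A x *v h - l h = lin2 (M $ 1 $ 1) (M $ 1 $ 2) (M $ 2 $ 1) (M $ 2 $ 2) h"
        unfolding l_def matrix_vector_mult_lin2 M_def J A_def[of 0, symmetric]
        by (simp add: vec2_eq_iff algebra_simps)
      then have "norm (A x *v h - l h) \<le> (\<bar>M $ 1 $ 1\<bar> + \<bar>M $ 1 $ 2\<bar> + \<bar>M $ 2 $ 1\<bar> + \<bar>M $ 2 $ 2\<bar>) * norm h"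
        using norm_lin2_le by metis
      also have "\<dots> \<le> \<epsilon> * norm h" using M[of 1 1] M[of 1 2] M[of 2 1] M[of 2 2] by (intro mult_right_mono) auto
      finally show "norm (A x *v h - l h) \<le> \<epsilon> * norm h" .
    qed (use \<epsilon> in simp)
  qed
  then have "\<forall>p\<in>cball 0 r. \<forall>q\<in>cball 0 r.
      norm (X p - X q - lin2 (J $ 1 $ 1) (J $ 1 $ 2) (J $ 2 $ 1) (J $ 2 $ 2) (p - q)) \<le> \<epsilon> * norm (p - q)"
    unfolding l_def lin2_diff by (simp add: algebra_simps)
  then show "\<exists>r>0. \<forall>p\<in>cball 0 r. \<forall>q\<in>cball 0 r.
      norm (X p - X q - lin2 (J $ 1 $ 1) (J $ 1 $ 2) (J $ 2 $ 1) (J $ 2 $ 2) (p - q)) \<le> \<epsilon> * norm (p - q)"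
    using r(1) by blast
qed

lemma strong_derivative_Lipschitz:
  assumes "strong_derivative_0 X a b c d"
  shows "\<exists>r>0. \<exists>L. \<forall>p\<in>ball 0 r. \<forall>q\<in>ball 0 r. norm (X p - X q) \<le> L * norm (p - q)"
proof -
  obtain r X' where r: "r > 0" "near_linear 1 a b c d X'" "\<forall>p\<in>ball 0 r. X' p = X p"
    using near_linear_extension[OF assms, of 1] by auto
  show ?thesis
  proof (rule exI[of _ r], rule conjI[OF r(1)], rule exI[of _ "\<bar>a\<bar> + \<bar>b\<bar> + \<bar>c\<bar> + \<bar>d\<bar> + 1"], intro ballI)
    fix p q :: "real^2" assume "p \<in> ball 0 r" "q \<in> ball 0 r"
    then show "norm (X p - X q) \<le> (\<bar>a\<bar> + \<bar>b\<bar> + \<bar>c\<bar> + \<bar>d\<bar> + 1) * norm (p - q)"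
      using near_linear_Lipschitz[OF r(2), of p q] r(3) by auto
  qed
qed

lemma strong_derivative_sign:
  assumes X: "strong_derivative_0 X a b c d" and c: "c \<noteq> 0"
  shows "\<exists>r>0. \<forall>p\<in>ball 0 r. p $ 2 = 0 \<longrightarrow> p \<noteq> 0 \<longrightarrow> c * p $ 1 * X p $ 2 > 0"
proof -
  \<comment> \<open>With this tolerance the remainder is at most half of the main term
    \<open>c * p $ 1\<close> on the switching line.\<close>
  have c2: "\<bar>c\<bar> / 2 > 0" using c by simp
  obtain r X' where r: "r > 0" "near_linear (\<bar>c\<bar> / 2) a b c d X'" "\<forall>p\<in>ball 0 r. X' p = X p"
    using near_linear_extension[OF X c2] by blast
  have "c * p $ 1 * X p $ 2 > 0" if p: "p \<in> ball 0 r" "p $ 2 = 0" "p \<noteq> 0" for p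
  proof -
    obtain s where s: "X' p = lin2 a b c d p + s" "\<bar>s $ 2\<bar> \<le> \<bar>c\<bar> / 2 * norm p"
      by (rule near_linearE0[OF r(2)])
    have p1: "p $ 1 \<noteq> 0" using p by (auto simp: vec2_eq_iff)
    have n: "norm p \<le> \<bar>p $ 1\<bar>" using norm_le_abs2[of p] p by simp
    have "\<bar>s $ 2\<bar> \<le> \<bar>c\<bar> / 2 * \<bar>p $ 1\<bar>" using s(2) mult_left_mono[OF n, of "\<bar>c\<bar> / 2"] by simp
    then have "\<bar>c * p $ 1\<bar> * \<bar>s $ 2\<bar> \<le> \<bar>c * p $ 1\<bar> * (\<bar>c\<bar> / 2 * \<bar>p $ 1\<bar>)" by (intro mult_left_mono) auto
    then have "\<bar>c * p $ 1 * s $ 2\<bar> \<le> (c * p $ 1)\<^sup>2 / 2" by (simp add: abs_mult power2_eq_square mult_ac)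
    moreover have "c * p $ 1 * X p $ 2 = (c * p $ 1)\<^sup>2 + c * p $ 1 * s $ 2"
      using r(3) p s(1) by (simp add: power2_eq_square algebra_simps)
    moreover have "(c * p $ 1)\<^sup>2 > 0" using c p1 by simp
    ultimately show ?thesis by linarith
  qed
  then show ?thesis using r(1) by blast
qed

section \<open>Eigenvalues of two by two matrices\<close>

lemma det_char_poly:
  fixes A :: "real^2^2"
  shows "det (mat z - map_matrix complex_of_real A) =
    z\<^sup>2 - of_real (A $ 1 $ 1 + A $ 2 $ 2) * z + of_real (A $ 1 $ 1 * A $ 2 $ 2 - A $ 1 $ 2 * A $ 2 $ 1)"
  by (simp add: det_2 mat_def map_matrix_def power2_eq_square algebra_simps)

lemma eigenvalues2_det:
  assumes "eigenvalues2 A l1 l2"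
  shows "l1 * l2 = of_real (A $ 1 $ 1 * A $ 2 $ 2 - A $ 1 $ 2 * A $ 2 $ 1)"
  using assms[unfolded eigenvalues2_def det_char_poly, rule_format, of 0] by simp

text \<open>With a nonnegative discriminant the quadratic formula gives a real root of the
  characteristic polynomial, which would be one of the two eigenvalues.\<close>

lemma nonreal_pair_discriminant:
  assumes e: "eigenvalues2 A l1 l2" and n: "nonreal_pair l1 l2"
  shows "(A $ 1 $ 1 + A $ 2 $ 2)\<^sup>2 < 4 * (A $ 1 $ 1 * A $ 2 $ 2 - A $ 1 $ 2 * A $ 2 $ 1)"
proof (rule ccontr)
  define t where "t = A $ 1 $ 1 + A $ 2 $ 2"
  define D where "D = A $ 1 $ 1 * A $ 2 $ 2 - A $ 1 $ 2 * A $ 2 $ 1"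
  assume "\<not> ?thesis"
  then have nn: "0 \<le> t\<^sup>2 - 4 * D" by (simp add: t_def D_def)
  define x where "x = (t + sqrt (t\<^sup>2 - 4 * D)) / 2"
  have "sqrt (t\<^sup>2 - 4 * D) * sqrt (t\<^sup>2 - 4 * D) = t\<^sup>2 - 4 * D" using nn by simp
  then have "x\<^sup>2 - t * x + D = 0"
    by (simp add: x_def power2_eq_square field_simps)
  then have "complex_of_real (x\<^sup>2 - t * x + D) = 0" by simp
  then have "(of_real x)\<^sup>2 - of_real t * of_real x + of_real D = (0 :: complex)" by simp
  then have "(of_real x - l1) * (of_real x - l2) = 0"
    using e[unfolded eigenvalues2_def det_char_poly, rule_format, of "of_real x"] by (simp add: t_def D_def)
  then have "l1 = of_real x \<or> l2 = of_real x" by auto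
  then show False using n by (auto simp: nonreal_pair_def)
qed

lemma saddle_pair_det:
  assumes e: "eigenvalues2 A l1 l2" and s: "saddle_pair l1 l2"
  shows "A $ 1 $ 1 * A $ 2 $ 2 - A $ 1 $ 2 * A $ 2 $ 1 < 0"
  using s eigenvalues2_det[OF e] by (simp add: saddle_pair_def)

lemma Omega_fs_local:
  assumes U: "open \<U>" "0 \<in> \<U>" and Z: "(X, Y) \<in> Omega_fs \<U>"
  shows "X 0 = 0" "Y 0 = 0" "has_flow_charts X Y"
    "\<exists>r>0. ball 0 r \<subseteq> \<U> \<and> (\<exists>L. \<forall>p\<in>ball 0 r. \<forall>q\<in>ball 0 r.
        norm (X p - X q) \<le> L * norm (p - q) \<and> norm (Y p - Y q) \<le> L * norm (p - q)) \<and>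
      (\<forall>p\<in>ball 0 r. p $ 2 = 0 \<longrightarrow> p \<noteq> 0 \<longrightarrow> X p $ 2 * Y p $ 2 > 0)"
proof -
  have C: "C1_field \<U> X" "C1_field \<U> Y"
    and cc: "jacobian X (at 0) $ 2 $ 1 * jacobian Y (at 0) $ 2 $ 1 > 0"
    using Z by (auto simp: Omega_fs_def Omega1_def Omega0_def Omega_def)
  show X0: "X 0 = 0" and Y0: "Y 0 = 0"
    using Z by (auto simp: Omega_fs_def Omega1_def Omega0_def)
  define A where "A = jacobian X (at 0)"
  define B where "B = jacobian Y (at 0)"
  note dX = C1_field_strong_derivative[OF U C(1) X0 A_def]
  note dY = C1_field_strong_derivative[OF U C(2) Y0 B_def]
  have c: "A $ 2 $ 1 * B $ 2 $ 1 > 0" using cc by (simp add: A_def B_def)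
  obtain lp1 lp2 lm1 lm2 where e: "eigenvalues2 A lp1 lp2" "eigenvalues2 B lm1 lm2"
    "nonreal_pair lp1 lp2 \<and> saddle_pair lm1 lm2 \<or> nonreal_pair lm1 lm2 \<and> saddle_pair lp1 lp2"
    using Z by (auto simp: Omega_fs_def A_def B_def)
  show "has_flow_charts X Y"
    using e(3)
  proof
    assume "nonreal_pair lp1 lp2 \<and> saddle_pair lm1 lm2"
    then show ?thesis
      using nonreal_pair_discriminant[OF e(1)] saddle_pair_det[OF e(2)] by (intro flow_charts_focus_above[OF dX dY _ _ c]) auto
  next
    assume "nonreal_pair lm1 lm2 \<and> saddle_pair lp1 lp2"
    then show ?thesis
      using nonreal_pair_discriminant[OF e(2)] saddle_pair_det[OF e(1)] by (intro flow_charts_focus_below[OF dX dY _ _ c]) auto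
  qed
  obtain r1 L1 where r1: "r1 > 0" "\<forall>p\<in>ball 0 r1. \<forall>q\<in>ball 0 r1. norm (X p - X q) \<le> L1 * norm (p - q)"
    using strong_derivative_Lipschitz[OF dX] by blast
  obtain r2 L2 where r2: "r2 > 0" "\<forall>p\<in>ball 0 r2. \<forall>q\<in>ball 0 r2. norm (Y p - Y q) \<le> L2 * norm (p - q)"
    using strong_derivative_Lipschitz[OF dY] by blast
  have c0: "A $ 2 $ 1 \<noteq> 0" "B $ 2 $ 1 \<noteq> 0" using c by auto
  obtain r3 where r3: "r3 > 0" "\<forall>p\<in>ball 0 r3. p $ 2 = 0 \<longrightarrow> p \<noteq> 0 \<longrightarrow> A $ 2 $ 1 * p $ 1 * X p $ 2 > 0"
    using strong_derivative_sign[OF dX c0(1)] by blast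
  obtain r4 where r4: "r4 > 0" "\<forall>p\<in>ball 0 r4. p $ 2 = 0 \<longrightarrow> p \<noteq> 0 \<longrightarrow> B $ 2 $ 1 * p $ 1 * Y p $ 2 > 0"
    using strong_derivative_sign[OF dY c0(2)] by blast
  obtain r5 where r5: "r5 > 0" "ball 0 r5 \<subseteq> \<U>" using U by (meson open_contains_ball)
  define r where "r = min (min r1 r2) (min (min r3 r4) r5)"
  have r: "r > 0" "r \<le> r1" "r \<le> r2" "r \<le> r3" "r \<le> r4" "r \<le> r5" using r1 r2 r3 r4 r5 by (auto simp: r_def)
  have sub: "p \<in> ball 0 s" if "p \<in> ball 0 r" "r \<le> s" for p :: "real^2" and s using that by auto
  show "\<exists>r>0. ball 0 r \<subseteq> \<U> \<and> (\<exists>L. \<forall>p\<in>ball 0 r. \<forall>q\<in>ball 0 r.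
        norm (X p - X q) \<le> L * norm (p - q) \<and> norm (Y p - Y q) \<le> L * norm (p - q)) \<and>
      (\<forall>p\<in>ball 0 r. p $ 2 = 0 \<longrightarrow> p \<noteq> 0 \<longrightarrow> X p $ 2 * Y p $ 2 > 0)"
  proof (rule exI[of _ r], intro conjI)
    show "r > 0" by (rule r(1))
    show "ball 0 r \<subseteq> \<U>" using r5(2) r(6) by auto
    have "norm (X p - X q) \<le> max L1 L2 * norm (p - q) \<and> norm (Y p - Y q) \<le> max L1 L2 * norm (p - q)"
      if "p \<in> ball 0 r" "q \<in> ball 0 r" for p q
    proof
      have "norm (X p - X q) \<le> L1 * norm (p - q)" using r1(2) sub[OF that(1) r(2)] sub[OF that(2) r(2)] by blast
      also have "\<dots> \<le> max L1 L2 * norm (p - q)" by (intro mult_right_mono) auto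
      finally show "norm (X p - X q) \<le> max L1 L2 * norm (p - q)" .
      have "norm (Y p - Y q) \<le> L2 * norm (p - q)" using r2(2) sub[OF that(1) r(3)] sub[OF that(2) r(3)] by blast
      also have "\<dots> \<le> max L1 L2 * norm (p - q)" by (intro mult_right_mono) auto
      finally show "norm (Y p - Y q) \<le> max L1 L2 * norm (p - q)" .
    qed
    then show "\<exists>L. \<forall>p\<in>ball 0 r. \<forall>q\<in>ball 0 r.
        norm (X p - X q) \<le> L * norm (p - q) \<and> norm (Y p - Y q) \<le> L * norm (p - q)" by blast
    show "\<forall>p\<in>ball 0 r. p $ 2 = 0 \<longrightarrow> p \<noteq> 0 \<longrightarrow> X p $ 2 * Y p $ 2 > 0"
    proof (intro ballI impI)
      fix p :: "real^2" assume p: "p \<in> ball 0 r" "p $ 2 = 0" "p \<noteq> 0"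
      have "A $ 2 $ 1 * p $ 1 * X p $ 2 > 0" using r3(2) sub[OF p(1) r(4)] p(2,3) by blast
      moreover have "B $ 2 $ 1 * p $ 1 * Y p $ 2 > 0" using r4(2) sub[OF p(1) r(5)] p(2,3) by blast
      \<comment> \<open>The product of the two sign inequalities contains the positive factor
        \<open>A $ 2 $ 1 * B $ 2 $ 1 * (p $ 1)\<^sup>2\<close>; the other factor is the one in the
        crossing condition.\<close>
      ultimately have "0 < A $ 2 $ 1 * p $ 1 * X p $ 2 * (B $ 2 $ 1 * p $ 1 * Y p $ 2)" by (rule mult_pos_pos)
      then have "0 < (A $ 2 $ 1 * B $ 2 $ 1 * (p $ 1)\<^sup>2) * (X p $ 2 * Y p $ 2)"
        by (simp add: power2_eq_square mult_ac)
      moreover have "0 < A $ 2 $ 1 * B $ 2 $ 1 * (p $ 1)\<^sup>2"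
        by (rule mult_pos_pos[OF c]) (use p in \<open>auto simp: vec2_eq_iff\<close>)
      ultimately show "X p $ 2 * Y p $ 2 > 0" by (rule zero_less_mult_pos)
    qed
  qed
qed

lemma X_fs_lin2: "X_fs = lin2 0 (-1) 1 0" and Y_fs_lin2: "Y_fs = lin2 0 1 1 0"
  by (auto simp: fun_eq_iff X_fs_def Y_fs_def vec2_eq_iff)

lemma jacobian_lin2: "jacobian (lin2 a b c d) (at p) = vector [vector [a, b], vector [c, d]]"
proof -
  have "frechet_derivative (lin2 a b c d) (at p) = lin2 a b c d"
    using frechet_derivative_at[OF bounded_linear_imp_has_derivative[OF bounded_linear_lin2]] by metis
  then show ?thesis
    by (simp add: jacobian_def matrix_def vec_eq_iff forall_2 axis_def)
qed

lemma C1_field_lin2: "C1_field \<U> (lin2 a b c d)"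
  unfolding C1_field_def jacobian_lin2
  using bounded_linear_imp_differentiable[OF bounded_linear_lin2] by (auto intro: continuous_on_const)

text \<open>The eigenvalues are \<open>\<i>\<close>, \<open>- \<i>\<close> above and
  \<open>1\<close>, \<open>- 1\<close> below; as the latter are real, \<open>ell\<close> is
  1.\<close>

lemma Z_fs_in_Omega_fs: "(X_fs, Y_fs) \<in> Omega_fs \<U>"
proof -
  have eX: "eigenvalues2 (jacobian X_fs (at 0)) \<i> (- \<i>)" and eY: "eigenvalues2 (jacobian Y_fs (at 0)) 1 (- 1)"
    unfolding eigenvalues2_def det_char_poly X_fs_lin2 Y_fs_lin2 jacobian_lin2
    by (auto simp: power2_eq_square algebra_simps)
  have "X_fs 0 = 0" "Y_fs 0 = 0" by (simp_all add: X_fs_def Y_fs_def vec2_eq_iff)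
  then have "(X_fs, Y_fs) \<in> Omega0 \<U>"
    by (simp add: Omega0_def Omega_def X_fs_lin2 Y_fs_lin2 C1_field_lin2 jacobian_lin2 det_2)
  moreover have "\<i> \<noteq> - \<i>" "(1::complex) \<noteq> - 1" "ell \<i> 1 \<noteq> 0"
    by (auto simp: ell_def complex_eq_iff)
  ultimately have "(X_fs, Y_fs) \<in> Omega1 \<U>"
    unfolding Omega1_def using eX eY by blast
  moreover have "nonreal_pair \<i> (- \<i>)" "saddle_pair 1 (- 1)"
    by (auto simp: nonreal_pair_def saddle_pair_def complex_is_Real_iff)
  ultimately show ?thesis unfolding Omega_fs_def using eX eY by blast
qed

text \<open>On such a \<open>U\<close> the two notions of trajectory have the same curves, hence the
  same maximal ones.\<close>

lemma maximal_trajectory_iff: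
  assumes "U \<subseteq> \<U>" "0 \<in> U" "X 0 = 0" "Y 0 = 0"
    and "\<And>p q. p \<in> U \<Longrightarrow> q \<in> U \<Longrightarrow> norm (X p - X q) \<le> L * norm (p - q)"
    and "\<And>p q. p \<in> U \<Longrightarrow> q \<in> U \<Longrightarrow> norm (Y p - Y q) \<le> L * norm (p - q)"
    and "\<And>p. p \<in> U \<Longrightarrow> p $ 2 = 0 \<Longrightarrow> p \<noteq> 0 \<Longrightarrow> X p $ 2 * Y p $ 2 > 0"
  shows "maximal_trajectory \<U> (X, Y) U I \<gamma> \<longleftrightarrow> max_itraj X Y U I \<gamma>"
proof -
  have "trajectory \<U> (X, Y) U I \<gamma> \<longleftrightarrow> itraj X Y U I \<gamma>" for I \<gamma>
    using itraj_imp_trajectory[where X = X and Y = Y and U = U and \<U> = \<U>] assms(1,3,4)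
      trajectory_imp_itraj[where X = X and Y = Y and U = U and \<U> = \<U> and L = L, OF _ assms(2-7)]
    by blast
  then show ?thesis unfolding maximal_trajectory_def max_itraj_def by simp
qed

lemma Omega_fs_orbit_charts:
  assumes U: "open \<U>" "0 \<in> \<U>" and Z: "(X, Y) \<in> Omega_fs \<U>"
  shows "\<exists>a0>0. \<forall>a. 0 < a \<and> a < a0 \<longrightarrow> (\<exists>U \<Phi> \<Phi>'. U \<subseteq> \<U> \<and> orbit_chart X Y a U \<Phi> \<Phi>' \<and>
    (\<forall>I \<gamma>. maximal_trajectory \<U> (X, Y) U I \<gamma> \<longleftrightarrow> max_itraj X Y U I \<gamma>))"
proof -
  note loc = Omega_fs_local[OF assms]
  obtain r L where r: "r > 0" "ball 0 r \<subseteq> \<U>"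
    and L: "\<And>p q. p \<in> ball 0 r \<Longrightarrow> q \<in> ball 0 r \<Longrightarrow> norm (X p - X q) \<le> L * norm (p - q)"
      "\<And>p q. p \<in> ball 0 r \<Longrightarrow> q \<in> ball 0 r \<Longrightarrow> norm (Y p - Y q) \<le> L * norm (p - q)"
    and cr: "\<And>p. p \<in> ball 0 r \<Longrightarrow> p $ 2 = 0 \<Longrightarrow> p \<noteq> 0 \<Longrightarrow> X p $ 2 * Y p $ 2 > 0"
    using loc(4) by blast
  obtain a0 where a0: "a0 > 0" "\<And>a. 0 < a \<and> a < a0 \<Longrightarrow> \<exists>U \<Phi> \<Phi>'. U \<subseteq> ball 0 r \<and> flow_chart X Y a U \<Phi> \<Phi>'"
    using loc(3) r(1) unfolding has_flow_charts_def by blast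
  have "\<exists>U \<Phi> \<Phi>'. U \<subseteq> \<U> \<and> orbit_chart X Y a U \<Phi> \<Phi>' \<and>
    (\<forall>I \<gamma>. maximal_trajectory \<U> (X, Y) U I \<gamma> \<longleftrightarrow> max_itraj X Y U I \<gamma>)" if a: "0 < a \<and> a < a0" for a
  proof -
    obtain U \<Phi> \<Phi>' where fc: "U \<subseteq> ball 0 r" "flow_chart X Y a U \<Phi> \<Phi>'" using a0(2)[OF a] by blast
    have "orbit_chart X Y a U \<Phi> \<Phi>'"
    proof
      show "flow_chart X Y a U \<Phi> \<Phi>'" by (rule fc(2))
      fix I J \<gamma> \<delta> t0 t
      assume tr: "itraj X Y U I \<gamma>" "itraj X Y U J \<delta>"
        and t: "t0 \<in> I" "t0 \<in> J" "\<gamma> t0 = \<delta> t0" "t \<in> I" "t \<in> J"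
      show "\<gamma> t = \<delta> t"
        by (rule itraj_unique[OF tr _ _ _ t, where L = L]) (use L cr fc(1) in blast)+
    qed
    moreover have "maximal_trajectory \<U> (X, Y) U I \<gamma> \<longleftrightarrow> max_itraj X Y U I \<gamma>" for I \<gamma>
    proof (rule maximal_trajectory_iff[where L = L])
      show "0 \<in> U" using fc(2) by (simp add: flow_chart_def)
    qed (use loc(1,2) L cr fc(1) r(2) in blast)+
    moreover have "U \<subseteq> \<U>" using fc(1) r(2) by blast
    ultimately show ?thesis by blast
  qed
  then show ?thesis using a0(1) by blast
qed

theorem lemma3p4:
  fixes \<U> :: "(real^2) set" and X Y :: "real^2 \<Rightarrow> real^2"
  assumes "open \<U>" and "bounded \<U>" and "0 \<in> \<U>"
    and "(X, Y) \<in> Omega_fs \<U>"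
  shows "(X_fs, Y_fs) \<in> Omega_fs \<U> \<and> locally_Sigma_equivalent \<U> (X, Y) (X_fs, Y_fs)"
proof
  show fs: "(X_fs, Y_fs) \<in> Omega_fs \<U>" by (rule Z_fs_in_Omega_fs)
  obtain a1 where a1: "a1 > 0" "\<And>a. 0 < a \<and> a < a1 \<Longrightarrow> \<exists>U \<Phi> \<Phi>'. U \<subseteq> \<U> \<and> orbit_chart X Y a U \<Phi> \<Phi>' \<and>
    (\<forall>I \<gamma>. maximal_trajectory \<U> (X, Y) U I \<gamma> \<longleftrightarrow> max_itraj X Y U I \<gamma>)"
    using Omega_fs_orbit_charts[OF assms(1,3,4)] by blast
  obtain a2 where a2: "a2 > 0" "\<And>a. 0 < a \<and> a < a2 \<Longrightarrow> \<exists>U \<Phi> \<Phi>'. U \<subseteq> \<U> \<and> orbit_chart X_fs Y_fs a U \<Phi> \<Phi>' \<and>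
    (\<forall>I \<gamma>. maximal_trajectory \<U> (X_fs, Y_fs) U I \<gamma> \<longleftrightarrow> max_itraj X_fs Y_fs U I \<gamma>)"
    using Omega_fs_orbit_charts[OF assms(1,3) fs] by blast
  \<comment> \<open>Strictly below both bounds, so that both charts map onto the same
    square.\<close>
  define a where "a = min a1 a2 / 2"
  have a: "0 < a \<and> a < a1" "0 < a \<and> a < a2" using a1(1) a2(1) by (auto simp: a_def)
  obtain U \<Phi> \<Phi>' where U: "U \<subseteq> \<U>" "orbit_chart X Y a U \<Phi> \<Phi>'"
    "\<And>I \<gamma>. maximal_trajectory \<U> (X, Y) U I \<gamma> \<longleftrightarrow> max_itraj X Y U I \<gamma>"
    using a1(2)[OF a(1)] by blast
  obtain V \<Psi> \<Psi>' where V: "V \<subseteq> \<U>" "orbit_chart X_fs Y_fs a V \<Psi> \<Psi>'"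
    "\<And>I \<gamma>. maximal_trajectory \<U> (X_fs, Y_fs) V I \<gamma> \<longleftrightarrow> max_itraj X_fs Y_fs V I \<gamma>"
    using a2(2)[OF a(2)] by blast
  have A: "open U" "0 \<in> U" "homeomorphism U (square a) \<Phi> \<Phi>'"
    "\<Phi> ` {p\<in>U. p $ 2 = 0} = {q\<in>square a. q $ 2 = \<bar>q $ 1\<bar>}"
    using orbit_chart.chart[OF U(2)] unfolding flow_chart_def by blast+
  have B: "open V" "0 \<in> V" "homeomorphism V (square a) \<Psi> \<Psi>'"
    "\<Psi> ` {p\<in>V. p $ 2 = 0} = {q\<in>square a. q $ 2 = \<bar>q $ 1\<bar>}"
    using orbit_chart.chart[OF V(2)] unfolding flow_chart_def by blast+
  have hom: "homeomorphism U V (\<Psi>' \<circ> \<Phi>) (\<Phi>' \<circ> \<Psi>)"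
    by (rule homeomorphism_compose[OF A(3) homeomorphism_symD[OF B(3)]])
  have S: "Sigma_line \<U> \<inter> U = {p\<in>U. p $ 2 = 0}" "Sigma_line \<U> \<inter> V = {p\<in>V. p $ 2 = 0}"
    using U(1) V(1) by (auto simp: Sigma_line_def)
  \<comment> \<open>Both charts send the switching line to the same graph of the absolute value, so
    going up by \<open>\<Phi>\<close> and down by \<open>\<Psi>'\<close> preserves it.\<close>
  have "\<Psi>' ` \<Psi> ` {p\<in>V. p $ 2 = 0} = {p\<in>V. p $ 2 = 0}"
    using B(3) by (auto simp: homeomorphism_def image_image)
  then have line: "(\<Psi>' \<circ> \<Phi>) ` (Sigma_line \<U> \<inter> U) = Sigma_line \<U> \<inter> V"
    unfolding S image_comp[symmetric] A(4) B(4)[symmetric] .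
  note corr = orbit_charts_correspond[OF U(2) V(2)]
  show "locally_Sigma_equivalent \<U> (X, Y) (X_fs, Y_fs)"
    unfolding locally_Sigma_equivalent_def
  proof (rule exI[of _ U], rule exI[of _ V], rule exI[of _ "\<Psi>' \<circ> \<Phi>"], rule exI[of _ "\<Phi>' \<circ> \<Psi>"],
      intro conjI allI impI)
    show "\<exists>J \<delta>. maximal_trajectory \<U> (X_fs, Y_fs) V J \<delta> \<and> maps_oriented (\<Psi>' \<circ> \<Phi>) I \<gamma> J \<delta>"
      if "maximal_trajectory \<U> (X, Y) U I \<gamma>" for I \<gamma>
      using corr(1) that unfolding U(3) V(3) by blast
    show "\<exists>I \<gamma>. maximal_trajectory \<U> (X, Y) U I \<gamma> \<and> maps_oriented (\<Psi>' \<circ> \<Phi>) I \<gamma> J \<delta>"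
      if "maximal_trajectory \<U> (X_fs, Y_fs) V J \<delta>" for J \<delta>
      using corr(2) that unfolding U(3) V(3) by blast
  qed (use A(1,2) B(1,2) U(1) V(1) hom line in blast)+
qed

end
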